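(* Let $T>0$. Let $\mathbf H_0\in Y_\mu$, let $\mathbf J^{\rm E}\in L^2(0,T;L^2(\Omega;\mathbb R^3))$ with $\partial_t\mathbf J^{\rm E}\in L^2(0,T;L^2(\Omega;\mathbb R^3))$, and let $\mathbf J^{\rm M}\in L^2(0,T;X)$. Then there exists a unique weak solution $(\mathbf E,\mathbf H)$ of the eddy current system $$\begin{cases}\nabla\times\mathbf H-\sigma\mathbf E=\mathbf J^{\rm E} & \text{in }\Omega\times(0,T),\\ \nabla\times\mathbf E+\mu\,\partial_t\mathbf H=\mathbf J^{\rm M} & \text{in }\Omega\times(0,T),\\ \mathbf H\times n=0 & \text{on }\partial\Omega\times(0,T),\\ \mathbf H=\mathbf H_0 & \text{in }\Omega\times\{0\}.\end{cases}$$ Moreover, $$\sup_{t\in[0,T]}\|\mathbf E(t)\|_{L^2}^2+\sup_{t\in[0,T]}\|\mathbf H(t)\|_{L^2}^2+\int_0^T\|\partial_t\mathbf H(t)\|_{L^2}^2\,dt\le C\Big(\|\mathbf H_0\|_{H^1(\Omega;{\rm curl})}^2+\|\mathbf J^{\rm E}(0)\|_{L^2}^2+\int_0^T\big[\|\mathbf J^{\rm E}(t)\|_{L^2}^2+\|\mathbf J^{\rm M}(t)\|_{L^2}^2+\|\partial_t\mathbf J^{\rm E}(t)\|_{L^2}^2\big]\,dt\Big),$$ where the constant $C$ depends only on $\Lambda$ and $T$.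
   Context: Standing assumptions. $\Omega\subset\mathbb R^3$ is a bounded domain with $\partial\Omega=\partial(\overline\Omega)$ satisfying the uniform two-sided ball condition with radius $r>0$: for every $z\in\partial\Omega$ there are a ball $B_r(x)\subset\Omega$ and a ball $B_r(y)\subset\mathbb R^3\setminus\Omega$ whose closures both contain $z$ (so $\Omega$ is a $C^{1,1}$ domain); $n$ is the outward unit normal. $\Lambda\ge1$ is a constant; $\mu:\Omega\to\mathbb R$ is Lipschitz continuous with $\Lambda^{-1}\le\mu\le\max\{\mu,|\nabla\mu|\}\le\Lambda$ a.e. in $\Omega$; $\sigma$ is a bounded measurable function on $\Omega$ with values in the real symmetric $3\times3$ matrices such that $\Lambda^{-1}|\eta|^2\le\sigma\eta\cdot\eta\le\Lambda|\eta|^2$ for all $\eta\in\mathbb R^3$, a.e. in $\Omega$. Spaces. $H^1(\Omega;{\rm curl})$ is the Hilbert space of all $\psi\in L^2(\Omega;\mathbb R^3)$ with distributional curl $\nabla\times\psi\in L^2(\Omega;\mathbb R^3)$, with scalar product $(\varphi,\psi)_{L^2}+(\nabla\times\varphi,\nabla\times\psi)_{L^2}$; $H^1_0(\Omega;{\rm curl})$ is its closed subspace of fields with zero tangential trace $\psi\times n=0$ on $\partial\Omega$ (in $H^{-1/2}(\partial\Omega;\mathbb R^3)$). $\|\cdot\|_{L^2}$ is the $L^2$ norm on $\Omega$ of scalar, vector or tensor functions. $X_\mu=\{\psi\in L^2(\Omega;\mathbb R^3):\int_\Omega\mu\,\psi\cdot\nabla u\,dx=0\ \text{for all }u\in H^1_0(\Omega)\}$,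 $Y_\mu=H^1_0(\Omega;{\rm curl})\cap X_\mu$; $X$ denotes $X_\mu$ with $\mu$ replaced by the constant $1$. Weak solution. Given $\mathbf J^{\rm E}\in L^2(0,T;L^2(\Omega;\mathbb R^3))$, $\mathbf J^{\rm M}\in L^2(0,T;X)$ and $\mathbf H_0\in Y_\mu$, a weak solution of the system is a pair $(\mathbf E,\mathbf H)\in L^2(0,T;H^1(\Omega;{\rm curl})\times H^1_0(\Omega;{\rm curl}))$ with $\partial_t\mathbf H\in L^2(0,T;L^2(\Omega;\mathbb R^3))$ such that for a.e. $t\in[0,T]$, for all $\varphi\in H^1(\Omega;{\rm curl})$ and all $\psi\in H^1_0(\Omega;{\rm curl})$, $$\int_\Omega\mathbf H\cdot\nabla\times\varphi\,dx-\int_\Omega\sigma\mathbf E\cdot\varphi\,dx=\int_\Omega\mathbf J^{\rm E}\cdot\varphi\,dx,\qquad \int_\Omega\mathbf E\cdot\nabla\times\psi\,dx+\int_\Omega\mu\,\partial_t\mathbf H\cdot\psi\,dx=\int_\Omega\mathbf J^{\rm M}\cdot\psi\,dx,$$ and $\mathbf H(0)=\mathbf H_0$ (which makes sense because such an $\mathbf H$ has a representative in $C([0,T];X_\mu)$). *)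

theory Defs
  imports "HOL-Analysis.Analysis" "HOL-Probability.Essential_Supremum"
begin

type_synonym R3 = "real^3"

text \<open>
  Elements of Lebesgue and Sobolev spaces are represented by functions (not by equivalence
  classes); only their values almost everywhere in \<open>\<Omega>\<close> matter.
\<close>

section \<open>Domain and coefficients\<close>

definition bounded_domain :: "R3 set \<Rightarrow> bool" where
  "bounded_domain \<Omega> \<longleftrightarrow> open \<Omega> \<and> connected \<Omega> \<and> \<Omega> \<noteq> {} \<and> bounded \<Omega>"

definition two_sided_ball_condition :: "R3 set \<Rightarrow> real \<Rightarrow> bool" where
  "two_sided_ball_condition \<Omega> r \<longleftrightarrow>
     (\<forall>z\<in>frontier \<Omega>.
        (\<exists>x. ball x r \<subseteq> \<Omega> \<and> z \<in> closure (ball x r)) \<and>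
        (\<exists>y. ball y r \<subseteq> - \<Omega> \<and> z \<in> closure (ball y r)))"

text \<open>A Lipschitz function is differentiable almost everywhere, so asking for the existence of
  the gradient at almost every point is no additional restriction.\<close>

definition admissible_mu :: "real \<Rightarrow> R3 set \<Rightarrow> (R3 \<Rightarrow> real) \<Rightarrow> bool" where
  "admissible_mu \<Lambda> \<Omega> \<mu> \<longleftrightarrow>
     (\<exists>L. L-lipschitz_on \<Omega> \<mu>) \<and>
     (AE x in lebesgue_on \<Omega>. \<exists>g. GDERIV \<mu> x :> g \<and>
        inverse \<Lambda> \<le> \<mu> x \<and> \<mu> x \<le> max (\<mu> x) (norm g) \<and> max (\<mu> x) (norm g) \<le> \<Lambda>)"

definition admissible_sigma :: "real \<Rightarrow> R3 set \<Rightarrow> (R3 \<Rightarrow> real^3^3) \<Rightarrow> bool" where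
  "admissible_sigma \<Lambda> \<Omega> \<sigma> \<longleftrightarrow>
     \<sigma> \<in> borel_measurable (lebesgue_on \<Omega>) \<and> bounded (\<sigma> ` \<Omega>) \<and>
     (\<forall>x\<in>\<Omega>. transpose (\<sigma> x) = \<sigma> x) \<and>
     (AE x in lebesgue_on \<Omega>. \<forall>\<eta>.
        inverse \<Lambda> * (norm \<eta>)\<^sup>2 \<le> (\<sigma> x *v \<eta>) \<bullet> \<eta> \<and> (\<sigma> x *v \<eta>) \<bullet> \<eta> \<le> \<Lambda> * (norm \<eta>)\<^sup>2)"

definition standing_assumptions ::
    "real \<Rightarrow> R3 set \<Rightarrow> real \<Rightarrow> (R3 \<Rightarrow> real) \<Rightarrow> (R3 \<Rightarrow> real^3^3) \<Rightarrow> bool" where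
  "standing_assumptions \<Lambda> \<Omega> r \<mu> \<sigma> \<longleftrightarrow>
     bounded_domain \<Omega> \<and> frontier \<Omega> = frontier (closure \<Omega>) \<and>
     r > 0 \<and> two_sided_ball_condition \<Omega> r \<and>
     admissible_mu \<Lambda> \<Omega> \<mu> \<and> admissible_sigma \<Lambda> \<Omega> \<sigma>"

section \<open>Test functions\<close>

fun Ck :: "nat \<Rightarrow> ('a::real_normed_vector \<Rightarrow> 'b::real_normed_vector) \<Rightarrow> bool" where
  "Ck 0 f \<longleftrightarrow> continuous_on UNIV f"
| "Ck (Suc k) f \<longleftrightarrow>
     (\<forall>x. f differentiable (at x)) \<and> (\<forall>v. Ck k (\<lambda>x. frechet_derivative f (at x) v))"

definition test_functions ::
    "'a::real_normed_vector set \<Rightarrow> ('a \<Rightarrow> 'b::real_normed_vector) set" where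
  "test_functions S = {f. (\<forall>k. Ck k f) \<and> compact (closure {x. f x \<noteq> 0}) \<and> closure {x. f x \<noteq> 0} \<subseteq> S}"

definition pd :: "3 \<Rightarrow> (R3 \<Rightarrow> 'b::real_normed_vector) \<Rightarrow> R3 \<Rightarrow> 'b" where
  "pd i f x = frechet_derivative f (at x) (axis i 1)"

definition curl :: "(R3 \<Rightarrow> R3) \<Rightarrow> R3 \<Rightarrow> R3" where
  "curl f x = vector [pd 2 f x $ 3 - pd 3 f x $ 2,
                      pd 3 f x $ 1 - pd 1 f x $ 3,
                      pd 1 f x $ 2 - pd 2 f x $ 1]"

section \<open>Function spaces on the domain\<close>

definition L2 :: "R3 set \<Rightarrow> (R3 \<Rightarrow> 'b::euclidean_space) set" where
  "L2 \<Omega> = {f. f \<in> borel_measurable (lebesgue_on \<Omega>) \<and>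
              integrable (lebesgue_on \<Omega>) (\<lambda>x. (norm (f x))\<^sup>2)}"

definition L2_inner :: "R3 set \<Rightarrow> (R3 \<Rightarrow> 'b::euclidean_space) \<Rightarrow> (R3 \<Rightarrow> 'b) \<Rightarrow> real" where
  "L2_inner \<Omega> f g = (LINT x|lebesgue_on \<Omega>. f x \<bullet> g x)"

definition L2_norm :: "R3 set \<Rightarrow> (R3 \<Rightarrow> 'b::euclidean_space) \<Rightarrow> real" where
  "L2_norm \<Omega> f = sqrt (LINT x|lebesgue_on \<Omega>. (norm (f x))\<^sup>2)"

definition has_weak_grad :: "R3 set \<Rightarrow> (R3 \<Rightarrow> real) \<Rightarrow> (R3 \<Rightarrow> R3) \<Rightarrow> bool" where
  "has_weak_grad \<Omega> u g \<longleftrightarrow>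
     (\<forall>\<phi>\<in>test_functions \<Omega>. \<forall>i.
        (LINT x|lebesgue_on \<Omega>. u x * pd i \<phi> x) = - (LINT x|lebesgue_on \<Omega>. g x $ i * \<phi> x))"

definition has_weak_curl :: "R3 set \<Rightarrow> (R3 \<Rightarrow> R3) \<Rightarrow> (R3 \<Rightarrow> R3) \<Rightarrow> bool" where
  "has_weak_curl \<Omega> f c \<longleftrightarrow> (\<forall>\<Phi>\<in>test_functions \<Omega>. L2_inner \<Omega> c \<Phi> = L2_inner \<Omega> f (curl \<Phi>))"

text \<open>Weak gradient and curl are determined up to null sets; the choice made here is
  meaningful only on \<open>H1\<close> and \<open>H1_curl\<close>, respectively.\<close>

definition wgrad :: "R3 set \<Rightarrow> (R3 \<Rightarrow> real) \<Rightarrow> R3 \<Rightarrow> R3" where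
  "wgrad \<Omega> u = (SOME g. g \<in> L2 \<Omega> \<and> has_weak_grad \<Omega> u g)"

definition wcurl :: "R3 set \<Rightarrow> (R3 \<Rightarrow> R3) \<Rightarrow> R3 \<Rightarrow> R3" where
  "wcurl \<Omega> f = (SOME c. c \<in> L2 \<Omega> \<and> has_weak_curl \<Omega> f c)"

definition H1 :: "R3 set \<Rightarrow> (R3 \<Rightarrow> real) set" where
  "H1 \<Omega> = {u \<in> L2 \<Omega>. \<exists>g\<in>L2 \<Omega>. has_weak_grad \<Omega> u g}"

definition H1_norm :: "R3 set \<Rightarrow> (R3 \<Rightarrow> real) \<Rightarrow> real" where
  "H1_norm \<Omega> u = sqrt ((L2_norm \<Omega> u)\<^sup>2 + (L2_norm \<Omega> (wgrad \<Omega> u))\<^sup>2)"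

definition H1_0 :: "R3 set \<Rightarrow> (R3 \<Rightarrow> real) set" where
  "H1_0 \<Omega> = {u \<in> H1 \<Omega>. \<exists>\<phi>. (\<forall>k::nat. \<phi> k \<in> test_functions \<Omega>) \<and>
                (\<lambda>k. H1_norm \<Omega> (\<lambda>x. \<phi> k x - u x)) \<longlonglongrightarrow> 0}"

definition H1_vec :: "R3 set \<Rightarrow> (R3 \<Rightarrow> R3) set" where
  "H1_vec \<Omega> = {\<phi>. \<forall>i. (\<lambda>x. \<phi> x $ i) \<in> H1 \<Omega>}"

definition H1_curl :: "R3 set \<Rightarrow> (R3 \<Rightarrow> R3) set" where
  "H1_curl \<Omega> = {\<psi> \<in> L2 \<Omega>. \<exists>c\<in>L2 \<Omega>. has_weak_curl \<Omega> \<psi> c}"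

definition H1_curl_norm :: "R3 set \<Rightarrow> (R3 \<Rightarrow> R3) \<Rightarrow> real" where
  "H1_curl_norm \<Omega> \<psi> = sqrt ((L2_norm \<Omega> \<psi>)\<^sup>2 + (L2_norm \<Omega> (wcurl \<Omega> \<psi>))\<^sup>2)"

text \<open>
  For \<open>\<psi>\<close> in \<open>H1_curl\<close>, the trace \<open>\<psi> \<times> n\<close> on \<open>\<partial>\<Omega>\<close> is by definition the element of
  the dual (of order -1/2) of the space of traces of \<open>H1\<close> vector fields given by Green's formula
  \<open>\<langle>\<psi> \<times> n, \<phi>\<rangle> = \<integral>\<^sub>\<Omega> \<psi> \<bullet> curl \<phi> - curl \<psi> \<bullet> \<phi>\<close>.
\<close>

definition tangential_trace :: "R3 set \<Rightarrow> (R3 \<Rightarrow> R3) \<Rightarrow> (R3 \<Rightarrow> R3) \<Rightarrow> real" where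
  "tangential_trace \<Omega> \<psi> \<phi> = L2_inner \<Omega> \<psi> (wcurl \<Omega> \<phi>) - L2_inner \<Omega> (wcurl \<Omega> \<psi>) \<phi>"

definition H1_0_curl :: "R3 set \<Rightarrow> (R3 \<Rightarrow> R3) set" where
  "H1_0_curl \<Omega> = {\<psi> \<in> H1_curl \<Omega>. \<forall>\<phi>\<in>H1_vec \<Omega>. tangential_trace \<Omega> \<psi> \<phi> = 0}"

definition X_space :: "R3 set \<Rightarrow> (R3 \<Rightarrow> real) \<Rightarrow> (R3 \<Rightarrow> R3) set" where
  "X_space \<Omega> \<mu> = {\<psi> \<in> L2 \<Omega>. \<forall>u\<in>H1_0 \<Omega>. (LINT x|lebesgue_on \<Omega>. \<mu> x * (\<psi> x \<bullet> wgrad \<Omega> u x)) = 0}"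

definition Y_space :: "R3 set \<Rightarrow> (R3 \<Rightarrow> real) \<Rightarrow> (R3 \<Rightarrow> R3) set" where
  "Y_space \<Omega> \<mu> = H1_0_curl \<Omega> \<inter> X_space \<Omega> \<mu>"

section \<open>Time-dependent fields\<close>

text \<open>The Bochner space \<open>L\<^sup>2(0,T;V)\<close> for a space \<open>V\<close> of vector fields with norm \<open>N\<close>; the
  second condition is strong measurability.\<close>

definition Bochner_L2 ::
    "real \<Rightarrow> (R3 \<Rightarrow> R3) set \<Rightarrow> ((R3 \<Rightarrow> R3) \<Rightarrow> real) \<Rightarrow> (real \<Rightarrow> R3 \<Rightarrow> R3) set" where
  "Bochner_L2 T V N = {f.
     (AE t in lebesgue_on {0..T}. f t \<in> V) \<and>
     (\<exists>s. (\<forall>k::nat. simple_function (lebesgue_on {0..T}) (s k) \<and> s k ` {0..T} \<subseteq> V) \<and>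
          (AE t in lebesgue_on {0..T}. (\<lambda>k. N (\<lambda>x. s k t x - f t x)) \<longlonglongrightarrow> 0)) \<and>
     integrable (lebesgue_on {0..T}) (\<lambda>t. (N (f t))\<^sup>2)}"

text \<open>\<open>g\<close> is the weak derivative of \<open>f\<close> and belongs to \<open>L\<^sup>2(0,T;L\<^sup>2(\<Omega>))\<close>. The identity
  \<open>\<integral> \<eta>' f dt = - \<integral> \<eta> g dt\<close> between elements of \<open>L\<^sup>2(\<Omega>)\<close> is expressed by pairing
  with all \<open>w\<close>.\<close>

definition has_time_deriv ::
    "R3 set \<Rightarrow> real \<Rightarrow> (real \<Rightarrow> R3 \<Rightarrow> R3) \<Rightarrow> (real \<Rightarrow> R3 \<Rightarrow> R3) \<Rightarrow> bool" where
  "has_time_deriv \<Omega> T f g \<longleftrightarrow>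
     g \<in> Bochner_L2 T (L2 \<Omega>) (L2_norm \<Omega>) \<and>
     (\<forall>\<eta>\<in>test_functions {0<..<T}. \<forall>w\<in>L2 \<Omega>.
        (LINT t|lebesgue_on {0..T}. deriv \<eta> t * L2_inner \<Omega> (f t) w) =
        - (LINT t|lebesgue_on {0..T}. \<eta> t * L2_inner \<Omega> (g t) w))"

text \<open>\<open>fc\<close> is a representative of \<open>f\<close> in \<open>C([0,T];V)\<close>, where \<open>V\<close> carries the \<open>L\<^sup>2\<close> norm.\<close>

definition cont_representative ::
    "R3 set \<Rightarrow> real \<Rightarrow> (R3 \<Rightarrow> R3) set \<Rightarrow> (real \<Rightarrow> R3 \<Rightarrow> R3) \<Rightarrow> (real \<Rightarrow> R3 \<Rightarrow> R3) \<Rightarrow> bool" where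
  "cont_representative \<Omega> T V f fc \<longleftrightarrow>
     (AE t in lebesgue_on {0..T}. AE x in lebesgue_on \<Omega>. fc t x = f t x) \<and>
     (\<forall>t\<in>{0..T}. fc t \<in> V) \<and>
     (\<forall>t\<in>{0..T}. ((\<lambda>s. L2_norm \<Omega> (\<lambda>x. fc s x - fc t x)) \<longlongrightarrow> 0) (at t within {0..T}))"

definition weak_solution ::
    "R3 set \<Rightarrow> (R3 \<Rightarrow> real) \<Rightarrow> (R3 \<Rightarrow> real^3^3) \<Rightarrow> real \<Rightarrow>
     (real \<Rightarrow> R3 \<Rightarrow> R3) \<Rightarrow> (real \<Rightarrow> R3 \<Rightarrow> R3) \<Rightarrow> (R3 \<Rightarrow> R3) \<Rightarrow>
     (real \<Rightarrow> R3 \<Rightarrow> R3) \<Rightarrow> (real \<Rightarrow> R3 \<Rightarrow> R3) \<Rightarrow> bool" where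
  "weak_solution \<Omega> \<mu> \<sigma> T JE JM H0 E H \<longleftrightarrow>
     E \<in> Bochner_L2 T (H1_curl \<Omega>) (H1_curl_norm \<Omega>) \<and>
     H \<in> Bochner_L2 T (H1_0_curl \<Omega>) (H1_curl_norm \<Omega>) \<and>
     (\<exists>Ht. has_time_deriv \<Omega> T H Ht \<and>
        (AE t in lebesgue_on {0..T}.
          (\<forall>\<phi>\<in>H1_curl \<Omega>.
             (LINT x|lebesgue_on \<Omega>. H t x \<bullet> wcurl \<Omega> \<phi> x)
               - (LINT x|lebesgue_on \<Omega>. (\<sigma> x *v E t x) \<bullet> \<phi> x)
             = (LINT x|lebesgue_on \<Omega>. JE t x \<bullet> \<phi> x)) \<and>
          (\<forall>\<psi>\<in>H1_0_curl \<Omega>.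
             (LINT x|lebesgue_on \<Omega>. E t x \<bullet> wcurl \<Omega> \<psi> x)
               + (LINT x|lebesgue_on \<Omega>. \<mu> x * (Ht t x \<bullet> \<psi> x))
             = (LINT x|lebesgue_on \<Omega>. JM t x \<bullet> \<psi> x)))) \<and>
     (\<exists>Hc. cont_representative \<Omega> T (X_space \<Omega> \<mu>) H Hc \<and>
           (AE x in lebesgue_on \<Omega>. Hc 0 x = H0 x))"

end

theory Submission
  imports Defs "HOL-Computational_Algebra.Polynomial"
begin

text \<open>
  Extended by zero outside \<open>\<Omega>\<close>, fields are elements of \<open>L\<^sup>2(\<real>\<^sup>3)\<close>. There the curl on \<open>H\<^sup>1(\<Omega>; curl)\<close>
  is a closed operator with graph \<open>G\<close>, and the curl on \<open>H\<^sup>1\<^sub>0(\<Omega>; curl)\<close> is its adjoint. This is where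
  the geometry of \<open>\<Omega>\<close> enters: the trace is tested with \<open>H\<^sup>1\<close> fields only, and these are dense in
  \<open>H\<^sup>1(\<Omega>; curl)\<close>, because near each boundary point \<open>\<Omega>\<close> can be translated into itself.

  With \<open>a = curl E = J\<^sup>M - \<mu> \<partial>\<^sub>t H\<close> one has \<open>H(t) = H\<^sub>0 + \<integral>\<^sub>0\<^sup>t \<mu>\<^sup>-\<^sup>1 (J\<^sup>M - a)\<close>, so the system asks for \<open>(E, a)(t) \<in> G\<close>
  such that \<open>(H, \<sigma> E + J\<^sup>E)(t)\<close> lies in the graph of the adjoint for almost every \<open>t\<close>. After
  differentiation in time this is a weakly coercive problem for \<open>(E, a)\<close>, which Lions' projection
  argument solves on each interval \<open>[0, b]\<close>, with a bound for \<open>\<sigma> E(b)\<close> as well. Solutions are unique by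
  the energy identity, so the solution on \<open>[0, T]\<close> inherits the bounds for all \<open>b \<le> T\<close>.
\<close>

section \<open>The Hilbert space of square-integrable functions\<close>

text \<open>Differentiated in time and tested with \<open>(e, c)\<close> in \<open>G\<close>, the
  first equation reads \<open>s E' \<bullet> e + mi a \<bullet> c = mi JM \<bullet> c - JE'
  \<bullet> e\<close>, with \<open>m\<close> and \<open>s\<close> the multiplications by
  \<open>\<mu>\<close> and \<open>\<sigma>\<close> and \<open>mi\<close> the inverse of
  \<open>m\<close>. The initial value of \<open>s E\<close> is the curl of \<open>H0\<close> minus
  \<open>JE(0)\<close>. This is why the time derivative of \<open>JE\<close>, its value at 0 and the
  curl of \<open>H0\<close> appear among the data. The dissipative term controls only
  \<open>a\<close>, while \<open>E\<close> is reached through the time derivative, and the unknown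
  is too irregular in time to be its own test function. Coercivity is therefore proved for smooth
  test functions only, and the solution appears as the vector representing a functional. The type
  \<open>l2\<close> is used twice: for fields on space and, with values in pairs of such fields, for
  functions of time. Hence its values range over separable Hilbert spaces, and \<open>l2\<close>
  must itself be shown complete and separable.\<close>

definition square_integrable ::
    "('a::euclidean_space \<Rightarrow> 'b::{real_inner, second_countable_topology, banach}) \<Rightarrow> bool" where
  "square_integrable f \<longleftrightarrow> f \<in> borel_measurable lborel \<and> integrable lborel (\<lambda>x. (norm (f x))\<^sup>2)"

lemma square_integrable_zero [simp]: "square_integrable (\<lambda>x. 0)"
  by (simp add: square_integrable_def)

lemma square_integrable_measurable [measurable_dest]:
  "square_integrable f \<Longrightarrow> f \<in> borel_measurable borel"
  by (simp add: square_integrable_def)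

lemma norm_add_power2_le: "(norm (x + y))\<^sup>2 \<le> 2 * (norm x)\<^sup>2 + 2 * (norm y)\<^sup>2"
  for x y :: "'a::real_inner"
proof -
  have "0 \<le> (norm (x - y))\<^sup>2" by simp
  then show ?thesis
    by (simp add: power2_norm_eq_inner inner_add inner_diff inner_commute)
qed

lemma two_abs_inner_le: "2 * \<bar>x \<bullet> y\<bar> \<le> (norm x)\<^sup>2 + (norm y)\<^sup>2"
  for x y :: "'a::real_inner"
proof -
  have "0 \<le> (norm (x - y))\<^sup>2" "0 \<le> (norm (x + y))\<^sup>2" by simp_all
  then show ?thesis
    by (simp add: power2_norm_eq_inner inner_add inner_diff inner_commute)
qed

lemma square_integrable_bound:
  fixes f :: "'a::euclidean_space \<Rightarrow> 'b::{real_inner, second_countable_topology, banach}"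
    and g :: "'a \<Rightarrow> 'c::{real_inner, second_countable_topology, banach}"
  assumes "square_integrable f" "g \<in> borel_measurable borel" "AE x in lborel. norm (g x) \<le> C * norm (f x)"
  shows "square_integrable g"
  unfolding square_integrable_def
proof
  show "g \<in> borel_measurable lborel" using assms(2) by simp
  have [measurable]: "g \<in> borel_measurable borel" by fact
  show "integrable lborel (\<lambda>x. (norm (g x))\<^sup>2)"
  proof (rule Bochner_Integration.integrable_bound)
    show "integrable lborel (\<lambda>x. C\<^sup>2 * (norm (f x))\<^sup>2)"
      using assms(1) by (simp add: square_integrable_def)
    show "AE x in lborel. norm ((norm (g x))\<^sup>2) \<le> norm (C\<^sup>2 * (norm (f x))\<^sup>2)"
      using assms(3)
    proof eventually_elim
      fix x assume "norm (g x) \<le> C * norm (f x)"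
      then have "(norm (g x))\<^sup>2 \<le> (C * norm (f x))\<^sup>2"
        by (intro power_mono) auto
      then show "norm ((norm (g x))\<^sup>2) \<le> norm (C\<^sup>2 * (norm (f x))\<^sup>2)"
        by (simp add: power_mult_distrib)
    qed
  qed simp
qed

lemma square_integrable_add:
  assumes "square_integrable f" "square_integrable g"
  shows "square_integrable (\<lambda>x. f x + g x)"
  unfolding square_integrable_def
proof
  note [measurable] = assms[THEN square_integrable_measurable]
  show "(\<lambda>x. f x + g x) \<in> borel_measurable lborel" by simp
  show "integrable lborel (\<lambda>x. (norm (f x + g x))\<^sup>2)"
  proof (rule Bochner_Integration.integrable_bound)
    show "integrable lborel (\<lambda>x. 2 * (norm (f x))\<^sup>2 + 2 * (norm (g x))\<^sup>2)"
      using assms by (simp add: square_integrable_def)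
  qed (auto intro!: AE_I2 norm_add_power2_le)
qed

lemma square_integrable_linear:
  assumes "square_integrable f" "bounded_linear L"
  shows "square_integrable (\<lambda>x. L (f x))"
proof -
  interpret L: bounded_linear L by fact
  obtain K where "\<And>x. norm (L x) \<le> norm x * K" using L.bounded by blast
  moreover have "(\<lambda>x. L (f x)) \<in> borel_measurable borel"
    using assms borel_measurable_continuous_onI[OF L.continuous_on[OF continuous_on_id]]
    by (intro measurable_compose[OF square_integrable_measurable[OF assms(1)]]) auto
  ultimately show ?thesis
    by (intro square_integrable_bound[OF assms(1), where C=K]) (auto simp: mult.commute)
qed

lemma square_integrable_scaleR: "square_integrable f \<Longrightarrow> square_integrable (\<lambda>x. c *\<^sub>R f x)"
  by (rule square_integrable_linear[OF _ bounded_linear_scaleR_right])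

lemma square_integrable_uminus: "square_integrable f \<Longrightarrow> square_integrable (\<lambda>x. - f x)"
  by (rule square_integrable_linear[OF _ bounded_linear_minus[OF bounded_linear_ident]])

lemma square_integrable_diff:
  assumes "square_integrable f" "square_integrable g"
  shows "square_integrable (\<lambda>x. f x - g x)"
  using square_integrable_add[OF assms(1) square_integrable_uminus[OF assms(2)]] by simp

lemma square_integrable_inner:
  assumes "square_integrable f" "square_integrable g"
  shows "integrable lborel (\<lambda>x. f x \<bullet> g x)"
proof (rule Bochner_Integration.integrable_bound)
  note [measurable] = assms[THEN square_integrable_measurable]
  show "integrable lborel (\<lambda>x. (norm (f x))\<^sup>2 + (norm (g x))\<^sup>2)"
    using assms by (simp add: square_integrable_def)
  show "AE x in lborel. norm (f x \<bullet> g x) \<le> norm ((norm (f x))\<^sup>2 + (norm (g x))\<^sup>2)"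
  proof (rule AE_I2)
    fix x show "norm (f x \<bullet> g x) \<le> norm ((norm (f x))\<^sup>2 + (norm (g x))\<^sup>2)"
      using two_abs_inner_le[of "f x" "g x"] by (simp only: real_norm_def abs_of_nonneg sum_power2_ge_zero)
  qed
  show "(\<lambda>x. f x \<bullet> g x) \<in> borel_measurable lborel" by simp
qed

\<comment> \<open>Equality almost everywhere, restricted to square integrable functions, is a
  partial equivalence, so no subtype has to be carved out first. Representatives are Borel functions
  on the whole Euclidean space; a domain enters later through extension by zero.\<close>
quotient_type (overloaded) ('a, 'b) l2 =
    "'a::euclidean_space \<Rightarrow> 'b::{real_inner, second_countable_topology, banach}" /
    partial: "\<lambda>f g. square_integrable f \<and> square_integrable g \<and> (AE x in lborel. f x = g x)"
proof (rule part_equivpI)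
  show "\<exists>f::'a \<Rightarrow> 'b. square_integrable f \<and> square_integrable f \<and> (AE x in lborel. f x = f x)"
    by (intro exI[of _ "\<lambda>x. 0"]) auto
qed (auto simp: symp_def transp_def elim: eventually_elim2)

definition to_l2 :: "('a::euclidean_space \<Rightarrow> 'b::{real_inner, second_countable_topology, banach}) \<Rightarrow> ('a, 'b) l2" where
  "to_l2 f = abs_l2 (if square_integrable f then f else (\<lambda>x. 0))"

lemma square_integrable_rep [simp]: "square_integrable (rep_l2 u)"
  using Quotient_rep_reflp[OF Quotient_l2] by blast

lemma rep_l2_measurable [measurable]: "rep_l2 u \<in> borel_measurable borel"
  by (rule square_integrable_measurable) simp

lemma to_l2_rep [simp]: "to_l2 (rep_l2 u) = u"
  by (simp add: to_l2_def Quotient_abs_rep[OF Quotient_l2])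

lemma rep_to_l2: "square_integrable f \<Longrightarrow> AE x in lborel. rep_l2 (to_l2 f) x = f x"
  using Quotient_rep_abs[OF Quotient_l2, of f] by (simp add: to_l2_def)

lemma to_l2_eq_iff:
  assumes "square_integrable f" "square_integrable g"
  shows "to_l2 f = to_l2 g \<longleftrightarrow> (AE x in lborel. f x = g x)"
  using Quotient_rel[OF Quotient_l2, of f g] assms by (simp add: to_l2_def)

lemma l2_eqI: "(AE x in lborel. rep_l2 u x = rep_l2 v x) \<Longrightarrow> u = v"
  using to_l2_eq_iff[of "rep_l2 u" "rep_l2 v"] by simp

lemma to_l2_eqI:
  assumes "square_integrable f" "AE x in lborel. f x = rep_l2 u x"
  shows "to_l2 f = u"
  using to_l2_eq_iff[of f "rep_l2 u"] assms by simp

instantiation l2 :: (euclidean_space, "{real_inner, second_countable_topology, banach}") real_vector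
begin

definition zero_l2 :: "('a, 'b) l2" where "0 = to_l2 (\<lambda>x. 0)"
definition plus_l2 :: "('a, 'b) l2 \<Rightarrow> ('a, 'b) l2 \<Rightarrow> ('a, 'b) l2" where
  "u + v = to_l2 (\<lambda>x. rep_l2 u x + rep_l2 v x)"
definition uminus_l2 :: "('a, 'b) l2 \<Rightarrow> ('a, 'b) l2" where
  "- u = to_l2 (\<lambda>x. - rep_l2 u x)"
definition minus_l2 :: "('a, 'b) l2 \<Rightarrow> ('a, 'b) l2 \<Rightarrow> ('a, 'b) l2" where
  "u - v = to_l2 (\<lambda>x. rep_l2 u x - rep_l2 v x)"
definition scaleR_l2 :: "real \<Rightarrow> ('a, 'b) l2 \<Rightarrow> ('a, 'b) l2" where
  "c *\<^sub>R u = to_l2 (\<lambda>x. c *\<^sub>R rep_l2 u x)"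

lemma rep_zero: "AE x in lborel. rep_l2 (0::('a, 'b) l2) x = 0"
  unfolding zero_l2_def by (rule rep_to_l2) simp

lemma rep_add: "AE x in lborel. rep_l2 (u + v :: ('a, 'b) l2) x = rep_l2 u x + rep_l2 v x"
  unfolding plus_l2_def by (rule rep_to_l2) (simp add: square_integrable_add)

lemma rep_uminus: "AE x in lborel. rep_l2 (- u :: ('a, 'b) l2) x = - rep_l2 u x"
  unfolding uminus_l2_def by (rule rep_to_l2) (simp add: square_integrable_uminus)

lemma rep_diff: "AE x in lborel. rep_l2 (u - v :: ('a, 'b) l2) x = rep_l2 u x - rep_l2 v x"
  unfolding minus_l2_def by (rule rep_to_l2) (simp add: square_integrable_diff)

lemma rep_scaleR: "AE x in lborel. rep_l2 (c *\<^sub>R u :: ('a, 'b) l2) x = c *\<^sub>R rep_l2 u x"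
  unfolding scaleR_l2_def by (rule rep_to_l2) (simp add: square_integrable_scaleR)

instance
proof
  fix u v w :: "('a, 'b) l2" and c d :: real
  show "u + v + w = u + (v + w)"
    using rep_add[of "u + v" w] rep_add[of u v] rep_add[of v w] rep_add[of u "v + w"]
    by (intro l2_eqI, eventually_elim) (simp add: add.assoc)
  show "u + v = v + u"
    using rep_add[of u v] rep_add[of v u] by (intro l2_eqI, eventually_elim) (simp add: add.commute)
  show "0 + u = u"
    using rep_add[of 0 u] rep_zero by (intro l2_eqI, eventually_elim) simp
  show "- u + u = 0"
    using rep_add[of "- u" u] rep_uminus[of u] rep_zero by (intro l2_eqI, eventually_elim) simp
  show "u - v = u + - v"
    using rep_add[of u "- v"] rep_uminus[of v] rep_diff[of u v] by (intro l2_eqI, eventually_elim) simp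
  show "c *\<^sub>R (u + v) = c *\<^sub>R u + c *\<^sub>R v"
    using rep_add[of u v] rep_scaleR[of c "u + v"] rep_scaleR[of c u] rep_scaleR[of c v]
      rep_add[of "c *\<^sub>R u" "c *\<^sub>R v"]
    by (intro l2_eqI, eventually_elim) (simp add: scaleR_add_right)
  show "(c + d) *\<^sub>R u = c *\<^sub>R u + d *\<^sub>R u"
    using rep_scaleR[of "c + d" u] rep_scaleR[of c u] rep_scaleR[of d u]
      rep_add[of "c *\<^sub>R u" "d *\<^sub>R u"]
    by (intro l2_eqI, eventually_elim) (simp add: scaleR_add_left)
  show "c *\<^sub>R d *\<^sub>R u = (c * d) *\<^sub>R u"
    using rep_scaleR[of d u] rep_scaleR[of c "d *\<^sub>R u"] rep_scaleR[of "c * d" u]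
    by (intro l2_eqI, eventually_elim) simp
  show "1 *\<^sub>R u = u"
    using rep_scaleR[of 1 u] by (intro l2_eqI, eventually_elim) simp
qed

end

instantiation l2 :: (euclidean_space, "{real_inner, second_countable_topology, banach}") real_inner
begin

definition inner_l2 :: "('a, 'b) l2 \<Rightarrow> ('a, 'b) l2 \<Rightarrow> real" where
  "inner_l2 u v = (LINT x|lborel. rep_l2 u x \<bullet> rep_l2 v x)"
definition norm_l2 :: "('a, 'b) l2 \<Rightarrow> real" where "norm_l2 u = sqrt (u \<bullet> u)"
definition dist_l2 :: "('a, 'b) l2 \<Rightarrow> ('a, 'b) l2 \<Rightarrow> real" where "dist_l2 u v = norm (u - v)"
definition sgn_l2 :: "('a, 'b) l2 \<Rightarrow> ('a, 'b) l2" where "sgn_l2 u = inverse (norm u) *\<^sub>R u"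
definition uniformity_l2 :: "(('a, 'b) l2 \<times> ('a, 'b) l2) filter" where
  "uniformity_l2 = (INF e\<in>{0 <..}. principal {(u, v). dist u v < e})"
definition open_l2 :: "('a, 'b) l2 set \<Rightarrow> bool" where
  "open_l2 U \<longleftrightarrow> (\<forall>u\<in>U. eventually (\<lambda>(u', v). u' = u \<longrightarrow> v \<in> U) uniformity)"

instance
proof
  fix u v w :: "('a, 'b) l2" and c :: real and U :: "('a, 'b) l2 set"
  have int: "integrable lborel (\<lambda>x. rep_l2 a x \<bullet> rep_l2 b x)" for a b :: "('a, 'b) l2"
    by (rule square_integrable_inner) simp_all
  show "dist u v = norm (u - v)" by (rule dist_l2_def)
  show "sgn u = inverse (norm u) *\<^sub>R u" by (rule sgn_l2_def)
  show "uniformity = (INF e\<in>{0 <..}. principal {(u::('a, 'b) l2, v). dist u v < e})"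
    by (rule uniformity_l2_def)
  show "open U = (\<forall>u\<in>U. eventually (\<lambda>(u', v). u' = u \<longrightarrow> v \<in> U) uniformity)"
    by (rule open_l2_def)
  show "u \<bullet> v = v \<bullet> u" by (simp add: inner_l2_def inner_commute)
  have "(LINT x|lborel. rep_l2 (u + v) x \<bullet> rep_l2 w x) =
      (LINT x|lborel. rep_l2 u x \<bullet> rep_l2 w x + rep_l2 v x \<bullet> rep_l2 w x)"
    using rep_add[of u v] by (intro integral_cong_AE) (auto simp: inner_add)
  then show "(u + v) \<bullet> w = u \<bullet> w + v \<bullet> w"
    using int by (simp add: inner_l2_def)
  have "(LINT x|lborel. rep_l2 (c *\<^sub>R u) x \<bullet> rep_l2 v x) = (LINT x|lborel. c * (rep_l2 u x \<bullet> rep_l2 v x))"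
    using rep_scaleR[of c u] by (intro integral_cong_AE) auto
  then show "(c *\<^sub>R u) \<bullet> v = c * (u \<bullet> v)"
    using int by (simp add: inner_l2_def)
  show "0 \<le> u \<bullet> u" by (simp add: inner_l2_def)
  have "(AE x in lborel. rep_l2 u x \<bullet> rep_l2 u x = 0) \<longleftrightarrow> (AE x in lborel. rep_l2 u x = rep_l2 0 x)"
    by (rule eventually_cong[OF rep_zero]) auto
  moreover have "(AE x in lborel. rep_l2 u x = rep_l2 0 x) \<longleftrightarrow> u = 0"
    using l2_eqI by blast
  ultimately show "(u \<bullet> u = 0) = (u = 0)"
    by (simp add: inner_l2_def integral_nonneg_eq_0_iff_AE[OF int])
  show "norm u = sqrt (u \<bullet> u)" by (rule norm_l2_def)
qed

end

lemma inner_to_l2: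
  assumes "square_integrable f" "square_integrable g"
  shows "to_l2 f \<bullet> to_l2 g = (LINT x|lborel. f x \<bullet> g x)"
proof -
  note [measurable] = assms[THEN square_integrable_measurable]
  show ?thesis
    unfolding inner_l2_def
    using rep_to_l2[OF assms(1)] rep_to_l2[OF assms(2)]
    by (intro integral_cong_AE) auto
qed

lemma inner_rep_to_l2:
  assumes "square_integrable f"
  shows "u \<bullet> to_l2 f = (LINT x|lborel. rep_l2 u x \<bullet> f x)"
  using inner_to_l2[of "rep_l2 u" f] assms by simp

lemma power2_norm_l2: "(norm u)\<^sup>2 = (LINT x|lborel. (norm (rep_l2 u x))\<^sup>2)"
  by (simp add: power2_norm_eq_inner inner_l2_def)

lemma power2_norm_to_l2: "square_integrable f \<Longrightarrow> (norm (to_l2 f))\<^sup>2 = (LINT x|lborel. (norm (f x))\<^sup>2)"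
  by (simp add: power2_norm_eq_inner inner_to_l2)

lemma to_l2_add:
  assumes "square_integrable f" "square_integrable g"
  shows "to_l2 (\<lambda>x. f x + g x) = to_l2 f + to_l2 g"
  using rep_to_l2[OF assms(1)] rep_to_l2[OF assms(2)] rep_add[of "to_l2 f" "to_l2 g"]
  by (intro to_l2_eqI square_integrable_add assms, eventually_elim) simp

lemma to_l2_diff:
  assumes "square_integrable f" "square_integrable g"
  shows "to_l2 (\<lambda>x. f x - g x) = to_l2 f - to_l2 g"
  using rep_to_l2[OF assms(1)] rep_to_l2[OF assms(2)] rep_diff[of "to_l2 f" "to_l2 g"]
  by (intro to_l2_eqI square_integrable_diff assms, eventually_elim) simp

lemma to_l2_scaleR:
  assumes "square_integrable f"
  shows "to_l2 (\<lambda>x. c *\<^sub>R f x) = c *\<^sub>R to_l2 f"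
  using rep_to_l2[OF assms(1)] rep_scaleR[of c "to_l2 f"]
  by (intro to_l2_eqI square_integrable_scaleR assms, eventually_elim) simp

text \<open>Riesz--Fischer: a subsequence with summable consecutive distances converges almost
  everywhere, and Fatou's lemma identifies its pointwise limit with the limit in norm.\<close>

instance l2 :: (euclidean_space, "{real_inner, second_countable_topology, banach}") complete_space
proof
  fix X :: "nat \<Rightarrow> ('a, 'b) l2"
  assume cauchy: "Cauchy X"
  have "\<exists>N. \<forall>m\<ge>N. \<forall>n\<ge>N. norm (X m - X n) < (1/2)^k" for k :: nat
    using CauchyD[OF cauchy, of "(1/2)^k"] by simp
  then obtain N where N: "\<And>k m n. m \<ge> N k \<Longrightarrow> n \<ge> N k \<Longrightarrow> norm (X m - X n) < (1/2)^k"
    by metis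
  \<comment> \<open>Summing the thresholds makes \<open>r\<close> strictly increasing while keeping
    \<open>r k\<close> above \<open>N k\<close>.\<close>
  define r where "r k = (\<Sum>j\<le>k. N j) + k" for k
  have rN: "r k \<ge> N k" for k
    unfolding r_def by (meson atMost_iff finite_atMost le_add1 member_le_sum order_refl order_trans zero_le)
  have r_mono: "strict_mono r" by (rule strict_mono_Suc_iff[THEN iffD2]) (simp add: r_def)
  have rN2: "r (Suc k) \<ge> N k" for k
    using rN[of k] strict_monoD[OF r_mono, of k "Suc k"] by simp
  define d where "d k = X (r (Suc k)) - X (r k)" for k
  have d: "norm (d k) < (1/2)^k" for k unfolding d_def by (rule N[OF rN2 rN])
  define f where "f k = rep_l2 (X (r k))" for k
  define h where "h k x = norm (f (Suc k) x - f k x)" for k x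
  have [measurable]: "f k \<in> borel_measurable borel" for k by (simp add: f_def)
  have [measurable]: "h k \<in> borel_measurable borel" for k by (simp add: h_def[abs_def])
  have sqh: "square_integrable (h k)" for k
    by (rule square_integrable_bound[of "rep_l2 (d k)" _ 1])
      (use rep_diff[of "X (r (Suc k))" "X (r k)"] in \<open>auto simp: h_def f_def d_def\<close>)
  have normh: "norm (to_l2 (h k)) = norm (d k)" for k
  proof -
    have "(norm (to_l2 (h k)))\<^sup>2 = (LINT x|lborel. (norm (h k x))\<^sup>2)" by (rule power2_norm_to_l2[OF sqh])
    also have "\<dots> = (norm (d k))\<^sup>2"
      unfolding power2_norm_l2
      by (rule integral_cong_AE) (use rep_diff[of "X (r (Suc k))" "X (r k)"] in \<open>auto simp: h_def f_def d_def\<close>)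
    finally show ?thesis by simp
  qed
  \<comment> \<open>Partial sums of the pointwise jumps along the subsequence. Their norms stay
    below the geometric sum 2, so by monotone convergence the series of jumps is finite almost
    everywhere.\<close>
  define g where "g n x = (\<Sum>k<n. h k x)" for n x
  have [measurable]: "g k \<in> borel_measurable borel" for k by (simp add: g_def[abs_def])
  have g_sq: "square_integrable (g n) \<and> norm (to_l2 (g n)) \<le> 2" for n
  proof -
    have "square_integrable (g n) \<and> norm (to_l2 (g n)) \<le> (\<Sum>k<n. (1/2)^k)"
    proof (induction n)
      case 0
      then show ?case by (simp add: g_def zero_l2_def[symmetric])
    next
      case (Suc n)
      have eq: "g (Suc n) = (\<lambda>x. g n x + h n x)" by (simp add: g_def fun_eq_iff)
      show ?case
        unfolding eq using Suc sqh[of n] normh[of n] d[of n]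
          norm_triangle_ineq[of "to_l2 (g n)" "to_l2 (h n)"]
        by (auto simp: square_integrable_add to_l2_add)
    qed
    moreover have "(\<Sum>k<n. (1/2::real)^k) \<le> 2"
      by (simp add: geometric_sum)
    ultimately show ?thesis by linarith
  qed
  have g_bound: "(\<integral>\<^sup>+x. ennreal ((g n x)\<^sup>2) \<partial>lborel) \<le> 4" for n
  proof -
    have "integrable lborel (\<lambda>x. (g n x)\<^sup>2)" using g_sq[of n] by (simp add: square_integrable_def)
    then have "(\<integral>\<^sup>+x. ennreal ((g n x)\<^sup>2) \<partial>lborel) = ennreal (LINT x|lborel. (g n x)\<^sup>2)"
      by (intro nn_integral_eq_integral) auto
    also have "(LINT x|lborel. (g n x)\<^sup>2) = (norm (to_l2 (g n)))\<^sup>2"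
      using g_sq[of n] by (simp add: power2_norm_to_l2)
    also have "\<dots> \<le> 2\<^sup>2" using g_sq[of n] by (intro power_mono) auto
    finally show ?thesis by (simp add: ennreal_leI)
  qed
  have g_mono: "g n x \<le> g m x" if "n \<le> m" for n m x
    unfolding g_def using that by (intro sum_mono2) (auto simp: h_def)
  have g_nonneg: "0 \<le> g n x" for n x unfolding g_def by (intro sum_nonneg) (simp add: h_def)
  have "(\<integral>\<^sup>+x. (SUP n. ennreal ((g n x)\<^sup>2)) \<partial>lborel) = (SUP n. \<integral>\<^sup>+x. ennreal ((g n x)\<^sup>2) \<partial>lborel)"
    by (rule nn_integral_monotone_convergence_SUP)
      (auto simp: incseq_def le_fun_def intro!: ennreal_leI power_mono g_mono g_nonneg)
  also have "\<dots> \<le> 4" by (intro SUP_least g_bound)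
  finally have "(\<integral>\<^sup>+x. (SUP n. ennreal ((g n x)\<^sup>2)) \<partial>lborel) \<noteq> \<infinity>"
    by (auto simp: top_unique)
  then have "AE x in lborel. (SUP n. ennreal ((g n x)\<^sup>2)) \<noteq> \<infinity>"
    by (intro nn_integral_noteq_infinite) auto
  then have conv: "AE x in lborel. convergent (\<lambda>k. f k x)"
  proof eventually_elim
    fix x assume fin: "(SUP n. ennreal ((g n x)\<^sup>2)) \<noteq> \<infinity>"
    then obtain B where B: "(SUP n. ennreal ((g n x)\<^sup>2)) = ennreal B" "B \<ge> 0"
      by (metis ennreal_cases infinity_ennreal_def)
    have "ennreal ((g n x)\<^sup>2) \<le> ennreal B" for n
      unfolding B(1)[symmetric] by (rule SUP_upper) simp
    then have "g n x \<le> sqrt B" for n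
      using B(2) by (intro real_le_rsqrt) simp
    then have "summable (\<lambda>k. h k x)"
      by (intro summableI_nonneg_bounded[where x="sqrt B"]) (auto simp: h_def g_def)
    then have "summable (\<lambda>k. f (Suc k) x - f k x)"
      unfolding h_def by (rule summable_norm_cancel)
    then have "convergent (\<lambda>n. \<Sum>k<n. f (Suc k) x - f k x)"
      by (simp add: summable_iff_convergent)
    then have "convergent (\<lambda>n. f n x - f 0 x)"
      by (simp only: sum_lessThan_telescope[of "\<lambda>k. f k x"])
    then show "convergent (\<lambda>k. f k x)"
      by (simp add: convergent_diff_const_right_iff)
  qed
  define F where "F x = lim (\<lambda>k. f k x)" for x
  have [measurable]: "F \<in> borel_measurable borel"
    unfolding F_def[abs_def] by (rule borel_measurable_lim_metric) simp
  have lim: "AE x in lborel. (\<lambda>k. f k x) \<longlonglongrightarrow> F x"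
    using conv by eventually_elim (simp add: F_def convergent_LIMSEQ_iff)
  \<comment> \<open>Fatou is applied along the subsequence with \<open>n\<close> fixed. This gives
    closeness of every late \<open>X n\<close> to the limit and also shows that the limit is square
    integrable.\<close>
  have fatou: "(\<integral>\<^sup>+x. ennreal ((norm (F x - rep_l2 (X n) x))\<^sup>2) \<partial>lborel) \<le> ennreal (e\<^sup>2)"
    if e: "\<And>k. k \<ge> k0 \<Longrightarrow> norm (X (r k) - X n) \<le> e" "e \<ge> 0" for n k0 e
  proof -
    have "(\<integral>\<^sup>+x. ennreal ((norm (F x - rep_l2 (X n) x))\<^sup>2) \<partial>lborel)
       = (\<integral>\<^sup>+x. liminf (\<lambda>k. ennreal ((norm (f k x - rep_l2 (X n) x))\<^sup>2)) \<partial>lborel)"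
    proof (rule nn_integral_cong_AE, use lim in eventually_elim)
      fix x assume "(\<lambda>k. f k x) \<longlonglongrightarrow> F x"
      then have "(\<lambda>k. ennreal ((norm (f k x - rep_l2 (X n) x))\<^sup>2)) \<longlonglongrightarrow> ennreal ((norm (F x - rep_l2 (X n) x))\<^sup>2)"
        by (intro tendsto_intros)
      then show "ennreal ((norm (F x - rep_l2 (X n) x))\<^sup>2) = liminf (\<lambda>k. ennreal ((norm (f k x - rep_l2 (X n) x))\<^sup>2))"
        by (metis lim_imp_Liminf trivial_limit_sequentially)
    qed
    also have "\<dots> \<le> liminf (\<lambda>k. \<integral>\<^sup>+x. ennreal ((norm (f k x - rep_l2 (X n) x))\<^sup>2) \<partial>lborel)"
      by (rule nn_integral_liminf) simp
    also have "\<dots> \<le> ennreal (e\<^sup>2)"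
    proof (rule Liminf_le, simp, rule eventually_sequentiallyI)
      fix k assume "k0 \<le> k"
      have "square_integrable (\<lambda>x. f k x - rep_l2 (X n) x)"
        by (simp add: f_def square_integrable_diff)
      then have "(\<integral>\<^sup>+x. ennreal ((norm (f k x - rep_l2 (X n) x))\<^sup>2) \<partial>lborel)
         = ennreal (LINT x|lborel. (norm (f k x - rep_l2 (X n) x))\<^sup>2)"
        by (intro nn_integral_eq_integral) (auto simp: square_integrable_def)
      also have "(LINT x|lborel. (norm (f k x - rep_l2 (X n) x))\<^sup>2) = (norm (X (r k) - X n))\<^sup>2"
        unfolding power2_norm_l2
        by (rule integral_cong_AE) (use rep_diff[of "X (r k)" "X n"] in \<open>auto simp: f_def\<close>)
      also have "ennreal \<dots> \<le> ennreal (e\<^sup>2)"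
        using e(1)[OF \<open>k0 \<le> k\<close>] by (intro ennreal_leI power_mono) auto
      finally show "(\<integral>\<^sup>+x. ennreal ((norm (f k x - rep_l2 (X n) x))\<^sup>2) \<partial>lborel) \<le> ennreal (e\<^sup>2)" .
    qed
    finally show ?thesis .
  qed
  have close: "square_integrable (\<lambda>x. F x - rep_l2 (X n) x)
      \<and> norm (to_l2 (\<lambda>x. F x - rep_l2 (X n) x)) \<le> (1/2)^j" if n: "n \<ge> N j" for n j
  proof -
    have le: "norm (X (r k) - X n) \<le> (1/2)^j" if "k \<ge> j" for k
    proof -
      have "r k \<ge> N j"
        using rN[of j] strict_mono_leD[OF r_mono that] by simp
      then show ?thesis using N[of j "r k" n] n by simp
    qed
    have b: "(\<integral>\<^sup>+x. ennreal ((norm (F x - rep_l2 (X n) x))\<^sup>2) \<partial>lborel) \<le> ennreal (((1/2)^j)\<^sup>2)"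
      by (rule fatou[of j]) (use le in auto)
    have sq: "square_integrable (\<lambda>x. F x - rep_l2 (X n) x)"
      unfolding square_integrable_def
      using le_less_trans[OF b ennreal_less_top]
      by (auto intro!: integrableI_nonneg)
    then have "ennreal ((norm (to_l2 (\<lambda>x. F x - rep_l2 (X n) x)))\<^sup>2)
        = (\<integral>\<^sup>+x. ennreal ((norm (F x - rep_l2 (X n) x))\<^sup>2) \<partial>lborel)"
      unfolding power2_norm_to_l2[OF sq]
      by (intro nn_integral_eq_integral[symmetric]) (auto simp: square_integrable_def)
    then have "ennreal ((norm (to_l2 (\<lambda>x. F x - rep_l2 (X n) x)))\<^sup>2) \<le> ennreal (((1/2)^j)\<^sup>2)"
      using b by simp
    then have "(norm (to_l2 (\<lambda>x. F x - rep_l2 (X n) x)))\<^sup>2 \<le> ((1/2)^j)\<^sup>2"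
      by simp
    then have "norm (to_l2 (\<lambda>x. F x - rep_l2 (X n) x)) \<le> (1/2)^j"
      by (rule power2_le_imp_le) simp
    with sq show ?thesis by blast
  qed
  have sqF: "square_integrable F"
    using square_integrable_add[OF close[of 0 "N 0", THEN conjunct1] square_integrable_rep[of "X (N 0)"]] by simp
  have "X \<longlonglongrightarrow> to_l2 F"
  proof (rule metric_LIMSEQ_I)
    fix e :: real assume "e > 0"
    then obtain j where j: "(1/2)^j < e" using real_arch_pow_inv[of e "1/2"] by auto
    show "\<exists>no. \<forall>n\<ge>no. dist (X n) (to_l2 F) < e"
    proof (intro exI allI impI)
      fix n assume "N j \<le> n"
      have "to_l2 (\<lambda>x. F x - rep_l2 (X n) x) = to_l2 F - X n"
        using to_l2_diff[OF sqF square_integrable_rep[of "X n"]] by simp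
      then show "dist (X n) (to_l2 F) < e"
        using close[OF \<open>N j \<le> n\<close>] j by (simp add: dist_norm norm_minus_commute)
    qed
  qed
  then show "convergent X" by (auto simp: convergent_def)
qed

instance l2 :: (euclidean_space, "{real_inner, second_countable_topology, banach}") banach ..

lemma LIMSEQ_squeeze_Suc:
  fixes f :: "nat \<Rightarrow> real"
  assumes "\<And>n. a \<le> f n" "\<And>n. f n < a + 1 / real (Suc n)"
  shows "f \<longlonglongrightarrow> a"
proof (rule tendsto_sandwich[of "\<lambda>_. a"])
  show "(\<lambda>n. a + 1 / real (Suc n)) \<longlonglongrightarrow> a"
    using tendsto_add[OF tendsto_const LIMSEQ_inverse_real_of_nat, of a] by (simp add: inverse_eq_divide)
  show "\<forall>\<^sub>F n in sequentially. f n \<le> a + 1 / real (Suc n)"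
    using less_imp_le[OF assms(2)] by (rule always_eventually[OF allI])
qed (use assms(1) in auto)

section \<open>Representation and projection in Hilbert spaces\<close>

text \<open>The relation \<open>R\<close> plays the role of a functional on a subspace. Its representing vector is
  the limit of a minimizing sequence of \<open>norm x ^ 2 / 2 - l\<close> over \<open>R\<close>.\<close>

lemma hilbert_representation:
  fixes R :: "('h::{real_inner, banach} \<times> real) set"
  assumes sub: "subspace R" and bound: "\<And>x l. (x, l) \<in> R \<Longrightarrow> \<bar>l\<bar> \<le> C * norm x" and "C \<ge> 0"
  obtains u where "u \<in> closure (fst ` R)" "norm u \<le> C" "\<And>x l. (x, l) \<in> R \<Longrightarrow> u \<bullet> x = l"
proof -
  define J where "J p = (norm (fst p))\<^sup>2 / 2 - snd p" for p :: "'h \<times> real"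
  have J_ge: "J p \<ge> - C\<^sup>2 / 2" if "p \<in> R" for p
  proof -
    have "\<bar>snd p\<bar> \<le> C * norm (fst p)" using bound[of "fst p" "snd p"] that by simp
    moreover have "0 \<le> (norm (fst p) - C)\<^sup>2" by simp
    ultimately show ?thesis unfolding J_def power2_diff by (simp add: field_simps)
  qed
  define I where "I = Inf (J ` R)"
  have R0: "0 \<in> R" using sub by (rule subspace_0)
  have bdd: "bdd_below (J ` R)" using J_ge by (rule bdd_belowI2)
  have I_le: "I \<le> J p" if "p \<in> R" for p unfolding I_def using bdd that by (intro cInf_lower) auto
  have "\<exists>p\<in>R. J p < I + 1 / real (Suc n)" for n
  proof -
    have "I < I + 1 / real (Suc n)" by simp
    then show ?thesis unfolding I_def using cInf_less_iff[of "J ` R"] bdd R0 by blast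
  qed
  then obtain p where p: "\<And>n. p n \<in> R" "\<And>n. J (p n) < I + 1 / real (Suc n)" by metis
  define x where "x n = fst (p n)" for n
  define l where "l n = snd (p n)" for n
  have xl: "(x n, l n) \<in> R" for n using p(1)[of n] by (simp add: x_def l_def)
  have Jlim: "(\<lambda>n. J (p n)) \<longlonglongrightarrow> I"
    using I_le[OF p(1)] p(2) by (rule LIMSEQ_squeeze_Suc)
  \<comment> \<open>Parallelogram law: half the sum of two elements of \<open>R\<close> lies in
    \<open>R\<close>, so its value under \<open>J\<close> is at least \<open>I\<close>.
    Near-minimizers therefore have close first components.\<close>
  have par: "(norm (x n - x m))\<^sup>2 \<le> 4 * (J (p n) + J (p m) - 2 * I)" for n m
  proof -
    have "(1/2) *\<^sub>R (p n + p m) \<in> R" using sub p(1) by (intro subspace_scale subspace_add)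
    then have "I \<le> J ((1/2) *\<^sub>R (p n + p m))" by (rule I_le)
    then show ?thesis
      unfolding J_def x_def power2_norm_eq_inner
      by (simp add: inner_add inner_diff inner_commute algebra_simps)
  qed
  have "Cauchy x"
  proof (rule metric_CauchyI)
    fix e :: real assume "e > 0"
    then have "e\<^sup>2 / 8 > 0" by simp
    then have "\<forall>\<^sub>F n in sequentially. J (p n) < I + e\<^sup>2 / 8"
      using order_tendstoD(2)[OF Jlim, of "I + e\<^sup>2 / 8"] by simp
    then obtain N where N: "\<And>n. n \<ge> N \<Longrightarrow> J (p n) < I + e\<^sup>2 / 8"
      by (auto simp: eventually_sequentially)
    have "dist (x m) (x n) < e" if "m \<ge> N" "n \<ge> N" for m n
    proof -
      have "(norm (x m - x n))\<^sup>2 < e\<^sup>2" using par[of m n] N[OF that(1)] N[OF that(2)] by simp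
      then show ?thesis using \<open>e > 0\<close> by (simp add: dist_norm power2_less_imp_less)
    qed
    then show "\<exists>M. \<forall>m\<ge>M. \<forall>n\<ge>M. dist (x m) (x n) < e" by blast
  qed
  then obtain u where u: "x \<longlonglongrightarrow> u" using Cauchy_convergent convergent_def by blast
  have rep: "u \<bullet> y = k" if "(y, k) \<in> R" for y k
  proof -
    define d where "d = u \<bullet> y - k"
    \<comment> \<open>Minimality in the direction \<open>(y, k)\<close>. The limit \<open>u\<close>
      may lie only in the closure, so the inequality is taken along the minimizing sequence and then
      passed to the limit.\<close>
    have quad: "0 \<le> t * d + t\<^sup>2 * (norm y)\<^sup>2 / 2" for t
    proof -
      have "I \<le> J (p n) + (t * (x n \<bullet> y - k) + t\<^sup>2 * (norm y)\<^sup>2 / 2)" for n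
      proof -
        have "p n + t *\<^sub>R (y, k) \<in> R" using sub p(1) that by (intro subspace_scale subspace_add)
        then have "I \<le> J (p n + t *\<^sub>R (y, k))" by (rule I_le)
        then show ?thesis
          unfolding J_def x_def power2_norm_eq_inner
          by (simp add: inner_add inner_commute algebra_simps power2_eq_square)
      qed
      moreover have "(\<lambda>n. J (p n) + (t * (x n \<bullet> y - k) + t\<^sup>2 * (norm y)\<^sup>2 / 2))
          \<longlonglongrightarrow> I + (t * d + t\<^sup>2 * (norm y)\<^sup>2 / 2)"
        unfolding d_def by (intro tendsto_intros Jlim u)
      ultimately have "I \<le> I + (t * d + t\<^sup>2 * (norm y)\<^sup>2 / 2)"
        by (intro LIMSEQ_le_const) auto
      then show ?thesis by simp
    qed
    have "d = 0"
    proof (rule ccontr)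
      assume "d \<noteq> 0"
      \<comment> \<open>The added 1 keeps the step \<open>t\<close> defined when
        \<open>y = 0\<close>; this \<open>t\<close> makes the quadratic of \<open>quad\<close>
        negative.\<close>
      define N where "N = (norm y)\<^sup>2 + 1"
      define t where "t = - d / N"
      have N: "N > 0" by (simp add: N_def add_nonneg_pos)
      have "t * d + t\<^sup>2 * (norm y)\<^sup>2 / 2 \<le> t * d + t\<^sup>2 * N / 2"
        by (simp add: N_def mult_left_mono divide_right_mono)
      also have "\<dots> = - d\<^sup>2 / (2 * N)"
        using N by (simp add: t_def field_simps power2_eq_square)
      also have "\<dots> < 0" using N \<open>d \<noteq> 0\<close> by (simp add: divide_neg_pos)
      finally show False using quad[of t] by simp
    qed
    then show ?thesis by (simp add: d_def)
  qed
  have "norm u * norm u \<le> C * norm u"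
  proof (rule LIMSEQ_le)
    show "(\<lambda>n. u \<bullet> x n) \<longlonglongrightarrow> norm u * norm u"
      unfolding power2_eq_square[symmetric] power2_norm_eq_inner by (intro tendsto_intros u)
    show "(\<lambda>n. C * norm (x n)) \<longlonglongrightarrow> C * norm u" by (intro tendsto_intros u)
    show "\<exists>N. \<forall>n\<ge>N. u \<bullet> x n \<le> C * norm (x n)"
      using rep[OF xl] bound[OF xl] by (auto intro: order_trans[OF abs_ge_self])
  qed
  then have "norm u \<le> C"
    using \<open>C \<ge> 0\<close> by (cases "u = 0") (auto simp: mult_le_cancel_right)
  moreover have "u \<in> closure (fst ` R)"
    using u xl by (force simp: closure_sequential)
  ultimately show thesis using rep that by blast
qed

text \<open>The functional \<open>v \<mapsto> x \<bullet> v\<close> on \<open>G\<close> is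
  represented by a vector in the closure of \<open>G\<close>, that is, in \<open>G\<close>
  itself.\<close>

lemma orthogonal_projection_ex:
  fixes G :: "'h::{real_inner, banach} set"
  assumes "subspace G" "closed G"
  shows "\<exists>p\<in>G. \<forall>v\<in>G. (x - p) \<bullet> v = 0"
proof -
  let ?R = "(\<lambda>v. (v, x \<bullet> v)) ` G"
  have "linear (\<lambda>v. (v, x \<bullet> v))" by (rule linearI) (auto simp: inner_add)
  then have sub: "subspace ?R" using assms(1) by (rule linear_subspace_image)
  have bd: "\<bar>l\<bar> \<le> norm x * norm v" if "(v, l) \<in> ?R" for v l
    using that Cauchy_Schwarz_ineq2 by auto
  obtain p where p: "p \<in> closure (fst ` ?R)" "\<And>v l. (v, l) \<in> ?R \<Longrightarrow> p \<bullet> v = l"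
    by (rule hilbert_representation[OF sub bd]) auto
  have "fst ` ?R = G" by (auto simp: image_image)
  then have "p \<in> G" using p(1) closure_closed[OF assms(2)] by simp
  moreover have "(x - p) \<bullet> v = 0" if "v \<in> G" for v
    using p(2)[of v "x \<bullet> v"] that by (simp add: inner_diff)
  ultimately show ?thesis by blast
qed

lemma subspace_closure:
  fixes S :: "'h::real_normed_vector set"
  assumes "subspace S"
  shows "subspace (closure S)"
proof (rule subspaceI)
  show "0 \<in> closure S" using subspace_0[OF assms] closure_subset by blast
  fix x y and c :: real assume "x \<in> closure S"
  then obtain f where f: "\<And>n. f n \<in> S" "f \<longlonglongrightarrow> x" by (auto simp: closure_sequential)
  then show "c *\<^sub>R x \<in> closure S"
    unfolding closure_sequential
    by (intro exI[of _ "\<lambda>n. c *\<^sub>R f n"]) (auto intro!: tendsto_intros subspace_scale[OF assms])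
  assume "y \<in> closure S"
  then obtain g where "\<And>n. g n \<in> S" "g \<longlonglongrightarrow> y" by (auto simp: closure_sequential)
  with f show "x + y \<in> closure S"
    unfolding closure_sequential
    by (intro exI[of _ "\<lambda>n. f n + g n"]) (auto intro!: tendsto_intros subspace_add[OF assms])
qed

definition proj :: "'h::{real_inner, banach} set \<Rightarrow> 'h \<Rightarrow> 'h" where
  "proj G x = (SOME p. p \<in> G \<and> (\<forall>v\<in>G. (x - p) \<bullet> v = 0))"

context
  fixes G :: "'h::{real_inner, banach} set"
  assumes G: "subspace G" "closed G"
begin

lemma proj_in: "proj G x \<in> G" and proj_orth: "v \<in> G \<Longrightarrow> (x - proj G x) \<bullet> v = 0"
  using someI_ex[OF orthogonal_projection_ex[OF G, of x, unfolded Bex_def]] unfolding proj_def[symmetric]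
  by auto

lemma proj_unique:
  assumes "p \<in> G" "\<And>v. v \<in> G \<Longrightarrow> (x - p) \<bullet> v = 0"
  shows "proj G x = p"
proof -
  have "p - proj G x \<in> G" using assms(1) proj_in G(1) by (intro subspace_diff)
  then have "(x - proj G x) \<bullet> (p - proj G x) - (x - p) \<bullet> (p - proj G x) = 0"
    using assms(2) proj_orth by simp
  then have "(p - proj G x) \<bullet> (p - proj G x) = 0"
    by (simp add: inner_diff)
  then show ?thesis by simp
qed

lemma proj_id: "x \<in> G \<Longrightarrow> proj G x = x"
  by (rule proj_unique) auto

lemma bounded_linear_proj: "bounded_linear (proj G)"
proof (rule bounded_linear_intro)
  show "proj G (x + y) = proj G x + proj G y" for x y
  proof (rule proj_unique)
    show "proj G x + proj G y \<in> G" using proj_in G(1) by (intro subspace_add)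
    show "(x + y - (proj G x + proj G y)) \<bullet> v = 0" if "v \<in> G" for v
      using proj_orth[OF that, of x] proj_orth[OF that, of y] by (simp add: inner_diff inner_add)
  qed
  show "proj G (c *\<^sub>R x) = c *\<^sub>R proj G x" for c x
  proof (rule proj_unique)
    show "c *\<^sub>R proj G x \<in> G" using proj_in G(1) by (intro subspace_scale)
    show "(c *\<^sub>R x - c *\<^sub>R proj G x) \<bullet> v = 0" if "v \<in> G" for v
      using proj_orth[OF that, of x] by (simp add: scaleR_diff_right[symmetric])
  qed
  show "norm (proj G x) \<le> norm x * 1" for x
  proof -
    have "norm (proj G x) * norm (proj G x) = x \<bullet> proj G x"
      using proj_orth[OF proj_in, of x x]
      by (simp add: inner_diff power2_eq_square[symmetric] power2_norm_eq_inner)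
    also have "\<dots> \<le> norm x * norm (proj G x)" by (rule norm_cauchy_schwarz)
    finally show ?thesis by (cases "proj G x = 0") (auto simp: mult_le_cancel_right)
  qed
qed

lemma proj_sym: "proj G x \<bullet> y = x \<bullet> proj G y"
  using proj_orth[OF proj_in, of x y] proj_orth[OF proj_in, of y x]
  by (simp add: inner_diff inner_commute)

end

lemma closed_subspace_eq_UNIV:
  fixes G :: "'h::{real_inner, banach} set"
  assumes "subspace G" "closed G" "\<And>x. (\<And>v. v \<in> G \<Longrightarrow> x \<bullet> v = 0) \<Longrightarrow> x = 0"
  shows "G = UNIV"
proof -
  have "x \<in> G" for x
    using orthogonal_projection_ex[OF assms(1,2), of x] assms(3) by force
  then show ?thesis by blast
qed

text \<open>Finite rational combinations of \<open>D\<close> are countable and dense, and balls of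
  radius \<open>1 / Suc n\<close> around them form a countable basis. Second countability of
  \<open>l2\<close> is what makes Bochner integrals of field-valued functions of time
  available.\<close>

lemma dense_span_imp_countable_basis:
  fixes D :: "'h::real_normed_vector set"
  assumes "countable D" "closure (span D) = UNIV"
  shows "\<exists>B::'h set set. countable B \<and> open = generate_topology B"
proof (cases "D = {}")
  case True
  then have triv: "x = 0" for x :: 'h using assms(2) by auto
  have all: "S = {} \<or> S = UNIV" for S :: "'h set"
  proof (cases "0 \<in> S")
    case True
    then show ?thesis using triv by (metis UNIV_eq_I)
  next
    case False
    then have "x \<notin> S" for x using triv[of x] by simp
    then show ?thesis by blast
  qed
  show ?thesis
  proof (intro exI conjI)
    show "countable {UNIV :: 'h set}" by simp
    show "open = generate_topology {UNIV :: 'h set}"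
      apply (rule ext)
      subgoal for S using all[of S] generate_topology.UN[of "{}"] by (auto intro: generate_topology.intros) done
  qed
next
  case False
  define d where "d = from_nat_into D"
  have d: "range d = D" using range_from_nat_into[OF False assms(1)] by (simp add: d_def)
  \<comment> \<open>Lists of pairs (index, coefficient) form a countable type, so the countability
    of the set of rational combinations comes for free.\<close>
  define g :: "(nat \<times> rat) list \<Rightarrow> 'h" where
    "g xs = sum_list (map (\<lambda>(n, q). of_rat q *\<^sub>R d n) xs)" for xs
  have g_Cons: "g ((n, q) # xs) = of_rat q *\<^sub>R d n + g xs" for n q xs by (simp add: g_def)
  have "span D \<subseteq> closure (range g)"
  proof
    fix x assume "x \<in> span D"
    then show "x \<in> closure (range g)"
    proof (induction rule: span_induct_alt)
      case base
      have "g [] = 0" by (simp add: g_def)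
      then show ?case by (metis closure_subset rangeI subsetD)
    next
      case (step c b y)
      then obtain n where n: "b = d n" using d by auto
      obtain xs where xs: "\<And>k. xs k \<in> range g" "xs \<longlonglongrightarrow> y"
        using step(2) by (auto simp: closure_sequential)
      then have "\<forall>k. \<exists>l. xs k = g l" by blast
      then obtain l where l: "\<And>k. xs k = g (l k)" by metis
      have "\<exists>q. c < of_rat q \<and> of_rat q < c + 1 / real (Suc k)" for k
        using of_rat_dense[of c "c + 1 / real (Suc k)"] by simp
      then obtain q where q: "\<And>k. c < of_rat (q k)" "\<And>k. of_rat (q k) < c + 1 / real (Suc k)" by metis
      have "(\<lambda>k. of_rat (q k)) \<longlonglongrightarrow> c"
        using less_imp_le[OF q(1)] q(2) by (rule LIMSEQ_squeeze_Suc)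
      then have "(\<lambda>k. of_rat (q k) *\<^sub>R d n + xs k) \<longlonglongrightarrow> c *\<^sub>R b + y"
        unfolding n by (intro tendsto_intros xs)
      moreover have "\<forall>k. of_rat (q k) *\<^sub>R d n + xs k \<in> range g"
        by (intro allI range_eqI[of _ _ "(n, q _) # l _"]) (simp only: g_Cons l)
      ultimately show ?case
        unfolding closure_sequential by (intro exI[of _ "\<lambda>k. of_rat (q k) *\<^sub>R d n + xs k"] conjI)
    qed
  qed
  then have dense: "closure (range g) = UNIV"
    using assms(2) closure_minimal closed_closure by blast
  define B where "B = (\<lambda>(xs, n). ball (g xs) (1 / real (Suc n))) ` (UNIV :: ((nat \<times> rat) list \<times> nat) set)"
  have "topological_basis B"
  proof (rule topological_basisI)
    show "open B'" if "B' \<in> B" for B' using that by (auto simp: B_def)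
    fix S :: "'h set" and x assume "open S" "x \<in> S"
    then obtain e where e: "e > 0" "ball x e \<subseteq> S" using openE by blast
    obtain n where n: "1 / real (Suc n) < e / 2"
      by (rule nat_approx_posE[of "e / 2"]) (use e(1) in simp)
    have that_pos: "0 < 1 / real (Suc n)" by simp
    have "x \<in> closure (range g)" using dense by simp
    then obtain xs where xs: "dist (g xs) x < 1 / real (Suc n)"
      unfolding closure_approachable using that_pos by blast
    have "x \<in> ball (g xs) (1 / real (Suc n))" using xs by simp
    moreover have "ball (g xs) (1 / real (Suc n)) \<subseteq> ball x e"
    proof
      fix y assume "y \<in> ball (g xs) (1 / real (Suc n))"
      then show "y \<in> ball x e"
        using xs n dist_triangle[of x y "g xs"] by (simp add: dist_commute)
    qed
    ultimately show "\<exists>B'\<in>B. x \<in> B' \<and> B' \<subseteq> S" using e(2) unfolding B_def by blast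
  qed
  moreover have "countable B" unfolding B_def by (intro countable_image) simp
  ultimately show ?thesis using topological_basis_imp_subbasis by blast
qed

section \<open>Separability and translations\<close>

text \<open>Dynkin's argument: the sets over which the integral vanishes contain the
  intersection-stable family \<open>I\<close>, and \<open>UNIV \<in> I\<close> supplies complements.
  Testing with the set where \<open>g\<close> is positive, and likewise for \<open>- g\<close>,
  finishes.\<close>

lemma AE_eq_0_if_integral_eq_0_on_generator:
  fixes g :: "'a::topological_space \<Rightarrow> real"
  assumes int: "integrable M g" and M: "sets M = sets borel"
    and gen: "sets borel = sigma_sets UNIV I" "Int_stable I" "UNIV \<in> I"
    and zero: "\<And>A. A \<in> I \<Longrightarrow> (LINT x:A|M. g x) = 0"
  shows "AE x in M. g x = 0"
proof -
  have space: "space M = UNIV" using sets_eq_imp_space_eq[OF M] by simp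
  have sI: "set_integrable M A g" if "A \<in> sets borel" for A
    using integrable_mult_indicator[OF _ int, of A] that M by (simp add: set_integrable_def)
  have pow: "I \<subseteq> Pow UNIV" by simp
  have all: "(LINT x:A|M. g x) = 0" if "A \<in> sigma_sets UNIV I" for A
    using gen(2) pow that
  proof (induction rule: sigma_sets_induct_disjoint)
    case (basic A) then show ?case by (rule zero)
  next
    case empty then show ?case by (simp add: set_lebesgue_integral_def)
  next
    case (compl A)
    then have A: "A \<in> sets borel" using gen(1) by simp
    have "(LINT x:UNIV|M. g x) = (LINT x:A \<union> (UNIV - A)|M. g x)" by simp
    also have "\<dots> = (LINT x:A|M. g x) + (LINT x:UNIV - A|M. g x)"
      using A by (intro set_integral_Un sI) auto
    finally show ?case using zero[OF gen(3)] compl by simp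
  next
    case (union A)
    then have A: "A i \<in> sets borel" for i using gen(1) by (auto simp: image_subset_iff)
    have "(LINT x:(\<Union>i. A i)|M. g x) = (\<Sum>i. (LINT x:(A i)|M. g x))"
      using A M union(1) by (intro lebesgue_integral_countable_add sI) (auto simp: disjoint_family_on_def)
    then show ?case using union by simp
  qed
  have [measurable]: "g \<in> borel_measurable M" using int by simp
  have pos: "AE x in M. h x \<le> 0" if h: "integrable M h" "\<And>A. A \<in> sets borel \<Longrightarrow> (LINT x:A|M. h x) = 0" for h :: "'a \<Rightarrow> real"
  proof -
    have [measurable]: "h \<in> borel_measurable M" using h by simp
    have A: "{x. 0 < h x} \<in> sets borel" using M space borel_measurable_iff_greater[of h M] by auto
    then have A': "{x. 0 < h x} \<in> sets M" using M by simp
    have "(LINT x|M. indicator {x. 0 < h x} x * h x) = 0"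
      using h(2)[OF A] by (simp add: set_lebesgue_integral_def)
    then have "AE x in M. indicator {x. 0 < h x} x * h x = 0"
      using integrable_mult_indicator[OF A' h(1)]
      by (subst (asm) integral_nonneg_eq_0_iff_AE) (auto simp: indicator_def)
    then show ?thesis by eventually_elim (auto simp: indicator_def split: if_splits)
  qed
  have "AE x in M. g x \<le> 0" by (rule pos[OF int]) (simp add: all gen(1))
  moreover have "AE x in M. - g x \<le> 0"
    by (rule pos) (use int all gen(1) in \<open>auto simp: set_lebesgue_integral_def\<close>)
  ultimately show ?thesis by eventually_elim simp
qed

lemma square_integrable_indicator:
  fixes U :: "'a::euclidean_space set"
  assumes "U \<in> sets borel" "emeasure lborel U < \<infinity>"
  shows "square_integrable (\<lambda>x. indicator U x *\<^sub>R b)"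
proof -
  have "(\<lambda>x. (norm (indicator U x *\<^sub>R b))\<^sup>2) = (\<lambda>x. indicator U x * (norm b)\<^sup>2)"
    by (auto simp: indicator_def fun_eq_iff)
  then show ?thesis using assms by (auto simp: square_integrable_def)
qed

text \<open>One countable family serves three purposes: countability gives separability, stability
  under intersections feeds the Dynkin argument, and openness gives continuity of translations on
  step functions. The choice operator fixes it, so that \<open>step_l2\<close> refers to the same
  family everywhere.\<close>

definition basic_opens :: "'a::euclidean_space set set" where
  "basic_opens = (SOME I. countable I \<and> Int_stable I \<and> UNIV \<in> I \<and> sets borel = sigma_sets UNIV I \<and> (\<forall>U\<in>I. open U))"

lemma basic_opens:
  "countable (basic_opens :: 'a::euclidean_space set set)" "Int_stable (basic_opens :: 'a set set)"
  "UNIV \<in> (basic_opens :: 'a set set)" "sets borel = sigma_sets UNIV (basic_opens :: 'a set set)"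
  "U \<in> (basic_opens :: 'a set set) \<Longrightarrow> open U"
proof -
  obtain B :: "'a set set" where B: "countable B" "topological_basis B" using ex_countable_basis by blast
  define I where "I = Inter ` {F. finite F \<and> F \<subseteq> B}"
  have "countable I" unfolding I_def by (intro countable_image countable_Collect_finite_subset B)
  moreover have "Int_stable I"
    unfolding Int_stable_def I_def
  proof safe
    fix F F' assume "finite F" "finite F'" "F \<subseteq> B" "F' \<subseteq> B"
    then show "\<Inter>F \<inter> \<Inter>F' \<in> Inter ` {F. finite F \<and> F \<subseteq> B}"
      by (intro image_eqI[of _ _ "F \<union> F'"]) auto
  qed
  moreover have "UNIV \<in> I" unfolding I_def by (intro image_eqI[of _ _ "{}"]) auto
  moreover have opn: "\<forall>U\<in>I. open U"
    unfolding I_def using topological_basis_open[OF B(2)] by (auto intro!: open_Inter)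
  moreover have "sets borel = sigma_sets UNIV I"
  proof
    have "B \<subseteq> I"
    proof
      fix b assume "b \<in> B" then show "b \<in> I" unfolding I_def by (intro image_eqI[of _ _ "{b}"]) auto
    qed
    then show "sets borel \<subseteq> sigma_sets UNIV I"
      unfolding borel_eq_countable_basis[OF B] by (simp add: sigma_sets_mono')
    show "sigma_sets UNIV I \<subseteq> sets borel"
      using sets.sigma_sets_subset[of I borel] opn by (simp add: subset_iff)
  qed
  ultimately have "\<exists>I::'a set set. countable I \<and> Int_stable I \<and> UNIV \<in> I \<and> sets borel = sigma_sets UNIV I \<and> (\<forall>U\<in>I. open U)"
    by blast
  from someI_ex[OF this] show "countable (basic_opens :: 'a::euclidean_space set set)" "Int_stable (basic_opens :: 'a set set)"
  "UNIV \<in> (basic_opens :: 'a set set)" "sets borel = sigma_sets UNIV (basic_opens :: 'a set set)"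
  "U \<in> (basic_opens :: 'a set set) \<Longrightarrow> open U"
    unfolding basic_opens_def[symmetric] by blast+
qed

text \<open>Members of \<open>basic_opens\<close>, among them \<open>UNIV\<close>, can have infinite
  measure. Intersecting with balls makes the step functions square integrable and keeps the family
  countable.\<close>

definition step_l2 :: "('a::euclidean_space, 'b::euclidean_space) l2 set" where
  "step_l2 = (\<lambda>(n, U, b). to_l2 (\<lambda>x. indicator (ball 0 (real n) \<inter> U) x *\<^sub>R b)) ` (UNIV \<times> basic_opens \<times> Basis)"

lemma closure_span_step_l2: "closure (span (step_l2 :: ('a::euclidean_space, 'b::euclidean_space) l2 set)) = UNIV"
proof (rule closed_subspace_eq_UNIV)
  show "subspace (closure (span (step_l2 :: ('a, 'b) l2 set)))"
    by (intro subspace_closure subspace_span)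
  fix u :: "('a, 'b) l2" assume orth: "\<And>v. v \<in> closure (span step_l2) \<Longrightarrow> u \<bullet> v = 0"
  have fin: "emeasure lborel (ball 0 (real n) \<inter> U) < \<infinity>" if "open U" for n and U :: "'a set"
    using that by (intro le_less_trans[OF emeasure_mono emeasure_lborel_ball_finite[of 0 "real n"]]) auto
  have "AE x in lborel. indicator (ball 0 (real n)) x * (rep_l2 u x \<bullet> b) = 0" if b: "b \<in> Basis" for n :: nat and b
  proof (rule AE_eq_0_if_integral_eq_0_on_generator[OF _ _ basic_opens(4,2,3)])
    have sq: "square_integrable (\<lambda>x. indicator (ball 0 (real n) \<inter> U) x *\<^sub>R b)" if "U \<in> basic_opens" for U :: "'a set"
      using basic_opens(5)[OF that] fin by (intro square_integrable_indicator) auto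
    show "integrable lborel (\<lambda>x. indicator (ball 0 (real n)) x * (rep_l2 u x \<bullet> b))"
      using square_integrable_inner[OF square_integrable_rep[of u] sq[OF basic_opens(3)]] by simp
    fix U :: "'a set" assume U: "U \<in> basic_opens"
    have "to_l2 (\<lambda>x. indicator (ball 0 (real n) \<inter> U) x *\<^sub>R b) \<in> step_l2"
      unfolding step_l2_def using U b by (intro image_eqI[of _ _ "(n, U, b)"]) auto
    then have "u \<bullet> to_l2 (\<lambda>x. indicator (ball 0 (real n) \<inter> U) x *\<^sub>R b) = 0"
      by (intro orth subsetD[OF closure_subset] span_base)
    then have "(LINT x|lborel. rep_l2 u x \<bullet> (indicator (ball 0 (real n) \<inter> U) x *\<^sub>R b)) = 0"
      by (simp only: inner_rep_to_l2[OF sq[OF U]])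
    then show "(LINT x:U|lborel. indicator (ball 0 (real n)) x * (rep_l2 u x \<bullet> b)) = 0"
      by (simp add: set_lebesgue_integral_def indicator_inter_arith mult_ac)
  qed simp
  then have "AE x in lborel. \<forall>b\<in>Basis. indicator (ball 0 (real n)) x * (rep_l2 u x \<bullet> b) = 0" for n :: nat
    by (intro AE_ball_countable[THEN iffD2]) (auto simp: countable_finite)
  then have "AE x in lborel. \<forall>n::nat. \<forall>b\<in>Basis. indicator (ball 0 (real n)) x * (rep_l2 u x \<bullet> b) = 0"
    by (rule AE_all_countable[THEN iffD2, rule_format])
  then have "AE x in lborel. rep_l2 u x = rep_l2 0 x"
    using rep_zero
  proof eventually_elim
    fix x assume *: "\<forall>n::nat. \<forall>b\<in>Basis. indicator (ball 0 (real n)) x * (rep_l2 u x \<bullet> b) = 0"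
      and 0: "rep_l2 (0::('a, 'b) l2) x = 0"
    obtain n :: nat where "norm x < real n" using reals_Archimedean2 by blast
    then have "rep_l2 u x = 0"
      using spec[OF *, of n] by (auto intro!: euclidean_eqI[where 'a='b])
    then show "rep_l2 u x = rep_l2 0 x" using 0 by simp
  qed
  then show "u = 0" by (rule l2_eqI)
qed simp

instance l2 :: (euclidean_space, euclidean_space) second_countable_topology
proof
  have "countable (step_l2 :: ('a, 'b) l2 set)"
    unfolding step_l2_def by (intro countable_image countable_SIGMA basic_opens) (auto simp: countable_finite)
  then show "\<exists>B::('a, 'b) l2 set set. countable B \<and> open = generate_topology B"
    by (rule dense_span_imp_countable_basis[OF _ closure_span_step_l2])
qed

section \<open>Translations of square integrable functions and their continuity\<close>

lemma lborel_distr_shift: "distr lborel borel (\<lambda>x. x + z) = (lborel :: 'a::euclidean_space measure)"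
proof -
  have "(+) z = (\<lambda>x. x + z)" by (simp add: fun_eq_iff add.commute)
  then show ?thesis using lborel_distr_plus[of z] by simp
qed

lemma AE_lborel_shift:
  fixes z :: "'a::euclidean_space"
  assumes "AE x in lborel. P x"
  shows "AE x in lborel. P (x + z)"
  by (rule AE_distrD[where f="\<lambda>x. x + z" and M'=borel]) (simp, subst lborel_distr_shift, rule assms)

lemma lborel_integral_shift:
  fixes f :: "'a::euclidean_space \<Rightarrow> 'b::{banach, second_countable_topology}"
  assumes [measurable]: "f \<in> borel_measurable borel"
  shows "(LINT x|lborel. f (x + z)) = (LINT x|lborel. f x)"
    and "integrable lborel (\<lambda>x. f (x + z)) \<longleftrightarrow> integrable lborel f"
  using integral_distr[of "\<lambda>x. x + z" lborel borel f] integrable_distr_eq[of "\<lambda>x. x + z" lborel borel f]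
  by (simp_all add: lborel_distr_shift)

lemma square_integrable_shift:
  assumes "square_integrable f" shows "square_integrable (\<lambda>x. f (x + z))"
  using assms lborel_integral_shift(2)[of "\<lambda>x. (norm (f x))\<^sup>2" z]
  unfolding square_integrable_def by (auto intro: measurable_compose[OF borel_measurable_add])

definition shift :: "'a \<Rightarrow> ('a::euclidean_space, 'b::{real_inner, second_countable_topology, banach}) l2 \<Rightarrow> ('a, 'b) l2" where
  "shift z u = to_l2 (\<lambda>x. rep_l2 u (x + z))"

lemma shift_to_l2:
  assumes "square_integrable f"
  shows "shift z (to_l2 f) = to_l2 (\<lambda>x. f (x + z))"
  unfolding shift_def
  using AE_lborel_shift[OF rep_to_l2[OF assms]] assms
  by (subst to_l2_eq_iff) (auto intro!: square_integrable_shift)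

lemma shift_add: "shift z (u + v) = shift z u + shift z v"
proof -
  have "shift z (u + v) = to_l2 (\<lambda>x. rep_l2 u (x + z) + rep_l2 v (x + z))"
    unfolding plus_l2_def by (rule shift_to_l2[OF square_integrable_add]) simp_all
  also have "\<dots> = shift z u + shift z v"
    unfolding shift_def by (rule to_l2_add) (simp_all add: square_integrable_shift)
  finally show ?thesis .
qed

lemma shift_scaleR: "shift z (c *\<^sub>R u) = c *\<^sub>R shift z u"
proof -
  have "shift z (c *\<^sub>R u) = to_l2 (\<lambda>x. c *\<^sub>R rep_l2 u (x + z))"
    unfolding scaleR_l2_def by (rule shift_to_l2[OF square_integrable_scaleR]) simp
  also have "\<dots> = c *\<^sub>R shift z u"
    unfolding shift_def by (rule to_l2_scaleR) (simp add: square_integrable_shift)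
  finally show ?thesis .
qed

lemma norm_shift: "norm (shift z u) = norm u"
proof -
  have "(norm (shift z u))\<^sup>2 = (LINT x|lborel. (norm (rep_l2 u (x + z)))\<^sup>2)"
    unfolding shift_def by (rule power2_norm_to_l2) (simp add: square_integrable_shift)
  also have "\<dots> = (norm u)\<^sup>2"
    unfolding power2_norm_l2 by (rule lborel_integral_shift(1)[of "\<lambda>x. (norm (rep_l2 u x))\<^sup>2"]) simp
  finally show ?thesis by simp
qed

lemma shift_diff: "shift z (u - v) = shift z u - shift z v"
  using shift_add[of z u "(-1) *\<^sub>R v"] shift_scaleR[of z "-1" v] by simp

text \<open>Translation is isometric, so the squared distance is
  \<open>2 * (u \<bullet> u) - 2 * (shift z u \<bullet> u)\<close> and it suffices that the inner
  products converge. Only points of \<open>U\<close> contribute to them, and there openness of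
  \<open>U\<close> gives pointwise convergence.\<close>

lemma shift_step_tendsto:
  fixes U :: "'a::euclidean_space set" and b :: "'b::euclidean_space"
  assumes U: "open U" "emeasure lborel U < \<infinity>" and z: "z \<longlonglongrightarrow> 0"
  shows "(\<lambda>n. shift (z n) (to_l2 (\<lambda>x. indicator U x *\<^sub>R b))) \<longlonglongrightarrow> to_l2 (\<lambda>x. indicator U x *\<^sub>R b)"
proof -
  define u where "u = to_l2 (\<lambda>x. indicator U x *\<^sub>R b)"
  have [measurable]: "U \<in> sets borel" using U by simp
  have sq: "square_integrable (\<lambda>x. indicator U x *\<^sub>R b)"
    using U by (intro square_integrable_indicator) auto
  have inn: "shift (z n) u \<bullet> u = (LINT x|lborel. indicator U (x + z n) * indicator U x * (b \<bullet> b))" for n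
    unfolding u_def shift_to_l2[OF sq] by (subst inner_to_l2[OF square_integrable_shift[OF sq] sq]) (simp add: mult_ac)
  have "(\<lambda>n. LINT x|lborel. indicator U (x + z n) * indicator U x * (b \<bullet> b))
      \<longlonglongrightarrow> (LINT x|lborel. indicator U x * (b \<bullet> b))"
  proof (rule integral_dominated_convergence[where w="\<lambda>x. indicator U x * (b \<bullet> b)"])
    show "integrable lborel (\<lambda>x. indicator U x * (b \<bullet> b))" using U by simp
    show "AE x in lborel. (\<lambda>n. indicator U (x + z n) * indicator U x * (b \<bullet> b)) \<longlonglongrightarrow> indicator U x * (b \<bullet> b)"
    proof (rule AE_I2)
      fix x
      show "(\<lambda>n. indicator U (x + z n) * indicator U x * (b \<bullet> b)) \<longlonglongrightarrow> indicator U x * (b \<bullet> b)"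
      proof (cases "x \<in> U")
        case True
        have "(\<lambda>n. x + z n) \<longlonglongrightarrow> x" using tendsto_add[OF tendsto_const z, of x] by simp
        then have "\<forall>\<^sub>F n in sequentially. x + z n \<in> U" using True U(1) by (simp add: topological_tendstoD)
        then have "\<forall>\<^sub>F n in sequentially. indicator U (x + z n) * indicator U x * (b \<bullet> b) = indicator U x * (b \<bullet> b)"
          by eventually_elim (simp add: True)
        then show ?thesis by (rule tendsto_eventually)
      qed simp
    qed
    show "AE x in lborel. norm (indicator U (x + z n) * indicator U x * (b \<bullet> b)) \<le> indicator U x * (b \<bullet> b)" for n
      by (auto simp: indicator_def)
  qed simp_all
  moreover have uu: "u \<bullet> u = (LINT x|lborel. indicator U x * (b \<bullet> b))"
    unfolding u_def
    by (subst inner_to_l2[OF sq sq], rule Bochner_Integration.integral_cong) (auto simp: indicator_def)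
  ultimately have lim: "(\<lambda>n. shift (z n) u \<bullet> u) \<longlonglongrightarrow> u \<bullet> u" by (simp add: inn)
  have "(norm (shift (z n) u - u))\<^sup>2 = 2 * (u \<bullet> u) - 2 * (shift (z n) u \<bullet> u)" for n
    using arg_cong[OF norm_shift[of "z n" u], of power2]
    by (simp add: power2_norm_eq_inner inner_diff inner_commute)
  moreover have "(\<lambda>n. 2 * (u \<bullet> u) - 2 * (shift (z n) u \<bullet> u)) \<longlonglongrightarrow> 2 * (u \<bullet> u) - 2 * (u \<bullet> u)"
    by (intro tendsto_intros lim)
  ultimately have "(\<lambda>n. (norm (shift (z n) u - u))\<^sup>2) \<longlonglongrightarrow> 0" by simp
  from tendsto_real_sqrt[OF this] have "(\<lambda>n. norm (shift (z n) u - u)) \<longlonglongrightarrow> 0" by simp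
  then show ?thesis unfolding u_def[symmetric] by (simp add: tendsto_norm_zero_iff LIM_zero_iff)
qed

text \<open>Because translations are isometric, the vectors with this property form a closed
  subspace; it contains the step functions, whose span is dense.\<close>

lemma shift_tendsto_seq:
  fixes u :: "('a::euclidean_space, 'b::euclidean_space) l2"
  assumes z: "z \<longlonglongrightarrow> 0"
  shows "(\<lambda>n. shift (z n) u) \<longlonglongrightarrow> u"
proof -
  let ?T = "{u :: ('a, 'b) l2. (\<lambda>n. shift (z n) u) \<longlonglongrightarrow> u}"
  have sub: "subspace ?T"
  proof (rule subspaceI)
    show "0 \<in> ?T" using shift_scaleR[of _ 0 "0 :: ('a, 'b) l2"] by simp
  qed (auto simp: shift_add shift_scaleR intro!: tendsto_intros)
  have "closed ?T"
  proof (rule closed_sequential_limits[THEN iffD2], intro allI impI, elim conjE)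
    fix v :: "nat \<Rightarrow> ('a, 'b) l2" and l assume v: "\<forall>n. v n \<in> ?T" and l: "v \<longlonglongrightarrow> l"
    have "(\<lambda>n. shift (z n) l) \<longlonglongrightarrow> l"
    proof (rule metric_LIMSEQ_I)
      fix e :: real assume "e > 0"
      then obtain k where k: "norm (v k - l) < e / 3"
        using metric_LIMSEQ_D[OF l, of "e/3"] by (auto simp: dist_norm)
      obtain N where N: "\<And>n. n \<ge> N \<Longrightarrow> norm (shift (z n) (v k) - v k) < e / 3"
        using v \<open>e > 0\<close> metric_LIMSEQ_D[of "\<lambda>n. shift (z n) (v k)" "v k" "e/3"] by (auto simp: dist_norm)
      have "norm (shift (z n) l - l) < e" if "n \<ge> N" for n
      proof -
        have eq: "shift (z n) l - l = shift (z n) (l - v k) + (shift (z n) (v k) - v k) + (v k - l)"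
          by (simp add: shift_diff)
        have "norm (shift (z n) l - l) \<le> norm (shift (z n) (l - v k)) + norm (shift (z n) (v k) - v k) + norm (v k - l)"
          unfolding eq by (intro norm_triangle_le add_mono norm_triangle_ineq order_refl)
        then show ?thesis using k N[OF that] by (simp add: norm_shift norm_minus_commute)
      qed
      then show "\<exists>no. \<forall>n\<ge>no. dist (shift (z n) l) l < e" by (auto simp: dist_norm)
    qed
    then show "l \<in> ?T" by simp
  qed
  moreover have "step_l2 \<subseteq> ?T"
    unfolding step_l2_def
  proof safe
    fix n :: nat and U :: "'a set" and b :: 'b assume "U \<in> basic_opens"
    then have "open U" by (rule basic_opens)
    then show "(\<lambda>k. shift (z k) (to_l2 (\<lambda>x. indicator (ball 0 (real n) \<inter> U) x *\<^sub>R b)))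
      \<longlonglongrightarrow> to_l2 (\<lambda>x. indicator (ball 0 (real n) \<inter> U) x *\<^sub>R b)"
      by (intro shift_step_tendsto z le_less_trans[OF emeasure_mono emeasure_lborel_ball_finite[of 0 "real n"]]) auto
  qed
  then have "span step_l2 \<subseteq> ?T" using sub by (rule span_minimal)
  ultimately have "closure (span step_l2) \<subseteq> ?T" by (intro closure_minimal)
  then show ?thesis using closure_span_step_l2 by blast
qed

lemma shift_tendsto: "((\<lambda>z. shift z u) \<longlongrightarrow> u) (at 0)"
  for u :: "('a::euclidean_space, 'b::euclidean_space) l2"
  unfolding tendsto_at_iff_sequentially comp_def using shift_tendsto_seq by blast

section \<open>Smooth functions\<close>

definition smooth :: "('a::real_normed_vector \<Rightarrow> 'b::real_normed_vector) \<Rightarrow> bool" where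
  "smooth f \<longleftrightarrow> (\<forall>k. Ck k f)"

text \<open>Passes from the chosen \<open>frechet_derivative\<close> in the recursion of
  \<open>Ck\<close> to an explicit formula for the derivative, the form in which closure properties
  can be proved by induction on the order.\<close>

lemma Ck_SucI:
  assumes "\<And>x. (f has_derivative f' x) (at x)" "\<And>v. Ck k (\<lambda>x. f' x v)"
  shows "Ck (Suc k) f"
proof -
  have "frechet_derivative f (at x) = f' x" for x
    using assms(1) frechet_derivative_at by metis
  then show ?thesis using assms by (auto simp: differentiable_def)
qed

lemma Ck_Suc_differentiable: "Ck (Suc k) f \<Longrightarrow> (f has_derivative frechet_derivative f (at x)) (at x)"
  by (simp add: frechet_derivative_works)

lemma Ck_Suc_imp_Ck: "Ck (Suc k) f \<Longrightarrow> Ck k f"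
proof (induction k arbitrary: f)
  case 0
  then have "f differentiable (at x)" for x by simp
  then show ?case
    by (auto intro!: continuous_at_imp_continuous_on differentiable_imp_continuous_within)
next
  case (Suc k)
  then have "f differentiable (at x)" "Ck k (\<lambda>x. frechet_derivative f (at x) v)" for x v
    by (auto simp del: Ck.simps simp: Ck.simps(2)[of _ f])
  then show ?case by simp
qed

lemma Ck_imp_continuous: "Ck k f \<Longrightarrow> continuous_on UNIV f"
proof (induction k)
  case (Suc k)
  then show ?case using Ck_Suc_imp_Ck by blast
qed simp

lemma Ck_const: "Ck k (\<lambda>x. c)"
proof (induction k arbitrary: c)
  case (Suc k)
  show ?case by (rule Ck_SucI[where f'="\<lambda>_ _. 0"]) (auto intro: Suc)
qed simp

lemma Ck_bounded_linear: "bounded_linear f \<Longrightarrow> Ck k f"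
proof (cases k)
  case 0
  then show "bounded_linear f \<Longrightarrow> Ck k f" by (simp add: linear_continuous_on)
next
  case (Suc k)
  then show "bounded_linear f \<Longrightarrow> Ck k f" for k
    by (cases k) (auto intro!: Ck_SucI[where f'="\<lambda>_. f"] Ck_const bounded_linear_imp_has_derivative simp: linear_continuous_on simp del: Ck.simps(2))
qed

lemma Ck_add: "Ck k f \<Longrightarrow> Ck k g \<Longrightarrow> Ck k (\<lambda>x. f x + g x)"
proof (induction k arbitrary: f g)
  case 0
  then show ?case by (simp add: continuous_on_add)
next
  case (Suc k)
  show ?case
  proof (rule Ck_SucI)
    show "((\<lambda>x. f x + g x) has_derivative (\<lambda>v. frechet_derivative f (at x) v + frechet_derivative g (at x) v)) (at x)" for x
      using Suc.prems by (intro has_derivative_add Ck_Suc_differentiable)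
    show "Ck k (\<lambda>x. frechet_derivative f (at x) v + frechet_derivative g (at x) v)" for v
      using Suc.prems by (intro Suc.IH) auto
  qed
qed

lemma (in bounded_bilinear) Ck_prod: "Ck k f \<Longrightarrow> Ck k g \<Longrightarrow> Ck k (\<lambda>x. prod (f x) (g x))"
proof (induction k arbitrary: f g)
  case 0
  then show ?case by (simp add: continuous_on)
next
  case (Suc k)
  show ?case
  proof (rule Ck_SucI)
    show "((\<lambda>x. prod (f x) (g x)) has_derivative
        (\<lambda>v. prod (f x) (frechet_derivative g (at x) v) + prod (frechet_derivative f (at x) v) (g x))) (at x)" for x
      using Suc.prems by (intro FDERIV Ck_Suc_differentiable)
    show "Ck k (\<lambda>x. prod (f x) (frechet_derivative g (at x) v) + prod (frechet_derivative f (at x) v) (g x))" for v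
      using Suc.prems by (intro Ck_add Suc.IH Ck_Suc_imp_Ck[of k f] Ck_Suc_imp_Ck[of k g]) auto
  qed
qed

lemma Ck_affine: "Ck k f \<Longrightarrow> Ck k (\<lambda>x. f (c *\<^sub>R x + z))"
proof (induction k arbitrary: f)
  case 0
  then show ?case by (auto intro!: continuous_on_compose2[of UNIV f] continuous_intros)
next
  case (Suc k)
  show ?case
  proof (rule Ck_SucI)
    have "(f has_derivative frechet_derivative f (at (c *\<^sub>R x + z))) (at (c *\<^sub>R x + z))" for x
      using Suc.prems by (rule Ck_Suc_differentiable)
    moreover have "((\<lambda>x. c *\<^sub>R x + z) has_derivative (\<lambda>v. c *\<^sub>R v)) (at x)" for x
      by (auto intro!: derivative_eq_intros)
    ultimately show "((\<lambda>x. f (c *\<^sub>R x + z)) has_derivative (\<lambda>v. frechet_derivative f (at (c *\<^sub>R x + z)) (c *\<^sub>R v))) (at x)" for x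
      using has_derivative_compose by blast
    show "Ck k (\<lambda>x. frechet_derivative f (at (c *\<^sub>R x + z)) (c *\<^sub>R v))" for v
      using Suc.prems by (intro Suc.IH[of "\<lambda>y. frechet_derivative f (at y) (c *\<^sub>R v)"]) auto
  qed
qed

lemma real_has_derivative_iff:
  fixes h :: "real \<Rightarrow> real"
  assumes "h differentiable (at y)"
  shows "(h has_real_derivative frechet_derivative h (at y) 1) (at y)"
proof -
  have D: "(h has_derivative frechet_derivative h (at y)) (at y)" using assms by (simp add: frechet_derivative_works)
  have eq: "frechet_derivative h (at y) = (*) (frechet_derivative h (at y) 1)"
  proof (rule ext)
    fix v
    have "frechet_derivative h (at y) (v *\<^sub>R 1) = v *\<^sub>R frechet_derivative h (at y) 1"
      by (rule linear_scale[OF has_derivative_linear[OF D]])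
    then show "frechet_derivative h (at y) v = frechet_derivative h (at y) 1 * v"
      by (simp add: mult.commute)
  qed
  show ?thesis
    unfolding has_field_derivative_def by (rule has_derivative_eq_rhs[OF D eq])
qed

lemma Ck_real_compose: "smooth h \<Longrightarrow> Ck k u \<Longrightarrow> Ck k (\<lambda>x. h (u x))"
  for h :: "real \<Rightarrow> real" and u :: "'a::real_normed_vector \<Rightarrow> real"
proof (induction k arbitrary: h)
  case 0
  then have "continuous_on UNIV h" "continuous_on UNIV u"
    using Ck_imp_continuous[of 0 h] by (auto simp: smooth_def simp del: Ck.simps(2))
  then show ?case by (auto intro: continuous_on_compose2)
next
  case (Suc k)
  define h' where "h' y = frechet_derivative h (at y) 1" for y
  have "Ck (Suc j) h" for j using Suc.prems(1) unfolding smooth_def by blast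
  then have diff: "h differentiable (at y)" and Ckh: "Ck j h'" for j y by (auto simp: h'_def[abs_def])
  have h': "smooth h'" using Ckh by (simp add: smooth_def)
  show ?case
  proof (rule Ck_SucI)
    show "((\<lambda>x. h (u x)) has_derivative (\<lambda>v. h' (u x) * frechet_derivative u (at x) v)) (at x)" for x
      using real_has_derivative_iff[OF diff, of "u x"] Ck_Suc_differentiable[OF Suc.prems(2), of x]
      unfolding h'_def has_field_derivative_def by (intro has_derivative_compose[of u _ x _ h])
    show "Ck k (\<lambda>x. h' (u x) * frechet_derivative u (at x) v)" for v
      using Suc.IH[OF h' Ck_Suc_imp_Ck[OF Suc.prems(2)]] Suc.prems(2)
      by (intro bounded_bilinear.Ck_prod[OF bounded_bilinear_mult]) auto
  qed
qed

lemma smoothI: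
  assumes "\<And>x. (f has_derivative f' x) (at x)" "\<And>v. smooth (\<lambda>x. f' x v)"
  shows "smooth f"
proof -
  have "Ck (Suc k) f" for k
    using assms by (intro Ck_SucI) (auto simp: smooth_def)
  then show ?thesis unfolding smooth_def using Ck_Suc_imp_Ck by blast
qed

lemma smooth_derivative:
  assumes "smooth f"
  shows "(f has_derivative frechet_derivative f (at x)) (at x)" "smooth (\<lambda>x. frechet_derivative f (at x) v)"
proof -
  have C: "Ck (Suc k) f" for k using assms unfolding smooth_def by blast
  show "(f has_derivative frechet_derivative f (at x)) (at x)" using C by (rule Ck_Suc_differentiable)
  show "smooth (\<lambda>x. frechet_derivative f (at x) v)" unfolding smooth_def using C by simp
qed

lemma smooth_continuous: "smooth f \<Longrightarrow> continuous_on UNIV f"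
  using Ck_imp_continuous[of 0] unfolding smooth_def by blast

lemma smooth_const [simp]: "smooth (\<lambda>x. c)"
  by (simp add: smooth_def Ck_const del: Ck.simps)

lemma smooth_bounded_linear: "bounded_linear f \<Longrightarrow> smooth f"
  by (simp add: smooth_def Ck_bounded_linear del: Ck.simps)

lemma smooth_add: "smooth f \<Longrightarrow> smooth g \<Longrightarrow> smooth (\<lambda>x. f x + g x)"
  by (simp add: smooth_def Ck_add del: Ck.simps)

lemma (in bounded_bilinear) smooth_prod: "smooth f \<Longrightarrow> smooth g \<Longrightarrow> smooth (\<lambda>x. prod (f x) (g x))"
  by (simp add: smooth_def Ck_prod del: Ck.simps)

lemmas smooth_mult = bounded_bilinear.smooth_prod[OF bounded_bilinear_mult]
lemmas smooth_scaleR = bounded_bilinear.smooth_prod[OF bounded_bilinear_scaleR]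

lemma smooth_cmult: "smooth f \<Longrightarrow> smooth (\<lambda>x. c * f x)" for f :: "_ \<Rightarrow> real"
  by (rule smooth_mult) simp_all

lemma smooth_diff: "smooth f \<Longrightarrow> smooth g \<Longrightarrow> smooth (\<lambda>x. f x - g x)"
  for f g :: "'a::real_normed_vector \<Rightarrow> 'b::real_normed_vector"
  using smooth_add[of f "\<lambda>x. (-1) *\<^sub>R g x"] smooth_scaleR[of "\<lambda>_. -1" g] by simp

lemma smooth_affine: "smooth f \<Longrightarrow> smooth (\<lambda>x. f (c *\<^sub>R x + z))"
  by (simp add: smooth_def Ck_affine del: Ck.simps)

lemma smooth_real_compose: "smooth h \<Longrightarrow> smooth u \<Longrightarrow> smooth (\<lambda>x. h (u x))"
  for h :: "real \<Rightarrow> real"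
  using Ck_real_compose[of h _ u] by (simp add: smooth_def[of u] smooth_def[of "\<lambda>x. h (u x)"] del: Ck.simps)

lemma smooth_linear_compose:
  assumes "bounded_linear L" "smooth f"
  shows "smooth (\<lambda>x. L (f x))"
proof -
  have "Ck k f \<Longrightarrow> Ck k (\<lambda>x. L (f x))" for k and f :: "'c \<Rightarrow> 'a"
  proof (induction k arbitrary: f)
    case 0
    then show ?case using assms(1) by (auto intro: bounded_linear.continuous_on)
  next
    case (Suc k)
    show ?case
    proof (rule Ck_SucI)
      show "((\<lambda>x. L (f x)) has_derivative (\<lambda>v. L (frechet_derivative f (at x) v))) (at x)" for x
        by (rule bounded_linear.has_derivative[OF assms(1) Ck_Suc_differentiable[OF Suc.prems]])
      show "Ck k (\<lambda>x. L (frechet_derivative f (at x) v))" for v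
        using Suc.prems by (intro Suc.IH[of "\<lambda>x. frechet_derivative f (at x) v"]) auto
    qed
  qed
  then show ?thesis using assms(2) by (simp add: smooth_def del: Ck.simps)
qed

lemma smooth_prod_finite: "finite A \<Longrightarrow> (\<And>a. a \<in> A \<Longrightarrow> smooth (f a)) \<Longrightarrow> smooth (\<lambda>x. \<Prod>a\<in>A. f a x :: real)"
  by (induction A rule: finite_induct) (auto intro!: smooth_mult)

lemma smooth_real_antiderivative:
  fixes f g :: "real \<Rightarrow> real"
  assumes "\<And>x. (f has_real_derivative g x) (at x)" "smooth g"
  shows "smooth f"
proof (rule smoothI)
  show "(f has_derivative (\<lambda>v. g x * v)) (at x)" for x
    using assms(1)[of x] by (simp add: has_field_derivative_def)
  show "smooth (\<lambda>x. g x * v)" for v using assms(2) by (rule smooth_mult) simp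
qed

text \<open>All derivatives of \<open>exp (- 1 / x)\<close> have the form \<open>poly p (1 / x) * exp (- 1 / x)\<close>.\<close>

definition flat_poly :: "real poly \<Rightarrow> real \<Rightarrow> real" where
  "flat_poly p x = (if x > 0 then poly p (1 / x) * exp (- 1 / x) else 0)"

lemma tendsto_poly_exp_neg: "((\<lambda>y::real. poly p y * exp (- y)) \<longlongrightarrow> 0) at_top"
proof -
  have "((\<lambda>y::real. \<Sum>i\<le>degree p. coeff p i * (y ^ i / exp y)) \<longlongrightarrow> (\<Sum>i\<le>degree p. coeff p i * 0)) at_top"
    by (intro tendsto_intros tendsto_power_div_exp_0)
  moreover have "poly p y * exp (- y) = (\<Sum>i\<le>degree p. coeff p i * (y ^ i / exp y))" for y :: real
    by (simp add: poly_altdef sum_distrib_right exp_minus divide_inverse mult.assoc)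
  ultimately show ?thesis by simp
qed

lemma flat_poly_tendsto_0: "(flat_poly p \<longlongrightarrow> 0) (at 0)"
proof -
  have "((\<lambda>x. poly p (inverse x) * exp (- inverse x)) \<longlongrightarrow> 0) (at_right 0)"
    using filterlim_compose[OF tendsto_poly_exp_neg filterlim_inverse_at_top_right] .
  then have "(flat_poly p \<longlongrightarrow> 0) (at_right 0)"
    by (rule Lim_transform_eventually)
      (auto simp: eventually_at_right_field flat_poly_def inverse_eq_divide intro!: exI[of _ 1])
  moreover have "(flat_poly p \<longlongrightarrow> 0) (at_left 0)"
    by (rule tendsto_eventually) (auto simp: eventually_at_left_field flat_poly_def intro!: exI[of _ "-1"])
  ultimately show ?thesis by (simp add: filterlim_split_at)
qed

text \<open>With \<open>y = 1 / x\<close>, the derivative of \<open>poly p y * exp (- y)\<close> in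
  \<open>x\<close> is \<open>y ^ 2 * (poly p y - poly (pderiv p) y) * exp (- y)\<close>, whence the
  factor \<open>[:0, 0, 1:]\<close>. At 0 the difference quotient is
  \<open>flat_poly ([:0, 1:] * p)\<close>, which tends to 0.\<close>

lemma flat_poly_has_derivative:
  "(flat_poly p has_real_derivative flat_poly ([:0, 0, 1:] * (p - pderiv p)) x) (at x)"
proof -
  consider "x < 0" | "x = 0" | "x > 0" by linarith
  then show ?thesis
  proof cases
    case 1
    have "((\<lambda>x. 0) has_real_derivative 0) (at x)" by simp
    then have "(flat_poly p has_real_derivative 0) (at x)"
      by (rule has_field_derivative_transform_within_open[of _ _ _ "{..<0}"]) (use 1 in \<open>auto simp: flat_poly_def\<close>)
    then show ?thesis using 1 by (simp add: flat_poly_def)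
  next
    case 2
    have "((\<lambda>h. (flat_poly p (0 + h) - flat_poly p 0) / h) \<longlongrightarrow> 0) (at 0)"
    proof (rule Lim_transform_eventually[OF flat_poly_tendsto_0[of "[:0, 1:] * p"]])
      show "\<forall>\<^sub>F h in at 0. flat_poly ([:0, 1:] * p) h = (flat_poly p (0 + h) - flat_poly p 0) / h"
        by (auto simp: eventually_at_filter flat_poly_def)
    qed
    then show ?thesis using 2 by (simp add: DERIV_def flat_poly_def)
  next
    case 3
    have "((\<lambda>x. poly p (1 / x) * exp (- 1 / x)) has_real_derivative
        poly p (1 / x) * (exp (- 1 / x) * (1 / x\<^sup>2)) + poly (pderiv p) (1 / x) * (- 1 / x\<^sup>2) * exp (- 1 / x)) (at x)"
      using 3
      by (auto intro!: derivative_eq_intros DERIV_chain'[of "\<lambda>x. 1 / x" _ _ _ "poly p"] poly_DERIV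
          simp: power2_eq_square field_simps)
    then have "(flat_poly p has_real_derivative
        poly p (1 / x) * (exp (- 1 / x) * (1 / x\<^sup>2)) + poly (pderiv p) (1 / x) * (- 1 / x\<^sup>2) * exp (- 1 / x)) (at x)"
      by (rule has_field_derivative_transform_within_open[of _ _ _ "{0<..}"]) (use 3 in \<open>auto simp: flat_poly_def\<close>)
    then show ?thesis using 3 by (simp add: flat_poly_def field_simps power2_eq_square)
  qed
qed

lemma smooth_flat_poly: "smooth (flat_poly p)"
proof -
  have "Ck k (flat_poly p)" for k
  proof (induction k arbitrary: p)
    case 0
    have "isCont (flat_poly p) x" for x using flat_poly_has_derivative by (rule DERIV_isCont)
    then show ?case by (simp add: continuous_at_imp_continuous_on)
  next
    case (Suc k)
    show ?case
    proof (rule Ck_SucI)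
      show "(flat_poly p has_derivative (\<lambda>v. flat_poly ([:0, 0, 1:] * (p - pderiv p)) x * v)) (at x)" for x
        using flat_poly_has_derivative[of p x] by (simp add: has_field_derivative_def)
      show "Ck k (\<lambda>x. flat_poly ([:0, 0, 1:] * (p - pderiv p)) x * v)" for v
        by (intro bounded_bilinear.Ck_prod[OF bounded_bilinear_mult] Suc Ck_const)
    qed
  qed
  then show ?thesis by (simp add: smooth_def)
qed

section \<open>Bump functions, smooth steps and partitions of unity\<close>

lemma flat_poly_1: "flat_poly 1 x > 0 \<longleftrightarrow> x > 0" "flat_poly 1 x \<ge> 0" "flat_poly 1 x = 0 \<longleftrightarrow> x \<le> 0"
  by (auto simp: flat_poly_def)

text \<open>A mollifier without normalisation: what counts is that it is positive exactly on the
  open box. The one-dimensional factor \<open>flat_poly 1\<close> is \<open>exp (- 1 / x)\<close>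
  for positive \<open>x\<close> and 0 otherwise.\<close>

definition box_bump :: "'a::euclidean_space \<Rightarrow> 'a \<Rightarrow> 'a \<Rightarrow> real" where
  "box_bump l u x = (\<Prod>b\<in>Basis. flat_poly 1 (x \<bullet> b - l \<bullet> b) * flat_poly 1 (u \<bullet> b - x \<bullet> b))"

lemma box_bump_nonneg: "box_bump l u x \<ge> 0"
  unfolding box_bump_def by (intro prod_nonneg mult_nonneg_nonneg flat_poly_1)

lemma box_bump_eq_0_iff: "box_bump l u x = 0 \<longleftrightarrow> x \<notin> box l u"
  unfolding box_bump_def by (auto simp: flat_poly_1 mem_box not_less)

lemma smooth_box_bump: "smooth (box_bump l u)"
  unfolding box_bump_def
  by (intro smooth_prod_finite smooth_mult smooth_real_compose[OF smooth_flat_poly] smooth_diff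
      smooth_const smooth_bounded_linear bounded_linear_inner_left) simp

lemma test_functionsI:
  assumes "smooth f" "\<And>x. f x \<noteq> 0 \<Longrightarrow> x \<in> K" "compact K" "K \<subseteq> S"
  shows "f \<in> test_functions S"
proof -
  have "closure {x. f x \<noteq> 0} \<subseteq> K"
    using assms(2) compact_imp_closed[OF assms(3)] by (intro closure_minimal) auto
  moreover from this have "compact (closure {x. f x \<noteq> 0})"
    using compact_Int_closed[OF assms(3) closed_closure] by (metis inf.absorb2)
  ultimately show ?thesis
    using assms(1,4) unfolding test_functions_def smooth_def by blast
qed

lemma box_bump_test_function: "cbox l u \<subseteq> S \<Longrightarrow> box_bump l u \<in> test_functions S"
  using box_subset_cbox box_bump_eq_0_iff
  by (intro test_functionsI[where K="cbox l u"] smooth_box_bump compact_cbox) blast+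

lemma smooth_antiderivative_ex:
  fixes g :: "real \<Rightarrow> real"
  assumes "smooth g"
  obtains f where "\<And>x. (f has_real_derivative g x) (at x)" "smooth f"
proof -
  have "\<exists>F. \<forall>x::real. - \<infinity> < ereal x \<longrightarrow> ereal x < \<infinity> \<longrightarrow> (F has_vector_derivative g x) (at x)"
    using smooth_continuous[OF assms]
    by (intro einterval_antiderivative) (auto simp: continuous_on_eq_continuous_at)
  then obtain f where "\<And>x. (f has_vector_derivative g x) (at x)" by auto
  then have "\<And>x. (f has_real_derivative g x) (at x)" by (simp add: has_real_derivative_iff_has_vector_derivative)
  with assms show thesis using smooth_real_antiderivative that by blast
qed

text \<open>A bump on the unit interval is integrated, and the antiderivative is shifted and
  rescaled.\<close>

lemma smooth_step_ex: "\<exists>s::real \<Rightarrow> real. smooth s \<and> (\<forall>x\<le>0. s x = 0) \<and> (\<forall>x\<ge>1. s x = 1)"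
proof -
  define g :: "real \<Rightarrow> real" where "g = box_bump 0 1"
  obtain f where f: "\<And>x. (f has_real_derivative g x) (at x)" "smooth f"
    using smooth_antiderivative_ex[OF smooth_box_bump, of 0 1] g_def by metis
  have g: "g x > 0 \<longleftrightarrow> 0 < x \<and> x < 1" "g x = 0 \<longleftrightarrow> x \<le> 0 \<or> x \<ge> 1" for x
    using box_bump_eq_0_iff[of 0 1 x] box_bump_nonneg[of 0 1 x] by (auto simp: g_def order_less_le)
  have cont: "continuous_on A f" for A
    using f(1) by (auto intro: DERIV_isCont continuous_at_imp_continuous_on)
  have f01: "f 0 < f 1"
  proof (rule DERIV_pos_imp_increasing_open[OF _ _ cont])
    show "\<exists>y. (f has_real_derivative y) (at x) \<and> 0 < y" if "0 < x" "x < 1" for x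
      using f(1)[of x] g(1)[of x] that by blast
  qed simp
  have const: "f b = f a" if "a < b" "\<And>x. a < x \<Longrightarrow> x < b \<Longrightarrow> g x = 0" for a b
    using that f(1) by (intro DERIV_isconst_end[OF _ cont]) metis+
  have le: "f x = f 0" if "x \<le> 0" for x
    using const[of x 0] g(2) that by (cases "x = 0") auto
  have ge: "f x = f 1" if "x \<ge> 1" for x
    using const[of 1 x] g(2) that by (cases "x = 1") auto
  let ?s = "\<lambda>x. (1 / (f 1 - f 0)) * (f x - f 0)"
  have "smooth ?s" by (intro smooth_cmult smooth_diff f smooth_const)
  moreover have "?s x = 0" if "x \<le> 0" for x by (simp only: le[OF that]) simp
  moreover have "?s x = 1" if "x \<ge> 1" for x using f01 by (simp only: ge[OF that]) simp
  ultimately show ?thesis by blast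
qed

text \<open>In each coordinate, differences of consecutive translates of a smooth step telescope to
  1. Multiplying over the coordinates and exchanging product and sum gives the partition, with all
  members localised at the scale \<open>\<delta>\<close>.\<close>

lemma smooth_partition_of_unity:
  fixes K :: "'a::euclidean_space set"
  assumes "bounded K" "\<delta> > 0"
  obtains I :: "('a \<Rightarrow> nat) set" and \<zeta> :: "('a \<Rightarrow> nat) \<Rightarrow> 'a \<Rightarrow> real" where
    "finite I" "\<And>i. smooth (\<zeta> i)" "\<And>i x y. \<zeta> i x \<noteq> 0 \<Longrightarrow> \<zeta> i y \<noteq> 0 \<Longrightarrow> dist x y < \<delta>"
    "\<And>x. x \<in> K \<Longrightarrow> (\<Sum>i\<in>I. \<zeta> i x) = 1"
proof -
  obtain s :: "real \<Rightarrow> real" where s: "smooth s" "\<And>x. x \<le> 0 \<Longrightarrow> s x = 0" "\<And>x. x \<ge> 1 \<Longrightarrow> s x = 1"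
    using smooth_step_ex by blast
  obtain R where R: "R > 0" "\<And>x. x \<in> K \<Longrightarrow> norm x \<le> R" using assms(1) bounded_pos by blast
  \<comment> \<open>Each \<open>\<zeta> i\<close> lives in a cube of side \<open>2 / N\<close>. The
    scale makes the sum of the sides, which bounds the diameter, smaller than
    \<open>\<delta>\<close>.\<close>
  define N where "N = (2 * real DIM('a) + 1) / \<delta>"
  have N: "N > 0" using assms(2) by (simp add: N_def)
  \<comment> \<open>With this \<open>m\<close>, the number \<open>N * (x \<bullet> b) + m\<close>
    lies between 1 and \<open>2 * m\<close> for \<open>x\<close> in \<open>K\<close>, so the
    telescoped sum of the steps is 1 - 0.\<close>
  obtain m :: nat where m: "N * R + 1 \<le> real m" using real_arch_simple by blast
  define c where "c b k x = s (N * (x \<bullet> b) + real m - real k) - s (N * (x \<bullet> b) + real m - real (Suc k))"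
    for b x :: 'a and k
  define \<zeta> where "\<zeta> i x = (\<Prod>b\<in>Basis. c b (i b) x)" for i :: "'a \<Rightarrow> nat" and x
  have c_supp: "c b k x = 0" if "N * (x \<bullet> b) + real m \<le> real k \<or> real k + 2 \<le> N * (x \<bullet> b) + real m" for b k x
    using that by (auto simp: c_def s)
  show thesis
  proof (rule that[of "PiE Basis (\<lambda>_. {..<2 * m})" \<zeta>])
    show "finite (PiE Basis (\<lambda>_. {..<2 * m}) :: ('a \<Rightarrow> nat) set)" by (intro finite_PiE) auto
    show "smooth (\<zeta> i)" for i
      unfolding \<zeta>_def c_def
      by (intro smooth_prod_finite smooth_diff smooth_add smooth_cmult smooth_real_compose[OF s(1)]
          smooth_const smooth_bounded_linear bounded_linear_inner_left) simp
    show "dist x y < \<delta>" if "\<zeta> i x \<noteq> 0" "\<zeta> i y \<noteq> 0" for i x y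
    proof -
      have "\<bar>(x - y) \<bullet> b\<bar> \<le> 2 / N" if "b \<in> Basis" for b
      proof -
        have "c b (i b) x \<noteq> 0" "c b (i b) y \<noteq> 0"
          using \<open>\<zeta> i x \<noteq> 0\<close> \<open>\<zeta> i y \<noteq> 0\<close> that by (auto simp: \<zeta>_def)
        then have "\<bar>N * (x \<bullet> b) - N * (y \<bullet> b)\<bar> \<le> 2"
          using c_supp[of x b "i b"] c_supp[of y b "i b"] by linarith
        then have "N * \<bar>(x - y) \<bullet> b\<bar> \<le> 2"
          using N by (simp add: inner_diff abs_mult right_diff_distrib[symmetric])
        then show ?thesis using N by (simp add: field_simps)
      qed
      then have "(\<Sum>b\<in>Basis. \<bar>(x - y) \<bullet> b\<bar>) \<le> (\<Sum>b\<in>(Basis::'a set). 2 / N)" by (intro sum_mono)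
      also have "\<dots> = 2 * real DIM('a) / N" by simp
      also have "\<dots> < \<delta>"
        using assms(2) by (simp add: N_def field_simps)
      finally show ?thesis using norm_le_l1[of "x - y"] by (simp add: dist_norm)
    qed
    show "(\<Sum>i\<in>PiE Basis (\<lambda>_. {..<2 * m}). \<zeta> i x) = 1" if "x \<in> K" for x
    proof -
      have "(\<Sum>i\<in>PiE Basis (\<lambda>_. {..<2 * m}). \<zeta> i x) = (\<Prod>b\<in>Basis. \<Sum>k<2 * m. c b k x)"
        unfolding \<zeta>_def by (subst prod_sum_PiE) auto
      also have "\<dots> = (\<Prod>b\<in>(Basis::'a set). 1)"
      proof (intro prod.cong refl)
        fix b :: 'a assume b: "b \<in> Basis"
        have "\<bar>x \<bullet> b\<bar> \<le> R" using Basis_le_norm[OF b, of x] R(2)[OF that] by linarith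
        then have "\<bar>N * (x \<bullet> b)\<bar> \<le> N * R" using N by (simp add: abs_mult)
        then have "N * (x \<bullet> b) + real m \<ge> 1" "N * (x \<bullet> b) + real m - real (2 * m) \<le> 0"
          using m by linarith+
        moreover have "(\<Sum>k<2 * m. c b k x) = s (N * (x \<bullet> b) + real m - real 0) - s (N * (x \<bullet> b) + real m - real (2 * m))"
          unfolding c_def by (rule sum_lessThan_telescope')
        ultimately show "(\<Sum>k<2 * m. c b k x) = 1" by (simp add: s)
      qed
      finally show ?thesis by simp
    qed
  qed
qed

section \<open>Test functions and mollification\<close>

abbreviation dderiv :: "('a::real_normed_vector \<Rightarrow> 'b::real_normed_vector) \<Rightarrow> 'a \<Rightarrow> 'a \<Rightarrow> 'b" where
  "dderiv f v x \<equiv> frechet_derivative f (at x) v"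

lemma smooth_line_derivative:
  fixes f :: "'a::real_normed_vector \<Rightarrow> real"
  assumes "smooth f"
  shows "((\<lambda>s. f (x + s *\<^sub>R v)) has_real_derivative dderiv f v (x + s *\<^sub>R v)) (at s)"
proof -
  have 1: "((\<lambda>s. x + s *\<^sub>R v) has_derivative (\<lambda>h. h *\<^sub>R v)) (at s)"
    by (auto intro!: derivative_eq_intros)
  have D: "(f has_derivative frechet_derivative f (at (x + s *\<^sub>R v))) (at (x + s *\<^sub>R v))"
    using assms by (rule smooth_derivative)
  have "((\<lambda>s. f (x + s *\<^sub>R v)) has_derivative (\<lambda>h. frechet_derivative f (at (x + s *\<^sub>R v)) (h *\<^sub>R v))) (at s)"
    using has_derivative_compose[OF 1 D] .
  moreover have "(\<lambda>h. frechet_derivative f (at (x + s *\<^sub>R v)) (h *\<^sub>R v)) = (*) (dderiv f v (x + s *\<^sub>R v))"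
    by (simp add: fun_eq_iff linear_scale[OF has_derivative_linear[OF D]] mult.commute)
  ultimately show ?thesis by (simp add: has_field_derivative_def)
qed

lemma (in bounded_bilinear) dderiv_prod:
  assumes "smooth f" "smooth g"
  shows "dderiv (\<lambda>x. prod (f x) (g x)) v x = prod (f x) (dderiv g v x) + prod (dderiv f v x) (g x)"
  using frechet_derivative_at[OF FDERIV[OF smooth_derivative(1)[OF assms(1)] smooth_derivative(1)[OF assms(2)]], of x]
  by (metis (no_types, lifting))

lemmas dderiv_mult = bounded_bilinear.dderiv_prod[OF bounded_bilinear_mult]
lemmas dderiv_scaleR = bounded_bilinear.dderiv_prod[OF bounded_bilinear_scaleR]

lemma dderiv_linear:
  assumes "bounded_linear L" "smooth f"
  shows "dderiv (\<lambda>x. L (f x)) v x = L (dderiv f v x)"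
  using frechet_derivative_at[OF bounded_linear.has_derivative[OF assms(1) smooth_derivative(1)[OF assms(2)]], of x]
  by (metis (no_types, lifting))

lemma dderiv_affine:
  assumes "smooth f"
  shows "dderiv (\<lambda>x. f (c *\<^sub>R x + z)) v x = c *\<^sub>R dderiv f v (c *\<^sub>R x + z)"
proof -
  have D: "(f has_derivative frechet_derivative f (at (c *\<^sub>R x + z))) (at (c *\<^sub>R x + z))"
    using assms by (rule smooth_derivative)
  have 1: "((\<lambda>x. c *\<^sub>R x + z) has_derivative (\<lambda>v. c *\<^sub>R v)) (at x)"
    by (auto intro!: derivative_eq_intros)
  have "dderiv (\<lambda>x. f (c *\<^sub>R x + z)) v x = dderiv f (c *\<^sub>R v) (c *\<^sub>R x + z)"
    using frechet_derivative_at[OF has_derivative_compose[OF 1 D]] by (metis (no_types, lifting))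
  then show ?thesis using linear_scale[OF has_derivative_linear[OF D]] by simp
qed

lemma dderiv_zero_outside:
  assumes "x \<notin> closure {x. f x \<noteq> 0}"
  shows "dderiv f v x = 0"
proof -
  have "((\<lambda>x. 0) has_derivative (\<lambda>v. 0)) (at x)" by simp
  then have "(f has_derivative (\<lambda>v. 0)) (at x)"
    by (rule has_derivative_transform_within_open[of _ _ _ _ "- closure {x. f x \<noteq> 0}"])
      (use assms closure_subset[of "{x. f x \<noteq> 0}"] in auto)
  then show ?thesis using frechet_derivative_at by metis
qed

text \<open>The second difference of \<open>f\<close> along \<open>u\<close> and \<open>v\<close> is
  symmetric in the two directions. Applying the mean value theorem twice expresses it as the squared
  step size times a mixed derivative at a nearby point, in either order of differentiation.\<close>

lemma dderiv_commute:
  fixes f :: "'a::real_normed_vector \<Rightarrow> real"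
  assumes f: "smooth f"
  shows "dderiv (dderiv f u) v x = dderiv (dderiv f v) u x"
proof -
  have mixed: "\<exists>s t. 0 < s \<and> s < h \<and> 0 < t \<and> t < h \<and>
      f (x + h *\<^sub>R u + h *\<^sub>R v) - f (x + h *\<^sub>R u) - f (x + h *\<^sub>R v) + f x
      = h * (h * dderiv (dderiv f u) v (x + s *\<^sub>R u + t *\<^sub>R v))" if h: "h > 0" for h and u v :: 'a
  proof -
    have A: "((\<lambda>s. f (x + h *\<^sub>R v + s *\<^sub>R u) - f (x + s *\<^sub>R u)) has_real_derivative
        dderiv f u (x + h *\<^sub>R v + s *\<^sub>R u) - dderiv f u (x + s *\<^sub>R u)) (at s)" for s
      by (intro DERIV_diff smooth_line_derivative f)
    obtain s where s: "0 < s" "s < h"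
      "(f (x + h *\<^sub>R v + h *\<^sub>R u) - f (x + h *\<^sub>R u)) - (f (x + h *\<^sub>R v + 0 *\<^sub>R u) - f (x + 0 *\<^sub>R u))
        = (h - 0) * (dderiv f u (x + h *\<^sub>R v + s *\<^sub>R u) - dderiv f u (x + s *\<^sub>R u))"
      using MVT2[OF h A] by blast
    have B: "((\<lambda>t. dderiv f u (x + s *\<^sub>R u + t *\<^sub>R v)) has_real_derivative
        dderiv (dderiv f u) v (x + s *\<^sub>R u + t *\<^sub>R v)) (at t)" for t
      by (intro smooth_line_derivative smooth_derivative f)
    obtain t where t: "0 < t" "t < h"
      "dderiv f u (x + s *\<^sub>R u + h *\<^sub>R v) - dderiv f u (x + s *\<^sub>R u + 0 *\<^sub>R v)
        = (h - 0) * dderiv (dderiv f u) v (x + s *\<^sub>R u + t *\<^sub>R v)"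
      using MVT2[OF h B] by blast
    show ?thesis
      using s t by (intro exI[of _ s] exI[of _ t]) (simp add: algebra_simps)
  qed
  define Q where "Q u v n = (f (x + (1 / real (Suc n)) *\<^sub>R u + (1 / real (Suc n)) *\<^sub>R v)
      - f (x + (1 / real (Suc n)) *\<^sub>R u) - f (x + (1 / real (Suc n)) *\<^sub>R v) + f x) * (real (Suc n))\<^sup>2" for u v n
  have conv: "Q u v \<longlonglongrightarrow> dderiv (dderiv f u) v x" for u v
  proof -
    define h where "h n = 1 / real (Suc n)" for n
    have hpos: "h n > 0" for n by (simp add: h_def)
    have h0: "h \<longlonglongrightarrow> 0" unfolding h_def using LIMSEQ_inverse_real_of_nat by (simp add: inverse_eq_divide)
    define P where "P n p \<longleftrightarrow> 0 < fst p \<and> fst p < h n \<and> 0 < snd p \<and> snd p < h n \<and>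
        f (x + h n *\<^sub>R u + h n *\<^sub>R v) - f (x + h n *\<^sub>R u) - f (x + h n *\<^sub>R v) + f x
          = h n * (h n * dderiv (dderiv f u) v (x + fst p *\<^sub>R u + snd p *\<^sub>R v))" for n and p :: "real \<times> real"
    have "\<exists>p. P n p" for n
      using mixed[OF hpos, of n u v] unfolding P_def by (metis fst_conv snd_conv)
    then obtain p where p: "\<And>n. P n (p n)" by metis
    define s where "s n = fst (p n)" for n
    define t where "t n = snd (p n)" for n
    have st: "0 < s n" "s n < h n" "0 < t n" "t n < h n"
      "f (x + h n *\<^sub>R u + h n *\<^sub>R v) - f (x + h n *\<^sub>R u) - f (x + h n *\<^sub>R v) + f x
        = h n * (h n * dderiv (dderiv f u) v (x + s n *\<^sub>R u + t n *\<^sub>R v))" for n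
      using p[of n] unfolding P_def s_def t_def by blast+
    have "s \<longlonglongrightarrow> 0"
      by (rule LIMSEQ_squeeze_Suc) (use st(1,2) less_imp_le in \<open>auto simp: h_def\<close>)
    moreover have "t \<longlonglongrightarrow> 0"
      by (rule LIMSEQ_squeeze_Suc) (use st(3,4) less_imp_le in \<open>auto simp: h_def\<close>)
    ultimately have "(\<lambda>n. x + s n *\<^sub>R u + t n *\<^sub>R v) \<longlonglongrightarrow> x + 0 *\<^sub>R u + 0 *\<^sub>R v"
      by (intro tendsto_intros)
    moreover have "isCont (dderiv (dderiv f u) v) x"
      using smooth_continuous[OF smooth_derivative(2)[OF smooth_derivative(2)[OF f]]]
      by (simp add: continuous_on_eq_continuous_at)
    ultimately have "(\<lambda>n. dderiv (dderiv f u) v (x + s n *\<^sub>R u + t n *\<^sub>R v)) \<longlonglongrightarrow> dderiv (dderiv f u) v x"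
      using isCont_tendsto_compose[of x "dderiv (dderiv f u) v" "\<lambda>n. x + s n *\<^sub>R u + t n *\<^sub>R v" sequentially]
      by simp
    moreover have "dderiv (dderiv f u) v (x + s n *\<^sub>R u + t n *\<^sub>R v) = Q u v n" for n
      unfolding Q_def h_def[symmetric] st(5) by (simp add: h_def power2_eq_square)
    ultimately show ?thesis by simp
  qed
  have "Q u v = Q v u" by (auto simp: Q_def fun_eq_iff algebra_simps)
  then show ?thesis using conv[of u v] conv[of v u] LIMSEQ_unique by metis
qed

lemma test_functions_smooth: "f \<in> test_functions S \<Longrightarrow> smooth f"
  by (simp add: test_functions_def smooth_def)

lemma test_functions_mapI:
  assumes "f \<in> test_functions S" "smooth g" "\<And>x. x \<notin> closure {x. f x \<noteq> 0} \<Longrightarrow> g x = 0"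
  shows "g \<in> test_functions S"
  using assms unfolding test_functions_def
  by (intro test_functionsI[unfolded test_functions_def, where K="closure {x. f x \<noteq> 0}"]) auto

lemma test_functions_zero_outside: "f \<in> test_functions S \<Longrightarrow> x \<notin> S \<Longrightarrow> f x = 0"
  using closure_subset[of "{x. f x \<noteq> 0}"] by (auto simp: test_functions_def)

lemma test_functions_dderiv: "f \<in> test_functions S \<Longrightarrow> dderiv f v \<in> test_functions S"
  by (rule test_functions_mapI[of f S]) (auto intro: smooth_derivative test_functions_smooth dderiv_zero_outside)

lemma test_functions_mapI':
  assumes "f \<in> test_functions S" "smooth g" "\<And>x. f x = 0 \<Longrightarrow> g x = 0"
  shows "g \<in> test_functions S"
  using assms closure_subset[of "{x. f x \<noteq> 0}"] by (intro test_functions_mapI[OF assms(1,2)]) blast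

lemma test_functions_scaleR_left:
  assumes "smooth \<zeta>" "f \<in> test_functions S"
  shows "(\<lambda>x. \<zeta> x *\<^sub>R f x) \<in> test_functions S"
  by (rule test_functions_mapI'[OF assms(2) smooth_scaleR[OF assms(1) test_functions_smooth[OF assms(2)]]]) simp

lemma test_functions_scaleR_right:
  assumes "smooth g" "f \<in> test_functions S"
  shows "(\<lambda>x. f x *\<^sub>R g x) \<in> test_functions S"
  by (rule test_functions_mapI'[OF assms(2) smooth_scaleR[OF test_functions_smooth[OF assms(2)] assms(1)]]) simp

lemma test_functions_linear:
  assumes "bounded_linear L" "f \<in> test_functions S"
  shows "(\<lambda>x. L (f x)) \<in> test_functions S"
  using linear_0[OF bounded_linear.linear[OF assms(1)]]
  by (intro test_functions_mapI'[OF assms(2) smooth_linear_compose[OF assms(1) test_functions_smooth[OF assms(2)]]]) simp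

lemma test_functions_bounded:
  fixes f :: "'a::euclidean_space \<Rightarrow> 'b::real_normed_vector"
  assumes "f \<in> test_functions S"
  obtains C R where "C \<ge> 0" "R > 0" "\<And>x. norm (f x) \<le> C" "\<And>x. f x \<noteq> 0 \<Longrightarrow> norm x \<le> R"
proof -
  let ?K = "closure {x. f x \<noteq> 0}"
  have K: "compact ?K" using assms by (simp add: test_functions_def)
  have "continuous_on ?K f"
    using smooth_continuous[OF test_functions_smooth[OF assms]] continuous_on_subset by blast
  then have "bounded (f ` ?K)" using K by (intro compact_imp_bounded compact_continuous_image)
  then obtain C where C: "C > 0" "\<And>x. x \<in> ?K \<Longrightarrow> norm (f x) \<le> C" by (auto simp: bounded_pos)
  obtain R where R: "R > 0" "\<And>x. x \<in> ?K \<Longrightarrow> norm x \<le> R"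
    using compact_imp_bounded[OF K] by (auto simp: bounded_pos)
  show thesis
  proof (rule that[of C R])
    show "norm (f x) \<le> C" for x
      using C closure_subset[of "{x. f x \<noteq> 0}"] by (cases "f x = 0") auto
    show "norm x \<le> R" if "f x \<noteq> 0" for x using R closure_subset[of "{x. f x \<noteq> 0}"] that by auto
  qed (use C R in auto)
qed

lemma test_functions_measurable: "f \<in> test_functions S \<Longrightarrow> f \<in> borel_measurable borel"
  by (intro borel_measurable_continuous_onI smooth_continuous test_functions_smooth)

lemma test_functions_square_integrable:
  fixes f :: "'a::euclidean_space \<Rightarrow> 'b::{real_inner, second_countable_topology, banach}"
  assumes "f \<in> test_functions S"
  shows "square_integrable f" "integrable lborel f"
proof -
  obtain C R where CR: "C \<ge> 0" "R > 0" "\<And>x. norm (f x) \<le> C" "\<And>x. f x \<noteq> 0 \<Longrightarrow> norm x \<le> R"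
    using test_functions_bounded[OF assms] by metis
  have [measurable]: "f \<in> borel_measurable borel" using assms by (rule test_functions_measurable)
  have fin: "emeasure lborel (cball (0::'a) R) < \<infinity>" by (rule emeasure_lborel_cball_finite)
  have le: "norm (f x) \<le> C * norm (indicator (cball 0 R) x *\<^sub>R (1::real))" for x
    using CR by (cases "f x = 0") (auto simp: indicator_def)
  show "square_integrable f"
    by (rule square_integrable_bound[OF square_integrable_indicator[OF _ fin, of "1::real"], where C=C]) (use le in auto)
  show "integrable lborel f"
  proof (rule Bochner_Integration.integrable_bound)
    show "integrable lborel (\<lambda>x. C * indicator (cball (0::'a) R) x)" using fin by simp
    show "AE x in lborel. norm (f x) \<le> norm (C * indicator (cball 0 R) x)"
      using le CR(1) by (auto simp: indicator_def)
  qed simp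
qed

text \<open>Difference quotients integrate to 0 by translation invariance. They converge to the
  derivative and, by the mean value theorem, are dominated by a constant on one fixed ball.\<close>

lemma integral_dderiv_test_function:
  fixes f :: "'a::euclidean_space \<Rightarrow> real"
  assumes f: "f \<in> test_functions S"
  shows "(LINT x|lborel. dderiv f v x) = 0"
proof -
  note sm = test_functions_smooth[OF f]
  obtain C R where CR: "C \<ge> 0" "\<And>x. norm (dderiv f v x) \<le> C"
    using test_functions_bounded[OF test_functions_dderiv[OF f, of v]] by metis
  obtain R where R: "\<And>x. f x \<noteq> 0 \<Longrightarrow> norm x \<le> R" using test_functions_bounded[OF f] by metis
  have [measurable]: "f \<in> borel_measurable borel" "dderiv f v \<in> borel_measurable borel"
    using f test_functions_dderiv[OF f] by (auto intro: test_functions_measurable)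
  \<comment> \<open>Steps of size at most 1 keep the translated supports inside the ball of radius
    \<open>R + norm v\<close>.\<close>
  define h where "h n = 1 / real (Suc n)" for n
  have h: "h n > 0" "h n \<le> 1" for n by (auto simp: h_def)
  have h0: "h \<longlonglongrightarrow> 0" unfolding h_def using LIMSEQ_inverse_real_of_nat by (simp add: inverse_eq_divide)
  define q where "q n x = (f (x + h n *\<^sub>R v) - f x) / h n" for n x
  have "(\<lambda>n. LINT x|lborel. q n x) \<longlonglongrightarrow> (LINT x|lborel. dderiv f v x)"
  proof (rule integral_dominated_convergence[where w="\<lambda>x. C * indicator (cball 0 (R + norm v)) x"])
    show "integrable lborel (\<lambda>x. C * indicator (cball 0 (R + norm v)) x)"
      by (intro integrable_mult_right integrable_real_indicator emeasure_lborel_cball_finite) simp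
    show "AE x in lborel. (\<lambda>n. q n x) \<longlonglongrightarrow> dderiv f v x"
    proof (rule AE_I2)
      fix x
      have "((\<lambda>t. (f (x + t *\<^sub>R v) - f x) / t) \<longlongrightarrow> dderiv f v x) (at 0)"
        using smooth_line_derivative[OF sm, of x v 0] by (simp add: DERIV_def)
      moreover have "filterlim h (at 0) sequentially"
        by (rule filterlim_atI[OF h0]) (use h(1) less_imp_neq in \<open>auto simp: h_def\<close>)
      ultimately show "(\<lambda>n. q n x) \<longlonglongrightarrow> dderiv f v x"
        unfolding q_def by (rule filterlim_compose)
    qed
    show "AE x in lborel. norm (q n x) \<le> C * indicator (cball 0 (R + norm v)) x" for n
    proof (rule AE_I2)
      fix x
      obtain s where s: "0 < s" "s < h n" "f (x + h n *\<^sub>R v) - f (x + 0 *\<^sub>R v) = (h n - 0) * dderiv f v (x + s *\<^sub>R v)"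
        using MVT2[OF h(1) smooth_line_derivative[OF sm, of x v]] by blast
      then have "norm (q n x) \<le> C" using CR(2)[of "x + s *\<^sub>R v"] h(1)[of n] by (simp add: q_def)
      moreover have "q n x = 0" if "x \<notin> cball 0 (R + norm v)"
      proof -
        have "norm (h n *\<^sub>R v) \<le> norm v" using h[of n] by (simp add: mult_left_le_one_le)
        moreover have "norm x \<le> norm (x + h n *\<^sub>R v) + norm (h n *\<^sub>R v)"
          using norm_triangle_ineq4[of "x + h n *\<^sub>R v" "h n *\<^sub>R v"] by simp
        moreover have "R + norm v < norm x" using that by simp
        ultimately have "R < norm (x + h n *\<^sub>R v)" "R < norm x" using norm_ge_zero[of v] by linarith+
        then have "f x = 0" "f (x + h n *\<^sub>R v) = 0" using R[of x] R[of "x + h n *\<^sub>R v"] by force+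
        then show ?thesis by (simp add: q_def)
      qed
      ultimately show "norm (q n x) \<le> C * indicator (cball 0 (R + norm v)) x"
        using CR(1) by (auto simp: indicator_def)
    qed
  qed (simp_all add: q_def)
  moreover have "(LINT x|lborel. q n x) = 0" for n
    using test_functions_square_integrable(2)[OF f] lborel_integral_shift[of f "h n *\<^sub>R v"]
    by (simp add: q_def)
  ultimately show ?thesis by (simp add: LIMSEQ_const_iff)
qed

lemma integration_by_parts_test_function:
  fixes u \<phi> :: "'a::euclidean_space \<Rightarrow> real"
  assumes "smooth u" "\<phi> \<in> test_functions S"
  shows "(LINT x|lborel. u x * dderiv \<phi> v x) = - (LINT x|lborel. dderiv u v x * \<phi> x)"
proof -
  note s = test_functions_smooth[OF assms(2)]
  have t: "(\<lambda>x. \<zeta> x * \<psi> x) \<in> test_functions S" if "smooth \<zeta>" "\<psi> \<in> test_functions S" for \<zeta> \<psi> :: "'a \<Rightarrow> real"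
    using test_functions_scaleR_left[OF that] by simp
  note i1 = test_functions_square_integrable(2)[OF t[OF assms(1) test_functions_dderiv[OF assms(2), of v]]]
  note i2 = test_functions_square_integrable(2)[OF t[OF smooth_derivative(2)[OF assms(1), of v] assms(2)]]
  have "0 = (LINT x|lborel. dderiv (\<lambda>x. u x * \<phi> x) v x)"
    using integral_dderiv_test_function[OF t[OF assms]] by simp
  also have "\<dots> = (LINT x|lborel. u x * dderiv \<phi> v x + dderiv u v x * \<phi> x)"
    by (simp only: dderiv_mult[OF assms(1) s])
  also have "\<dots> = (LINT x|lborel. u x * dderiv \<phi> v x) + (LINT x|lborel. dderiv u v x * \<phi> x)"
    using i1 i2 by (rule Bochner_Integration.integral_add)
  finally show ?thesis by simp
qed

lemma box_bump_shift: "box_bump l u (x - y) = box_bump (l + y) (u + y) x"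
  by (simp add: box_bump_def inner_diff inner_add algebra_simps)

text \<open>If \<open>F 0\<close> were nonzero, \<open>F\<close> would have a fixed sign near 0, and
  a box inside both this neighbourhood and \<open>U\<close> would give a nonzero average. Since 0 is
  placed in the closure of \<open>U\<close> rather than in \<open>U\<close>, the set can be a cone
  with apex 0; this is what admits translations in inward directions alone.\<close>

lemma eq_0_if_bump_averages_eq_0:
  fixes F :: "'a::euclidean_space \<Rightarrow> real"
  assumes lim: "(F \<longlongrightarrow> F 0) (at 0)" and U: "open U" "0 \<in> closure U"
    and int: "\<And>l u. integrable lborel (\<lambda>z. box_bump l u z * F z)"
    and zero: "\<And>l u. cbox l u \<subseteq> U \<Longrightarrow> (LINT z|lborel. box_bump l u z * F z) = 0"
  shows "F 0 = 0"
proof (rule ccontr)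
  assume "F 0 \<noteq> 0"
  define G where "G z = sgn (F 0) * F z" for z
  have "(G \<longlongrightarrow> G 0) (at 0)" unfolding G_def by (intro tendsto_intros lim)
  moreover have G0: "G 0 > 0" using \<open>F 0 \<noteq> 0\<close> by (auto simp: G_def sgn_if)
  ultimately have "\<forall>\<^sub>F z in at 0. G z > 0" by (rule order_tendstoD)
  then have "\<forall>\<^sub>F z in nhds 0. G z > 0" using G0 by (auto simp: eventually_at_filter elim: eventually_mono)
  then obtain V where V: "open V" "0 \<in> V" "\<And>z. z \<in> V \<Longrightarrow> G z > 0" by (auto simp: eventually_nhds)
  have "U \<inter> V \<noteq> {}" using U(2) V(1,2) by (auto simp: closure_iff_nhds_not_empty)
  then obtain p where p: "p \<in> U \<inter> V" by blast
  obtain l u where lu: "cbox l u \<subseteq> U \<inter> V" "p \<in> box l u" "\<forall>b\<in>Basis. l \<bullet> b < u \<bullet> b"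
    using open_contains_cbox[OF open_Int[OF U(1) V(1)] p] by metis
  have "integrable lborel (\<lambda>z. box_bump l u z * G z)"
    using integrable_mult_right[OF int[of l u], of "sgn (F 0)"] by (simp add: G_def mult_ac)
  moreover have "(LINT z|lborel. box_bump l u z * G z) = 0"
    using zero[of l u] lu(1) by (simp add: G_def mult.left_commute)
  moreover have nn: "box_bump l u z * G z \<ge> 0" for z
  proof (cases "z \<in> box l u")
    case True
    then have "G z > 0" using V(3)[of z] lu(1) box_subset_cbox by blast
    then show ?thesis using box_bump_nonneg[of l u z] by simp
  next
    case False
    then show ?thesis using box_bump_eq_0_iff[of l u z] by simp
  qed
  ultimately have "AE z in lborel. box_bump l u z * G z = 0"
    by (subst (asm) integral_nonneg_eq_0_iff_AE) auto
  then have "AE z in lborel. z \<notin> box l u"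
  proof eventually_elim
    fix z assume "box_bump l u z * G z = 0"
    then show "z \<notin> box l u" using box_bump_eq_0_iff[of l u z] V(3)[of z] lu(1) box_subset_cbox by force
  qed
  then have "box l u \<in> null_sets lborel" by (subst AE_iff_null_sets) auto
  then have "emeasure lborel (box l u) = 0" by auto
  moreover have "(\<Prod>b\<in>Basis. (u - l) \<bullet> b) > 0"
    using lu(3) by (intro prod_pos) (auto simp: inner_diff)
  then have "emeasure lborel (box l u) \<noteq> 0"
    using lu(3) by (subst emeasure_lborel_box) (auto simp: less_imp_le inner_diff_left)
  ultimately show False by simp
qed

text \<open>Fubini and the substitution \<open>x = y + z\<close> turn an average of a correlation
  into a double integral with kernel \<open>\<rho> (x - y)\<close>, whose derivatives can be read in
  either variable. With the indicator of a half-line as \<open>\<rho>\<close>, the same statement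
  later serves for integration by parts in time.\<close>

lemma mollifier_swap:
  fixes f g :: "'a::euclidean_space \<Rightarrow> 'b::{real_inner, second_countable_topology, banach}" and \<rho> :: "'a \<Rightarrow> real"
  assumes f: "integrable lborel f" and g: "integrable lborel g"
    and \<rho>: "\<rho> \<in> borel_measurable borel" "\<And>x. \<bar>\<rho> x\<bar> \<le> C"
  shows "integrable (lborel \<Otimes>\<^sub>M lborel) (\<lambda>(x, y). \<rho> (x - y) * (f x \<bullet> g y))"
    and "(LINT z|lborel. \<rho> z * (LINT y|lborel. f (y + z) \<bullet> g y)) = (LINT y|lborel. LINT x|lborel. \<rho> (x - y) * (f x \<bullet> g y))"
    and "integrable lborel (\<lambda>z. \<rho> z * (LINT y|lborel. f (y + z) \<bullet> g y))"
proof -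
  have [measurable]: "f \<in> borel_measurable borel" "g \<in> borel_measurable borel" "\<rho> \<in> borel_measurable borel"
    using f g \<rho> by auto
  have C: "C \<ge> 0" using \<rho>(2)[of undefined] by linarith
  have bd: "\<bar>a * (x \<bullet> y)\<bar> \<le> C * (norm x * norm y)" if "\<bar>a\<bar> \<le> C" for a and x y :: 'b
    unfolding abs_mult by (intro mult_mono that Cauchy_Schwarz_ineq2 C) auto
  have I: "integrable (lborel \<Otimes>\<^sub>M lborel) (\<lambda>(y, x). \<rho> (x - y) * (f x \<bullet> g y))"
  proof (rule lborel_pair.Fubini_integrable)
    have ix: "integrable lborel (\<lambda>x. \<rho> (x - y) * (f x \<bullet> g y))" for y
    proof (rule Bochner_Integration.integrable_bound)
      show "integrable lborel (\<lambda>x. C * (norm (f x) * norm (g y)))" using f by simp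
    qed (use bd[OF \<rho>(2)] in \<open>auto intro!: AE_I2 order_trans[OF _ abs_ge_self]\<close>)
    then show "AE y in lborel. integrable lborel (\<lambda>x. case (y, x) of (y, x) \<Rightarrow> \<rho> (x - y) * (f x \<bullet> g y))" by simp
    show "integrable lborel (\<lambda>y. LINT x|lborel. norm (case (y, x) of (y, x) \<Rightarrow> \<rho> (x - y) * (f x \<bullet> g y)))"
    proof (rule Bochner_Integration.integrable_bound)
      show "integrable lborel (\<lambda>y. C * ((LINT x|lborel. norm (f x)) * norm (g y)))" using g by simp
      show "AE y in lborel. norm (LINT x|lborel. norm (case (y, x) of (y, x) \<Rightarrow> \<rho> (x - y) * (f x \<bullet> g y)))
          \<le> norm (C * ((LINT x|lborel. norm (f x)) * norm (g y)))"
      proof (rule AE_I2)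
        fix y
        have "(LINT x|lborel. norm (\<rho> (x - y) * (f x \<bullet> g y))) \<le> (LINT x|lborel. C * (norm (f x) * norm (g y)))"
          using f ix[of y] bd[OF \<rho>(2)] by (intro integral_mono integrable_norm) auto
        also have "\<dots> = C * ((LINT x|lborel. norm (f x)) * norm (g y))" using f by simp
        finally show "norm (LINT x|lborel. norm (case (y, x) of (y, x) \<Rightarrow> \<rho> (x - y) * (f x \<bullet> g y)))
          \<le> norm (C * ((LINT x|lborel. norm (f x)) * norm (g y)))" by simp
      qed
    qed simp
  qed measurable
  show "integrable (lborel \<Otimes>\<^sub>M lborel) (\<lambda>(x, y). \<rho> (x - y) * (f x \<bullet> g y))"
    using lborel_pair.integrable_product_swap[OF I] by (simp add: split_beta')
  have ish: "(LINT z|lborel. \<rho> z * (f (y + z) \<bullet> g y)) = (LINT x|lborel. \<rho> (x - y) * (f x \<bullet> g y))"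
     "integrable lborel (\<lambda>z. \<rho> z * (f (y + z) \<bullet> g y)) \<longleftrightarrow> integrable lborel (\<lambda>x. \<rho> (x - y) * (f x \<bullet> g y))"
     "(LINT z|lborel. \<bar>\<rho> z * (f (y + z) \<bullet> g y)\<bar>) = (LINT x|lborel. \<bar>\<rho> (x - y) * (f x \<bullet> g y)\<bar>)" for y
    using lborel_integral_shift[of "\<lambda>x. \<rho> (x - y) * (f x \<bullet> g y)" y]
      lborel_integral_shift[of "\<lambda>x. \<bar>\<rho> (x - y) * (f x \<bullet> g y)\<bar>" y]
    by (simp_all add: add.commute)
  have I2: "integrable (lborel \<Otimes>\<^sub>M lborel) (\<lambda>(y, z). \<rho> z * (f (y + z) \<bullet> g y))"
  proof (rule lborel_pair.Fubini_integrable)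
    show "integrable lborel (\<lambda>y. LINT z|lborel. norm (case (y, z) of (y, z) \<Rightarrow> \<rho> z * (f (y + z) \<bullet> g y)))"
      using lborel_pair.integrable_fst'[OF integrable_norm[OF I]] by (simp add: ish)
    show "AE y in lborel. integrable lborel (\<lambda>z. case (y, z) of (y, z) \<Rightarrow> \<rho> z * (f (y + z) \<bullet> g y))"
      using lborel_pair.AE_integrable_fst'[OF I] by (simp add: ish)
  qed measurable
  have "(LINT z|lborel. \<rho> z * (LINT y|lborel. f (y + z) \<bullet> g y)) = (LINT z|lborel. LINT y|lborel. \<rho> z * (f (y + z) \<bullet> g y))"
    by simp
  also have "\<dots> = (LINT y|lborel. LINT z|lborel. \<rho> z * (f (y + z) \<bullet> g y))"
    by (rule lborel_pair.Fubini_integral[OF I2])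
  finally show "(LINT z|lborel. \<rho> z * (LINT y|lborel. f (y + z) \<bullet> g y)) = (LINT y|lborel. LINT x|lborel. \<rho> (x - y) * (f x \<bullet> g y))"
    by (simp add: ish)
  show "integrable lborel (\<lambda>z. \<rho> z * (LINT y|lborel. f (y + z) \<bullet> g y))"
    using lborel_pair.integrable_snd[OF I2] by simp
qed

lemma correlation_tendsto:
  fixes f g :: "'a::euclidean_space \<Rightarrow> 'b::euclidean_space"
  assumes "square_integrable f" "square_integrable g"
  shows "((\<lambda>z. LINT y|lborel. f (y + z) \<bullet> g y) \<longlongrightarrow> (LINT y|lborel. f y \<bullet> g y)) (at 0)"
proof -
  have "((\<lambda>z. shift z (to_l2 f) \<bullet> to_l2 g) \<longlongrightarrow> to_l2 f \<bullet> to_l2 g) (at 0)"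
    by (intro tendsto_intros shift_tendsto)
  then show ?thesis
    using assms by (simp add: shift_to_l2 inner_to_l2 square_integrable_shift)
qed

lemma box_bump_bounded: obtains C where "\<And>x. \<bar>box_bump l u x\<bar> \<le> C"
  using test_functions_bounded[OF box_bump_test_function[OF subset_UNIV]] by (metis real_norm_def)

lemma square_integrable_imp_integrable_bounded:
  fixes f :: "'a::euclidean_space \<Rightarrow> 'b::{real_inner, second_countable_topology, banach}"
  assumes "square_integrable f" "bounded B" "\<And>x. x \<notin> B \<Longrightarrow> f x = 0"
  shows "integrable lborel f"
proof -
  obtain R where R: "\<And>x. x \<in> B \<Longrightarrow> norm x \<le> R" using assms(2) by (auto simp: bounded_iff)
  note [measurable] = square_integrable_measurable[OF assms(1)]
  show ?thesis
  proof (rule Bochner_Integration.integrable_bound)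
    show "integrable lborel (\<lambda>x. indicator (cball 0 R) x + (norm (f x))\<^sup>2)"
      using assms(1) emeasure_lborel_cball_finite[of "0::'a" R] by (simp add: square_integrable_def)
    show "AE x in lborel. norm (f x) \<le> norm (indicator (cball 0 R) x + (norm (f x))\<^sup>2)"
    proof (rule AE_I2)
      fix x
      have "0 \<le> (norm (f x) - 1/2)\<^sup>2" by simp
      then have "norm (f x) \<le> 1 + (norm (f x))\<^sup>2" by (simp add: power2_eq_square algebra_simps)
      moreover have "f x = 0" if "x \<notin> cball 0 R" using assms(3)[of x] R[of x] that by auto
      ultimately show "norm (f x) \<le> norm (indicator (cball 0 R) x + (norm (f x))\<^sup>2)"
        by (cases "x \<in> cball 0 R") auto
    qed
  qed simp
qed

text \<open>The function is correlated with its own restriction to a box. For small shifts, averages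
  over bumps become integrals of \<open>f\<close> against translated bumps supported in
  \<open>\<Omega>\<close> and vanish; at shift 0 the correlation is the squared norm over the box.
  Countably many boxes exhaust \<open>\<Omega>\<close>.\<close>

lemma AE_eq_0_if_orthogonal_to_test_functions:
  fixes f :: "'a::euclidean_space \<Rightarrow> real"
  assumes f: "square_integrable f" and "open \<Omega>"
    and orth: "\<And>\<phi>. \<phi> \<in> test_functions \<Omega> \<Longrightarrow> (LINT x|lborel. f x * \<phi> x) = 0"
  shows "AE x\<in>\<Omega> in lborel. f x = 0"
proof -
  note [measurable] = square_integrable_measurable[OF f]
  have on_box: "AE x in lborel. x \<in> cbox a b \<longrightarrow> f x = 0" if K: "cbox a b \<subseteq> \<Omega>" for a b
  proof (cases "cbox a b = {}")
    case False
    obtain \<delta> where \<delta>: "\<delta> > 0" "\<And>y z. y \<in> cbox a b \<Longrightarrow> norm z < \<delta> \<Longrightarrow> y + z \<in> \<Omega>"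
    proof -
      obtain d where d: "d > 0" "(\<Union>y\<in>cbox a b. ball y d) \<subseteq> \<Omega>"
        using compact_subset_open_imp_ball_epsilon_subset[OF compact_cbox \<open>open \<Omega>\<close> K] by blast
      have "y + z \<in> \<Omega>" if "y \<in> cbox a b" "norm z < d" for y z
        using that d(2) by (intro subsetD[OF d(2)] UN_I[OF that(1)]) (simp add: dist_norm)
      then show thesis using d(1) by (intro that)
    qed
    obtain R where R: "\<And>y. y \<in> cbox a b \<Longrightarrow> norm y \<le> R" using bounded_cbox[of a b] unfolding bounded_iff by blast
    \<comment> \<open>Large enough that \<open>f1\<close> agrees with \<open>f\<close> on all
      translates of the box by less than \<open>\<delta>\<close>, and bounded so that
      \<open>f1\<close> is integrable, as \<open>mollifier_swap\<close> requires.\<close>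
    define B where "B = cball (0::'a) (R + \<delta>)"
    define f1 where "f1 x = indicator B x *\<^sub>R f x" for x
    define g where "g x = indicator (cbox a b) x *\<^sub>R f x" for x
    have sq: "square_integrable f1" "square_integrable g"
      unfolding f1_def g_def B_def
      by (rule square_integrable_bound[OF f, where C=1]; auto simp: indicator_def)+
    have L1: "integrable lborel f1" "integrable lborel g"
      using sq(1) by (rule square_integrable_imp_integrable_bounded[where B=B], simp add: B_def, simp add: f1_def)
       (use sq(2) in \<open>rule square_integrable_imp_integrable_bounded[where B="cbox a b"], simp_all add: g_def\<close>)
    define F where "F z = (LINT y|lborel. f1 (y + z) \<bullet> g y)" for z
    have "F 0 = 0"
    proof (rule eq_0_if_bump_averages_eq_0)
      show "(F \<longlongrightarrow> F 0) (at 0)" using correlation_tendsto[OF sq] by (simp add: F_def[abs_def])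
      show "open (ball (0::'a) \<delta>)" "0 \<in> closure (ball (0::'a) \<delta>)"
        using \<delta>(1) by (auto intro: closure_subset[THEN subsetD])
      fix l u :: 'a
      obtain C where C: "\<And>x. \<bar>box_bump l u x\<bar> \<le> C" using box_bump_bounded by blast
      have m: "box_bump l u \<in> borel_measurable borel"
        by (intro borel_measurable_continuous_onI smooth_continuous smooth_box_bump)
      show "integrable lborel (\<lambda>z. box_bump l u z * F z)"
        unfolding F_def by (rule mollifier_swap(3)[OF L1 m C])
      assume lu: "cbox l u \<subseteq> ball 0 \<delta>"
      have "(LINT x|lborel. box_bump l u (x - y) * (f1 x \<bullet> g y)) = 0" for y
      proof (cases "y \<in> cbox a b")
        case True
        have z: "norm (x - y) < \<delta>" if "x \<in> cbox (l + y) (u + y)" for x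
        proof -
          have "x - y \<in> cbox l u" using that by (auto simp: mem_box inner_add inner_diff algebra_simps)
          then show ?thesis using lu by auto
        qed
        have "cbox (l + y) (u + y) \<subseteq> \<Omega>"
        proof
          fix x assume "x \<in> cbox (l + y) (u + y)"
          then show "x \<in> \<Omega>" using \<delta>(2)[OF True z, of x] by simp
        qed
        then have "(LINT x|lborel. f x * box_bump (l + y) (u + y) x) = 0"
          by (intro orth box_bump_test_function)
        moreover have "box_bump l u (x - y) * (f1 x \<bullet> g y) = (f x * box_bump (l + y) (u + y) x) * g y" for x
        proof (cases "x \<in> box (l + y) (u + y)")
          case x: True
          have "norm x \<le> norm y + norm (x - y)" using norm_triangle_ineq[of y "x - y"] by simp
          also have "\<dots> \<le> R + \<delta>" using z[of x] R[OF True] x box_subset_cbox by fastforce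
          finally have "f1 x = f x" by (simp add: f1_def B_def)
          then show ?thesis by (simp add: box_bump_shift mult_ac)
        qed (simp add: box_bump_shift box_bump_eq_0_iff)
        ultimately show ?thesis by (simp only: integral_mult_left_zero mult_zero_left)
      qed (simp add: g_def)
      then show "(LINT z|lborel. box_bump l u z * F z) = 0"
        unfolding F_def by (subst mollifier_swap(2)[OF L1 m C]) simp
    qed
    moreover have "f1 y \<bullet> g y = (g y)\<^sup>2" for y
      using R[of y] \<delta>(1) by (auto simp: f1_def g_def B_def indicator_def power2_eq_square)
    ultimately have "(LINT y|lborel. (g y)\<^sup>2) = 0" by (simp add: F_def)
    moreover have "integrable lborel (\<lambda>y. (g y)\<^sup>2)" using sq(2) by (simp add: square_integrable_def)
    ultimately have "AE y in lborel. (g y)\<^sup>2 = 0" by (subst (asm) integral_nonneg_eq_0_iff_AE) auto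
    then show ?thesis by eventually_elim (auto simp: g_def indicator_def)
  qed simp
  obtain \<D> where D: "countable \<D>" "\<D> \<subseteq> Pow \<Omega>" "\<And>X. X \<in> \<D> \<Longrightarrow> \<exists>a b. X = cbox a b" "\<Union>\<D> = \<Omega>"
    using open_countable_Union_open_cbox[OF \<open>open \<Omega>\<close>] by metis
  have "AE x in lborel. \<forall>X\<in>\<D>. x \<in> X \<longrightarrow> f x = 0"
    unfolding AE_ball_countable[OF D(1)]
  proof
    fix X assume "X \<in> \<D>"
    then obtain a b where "X = cbox a b" "cbox a b \<subseteq> \<Omega>" using D(2,3) by blast
    then show "AE x in lborel. x \<in> X \<longrightarrow> f x = 0" using on_box by simp
  qed
  then show ?thesis by eventually_elim (use D(4) in blast)
qed

section \<open>Domains with the two-sided ball condition\<close>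

text \<open>Otherwise the midpoint of the centres would lie in both balls.\<close>

lemma disjoint_balls_dist:
  fixes a b :: "'a::real_normed_vector"
  assumes "ball a r \<inter> ball b r = {}"
  shows "2 * r \<le> norm (a - b)"
proof (rule ccontr)
  assume "\<not> 2 * r \<le> norm (a - b)"
  moreover have "a - midpoint a b = (1/2) *\<^sub>R (a - b)" "b - midpoint a b = (1/2) *\<^sub>R (b - a)"
    by (simp_all add: midpoint_def algebra_simps) (simp_all add: scaleR_2[symmetric] scaleR_left_distrib[symmetric])
  ultimately have "midpoint a b \<in> ball a r \<inter> ball b r"
    by (simp add: dist_norm norm_minus_commute)
  then show False using assms by blast
qed

text \<open>The outward normal is encoded by the two tangent balls, with the inner one centred at
  \<open>z - r *\<^sub>R n\<close>. All geometry then reduces to distances between centres of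
  disjoint balls.\<close>

definition unit_normal :: "R3 set \<Rightarrow> real \<Rightarrow> R3 \<Rightarrow> R3 \<Rightarrow> bool" where
  "unit_normal \<Omega> r z n \<longleftrightarrow> norm n = 1 \<and> ball (z - r *\<^sub>R n) r \<subseteq> \<Omega> \<and> ball (z + r *\<^sub>R n) r \<subseteq> - \<Omega>"

text \<open>Both centres have distance exactly \<open>r\<close> from \<open>z\<close> and, the balls
  being disjoint, distance at least \<open>2 * r\<close> from each other. By the parallelogram law
  \<open>z\<close> is then their midpoint.\<close>

lemma unit_normal_ex:
  assumes \<Omega>: "open \<Omega>" "two_sided_ball_condition \<Omega> r" and r: "r > 0" and z: "z \<in> frontier \<Omega>"
  shows "\<exists>n. unit_normal \<Omega> r z n"
proof -
  obtain x y where x: "ball x r \<subseteq> \<Omega>" "z \<in> closure (ball x r)" and y: "ball y r \<subseteq> - \<Omega>" "z \<in> closure (ball y r)"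
    using \<Omega>(2) z unfolding two_sided_ball_condition_def by blast
  have zf: "z \<notin> \<Omega>" "z \<in> closure \<Omega>" using z \<Omega>(1) by (auto simp: frontier_def interior_open)
  have "norm (x - z) \<le> r" using x(2) r by (simp add: dist_norm)
  moreover have "z \<notin> ball x r" using x(1) zf by blast
  ultimately have nx: "norm (x - z) = r" by (simp add: dist_norm)
  have "ball y r \<inter> closure \<Omega> = {}" using y(1) by (subst open_Int_closure_eq_empty) auto
  then have "z \<notin> ball y r" using zf by blast
  moreover have "norm (y - z) \<le> r" using y(2) r by (simp add: dist_norm)
  ultimately have ny: "norm (y - z) = r" by (simp add: dist_norm)
  have "2 * r \<le> norm (x - y)" by (rule disjoint_balls_dist) (use x y in blast)
  then have "(2 * r)\<^sup>2 \<le> (norm (x - y))\<^sup>2" using r by (intro power_mono) auto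
  then have "4 * r\<^sup>2 \<le> (norm (x - y))\<^sup>2" by (simp add: power_mult_distrib)
  moreover have "(norm (a - b))\<^sup>2 + (norm (a + b))\<^sup>2 = 2 * (norm a)\<^sup>2 + 2 * (norm b)\<^sup>2" for a b :: R3
    by (simp add: power2_norm_eq_inner inner_diff inner_add inner_commute)
  from this[of "x - z" "y - z"]
  have "(norm (x - y))\<^sup>2 + (norm ((x - z) + (y - z)))\<^sup>2 = 4 * r\<^sup>2" by (simp only: nx ny) simp
  ultimately have "(norm ((x - z) + (y - z)))\<^sup>2 \<le> 0" by linarith
  then have "(x - z) + (y - z) = 0" using zero_less_norm_iff by fastforce
  then have yz: "y = z + (z - x)" by (simp add: algebra_simps)
  define n where "n = (1 / r) *\<^sub>R (z - x)"
  have "r *\<^sub>R n = z - x" "norm n = 1"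
    using r nx by (simp_all add: n_def norm_minus_commute)
  then have "unit_normal \<Omega> r z n" using x y by (simp add: unit_normal_def yz)
  then show ?thesis ..
qed

text \<open>The inner ball at each of the two points is disjoint from the outer ball at the other,
  so two pairs of centres are at least \<open>2 * r\<close> apart. Adding the squared inequalities
  cancels the mixed terms and leaves the Lipschitz bound on the normal, the quantitative form of the
  C^{1,1} regularity.\<close>

lemma unit_normal_lipschitz:
  assumes "unit_normal \<Omega> r z n" "unit_normal \<Omega> r w m" "r > 0"
  shows "r * norm (n - m) \<le> norm (z - w)"
proof -
  have "2 * r \<le> norm ((z - r *\<^sub>R n) - (w + r *\<^sub>R m))" "2 * r \<le> norm ((z + r *\<^sub>R n) - (w - r *\<^sub>R m))"
    using assms(1,2) unfolding unit_normal_def by (intro disjoint_balls_dist; blast)+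
  then have "(2 * r)\<^sup>2 \<le> (norm ((z - r *\<^sub>R n) - (w + r *\<^sub>R m)))\<^sup>2" "(2 * r)\<^sup>2 \<le> (norm ((z + r *\<^sub>R n) - (w - r *\<^sub>R m)))\<^sup>2"
    using assms(3) by (intro power_mono; simp)+
  moreover have "(norm ((z - r *\<^sub>R n) - (w + r *\<^sub>R m)))\<^sup>2 + (norm ((z + r *\<^sub>R n) - (w - r *\<^sub>R m)))\<^sup>2
      = 2 * (norm (z - w))\<^sup>2 + 4 * r\<^sup>2 * (norm n)\<^sup>2 + 4 * r\<^sup>2 * (norm m)\<^sup>2 - 2 * (r * norm (n - m))\<^sup>2"
    unfolding power_mult_distrib power2_norm_eq_inner
    by (simp add: inner_diff inner_add inner_commute power2_eq_square algebra_simps)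
  moreover have "norm n = 1" "norm m = 1" using assms(1,2) by (auto simp: unit_normal_def)
  ultimately have "(r * norm (n - m))\<^sup>2 \<le> (norm (z - w))\<^sup>2" by (simp add: power_mult_distrib)
  then show ?thesis by (rule power2_le_imp_le) simp
qed

text \<open>Boundary points within \<open>r / 2\<close> of \<open>z\<close> have normals within 1/2
  of \<open>n\<close>, so the cone condition with 3/4 leaves a slope of at least 1/4 against each of
  them. A step \<open>v\<close> from a boundary point then enters the inner ball there. If a segment
  starting inside met the boundary, its starting point would lie in the outer ball at the
  crossing.\<close>

lemma inner_cone_direction:
  assumes \<Omega>: "open \<Omega>" "two_sided_ball_condition \<Omega> r" and r: "r > 0" and n: "unit_normal \<Omega> r z n"
    and y: "y \<in> closure \<Omega>" "norm (y - z) \<le> r / 4"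
    and v: "norm v < r / 4" "v \<bullet> n < - (3/4) * norm v"
  shows "y + v \<in> \<Omega>"
proof (rule ccontr)
  assume not: "y + v \<notin> \<Omega>"
  have v0: "norm v > 0" using v(2) by auto
  have slope: "v \<bullet> m \<le> - (1/4) * norm v" if "unit_normal \<Omega> r w m" "norm (w - z) \<le> r / 2" for w m
  proof -
    have "r * norm (m - n) \<le> r / 2" using unit_normal_lipschitz[OF that(1) n r] that(2) by simp
    then have "norm (m - n) \<le> 1/2" using r by simp
    have "v \<bullet> m = v \<bullet> n + v \<bullet> (m - n)" by (simp add: inner_diff)
    also have "v \<bullet> (m - n) \<le> norm v * norm (m - n)" by (rule norm_cauchy_schwarz)
    also have "\<dots> \<le> norm v * (1/2)" using \<open>norm (m - n) \<le> 1/2\<close> by (intro mult_left_mono) auto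
    finally show ?thesis using v(2) by simp
  qed
  \<comment> \<open>This vector decides membership in the inner ball (with \<open>t = 1\<close>) and
    in the outer ball (for a crossing at parameter \<open>t\<close>). The bound
    \<open>norm v < r / 4\<close> lets the negative linear term dominate the quadratic one.\<close>
  have mem: "norm (t *\<^sub>R v + r *\<^sub>R m) < r"
    if "v \<bullet> m \<le> - (1/4) * norm v" "norm m = 1" "0 < t" "t \<le> 1" for t m
  proof -
    have "t\<^sup>2 * (norm v)\<^sup>2 \<le> t * (norm v * norm v)"
      using that(3,4) by (simp add: power2_eq_square mult_left_le_one_le mult.assoc)
    also have "\<dots> < t * (norm v * (r / 4))" using v0 v(1) that(3) by (intro mult_strict_left_mono) auto
    also have "\<dots> \<le> t * (- (v \<bullet> m) * r)"
    proof (intro mult_left_mono)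
      have "norm v * (1/4) * r \<le> - (v \<bullet> m) * r" using that(1) r by (intro mult_right_mono) auto
      then show "norm v * (r / 4) \<le> - (v \<bullet> m) * r" by simp
    qed (use that in simp)
    finally have "t\<^sup>2 * (norm v)\<^sup>2 + t * r * (v \<bullet> m) < 0" by (simp add: algebra_simps)
    moreover have "t * r * (v \<bullet> m) \<le> 0"
    proof (rule mult_nonneg_nonpos)
      show "v \<bullet> m \<le> 0" using that(1) v0 by linarith
    qed (use that(3) r in simp)
    moreover have "(norm (t *\<^sub>R v + r *\<^sub>R m))\<^sup>2 = t\<^sup>2 * (norm v)\<^sup>2 + 2 * (t * r * (v \<bullet> m)) + r\<^sup>2 * (norm m)\<^sup>2"
      unfolding power2_norm_eq_inner by (simp add: inner_add inner_commute power2_eq_square algebra_simps)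
    ultimately have "(norm (t *\<^sub>R v + r *\<^sub>R m))\<^sup>2 < r\<^sup>2" using that(2) by simp
    then show ?thesis by (rule power2_less_imp_less) (use r in simp)
  qed
  show False
  proof (cases "y \<in> \<Omega>")
    case False
    then have "y \<in> frontier \<Omega>" using y(1) \<Omega>(1) by (simp add: frontier_def interior_open)
    then obtain m where m: "unit_normal \<Omega> r y m" using unit_normal_ex[OF \<Omega> r] by blast
    have "norm (1 *\<^sub>R v + r *\<^sub>R m) < r"
      using y(2) r m by (intro mem slope[OF m]) (auto simp: unit_normal_def)
    moreover have "y - r *\<^sub>R m - (y + v) = - (1 *\<^sub>R v + r *\<^sub>R m)" by simp
    ultimately have "y + v \<in> ball (y - r *\<^sub>R m) r"
      by (simp only: mem_ball dist_norm norm_minus_cancel)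
    then show False using m not by (auto simp: unit_normal_def)
  next
    case True
    have "closed_segment y (y + v) \<inter> frontier \<Omega> \<noteq> {}"
      by (rule connected_Int_frontier) (use True not in auto)
    then obtain w where w: "w \<in> closed_segment y (y + v)" "w \<in> frontier \<Omega>" by blast
    then obtain t where t: "0 \<le> t" "t \<le> 1" "w = y + t *\<^sub>R v"
      by (auto simp: in_segment algebra_simps)
    have "w \<noteq> y" using w(2) True \<Omega>(1) by (auto simp: frontier_def interior_open)
    then have t0: "0 < t" using t by (cases "t = 0") auto
    obtain m where m: "unit_normal \<Omega> r w m" using unit_normal_ex[OF \<Omega> r w(2)] by blast
    have "norm (t *\<^sub>R v) \<le> norm v" using t by (simp add: mult_left_le_one_le)
    then have "norm (w - z) \<le> r / 2"
      using norm_triangle_ineq[of "y - z" "t *\<^sub>R v"] y(2) v(1) t(3) by (simp add: algebra_simps)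
    then have "norm (t *\<^sub>R v + r *\<^sub>R m) < r"
      using m t0 t(2) by (intro mem slope[OF m]) (auto simp: unit_normal_def)
    then have "y \<in> ball (w + r *\<^sub>R m) r" by (simp add: dist_norm t(3) algebra_simps)
    then show False using m True by (auto simp: unit_normal_def)
  qed
qed

text \<open>Near every point of the closure there is a fixed open set of arbitrarily small translations
  into \<open>\<Omega>\<close>: a cone around the inner normal, or a ball away from the boundary.\<close>

lemma inward_translations:
  assumes \<Omega>: "open \<Omega>" "two_sided_ball_condition \<Omega> r" and r: "r > 0"
    and K: "K \<subseteq> closure \<Omega>" "\<And>x y. x \<in> K \<Longrightarrow> y \<in> K \<Longrightarrow> dist x y < r / 16"
  shows "\<exists>U. open U \<and> 0 \<in> closure U \<and> (\<forall>y\<in>K. \<forall>v\<in>U. y + v \<in> \<Omega>)"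
proof (cases "\<exists>y\<in>K. \<exists>z\<in>frontier \<Omega>. dist y z \<le> r / 8")
  case True
  then obtain y0 z where z: "y0 \<in> K" "z \<in> frontier \<Omega>" "dist y0 z \<le> r / 8" by blast
  obtain n where n: "unit_normal \<Omega> r z n" using unit_normal_ex[OF \<Omega> r z(2)] by blast
  then have n1: "norm n = 1" by (simp add: unit_normal_def)
  define U where "U = {v. norm v < r / 4} \<inter> {v. v \<bullet> n < - (3/4) * norm v}"
  have "open U" unfolding U_def by (intro open_Int open_Collect_less continuous_intros)
  moreover have "0 \<in> closure U"
    unfolding closure_approachable
  proof (intro allI impI)
    fix e :: real assume "e > 0"
    define t where "t = min (e / 2) (r / 8)"
    have "t > 0" "t < e" "t < r / 4" using \<open>e > 0\<close> r by (auto simp: t_def min_def)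
    then have "- t *\<^sub>R n \<in> U" "dist (- t *\<^sub>R n) 0 < e"
      using n1 dot_square_norm[of n] by (auto simp: U_def dist_norm)
    then show "\<exists>y\<in>U. dist y 0 < e" by blast
  qed
  moreover have "y + v \<in> \<Omega>" if "y \<in> K" "v \<in> U" for y v
  proof (rule inner_cone_direction[OF \<Omega> r n])
    have "dist y z \<le> r / 16 + r / 8" using K(2)[OF that(1) z(1)] z(3) dist_triangle[of y z y0] by simp
    then show "norm (y - z) \<le> r / 4" using r by (simp add: dist_norm)
  qed (use that K(1) in \<open>auto simp: U_def\<close>)
  ultimately show ?thesis by blast
next
  case False
  \<comment> \<open>Here \<open>K\<close> stays farther than \<open>r / 8\<close> from the boundary,
    so a segment shorter than \<open>r / 16\<close> cannot reach it.\<close>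
  have "y + v \<in> \<Omega>" if y: "y \<in> K" and v: "v \<in> ball 0 (r / 16)" for y v
  proof (rule ccontr)
    assume "y + v \<notin> \<Omega>"
    moreover have "y \<in> \<Omega>" using False y K(1) r \<Omega>(1) by (force simp: frontier_def interior_open)
    ultimately have "closed_segment y (y + v) \<inter> frontier \<Omega> \<noteq> {}"
      by (intro connected_Int_frontier) auto
    then obtain w where w: "w \<in> closed_segment y (y + v)" "w \<in> frontier \<Omega>" by blast
    then have "dist y w \<le> norm v" using segment_bound(1)[OF w(1)] by (simp add: dist_norm norm_minus_commute)
    then show False using False y w(2) v r by force
  qed
  then show ?thesis using r by (intro exI[of _ "ball 0 (r / 16)"]) auto
qed

section \<open>Functions on a domain as elements of the Hilbert space\<close>

lemma measurable_AE_cong_complete: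
  fixes f g :: "'a \<Rightarrow> 'b::topological_space"
  assumes "complete_measure M" "f \<in> borel_measurable M" "AE x in M. f x = g x"
  shows "g \<in> borel_measurable M"
proof (rule borel_measurableI)
  fix S :: "'b set" assume "open S"
  then have "f -` S \<inter> space M \<in> sets M" using assms(2) by (intro measurable_sets) auto
  moreover have "AE x in M. x \<in> f -` S \<inter> space M \<longleftrightarrow> x \<in> g -` S \<inter> space M"
    using assms(3) by eventually_elim simp
  ultimately show "g -` S \<inter> space M \<in> sets M"
    using complete_measure.in_sets_AE[OF assms(1)] by blast
qed

lemma complete_measure_lebesgue: "complete_measure lebesgue"
  by (rule completion.complete_measure_axioms)

text \<open>The fields of the problem are Lebesgue measurable, whereas elements of \<open>l2\<close>
  are classes of Borel functions. Simple functions have Borel versions, and the limit inherits one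
  off a countable union of null sets.\<close>

lemma ex_borel_version:
  fixes f :: "'a::euclidean_space \<Rightarrow> 'b::{second_countable_topology, banach}"
  assumes "f \<in> borel_measurable lebesgue"
  shows "\<exists>g. g \<in> borel_measurable borel \<and> (AE x in lborel. g x = f x)"
proof -
  obtain s where s: "\<And>i. simple_function lebesgue (s i)" "\<And>x. (\<lambda>i. s i x) \<longlonglongrightarrow> f x"
    using borel_measurable_implies_sequence_metric[OF assms, of 0] by auto
  have "\<exists>s'. simple_function lborel s' \<and> (AE x in lborel. s i x = s' x)" for i
    by (rule completion_ex_simple_function[OF s(1)])
  then obtain s' where s': "\<And>i. simple_function lborel (s' i)" "\<And>i. AE x in lborel. s i x = s' i x" by metis
  have "AE x in lborel. \<forall>i. s i x = s' i x" using s'(2) by (simp add: AE_all_countable)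
  then have "AE x in lborel. lim (\<lambda>i. s' i x) = f x"
  proof eventually_elim
    fix x assume "\<forall>i. s i x = s' i x"
    then have "(\<lambda>i. s' i x) \<longlonglongrightarrow> f x" using s(2)[of x] by simp
    then show "lim (\<lambda>i. s' i x) = f x" by (rule limI)
  qed
  moreover have "s' i \<in> borel_measurable lborel" for i
    using s'(1) by (rule borel_measurable_simple_function)
  then have "(\<lambda>x. lim (\<lambda>i. s' i x)) \<in> borel_measurable borel"
    by (intro borel_measurable_lim_metric) simp
  ultimately show ?thesis by blast
qed

text \<open>The class of the extension by zero. Which Borel version is chosen is immaterial, since
  versions agree almost everywhere; the value is meaningful for square integrable fields on
  \<open>\<Omega>\<close>.\<close>

definition emb :: "'a set \<Rightarrow> ('a::euclidean_space \<Rightarrow> 'b::{real_inner, second_countable_topology, banach}) \<Rightarrow> ('a, 'b) l2" where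
  "emb \<Omega> f = to_l2 (SOME g. g \<in> borel_measurable borel \<and> (AE x in lborel. g x = indicator \<Omega> x *\<^sub>R f x))"

context
  fixes \<Omega> :: "'a::euclidean_space set"
  assumes \<Omega>: "\<Omega> \<in> sets borel"
begin

lemma \<Omega>_lebesgue [simp]: "\<Omega> \<in> sets lebesgue" "\<Omega> \<inter> space lebesgue \<in> sets lebesgue"
  using \<Omega> by auto

lemma AE_lebesgue_on_iff: "(AE x in lebesgue_on \<Omega>. P x) \<longleftrightarrow> (AE x\<in>\<Omega> in lborel. P x)"
  by (subst AE_restrict_space_iff) (simp_all add: AE_completion_iff)

text \<open>Here \<open>k\<close> is a Borel version of the zero extension of \<open>h\<close>.
  Through this lemma integrals over the domain, and also over time intervals, become integrals with
  respect to \<open>lborel\<close>.\<close>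

lemma integral_lebesgue_on:
  fixes h k :: "'a \<Rightarrow> 'b::{banach, second_countable_topology}"
  assumes "k \<in> borel_measurable borel" "AE x in lborel. k x = indicator \<Omega> x *\<^sub>R h x"
  shows "(LINT x|lebesgue_on \<Omega>. h x) = (LINT x|lborel. k x)"
    and "integrable (lebesgue_on \<Omega>) h \<longleftrightarrow> integrable lborel k"
    and "h \<in> borel_measurable (lebesgue_on \<Omega>)"
proof -
  have ae: "AE x in lebesgue. k x = indicator \<Omega> x *\<^sub>R h x" using assms(2) by (simp add: AE_completion_iff)
  have k: "k \<in> borel_measurable lebesgue" using assms(1) by (simp add: measurable_completion)
  have m: "(\<lambda>x. indicator \<Omega> x *\<^sub>R h x) \<in> borel_measurable lebesgue"
    by (rule measurable_AE_cong_complete[OF complete_measure_lebesgue k ae])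
  then show "h \<in> borel_measurable (lebesgue_on \<Omega>)" by (simp add: borel_measurable_restrict_space_iff)
  have "(LINT x|lebesgue_on \<Omega>. h x) = (LINT x|lebesgue. indicator \<Omega> x *\<^sub>R h x)"
    by (rule integral_restrict_space) simp
  also have "\<dots> = (LINT x|lebesgue. k x)"
    by (rule integral_cong_AE[OF m k]) (use ae in auto)
  also have "\<dots> = (LINT x|lborel. k x)" using assms(1) by (intro integral_completion) simp
  finally show "(LINT x|lebesgue_on \<Omega>. h x) = (LINT x|lborel. k x)" .
  have "integrable (lebesgue_on \<Omega>) h \<longleftrightarrow> integrable lebesgue (\<lambda>x. indicator \<Omega> x *\<^sub>R h x)"
    by (rule integrable_restrict_space) simp
  also have "\<dots> \<longleftrightarrow> integrable lebesgue k"
    by (rule integrable_cong_AE[OF m k]) (use ae in auto)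
  also have "\<dots> \<longleftrightarrow> integrable lborel k" using assms(1) by (intro integrable_completion) simp
  finally show "integrable (lebesgue_on \<Omega>) h \<longleftrightarrow> integrable lborel k" .
qed

lemma square_integrable_imp_lebesgue_on:
  fixes k :: "'a \<Rightarrow> 'b::{real_inner, second_countable_topology, banach}"
  assumes "square_integrable k" "AE x in lborel. k x = indicator \<Omega> x *\<^sub>R f x"
  shows "f \<in> borel_measurable (lebesgue_on \<Omega>)" "integrable (lebesgue_on \<Omega>) (\<lambda>x. (norm (f x))\<^sup>2)"
    "(LINT x|lebesgue_on \<Omega>. (norm (f x))\<^sup>2) = (LINT x|lborel. (norm (k x))\<^sup>2)"
proof -
  have k: "k \<in> borel_measurable borel" "integrable lborel (\<lambda>x. (norm (k x))\<^sup>2)"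
    using assms(1) by (auto simp: square_integrable_def)
  show "f \<in> borel_measurable (lebesgue_on \<Omega>)" by (rule integral_lebesgue_on(3)[OF k(1) assms(2)])
  have "(\<lambda>x. (norm (k x))\<^sup>2) \<in> borel_measurable borel" using k(1) by measurable
  moreover have "AE x in lborel. (norm (k x))\<^sup>2 = indicator \<Omega> x *\<^sub>R (norm (f x))\<^sup>2"
    using assms(2) by eventually_elim (auto simp: indicator_def)
  ultimately show "integrable (lebesgue_on \<Omega>) (\<lambda>x. (norm (f x))\<^sup>2)"
    "(LINT x|lebesgue_on \<Omega>. (norm (f x))\<^sup>2) = (LINT x|lborel. (norm (k x))\<^sup>2)"
    using k(2) integral_lebesgue_on(1,2)[of "\<lambda>x. (norm (k x))\<^sup>2" "\<lambda>x. (norm (f x))\<^sup>2"] by simp_all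
qed

lemma ex_square_integrable_version:
  fixes f :: "'a \<Rightarrow> 'b::{real_inner, second_countable_topology, banach}"
  assumes "f \<in> borel_measurable (lebesgue_on \<Omega>)" "integrable (lebesgue_on \<Omega>) (\<lambda>x. (norm (f x))\<^sup>2)"
  shows "AE x in lborel. rep_l2 (emb \<Omega> f) x = indicator \<Omega> x *\<^sub>R f x"
proof -
  have "(\<lambda>x. indicator \<Omega> x *\<^sub>R f x) \<in> borel_measurable lebesgue"
    using assms(1) by (simp add: borel_measurable_restrict_space_iff)
  from someI_ex[OF ex_borel_version[OF this]]
  obtain g where g: "emb \<Omega> f = to_l2 g" "g \<in> borel_measurable borel" "AE x in lborel. g x = indicator \<Omega> x *\<^sub>R f x"
    unfolding emb_def by blast
  have "AE x in lborel. (norm (g x))\<^sup>2 = indicator \<Omega> x *\<^sub>R (norm (f x))\<^sup>2"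
    using g(3) by eventually_elim (auto simp: indicator_def)
  then have "square_integrable g"
    unfolding square_integrable_def using g(2) assms(2) integral_lebesgue_on(2)[of "\<lambda>x. (norm (g x))\<^sup>2" "\<lambda>x. (norm (f x))\<^sup>2"]
    by simp
  from rep_to_l2[OF this] g(3) show ?thesis unfolding g(1) by eventually_elim simp
qed

end

section \<open>The curl and its two weak realizations\<close>

lemma inner_cross3_skew: "cross3 e f \<bullet> g = - (f \<bullet> cross3 e g)"
  by (simp add: cross3_def inner_vec_def sum_3 vector_def algebra_simps)

lemma bounded_linear_cross3: "bounded_linear (cross3 e)"
  by (intro linear_conv_bounded_linear[THEN iffD1] linearI) (auto simp: cross3_def vec_eq_iff forall_3 algebra_simps)

lemma pd_eq: "pd i f x = dderiv f (axis i 1) x"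
  by (simp add: pd_def)

lemma pd_component: "smooth f \<Longrightarrow> pd i (\<lambda>x. f x $ j) x = pd i f x $ j"
  unfolding pd_eq by (rule dderiv_linear[OF bounded_linear_vec_nth])

text \<open>In this form product rule and sign rules for the curl reduce to linearity and skewness
  of the cross product.\<close>

lemma curl_eq_sum: "curl f x = (\<Sum>i\<in>UNIV. cross3 (axis i 1) (pd i f x))"
  by (simp add: curl_def cross3_def vec_eq_iff forall_3 sum_3 axis_def)

lemma smooth_pd: "smooth f \<Longrightarrow> smooth (pd i f)"
  unfolding pd_def[abs_def] by (rule smooth_derivative)

lemma test_functions_pd: "f \<in> test_functions S \<Longrightarrow> pd i f \<in> test_functions S"
  unfolding pd_def[abs_def] by (rule test_functions_dderiv)

lemma smooth_sum: "finite A \<Longrightarrow> (\<And>a. a \<in> A \<Longrightarrow> smooth (f a)) \<Longrightarrow> smooth (\<lambda>x. \<Sum>a\<in>A. f a x)"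
  by (induction A rule: finite_induct) (auto intro!: smooth_add)

lemma smooth_curl: "smooth f \<Longrightarrow> smooth (curl f)"
  unfolding curl_eq_sum[abs_def] by (intro smooth_sum smooth_linear_compose[OF bounded_linear_cross3] smooth_pd) simp

lemma test_functions_curl:
  assumes "f \<in> test_functions S" shows "curl f \<in> test_functions S"
proof (rule test_functions_mapI[OF assms smooth_curl[OF test_functions_smooth[OF assms]]])
  fix x assume "x \<notin> closure {x. f x \<noteq> 0}"
  then have "pd i f x = 0" for i unfolding pd_def by (rule dderiv_zero_outside)
  then show "curl f x = 0" by (simp add: curl_eq_sum)
qed

text \<open>The cross product of the gradient of \<open>\<zeta>\<close> at \<open>x\<close> with
  \<open>v\<close>: the zeroth-order term that arises when a curl falls on a product.\<close>

definition gradcross :: "(R3 \<Rightarrow> real) \<Rightarrow> R3 \<Rightarrow> R3 \<Rightarrow> R3" where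
  "gradcross \<zeta> x v = (\<Sum>i\<in>UNIV. pd i \<zeta> x *\<^sub>R cross3 (axis i 1) v)"

lemma gradcross_skew: "gradcross \<zeta> x v \<bullet> w = - (v \<bullet> gradcross \<zeta> x w)"
  by (simp add: gradcross_def inner_sum_left inner_sum_right inner_cross3_skew sum_negf)

lemma curl_scaleR:
  assumes "smooth \<zeta>" "smooth f"
  shows "curl (\<lambda>x. \<zeta> x *\<^sub>R f x) x = \<zeta> x *\<^sub>R curl f x + gradcross \<zeta> x (f x)"
proof -
  have "pd i (\<lambda>x. \<zeta> x *\<^sub>R f x) x = \<zeta> x *\<^sub>R pd i f x + pd i \<zeta> x *\<^sub>R f x" for i
    unfolding pd_eq by (rule dderiv_scaleR[OF assms])
  then show ?thesis
    by (simp add: curl_eq_sum gradcross_def linear_add[OF bounded_linear.linear[OF bounded_linear_cross3]]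
        linear_scale[OF bounded_linear.linear[OF bounded_linear_cross3]] sum.distrib scaleR_sum_right)
qed

lemma curl_scaleR_const: "smooth \<zeta> \<Longrightarrow> curl (\<lambda>x. \<zeta> x *\<^sub>R v) x = gradcross \<zeta> x v"
proof -
  have "pd i (\<lambda>x. v) x = 0" for i by (simp add: pd_def frechet_derivative_const)
  then have "curl (\<lambda>x. v) x = 0" by (simp add: curl_eq_sum linear_0[OF bounded_linear.linear[OF bounded_linear_cross3]])
  then show "smooth \<zeta> \<Longrightarrow> curl (\<lambda>x. \<zeta> x *\<^sub>R v) x = gradcross \<zeta> x v"
    using curl_scaleR[of \<zeta> "\<lambda>x. v" x] by simp
qed

lemma integral_curl_symmetric:
  assumes "\<Phi> \<in> test_functions S" "smooth f"
  shows "(LINT x|lborel. curl f x \<bullet> \<Phi> x) = (LINT x|lborel. f x \<bullet> curl \<Phi> x)"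
proof -
  note s\<Phi> = test_functions_smooth[OF assms(1)]
  have c\<Phi>: "(\<lambda>x. \<Phi> x $ j) \<in> test_functions S" for j
    using test_functions_linear[OF bounded_linear_vec_nth assms(1)] .
  have cf: "smooth (\<lambda>x. f x $ j)" for j
    using smooth_linear_compose[OF bounded_linear_vec_nth assms(2)] .
  have int: "integrable lborel (\<lambda>x. u x * \<phi> x)" if "smooth u" "\<phi> \<in> test_functions S" for u \<phi> :: "R3 \<Rightarrow> real"
    using test_functions_square_integrable(2)[OF test_functions_scaleR_left[OF that]] by simp
  have ibp: "(LINT x|lborel. pd i f x $ j * \<Phi> x $ k) = - (LINT x|lborel. f x $ j * pd i \<Phi> x $ k)" for i j k
    using integration_by_parts_test_function[OF cf[of j] c\<Phi>[of k], of "axis i 1"]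
    unfolding pd_eq[symmetric] pd_component[OF assms(2)] pd_component[OF s\<Phi>] by simp
  have i1: "integrable lborel (\<lambda>x. pd i f x $ j * \<Phi> x $ k)" for i j k
    by (intro int c\<Phi> smooth_linear_compose[OF bounded_linear_vec_nth] smooth_pd assms(2))
  have i2: "integrable lborel (\<lambda>x. f x $ j * pd i \<Phi> x $ k)" for i j k
    by (intro int cf test_functions_linear[OF bounded_linear_vec_nth] test_functions_pd assms(1))
  have "(LINT x|lborel. curl f x \<bullet> \<Phi> x) =
     (LINT x|lborel. (pd 2 f x $ 3 * \<Phi> x $ 1 - pd 3 f x $ 2 * \<Phi> x $ 1) + (pd 3 f x $ 1 * \<Phi> x $ 2 - pd 1 f x $ 3 * \<Phi> x $ 2)
       + (pd 1 f x $ 2 * \<Phi> x $ 3 - pd 2 f x $ 1 * \<Phi> x $ 3))"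
    by (simp add: curl_def inner_vec_def sum_3 algebra_simps)
  also have "\<dots> = (LINT x|lborel. (f x $ 1 * pd 2 \<Phi> x $ 3 - f x $ 1 * pd 3 \<Phi> x $ 2) + (f x $ 2 * pd 3 \<Phi> x $ 1 - f x $ 2 * pd 1 \<Phi> x $ 3)
       + (f x $ 3 * pd 1 \<Phi> x $ 2 - f x $ 3 * pd 2 \<Phi> x $ 1))"
    using i1 i2 by (simp add: ibp)
  also have "\<dots> = (LINT x|lborel. f x \<bullet> curl \<Phi> x)"
    by (simp add: curl_def inner_vec_def sum_3 algebra_simps)
  finally show ?thesis .
qed

text \<open>Symmetry of second derivatives. Gradients of test functions are thus curl-free test
  fields, which is the source of the divergence constraint on \<open>H\<close>.\<close>

lemma curl_grad_eq_0:
  fixes \<phi> :: "R3 \<Rightarrow> real"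
  assumes "smooth \<phi>"
  shows "curl (\<lambda>x. \<chi> i. pd i \<phi> x) x = 0" "smooth (\<lambda>x. \<chi> i. pd i \<phi> x)"
proof -
  have eq: "(\<lambda>x. \<chi> i. pd i \<phi> x) = (\<lambda>x. \<Sum>i\<in>UNIV. pd i \<phi> x *\<^sub>R axis i 1)"
    by (auto simp: fun_eq_iff vec_eq_iff axis_def sum.delta' if_distrib cong: if_cong)
  show s: "smooth (\<lambda>x. \<chi> i. pd i \<phi> x)"
    unfolding eq by (intro smooth_sum smooth_scaleR smooth_pd assms smooth_const) simp
  have "pd i (\<lambda>x. \<chi> i. pd i \<phi> x) x $ j = pd i (pd j \<phi>) x" for i j
    using pd_component[OF s, of i j x] by simp
  moreover have "pd i (pd j \<phi>) x = pd j (pd i \<phi>) x" for i j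
    unfolding pd_def[abs_def] by (rule dderiv_commute[OF assms])
  ultimately show "curl (\<lambda>x. \<chi> i. pd i \<phi> x) x = 0"
    by (simp add: curl_def vec_eq_iff forall_3)
qed

subsection \<open>Density\<close>

text \<open>If \<open>c\<close> is the weak curl of \<open>f\<close> on the whole space and \<open>d\<close> that of \<open>g\<close> on \<open>\<Omega>\<close>, and small
  translations by \<open>U\<close> move the support of \<open>f\<close> and \<open>c\<close> into \<open>\<Omega>\<close>, then the averages of the correlation
  of \<open>(f, c)\<close> with \<open>(d, - g)\<close> over bumps in \<open>U\<close> vanish: the derivatives can be moved
  to the mollifier in both arguments. No smooth approximation of \<open>f\<close> or \<open>g\<close> is needed.\<close>

lemma curl_duality_local:
  fixes f c g d :: "R3 \<Rightarrow> R3"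
  assumes sq: "square_integrable f" "square_integrable c" "square_integrable g" "square_integrable d"
    and L1: "integrable lborel f" "integrable lborel c" "integrable lborel g" "integrable lborel d"
    and fc: "\<And>\<Phi>. \<Phi> \<in> test_functions UNIV \<Longrightarrow> (LINT x|lborel. c x \<bullet> \<Phi> x) = (LINT x|lborel. f x \<bullet> curl \<Phi> x)"
    and gd: "\<And>\<Phi>. \<Phi> \<in> test_functions \<Omega> \<Longrightarrow> (LINT x|lborel. d x \<bullet> \<Phi> x) = (LINT x|lborel. g x \<bullet> curl \<Phi> x)"
    and U: "open U" "0 \<in> closure U" "\<And>y v. f y \<noteq> 0 \<Longrightarrow> v \<in> U \<Longrightarrow> y + v \<in> \<Omega>"
  shows "(LINT x|lborel. d x \<bullet> f x) = (LINT x|lborel. g x \<bullet> c x)"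
proof -
  define F where "F z = (LINT y|lborel. d (y + z) \<bullet> f y) - (LINT y|lborel. g (y + z) \<bullet> c y)" for z
  have "F 0 = 0"
  proof (rule eq_0_if_bump_averages_eq_0[OF _ U(1,2)])
    have "((\<lambda>z. (LINT y|lborel. d (y + z) \<bullet> f y) - (LINT y|lborel. g (y + z) \<bullet> c y)) \<longlongrightarrow>
       (LINT y|lborel. d y \<bullet> f y) - (LINT y|lborel. g y \<bullet> c y)) (at 0)"
      by (intro tendsto_diff correlation_tendsto sq)
    then show "(F \<longlongrightarrow> F 0) (at 0)" unfolding F_def by simp
    fix l u :: R3
    let ?\<rho> = "box_bump l u"
    note \<rho>s = smooth_box_bump[of l u]
    obtain C where C: "\<And>x. \<bar>?\<rho> x\<bar> \<le> C" using box_bump_bounded by blast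
    have m: "?\<rho> \<in> borel_measurable borel"
      by (intro borel_measurable_continuous_onI smooth_continuous \<rho>s)
    have i1: "integrable lborel (\<lambda>z. ?\<rho> z * (LINT y|lborel. d (y + z) \<bullet> f y))"
      and i2: "integrable lborel (\<lambda>z. ?\<rho> z * (LINT y|lborel. g (y + z) \<bullet> c y))"
      by (rule mollifier_swap(3)[OF _ _ m C]; rule L1)+
    then show "integrable lborel (\<lambda>z. ?\<rho> z * F z)"
      unfolding F_def right_diff_distrib by (rule Bochner_Integration.integrable_diff)
    assume lu: "cbox l u \<subseteq> U"
    \<comment> \<open>The common double integrand: both correlations are brought to the integral of
      \<open>K\<close>, each from its own variable.\<close>
    define K where "K x y = (\<Sum>i\<in>UNIV. pd i ?\<rho> (x - y) * (g x \<bullet> cross3 (axis i 1) (f y)))" for x y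
    have K: "K x y = g x \<bullet> gradcross ?\<rho> (x - y) (f y)" for x y
      by (simp add: K_def gradcross_def inner_sum_right)
    have pd\<rho>: "pd i ?\<rho> \<in> test_functions UNIV" for i
      by (intro test_functions_pd box_bump_test_function) simp
    have Kint: "integrable (lborel \<Otimes>\<^sub>M lborel) (\<lambda>(x, y). K x y)"
    proof -
      have "integrable (lborel \<Otimes>\<^sub>M lborel) (\<lambda>(x, y). pd i ?\<rho> (x - y) * (g x \<bullet> cross3 (axis i 1) (f y)))" for i
      proof -
        obtain D where D: "\<And>x. norm (pd i ?\<rho> x) \<le> D" using test_functions_bounded[OF pd\<rho>[of i]] by metis
        show ?thesis
          by (rule mollifier_swap(1)[OF L1(3) _ test_functions_measurable[OF pd\<rho>]])
            (use D L1(1) in \<open>auto intro: integrable_bounded_linear[OF bounded_linear_cross3]\<close>)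
      qed
      then have "integrable (lborel \<Otimes>\<^sub>M lborel) (\<lambda>p. \<Sum>i\<in>UNIV. (\<lambda>(x, y). pd i ?\<rho> (x - y) * (g x \<bullet> cross3 (axis i 1) (f y))) p)"
        by (intro Bochner_Integration.integrable_sum)
      then show ?thesis by (simp add: K_def split_beta')
    qed
    have pd_shift: "pd i (\<lambda>x. ?\<rho> (x - y)) x = pd i ?\<rho> (x - y)" for i x y
      using dderiv_affine[OF \<rho>s, where c=1 and z="- y" and v="axis i 1" and x=x] by (simp add: pd_eq)
    have pd_refl: "pd i (\<lambda>y. ?\<rho> (x - y)) y = - pd i ?\<rho> (x - y)" for i x y
      using dderiv_affine[OF \<rho>s, where c="-1" and z=x and v="axis i 1" and x=y] by (simp add: pd_eq)
    have sm_shift: "smooth (\<lambda>x. ?\<rho> (x - y))" for y using smooth_affine[OF \<rho>s, of 1 "- y"] by simp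
    have sm_refl: "smooth (\<lambda>y. ?\<rho> (x - y))" for x using smooth_affine[OF \<rho>s, of "-1" x] by simp
    \<comment> \<open>In the variable \<open>x\<close>, the kernel times \<open>f y\<close> is a
      test field in \<open>\<Omega>\<close>, because the bump sits in the translate of
      \<open>U\<close> by \<open>y\<close>. The local weak curl of \<open>g\<close> applies to
      it.\<close>
    have first: "(LINT x|lborel. ?\<rho> (x - y) * (d x \<bullet> f y)) = (LINT x|lborel. K x y)" for y
    proof (cases "f y = 0")
      case True
      then have "gradcross ?\<rho> (x - y) (f y) = 0" for x
        by (simp add: gradcross_def linear_0[OF bounded_linear.linear[OF bounded_linear_cross3]])
      then show ?thesis using True by (simp add: K)
    next
      case False
      have "cbox (l + y) (u + y) \<subseteq> \<Omega>"
      proof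
        fix x assume "x \<in> cbox (l + y) (u + y)"
        then have "x - y \<in> cbox l u" by (auto simp: mem_box inner_add inner_diff algebra_simps)
        then show "x \<in> \<Omega>" using U(3)[OF False, of "x - y"] lu by auto
      qed
      then have t: "(\<lambda>x. ?\<rho> (x - y) *\<^sub>R f y) \<in> test_functions \<Omega>"
        unfolding box_bump_shift by (intro test_functions_scaleR_right box_bump_test_function) simp_all
      have "curl (\<lambda>x. ?\<rho> (x - y) *\<^sub>R f y) x = gradcross ?\<rho> (x - y) (f y)" for x
        by (simp add: curl_scaleR_const[OF sm_shift] gradcross_def pd_shift)
      then show ?thesis using gd[OF t] by (simp add: K)
    qed
    \<comment> \<open>In the variable \<open>y\<close> the gradient of the kernel changes sign, and
      skewness of the cross product changes it back. This test field can leave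
      \<open>\<Omega>\<close>, hence the demand that \<open>c\<close> be the weak curl of
      \<open>f\<close> on the whole space.\<close>
    have second: "(LINT y|lborel. ?\<rho> (x - y) * (g x \<bullet> c y)) = (LINT y|lborel. K x y)" for x
    proof -
      have t: "(\<lambda>y. ?\<rho> (x - y) *\<^sub>R g x) \<in> test_functions UNIV"
      proof (rule test_functionsI[where K="cbox (x - u) (x - l)"])
        show "smooth (\<lambda>y. ?\<rho> (x - y) *\<^sub>R g x)" by (intro smooth_scaleR sm_refl smooth_const)
        fix y assume "?\<rho> (x - y) *\<^sub>R g x \<noteq> 0"
        then have "x - y \<in> box l u" using box_bump_eq_0_iff by force
        then show "y \<in> cbox (x - u) (x - l)" by (force simp: mem_box inner_diff algebra_simps)
      qed auto
      have "curl (\<lambda>y. ?\<rho> (x - y) *\<^sub>R g x) y = - gradcross ?\<rho> (x - y) (g x)" for y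
        by (simp add: curl_scaleR_const[OF sm_refl] gradcross_def pd_refl sum_negf)
      moreover have "f y \<bullet> - gradcross ?\<rho> (x - y) (g x) = K x y" for y
        using gradcross_skew[of ?\<rho> "x - y" "f y" "g x"] by (simp add: K inner_commute)
      ultimately show ?thesis using fc[OF t] by (simp add: inner_commute)
    qed
    have "(LINT z|lborel. ?\<rho> z * (LINT y|lborel. d (y + z) \<bullet> f y)) = (LINT y|lborel. LINT x|lborel. K x y)"
      unfolding mollifier_swap(2)[OF L1(4) L1(1) m C] first ..
    also have "\<dots> = (LINT x|lborel. LINT y|lborel. K x y)"
      using lborel_pair.Fubini_integral[OF Kint] .
    also have "\<dots> = (LINT x|lborel. LINT y|lborel. ?\<rho> (x - y) * (g x \<bullet> c y))"
      unfolding second ..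
    also have "\<dots> = (LINT y|lborel. LINT x|lborel. ?\<rho> (x - y) * (g x \<bullet> c y))"
      using lborel_pair.Fubini_integral[OF mollifier_swap(1)[OF L1(3) L1(2) m C]] by simp
    also have "\<dots> = (LINT z|lborel. ?\<rho> z * (LINT y|lborel. g (y + z) \<bullet> c y))"
      unfolding mollifier_swap(2)[OF L1(3) L1(2) m C] ..
    finally show "(LINT z|lborel. ?\<rho> z * F z) = 0"
      unfolding F_def right_diff_distrib by (subst Bochner_Integration.integral_diff[OF i1 i2]) simp
  qed
  then show ?thesis by (simp add: F_def)
qed

lemma square_integrable_scale_continuous:
  fixes f :: "'a::euclidean_space \<Rightarrow> 'b::euclidean_space" and \<zeta> :: "'a \<Rightarrow> real"
  assumes "square_integrable f" "bounded \<Omega>" "\<And>x. x \<notin> \<Omega> \<Longrightarrow> f x = 0" "continuous_on UNIV \<zeta>"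
  shows "square_integrable (\<lambda>x. \<zeta> x *\<^sub>R f x)"
proof -
  have "compact (closure \<Omega>)" using assms(2) by simp
  then have "bounded (\<zeta> ` closure \<Omega>)"
    using assms(4) continuous_on_subset by (intro compact_imp_bounded compact_continuous_image) auto
  then obtain C where C: "\<And>x. x \<in> closure \<Omega> \<Longrightarrow> \<bar>\<zeta> x\<bar> \<le> C" by (auto simp: bounded_iff)
  note [measurable] = square_integrable_measurable[OF assms(1)] borel_measurable_continuous_onI[OF assms(4)]
  show ?thesis
  proof (rule square_integrable_bound[OF assms(1), where C=C])
    show "AE x in lborel. norm (\<zeta> x *\<^sub>R f x) \<le> C * norm (f x)"
    proof (rule AE_I2)
      fix x show "norm (\<zeta> x *\<^sub>R f x) \<le> C * norm (f x)"
        using C[of x] assms(3)[of x] closure_subset[of \<Omega>] by (cases "x \<in> \<Omega>") (auto intro!: mult_right_mono)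
    qed
  qed simp
qed

text \<open>Green's formula without boundary term, for a field whose zero extension has a weak curl
  on the whole space, against every field with a weak curl inside \<open>\<Omega>\<close>. A fine
  partition of unity localises \<open>f\<close> so that each piece can be translated inward, and the
  product rule terms cancel on summation.\<close>

lemma curl_duality:
  fixes f c g d :: "R3 \<Rightarrow> R3"
  assumes \<Omega>: "open \<Omega>" "bounded \<Omega>" "two_sided_ball_condition \<Omega> r" "r > 0"
    and sq: "square_integrable f" "square_integrable c" "square_integrable g" "square_integrable d"
    and out: "\<And>x. x \<notin> \<Omega> \<Longrightarrow> f x = 0" "\<And>x. x \<notin> \<Omega> \<Longrightarrow> c x = 0" "\<And>x. x \<notin> \<Omega> \<Longrightarrow> g x = 0" "\<And>x. x \<notin> \<Omega> \<Longrightarrow> d x = 0"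
    and fc: "\<And>\<Phi>. \<Phi> \<in> test_functions UNIV \<Longrightarrow> (LINT x|lborel. c x \<bullet> \<Phi> x) = (LINT x|lborel. f x \<bullet> curl \<Phi> x)"
    and gd: "\<And>\<Phi>. \<Phi> \<in> test_functions \<Omega> \<Longrightarrow> (LINT x|lborel. d x \<bullet> \<Phi> x) = (LINT x|lborel. g x \<bullet> curl \<Phi> x)"
  shows "(LINT x|lborel. d x \<bullet> f x) = (LINT x|lborel. g x \<bullet> c x)"
proof -
  obtain R where R: "\<Omega> \<subseteq> ball 0 R"
    using \<Omega>(2) bounded_subset_ballD by blast
  have "r / 32 > 0" using \<Omega>(4) by simp
  obtain I :: "(R3 \<Rightarrow> nat) set" and \<zeta> :: "(R3 \<Rightarrow> nat) \<Rightarrow> R3 \<Rightarrow> real" where part: "finite I" "\<And>i. smooth (\<zeta> i)"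
    "\<And>i x y. \<zeta> i x \<noteq> 0 \<Longrightarrow> \<zeta> i y \<noteq> 0 \<Longrightarrow> dist x y < r / 32"
    "\<And>x. x \<in> ball 0 R \<Longrightarrow> (\<Sum>i\<in>I. \<zeta> i x) = 1"
    by (rule smooth_partition_of_unity[OF bounded_ball[of "0::R3" R] \<open>r / 32 > 0\<close>]) blast
  define f' where "f' i x = \<zeta> i x *\<^sub>R f x" for i x
  define c' where "c' i x = \<zeta> i x *\<^sub>R c x + gradcross (\<zeta> i) x (f x)" for i x
  have sc: "square_integrable (\<lambda>x. \<eta> x *\<^sub>R h x)"
    if "smooth \<eta>" "square_integrable h" "\<And>x. x \<notin> \<Omega> \<Longrightarrow> h x = 0" for \<eta> :: "R3 \<Rightarrow> real" and h :: "R3 \<Rightarrow> R3"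
    by (rule square_integrable_scale_continuous[OF that(2) \<Omega>(2) that(3) smooth_continuous[OF that(1)]])
  have cross0: "cross3 e 0 = 0" for e by (rule linear_0[OF bounded_linear.linear[OF bounded_linear_cross3]])
  have sf': "square_integrable (f' i)" for i
    unfolding f'_def[abs_def] by (intro sc part sq out)
  have sgc: "square_integrable (\<lambda>x. gradcross (\<zeta> i) x (f x))" for i
    unfolding gradcross_def sum_3
    by (intro square_integrable_add sc smooth_pd part square_integrable_linear[OF _ bounded_linear_cross3] sq)
      (simp_all add: out cross0)
  have sc': "square_integrable (c' i)" for i
    unfolding c'_def[abs_def] by (intro square_integrable_add sgc sc part sq out)
  have out': "f' i x = 0" "c' i x = 0" if "x \<notin> \<Omega>" for i x
    using out[OF that] by (simp_all add: f'_def c'_def gradcross_def cross0)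
  note L1 = square_integrable_imp_integrable_bounded[OF _ \<Omega>(2)]
  have local: "(LINT x|lborel. d x \<bullet> f' i x) = (LINT x|lborel. g x \<bullet> c' i x)" for i
  proof -
    let ?S = "{x. \<zeta> i x \<noteq> 0}"
    have "\<exists>U. open U \<and> 0 \<in> closure U \<and> (\<forall>y\<in>\<Omega> \<inter> ?S. \<forall>v\<in>U. y + v \<in> \<Omega>)"
    proof (rule inward_translations[OF \<Omega>(1,3,4)])
      show "\<Omega> \<inter> ?S \<subseteq> closure \<Omega>" using closure_subset by blast
      fix x y assume "x \<in> \<Omega> \<inter> ?S" "y \<in> \<Omega> \<inter> ?S"
      then show "dist x y < r / 16" using part(3)[of i x y] \<Omega>(4) by simp
    qed
    then obtain U where U: "open U" "0 \<in> closure U" "\<And>y v. y \<in> \<Omega> \<inter> ?S \<Longrightarrow> v \<in> U \<Longrightarrow> y + v \<in> \<Omega>" by blast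
    show ?thesis
    proof (rule curl_duality_local[OF sf' sc' sq(3,4) _ _ _ _ _ gd U(1,2)])
      show "integrable lborel (f' i)" "integrable lborel (c' i)" "integrable lborel g" "integrable lborel d"
        by (rule L1; use sf' sc' sq out out' in simp)+
      show "y + v \<in> \<Omega>" if "f' i y \<noteq> 0" "v \<in> U" for y v
        using that U(3)[of y v] out'(1)[of y i] by (auto simp: f'_def)
      fix \<Phi> :: "R3 \<Rightarrow> R3" assume \<Phi>: "\<Phi> \<in> test_functions UNIV"
      note s\<Phi> = test_functions_smooth[OF \<Phi>]
      have t: "(\<lambda>x. \<zeta> i x *\<^sub>R \<Phi> x) \<in> test_functions UNIV" by (rule test_functions_scaleR_left[OF part(2) \<Phi>])
      have "(LINT x|lborel. c' i x \<bullet> \<Phi> x) = (LINT x|lborel. c x \<bullet> (\<zeta> i x *\<^sub>R \<Phi> x) + gradcross (\<zeta> i) x (f x) \<bullet> \<Phi> x)"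
        by (simp add: c'_def inner_add)
      also have "\<dots> = (LINT x|lborel. c x \<bullet> (\<zeta> i x *\<^sub>R \<Phi> x)) + (LINT x|lborel. gradcross (\<zeta> i) x (f x) \<bullet> \<Phi> x)"
        by (intro Bochner_Integration.integral_add square_integrable_inner sq sgc
            test_functions_square_integrable[OF t] test_functions_square_integrable[OF \<Phi>])
      also have "\<dots> = (LINT x|lborel. f x \<bullet> curl (\<lambda>x. \<zeta> i x *\<^sub>R \<Phi> x) x) + (LINT x|lborel. gradcross (\<zeta> i) x (f x) \<bullet> \<Phi> x)"
        by (simp only: fc[OF t])
      also have "\<dots> = (LINT x|lborel. f x \<bullet> curl (\<lambda>x. \<zeta> i x *\<^sub>R \<Phi> x) x + gradcross (\<zeta> i) x (f x) \<bullet> \<Phi> x)"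
        by (intro Bochner_Integration.integral_add[symmetric] square_integrable_inner sq sgc
            test_functions_square_integrable[OF test_functions_curl[OF t]] test_functions_square_integrable[OF \<Phi>])
      also have "\<dots> = (LINT x|lborel. f' i x \<bullet> curl \<Phi> x)"
        by (simp add: curl_scaleR[OF part(2) s\<Phi>] inner_add gradcross_skew f'_def)
      finally show "(LINT x|lborel. c' i x \<bullet> \<Phi> x) = (LINT x|lborel. f' i x \<bullet> curl \<Phi> x)" .
    qed
  qed
  have sum_f: "(\<Sum>i\<in>I. f' i x) = f x" for x
  proof (cases "x \<in> \<Omega>")
    case True
    then have "(\<Sum>i\<in>I. \<zeta> i x) = 1" using R by (intro part) auto
    then show ?thesis by (simp add: f'_def scaleR_sum_left[symmetric])
  qed (simp add: out out')
  have sum_c: "(\<Sum>i\<in>I. c' i x) = c x" for x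
  proof (cases "x \<in> \<Omega>")
    case True
    then have xB: "x \<in> ball 0 R" using R by auto
    then have 1: "(\<Sum>i\<in>I. \<zeta> i x) = 1" by (rule part)
    \<comment> \<open>The partition sums to 1 on an open ball containing \<open>\<Omega>\<close>, so
      the derivatives of the sum vanish there.\<close>
    have "(\<Sum>i\<in>I. pd k (\<zeta> i) x) = 0" for k
    proof -
      have "((\<lambda>x. \<Sum>i\<in>I. \<zeta> i x) has_derivative (\<lambda>v. \<Sum>i\<in>I. frechet_derivative (\<zeta> i) (at x) v)) (at x)"
        by (intro has_derivative_sum smooth_derivative part)
      moreover have "((\<lambda>x. \<Sum>i\<in>I. \<zeta> i x) has_derivative (\<lambda>v. 0)) (at x)"
        by (rule has_derivative_transform_within_open[OF has_derivative_const open_ball xB]) (simp add: part)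
      ultimately have "(\<lambda>v. \<Sum>i\<in>I. frechet_derivative (\<zeta> i) (at x) v) = (\<lambda>v. 0)"
        by (rule has_derivative_unique)
      then show ?thesis unfolding pd_def by metis
    qed
    then have "(\<Sum>i\<in>I. gradcross (\<zeta> i) x (f x)) = 0"
      unfolding gradcross_def by (subst sum.swap) (simp add: scaleR_sum_left[symmetric])
    then show ?thesis using 1 by (simp add: c'_def sum.distrib scaleR_sum_left[symmetric])
  qed (simp add: out out')
  have "(LINT x|lborel. d x \<bullet> f x) = (LINT x|lborel. (\<Sum>i\<in>I. d x \<bullet> f' i x))"
    by (simp add: inner_sum_right[symmetric] sum_f)
  also have "\<dots> = (\<Sum>i\<in>I. LINT x|lborel. d x \<bullet> f' i x)"
    by (intro Bochner_Integration.integral_sum square_integrable_inner sq sf')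
  also have "\<dots> = (\<Sum>i\<in>I. LINT x|lborel. g x \<bullet> c' i x)" by (simp only: local)
  also have "\<dots> = (LINT x|lborel. (\<Sum>i\<in>I. g x \<bullet> c' i x))"
    by (intro Bochner_Integration.integral_sum[symmetric] square_integrable_inner sq sc')
  also have "\<dots> = (LINT x|lborel. g x \<bullet> c x)"
    by (simp add: inner_sum_right[symmetric] sum_c)
  finally show ?thesis .
qed

section \<open>The function spaces as subspaces of the Hilbert space\<close>

text \<open>The orthogonal projection onto classes vanishing outside \<open>\<Omega>\<close>; the
  equation \<open>cut \<Omega> u = u\<close> encodes that \<open>u\<close> is a field on
  \<open>\<Omega>\<close>.\<close>

definition cut :: "'a set \<Rightarrow> ('a::euclidean_space, 'b::{real_inner, second_countable_topology, banach}) l2 \<Rightarrow> ('a, 'b) l2" where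
  "cut \<Omega> u = to_l2 (\<lambda>x. indicator \<Omega> x *\<^sub>R rep_l2 u x)"

context
  fixes \<Omega> :: "'a::euclidean_space set"
  assumes \<Omega>: "\<Omega> \<in> sets borel"
begin

lemma square_integrable_indicator_scale:
  "square_integrable f \<Longrightarrow> square_integrable (\<lambda>x. indicator \<Omega> x *\<^sub>R f x)"
  by (rule square_integrable_bound[where C=1]) (use \<Omega> in \<open>auto simp: indicator_def\<close>)

lemma rep_cut: "AE x in lborel. rep_l2 (cut \<Omega> u) x = indicator \<Omega> x *\<^sub>R rep_l2 u x"
  unfolding cut_def by (rule rep_to_l2) (simp add: square_integrable_indicator_scale)

lemma cut_cut: "cut \<Omega> (cut \<Omega> u) = cut \<Omega> u"
  using rep_cut[of u] rep_cut[of "cut \<Omega> u"]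
  by (intro l2_eqI, eventually_elim) (simp add: indicator_def)

lemma cut_sym: "cut \<Omega> u \<bullet> v = u \<bullet> cut \<Omega> v"
  unfolding inner_l2_def using rep_cut[of u] rep_cut[of v]
  by (intro integral_cong_AE) (auto simp: indicator_def)

lemma bounded_linear_cut: "bounded_linear (cut \<Omega>)"
proof (rule bounded_linear_intro)
  show "cut \<Omega> (u + v) = cut \<Omega> u + cut \<Omega> v" for u v :: "('a, 'b::{real_inner, second_countable_topology, banach}) l2"
    using rep_cut[of "u + v"] rep_cut[of u] rep_cut[of v] rep_add[of u v] rep_add[of "cut \<Omega> u" "cut \<Omega> v"]
    by (intro l2_eqI, eventually_elim) (simp add: scaleR_add_right)
  show "cut \<Omega> (c *\<^sub>R u) = c *\<^sub>R cut \<Omega> u" for c and u :: "('a, 'b) l2"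
    using rep_cut[of "c *\<^sub>R u"] rep_cut[of u] rep_scaleR[of c u] rep_scaleR[of c "cut \<Omega> u"]
    by (intro l2_eqI, eventually_elim) simp
  show "norm (cut \<Omega> u) \<le> norm u * 1" for u :: "('a, 'b) l2"
  proof -
    have "(norm (cut \<Omega> u))\<^sup>2 = cut \<Omega> u \<bullet> u"
      by (simp add: power2_norm_eq_inner cut_sym[of u "cut \<Omega> u"] cut_sym[of u u] cut_cut)
    also have "\<dots> \<le> norm (cut \<Omega> u) * norm u" by (rule norm_cauchy_schwarz)
    finally show ?thesis by (cases "cut \<Omega> u = 0") (auto simp: power2_eq_square mult_le_cancel_left)
  qed
qed

lemmas cut_add = linear_add[OF bounded_linear.linear[OF bounded_linear_cut]]
  and cut_diff = linear_diff[OF bounded_linear.linear[OF bounded_linear_cut]]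
  and cut_scaleR = linear_scale[OF bounded_linear.linear[OF bounded_linear_cut]]
  and cut_zero = linear_0[OF bounded_linear.linear[OF bounded_linear_cut]]

end

context
  fixes \<Omega> :: "R3 set"
  assumes \<Omega>: "\<Omega> \<in> sets borel"
begin

lemma rep_emb: "f \<in> L2 \<Omega> \<Longrightarrow> AE x in lborel. rep_l2 (emb \<Omega> f) x = indicator \<Omega> x *\<^sub>R f x"
  unfolding L2_def by (intro ex_square_integrable_version[OF \<Omega>]) auto

text \<open>Recognises the class of a field from any candidate in \<open>l2\<close> with the right
  values; the algebraic rules for \<open>emb\<close> come from it.\<close>

lemma L2I:
  assumes "AE x in lborel. rep_l2 u x = indicator \<Omega> x *\<^sub>R f x"
  shows "f \<in> L2 \<Omega>" "emb \<Omega> f = u"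
proof -
  show "f \<in> L2 \<Omega>"
    using square_integrable_imp_lebesgue_on[OF \<Omega> square_integrable_rep assms] by (simp add: L2_def)
  from rep_emb[OF this] show "emb \<Omega> f = u"
    using assms by (intro l2_eqI, eventually_elim) simp
qed

lemma L2_square_integrable: "square_integrable f \<Longrightarrow> f \<in> L2 \<Omega>" "square_integrable f \<Longrightarrow> emb \<Omega> f = cut \<Omega> (to_l2 f)"
proof -
  assume f: "square_integrable f"
  have "AE x in lborel. rep_l2 (cut \<Omega> (to_l2 f)) x = indicator \<Omega> x *\<^sub>R f x"
    using rep_cut[OF \<Omega>, of "to_l2 f"] rep_to_l2[OF f] by eventually_elim simp
  then show "f \<in> L2 \<Omega>" "emb \<Omega> f = cut \<Omega> (to_l2 f)" by (rule L2I)+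
qed

lemma rep_L2 [simp]: "rep_l2 u \<in> L2 \<Omega>" "emb \<Omega> (rep_l2 u) = cut \<Omega> u"
  using L2_square_integrable[of "rep_l2 u"] by simp_all

lemma cut_emb: "f \<in> L2 \<Omega> \<Longrightarrow> cut \<Omega> (emb \<Omega> f) = emb \<Omega> f"
proof (rule l2_eqI)
  assume f: "f \<in> L2 \<Omega>"
  show "AE x in lborel. rep_l2 (cut \<Omega> (emb \<Omega> f)) x = rep_l2 (emb \<Omega> f) x"
    using rep_cut[OF \<Omega>, of "emb \<Omega> f"] rep_emb[OF f] by eventually_elim (simp add: indicator_def)
qed

lemma L2_add: "f \<in> L2 \<Omega> \<Longrightarrow> g \<in> L2 \<Omega> \<Longrightarrow> (\<lambda>x. f x + g x) \<in> L2 \<Omega>"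
  and emb_add: "f \<in> L2 \<Omega> \<Longrightarrow> g \<in> L2 \<Omega> \<Longrightarrow> emb \<Omega> (\<lambda>x. f x + g x) = emb \<Omega> f + emb \<Omega> g"
proof -
  assume f: "f \<in> L2 \<Omega>" "g \<in> L2 \<Omega>"
  have "AE x in lborel. rep_l2 (emb \<Omega> f + emb \<Omega> g) x = indicator \<Omega> x *\<^sub>R (f x + g x)"
    using rep_add[of "emb \<Omega> f" "emb \<Omega> g"] rep_emb[OF f(1)] rep_emb[OF f(2)]
    by eventually_elim (simp add: scaleR_add_right)
  then show "(\<lambda>x. f x + g x) \<in> L2 \<Omega>" "emb \<Omega> (\<lambda>x. f x + g x) = emb \<Omega> f + emb \<Omega> g" by (rule L2I)+
qed

lemma L2_linear:
  assumes L: "bounded_linear L" and f: "f \<in> L2 \<Omega>"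
  shows "(\<lambda>x. L (f x)) \<in> L2 \<Omega>"
proof -
  have "AE x in lborel. rep_l2 (to_l2 (\<lambda>x. L (rep_l2 (emb \<Omega> f) x))) x = indicator \<Omega> x *\<^sub>R L (f x)"
    using rep_to_l2[OF square_integrable_linear[OF square_integrable_rep L], of "emb \<Omega> f"] rep_emb[OF f]
    by eventually_elim (simp add: linear_scale[OF bounded_linear.linear[OF L]])
  then show ?thesis by (rule L2I)
qed

lemma L2_diff: "f \<in> L2 \<Omega> \<Longrightarrow> g \<in> L2 \<Omega> \<Longrightarrow> (\<lambda>x. f x - g x) \<in> L2 \<Omega>"
  and emb_diff: "f \<in> L2 \<Omega> \<Longrightarrow> g \<in> L2 \<Omega> \<Longrightarrow> emb \<Omega> (\<lambda>x. f x - g x) = emb \<Omega> f - emb \<Omega> g"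
proof -
  assume f: "f \<in> L2 \<Omega>" "g \<in> L2 \<Omega>"
  have "AE x in lborel. rep_l2 (emb \<Omega> f - emb \<Omega> g) x = indicator \<Omega> x *\<^sub>R (f x - g x)"
    using rep_diff[of "emb \<Omega> f" "emb \<Omega> g"] rep_emb[OF f(1)] rep_emb[OF f(2)]
    by eventually_elim (simp add: scaleR_diff_right)
  then show "(\<lambda>x. f x - g x) \<in> L2 \<Omega>" "emb \<Omega> (\<lambda>x. f x - g x) = emb \<Omega> f - emb \<Omega> g" by (rule L2I)+
qed

lemma L2_inner_integral:
  fixes f :: "R3 \<Rightarrow> 'b::euclidean_space"
  assumes f: "AE x in lborel. rep_l2 u x = indicator \<Omega> x *\<^sub>R f x" and g: "AE x in lborel. indicator \<Omega> x *\<^sub>R k x = indicator \<Omega> x *\<^sub>R g x"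
    and k: "square_integrable k"
  shows "(LINT x|lebesgue_on \<Omega>. f x \<bullet> g x) = u \<bullet> to_l2 k" "integrable (lebesgue_on \<Omega>) (\<lambda>x. f x \<bullet> g x)"
proof -
  note [measurable] = square_integrable_measurable[OF k]
  have m: "(\<lambda>x. rep_l2 u x \<bullet> k x) \<in> borel_measurable borel" by measurable
  have "AE x in lborel. rep_l2 u x \<bullet> k x = indicator \<Omega> x *\<^sub>R (f x \<bullet> g x)"
    using f g by eventually_elim (auto simp: indicator_def)
  note I = integral_lebesgue_on[OF \<Omega> m this]
  show "(LINT x|lebesgue_on \<Omega>. f x \<bullet> g x) = u \<bullet> to_l2 k" unfolding I(1) by (rule inner_rep_to_l2[OF k, symmetric])
  show "integrable (lebesgue_on \<Omega>) (\<lambda>x. f x \<bullet> g x)" unfolding I(2) by (rule square_integrable_inner[OF _ k]) simp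
qed

lemma L2_inner_emb:
  fixes f g :: "R3 \<Rightarrow> 'b::euclidean_space"
  assumes "f \<in> L2 \<Omega>" "g \<in> L2 \<Omega>"
  shows "L2_inner \<Omega> f g = emb \<Omega> f \<bullet> emb \<Omega> g" "integrable (lebesgue_on \<Omega>) (\<lambda>x. f x \<bullet> g x)"
proof -
  have "AE x in lborel. indicator \<Omega> x *\<^sub>R rep_l2 (emb \<Omega> g) x = indicator \<Omega> x *\<^sub>R g x"
    using rep_emb[OF assms(2)] by eventually_elim (simp add: indicator_def)
  from L2_inner_integral[OF rep_emb[OF assms(1)] this square_integrable_rep]
  show "L2_inner \<Omega> f g = emb \<Omega> f \<bullet> emb \<Omega> g" "integrable (lebesgue_on \<Omega>) (\<lambda>x. f x \<bullet> g x)"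
    by (simp_all add: L2_inner_def)
qed

lemma L2_inner_to_l2:
  fixes f g :: "R3 \<Rightarrow> 'b::euclidean_space"
  assumes "f \<in> L2 \<Omega>" "square_integrable g"
  shows "L2_inner \<Omega> f g = emb \<Omega> f \<bullet> to_l2 g"
  using L2_inner_integral[OF rep_emb[OF assms(1)] _ assms(2), of g] by (simp add: L2_inner_def)

lemma L2_norm_emb: "f \<in> L2 \<Omega> \<Longrightarrow> L2_norm \<Omega> f = norm (emb \<Omega> f)"
  using L2_inner_emb(1)[of f f] by (simp add: L2_norm_def L2_inner_def norm_eq_sqrt_inner power2_norm_eq_inner)

lemma emb_eq_iff:
  assumes "f \<in> L2 \<Omega>" "g \<in> L2 \<Omega>"
  shows "emb \<Omega> f = emb \<Omega> g \<longleftrightarrow> (AE x in lebesgue_on \<Omega>. f x = g x)"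
proof
  assume eq: "emb \<Omega> f = emb \<Omega> g"
  have "AE x\<in>\<Omega> in lborel. f x = g x"
    using rep_emb[OF assms(1)] rep_emb[OF assms(2)] by eventually_elim (auto simp: eq indicator_def)
  then show "AE x in lebesgue_on \<Omega>. f x = g x" by (simp add: AE_lebesgue_on_iff[OF \<Omega>])
next
  assume "AE x in lebesgue_on \<Omega>. f x = g x"
  then have "AE x\<in>\<Omega> in lborel. f x = g x" by (simp add: AE_lebesgue_on_iff[OF \<Omega>])
  then show "emb \<Omega> f = emb \<Omega> g"
    using rep_emb[OF assms(1)] rep_emb[OF assms(2)]
    by (intro l2_eqI, eventually_elim) (auto simp: indicator_def)
qed

end

text \<open>The graph as a subspace of a product keeps domain and operator together, makes
  closedness a matter of continuous equations, and lets the graph norm be the product norm.\<close>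

definition graph_curl :: "R3 set \<Rightarrow> ((R3, R3) l2 \<times> (R3, R3) l2) set" where
  "graph_curl \<Omega> = {(u, a). cut \<Omega> u = u \<and> cut \<Omega> a = a \<and>
      (\<forall>\<Phi>\<in>test_functions \<Omega>. a \<bullet> to_l2 \<Phi> = u \<bullet> to_l2 (curl \<Phi>))}"

text \<open>Defined by duality with all of \<open>graph_curl\<close>, hence the adjoint of the
  maximal weak curl. That this is the space with vanishing trace, where only \<open>H1_vec\<close>
  fields are tested, is the content of \<open>graph0_curl_rep\<close> and
  \<open>H1_0_curl_in_graph0\<close>.\<close>

definition graph0_curl :: "R3 set \<Rightarrow> ((R3, R3) l2 \<times> (R3, R3) l2) set" where
  "graph0_curl \<Omega> = {(h, k). cut \<Omega> h = h \<and> cut \<Omega> k = k \<and> (\<forall>(u, a)\<in>graph_curl \<Omega>. h \<bullet> a = k \<bullet> u)}"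

section \<open>Identification of the curl spaces with the two graphs\<close>

context
  fixes \<Omega> :: "R3 set"
  assumes op: "open \<Omega>"
begin

lemma \<Omega>_borel: "\<Omega> \<in> sets borel"
  using op by simp

lemmas test_sq = test_functions_square_integrable(1)

text \<open>The scalar fundamental lemma applied to each component; the hypothesis on
  \<open>cut\<close> takes care of the complement of \<open>\<Omega>\<close>.\<close>

lemma eq_0_if_orthogonal_to_test_fields:
  assumes "cut \<Omega> v = v"
    and orth: "\<And>\<phi> i. \<phi> \<in> test_functions \<Omega> \<Longrightarrow> v \<bullet> to_l2 (\<lambda>x. \<phi> x *\<^sub>R axis i (1::real)) = 0"
  shows "v = (0 :: (R3, R3) l2)"
proof (rule l2_eqI)
  have "AE x\<in>\<Omega> in lborel. rep_l2 v x $ i = 0" for i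
  proof (rule AE_eq_0_if_orthogonal_to_test_functions[OF _ op])
    show "square_integrable (\<lambda>x. rep_l2 v x $ i)"
      by (rule square_integrable_linear[OF square_integrable_rep bounded_linear_vec_nth])
    fix \<phi> :: "R3 \<Rightarrow> real" assume \<phi>: "\<phi> \<in> test_functions \<Omega>"
    have sq: "square_integrable (\<lambda>x. \<phi> x *\<^sub>R axis i (1::real))"
      by (rule test_sq[OF test_functions_scaleR_right[OF smooth_const \<phi>]])
    show "(LINT x|lborel. rep_l2 v x $ i * \<phi> x) = 0"
      using orth[OF \<phi>, of i] by (simp add: inner_rep_to_l2[OF sq] inner_axis mult.commute)
  qed
  then have "AE x in lborel. \<forall>i. x \<in> \<Omega> \<longrightarrow> rep_l2 v x $ i = 0"
    by (rule AE_all_countable[THEN iffD2, rule_format])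
  moreover have "AE x in lborel. rep_l2 v x = indicator \<Omega> x *\<^sub>R rep_l2 v x"
    using rep_cut[OF \<Omega>_borel, of v] assms(1) by simp
  ultimately show "AE x in lborel. rep_l2 v x = rep_l2 0 x"
    using rep_zero[where 'a="(real, 3) vec" and 'b="(real, 3) vec"]
    by eventually_elim (auto simp: vec_eq_iff indicator_def split: if_splits)
qed

lemma subspace_graph_curl: "subspace (graph_curl \<Omega>)"
proof (rule subspaceI)
  show "0 \<in> graph_curl \<Omega>" by (simp add: graph_curl_def zero_prod_def cut_zero[OF \<Omega>_borel])
  show "p + q \<in> graph_curl \<Omega>" if "p \<in> graph_curl \<Omega>" "q \<in> graph_curl \<Omega>" for p q
    using that by (cases p; cases q) (auto simp: graph_curl_def cut_add[OF \<Omega>_borel] inner_add)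
  show "c *\<^sub>R p \<in> graph_curl \<Omega>" if "p \<in> graph_curl \<Omega>" for c p
    using that by (cases p) (auto simp: graph_curl_def cut_scaleR[OF \<Omega>_borel])
qed

lemma closed_graph_curl: "closed (graph_curl \<Omega>)"
proof -
  note [continuous_intros] = bounded_linear.continuous_on[OF bounded_linear_cut[OF \<Omega>_borel]]
  have "graph_curl \<Omega> = {p. cut \<Omega> (fst p) = fst p} \<inter> {p. cut \<Omega> (snd p) = snd p} \<inter>
      (\<Inter>\<Phi>\<in>test_functions \<Omega>. {p. snd p \<bullet> to_l2 \<Phi> = fst p \<bullet> to_l2 (curl \<Phi>)})"
    by (auto simp: graph_curl_def)
  then show ?thesis
    by (auto intro!: closed_Int closed_INT closed_Collect_eq continuous_intros)
qed

lemma subspace_graph0_curl: "subspace (graph0_curl \<Omega>)"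
proof (rule subspaceI)
  show "0 \<in> graph0_curl \<Omega>" by (simp add: graph0_curl_def zero_prod_def cut_zero[OF \<Omega>_borel])
  show "p + q \<in> graph0_curl \<Omega>" if "p \<in> graph0_curl \<Omega>" "q \<in> graph0_curl \<Omega>" for p q
    using that by (cases p; cases q) (force simp: graph0_curl_def cut_add[OF \<Omega>_borel] inner_add)
  show "c *\<^sub>R p \<in> graph0_curl \<Omega>" if "p \<in> graph0_curl \<Omega>" for c p
    using that by (cases p) (force simp: graph0_curl_def cut_scaleR[OF \<Omega>_borel])
qed

lemma closed_graph0_curl: "closed (graph0_curl \<Omega>)"
proof -
  note [continuous_intros] = bounded_linear.continuous_on[OF bounded_linear_cut[OF \<Omega>_borel]]
  have "graph0_curl \<Omega> = {p. cut \<Omega> (fst p) = fst p} \<inter> {p. cut \<Omega> (snd p) = snd p} \<inter>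
      (\<Inter>q\<in>graph_curl \<Omega>. {p. fst p \<bullet> snd q = snd p \<bullet> fst q})"
    by (auto simp: graph0_curl_def split_beta')
  then show ?thesis
    by (auto intro!: closed_Int closed_INT closed_Collect_eq continuous_intros)
qed

lemma graph_curl_unique: "(0, a) \<in> graph_curl \<Omega> \<Longrightarrow> a = 0"
  using test_functions_scaleR_right[OF smooth_const]
  by (intro eq_0_if_orthogonal_to_test_fields) (auto simp: graph_curl_def)

lemma has_weak_curl_iff:
  assumes "f \<in> L2 \<Omega>" "c \<in> L2 \<Omega>"
  shows "has_weak_curl \<Omega> f c \<longleftrightarrow> (emb \<Omega> f, emb \<Omega> c) \<in> graph_curl \<Omega>"
proof -
  have "L2_inner \<Omega> c \<Phi> = emb \<Omega> c \<bullet> to_l2 \<Phi>" "L2_inner \<Omega> f (curl \<Phi>) = emb \<Omega> f \<bullet> to_l2 (curl \<Phi>)"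
    if "\<Phi> \<in> test_functions \<Omega>" for \<Phi>
    using assms test_sq[OF that] test_sq[OF test_functions_curl[OF that]] by (simp_all add: L2_inner_to_l2[OF \<Omega>_borel])
  then show ?thesis
    unfolding has_weak_curl_def graph_curl_def using assms by (simp add: cut_emb[OF \<Omega>_borel])
qed

lemma wcurl: "f \<in> H1_curl \<Omega> \<Longrightarrow> wcurl \<Omega> f \<in> L2 \<Omega>" "f \<in> H1_curl \<Omega> \<Longrightarrow> (emb \<Omega> f, emb \<Omega> (wcurl \<Omega> f)) \<in> graph_curl \<Omega>"
proof -
  assume f: "f \<in> H1_curl \<Omega>"
  then have "\<exists>c. c \<in> L2 \<Omega> \<and> has_weak_curl \<Omega> f c" by (auto simp: H1_curl_def)
  from someI_ex[OF this] have *: "wcurl \<Omega> f \<in> L2 \<Omega>" "has_weak_curl \<Omega> f (wcurl \<Omega> f)"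
    by (auto simp: wcurl_def)
  then show "wcurl \<Omega> f \<in> L2 \<Omega>" "(emb \<Omega> f, emb \<Omega> (wcurl \<Omega> f)) \<in> graph_curl \<Omega>"
    using has_weak_curl_iff f by (auto simp: H1_curl_def)
qed

lemma H1_curl_L2: "f \<in> H1_curl \<Omega> \<Longrightarrow> f \<in> L2 \<Omega>"
  by (simp add: H1_curl_def)

lemma H1_curlI:
  assumes "f \<in> L2 \<Omega>" "(emb \<Omega> f, a) \<in> graph_curl \<Omega>"
  shows "f \<in> H1_curl \<Omega>" "emb \<Omega> (wcurl \<Omega> f) = a"
proof -
  have a: "cut \<Omega> a = a" using assms(2) by (simp add: graph_curl_def)
  then have "has_weak_curl \<Omega> f (rep_l2 a)"
    using has_weak_curl_iff[OF assms(1) rep_L2(1)[OF \<Omega>_borel, of a]] assms(2) rep_L2(2)[OF \<Omega>_borel, of a] by simp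
  then show f: "f \<in> H1_curl \<Omega>" using assms(1) rep_L2(1)[OF \<Omega>_borel] by (auto simp: H1_curl_def)
  have "(emb \<Omega> f, emb \<Omega> (wcurl \<Omega> f)) - (emb \<Omega> f, a) \<in> graph_curl \<Omega>"
    by (intro subspace_diff subspace_graph_curl wcurl f assms)
  then have "emb \<Omega> (wcurl \<Omega> f) - a = 0" by (intro graph_curl_unique) simp
  then show "emb \<Omega> (wcurl \<Omega> f) = a" by simp
qed

lemma graph_curl_rep:
  assumes "(u, a) \<in> graph_curl \<Omega>"
  shows "rep_l2 u \<in> H1_curl \<Omega>" "emb \<Omega> (rep_l2 u) = u" "emb \<Omega> (wcurl \<Omega> (rep_l2 u)) = a"
proof -
  show u: "emb \<Omega> (rep_l2 u) = u" using assms rep_L2(2)[OF \<Omega>_borel, of u] by (simp add: graph_curl_def)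
  show "rep_l2 u \<in> H1_curl \<Omega>" "emb \<Omega> (wcurl \<Omega> (rep_l2 u)) = a"
    by (rule H1_curlI[OF rep_L2(1)[OF \<Omega>_borel]]; use u assms in simp)+
qed

lemma smooth_in_graph_curl:
  assumes "smooth f" "square_integrable f" "square_integrable (curl f)"
  shows "(emb \<Omega> f, emb \<Omega> (curl f)) \<in> graph_curl \<Omega>"
proof (subst has_weak_curl_iff[symmetric])
  show "has_weak_curl \<Omega> f (curl f)"
    unfolding has_weak_curl_def
  proof
    fix \<Phi> :: "R3 \<Rightarrow> R3" assume \<Phi>: "\<Phi> \<in> test_functions \<Omega>"
    have supp: "cut \<Omega> (to_l2 g) = to_l2 g" if "square_integrable g" "\<And>x. x \<notin> \<Omega> \<Longrightarrow> g x = 0" for g :: "R3 \<Rightarrow> R3"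
      using rep_cut[OF \<Omega>_borel, of "to_l2 g"] rep_to_l2[OF that(1)]
      by (intro l2_eqI, eventually_elim) (auto simp: indicator_def that(2))
    have c: "cut \<Omega> (to_l2 \<Phi>) = to_l2 \<Phi>" "cut \<Omega> (to_l2 (curl \<Phi>)) = to_l2 (curl \<Phi>)"
      by (rule supp; use test_functions_zero_outside[OF \<Phi>] test_functions_zero_outside[OF test_functions_curl[OF \<Phi>]]
        test_sq[OF \<Phi>] test_sq[OF test_functions_curl[OF \<Phi>]] in simp)+
    show "L2_inner \<Omega> (curl f) \<Phi> = L2_inner \<Omega> f (curl \<Phi>)"
      using integral_curl_symmetric[OF \<Phi> assms(1)] assms test_sq[OF \<Phi>] test_sq[OF test_functions_curl[OF \<Phi>]]
      by (simp add: L2_inner_to_l2[OF \<Omega>_borel] L2_square_integrable[OF \<Omega>_borel] cut_sym[OF \<Omega>_borel] c inner_to_l2)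
  qed
qed (use assms L2_square_integrable[OF \<Omega>_borel] in auto)

lemma smooth_has_weak_grad:
  fixes \<phi> :: "R3 \<Rightarrow> real"
  assumes "smooth \<phi>"
  shows "has_weak_grad \<Omega> \<phi> (\<lambda>x. \<chi> i. pd i \<phi> x)"
  unfolding has_weak_grad_def
proof (intro ballI allI)
  fix \<psi> :: "R3 \<Rightarrow> real" and i assume \<psi>: "\<psi> \<in> test_functions \<Omega>"
  have m: "f \<in> borel_measurable borel" if "smooth f" for f :: "R3 \<Rightarrow> real"
    by (intro borel_measurable_continuous_onI smooth_continuous that)
  note sm = m[OF smooth_mult[OF assms smooth_pd[OF test_functions_smooth[OF \<psi>]]], of i]
    m[OF smooth_mult[OF smooth_pd[OF assms] test_functions_smooth[OF \<psi>]], of i]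
  have "(LINT x|lebesgue_on \<Omega>. \<phi> x * pd i \<psi> x) = (LINT x|lborel. \<phi> x * pd i \<psi> x)"
    by (rule integral_lebesgue_on(1)[OF \<Omega>_borel sm(1)])
      (use test_functions_zero_outside[OF test_functions_pd[OF \<psi>]] in \<open>auto simp: indicator_def\<close>)
  also have "\<dots> = - (LINT x|lborel. pd i \<phi> x * \<psi> x)"
    using integration_by_parts_test_function[OF assms \<psi>, of "axis i 1"] by (simp add: pd_eq)
  also have "(LINT x|lborel. pd i \<phi> x * \<psi> x) = (LINT x|lebesgue_on \<Omega>. pd i \<phi> x * \<psi> x)"
    by (rule integral_lebesgue_on(1)[OF \<Omega>_borel sm(2), symmetric])
      (use test_functions_zero_outside[OF \<psi>] in \<open>auto simp: indicator_def\<close>)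
  finally show "(LINT x|lebesgue_on \<Omega>. \<phi> x * pd i \<psi> x) = - (LINT x|lebesgue_on \<Omega>. (\<chi> i. pd i \<phi> x) $ i * \<psi> x)"
    by simp
qed

lemma L2_vecI:
  fixes f :: "R3 \<Rightarrow> R3"
  assumes "\<And>i. (\<lambda>x. f x $ i) \<in> L2 \<Omega>" shows "f \<in> L2 \<Omega>"
proof -
  have "(\<lambda>x. f x $ i *\<^sub>R axis i (1::real)) \<in> L2 \<Omega>" for i :: 3
    by (rule L2_linear[OF \<Omega>_borel bounded_linear_scaleR_left assms])
  then have "(\<lambda>x. f x $ 1 *\<^sub>R axis 1 1 + f x $ 2 *\<^sub>R axis 2 1 + f x $ 3 *\<^sub>R axis 3 1 :: R3) \<in> L2 \<Omega>"
    by (intro L2_add[OF \<Omega>_borel])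
  moreover have "f x $ 1 *\<^sub>R axis 1 1 + f x $ 2 *\<^sub>R axis 2 1 + f x $ 3 *\<^sub>R axis 3 1 = f x" for x
    by (simp add: vec_eq_iff forall_3 axis_def)
  ultimately show ?thesis by simp
qed

text \<open>The weak curl is assembled from the weak gradients of the components.\<close>

lemma H1_vec_subset_H1_curl: "H1_vec \<Omega> \<subseteq> H1_curl \<Omega>"
proof
  fix f assume "f \<in> H1_vec \<Omega>"
  then have f: "\<And>j. (\<lambda>x. f x $ j) \<in> L2 \<Omega>" "\<forall>j. \<exists>g\<in>L2 \<Omega>. has_weak_grad \<Omega> (\<lambda>x. f x $ j) g"
    by (auto simp: H1_vec_def H1_def)
  then obtain g where g: "\<And>j. g j \<in> L2 \<Omega>" "\<And>j. has_weak_grad \<Omega> (\<lambda>x. f x $ j) (g j)" by metis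
  have fL: "f \<in> L2 \<Omega>" by (rule L2_vecI[OF f(1)])
  have gi: "(\<lambda>x. g j x $ i) \<in> L2 \<Omega>" for i j by (rule L2_linear[OF \<Omega>_borel bounded_linear_vec_nth g(1)])
  define c where "c x = (vector [g 3 x $ 2 - g 2 x $ 3, g 1 x $ 3 - g 3 x $ 1, g 2 x $ 1 - g 1 x $ 2] :: R3)" for x
  have "\<forall>i. (\<lambda>x. c x $ i) \<in> L2 \<Omega>"
    unfolding forall_3 c_def by (auto intro: L2_diff[OF \<Omega>_borel gi gi])
  then have cL: "c \<in> L2 \<Omega>" using L2_vecI by blast
  have "has_weak_curl \<Omega> f c"
    unfolding has_weak_curl_def
  proof
    fix \<Phi> :: "R3 \<Rightarrow> R3" assume \<Phi>: "\<Phi> \<in> test_functions \<Omega>"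
    have t: "(\<lambda>x. \<Phi> x $ k) \<in> test_functions \<Omega>" for k by (rule test_functions_linear[OF bounded_linear_vec_nth \<Phi>])
    have t': "(\<lambda>x. pd i \<Phi> x $ k) \<in> test_functions \<Omega>" for i k
      by (rule test_functions_linear[OF bounded_linear_vec_nth test_functions_pd[OF \<Phi>]])
    have ibp: "(LINT x|lebesgue_on \<Omega>. g j x $ i * \<Phi> x $ k) = - (LINT x|lebesgue_on \<Omega>. f x $ j * pd i \<Phi> x $ k)" for i j k
      using bspec[OF g(2)[of j, unfolded has_weak_grad_def] t[of k], THEN spec, of i]
      by (simp add: pd_component[OF test_functions_smooth[OF \<Phi>]])
    have i1: "integrable (lebesgue_on \<Omega>) (\<lambda>x. g j x $ i * \<Phi> x $ k)" for i j k
      using L2_inner_emb(2)[OF \<Omega>_borel gi L2_square_integrable(1)[OF \<Omega>_borel test_sq[OF t]]] by simp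
    have i2: "integrable (lebesgue_on \<Omega>) (\<lambda>x. f x $ j * pd i \<Phi> x $ k)" for i j k
      using L2_inner_emb(2)[OF \<Omega>_borel f(1) L2_square_integrable(1)[OF \<Omega>_borel test_sq[OF t']]] by simp
    have "L2_inner \<Omega> c \<Phi> =
     (LINT x|lebesgue_on \<Omega>. (g 3 x $ 2 * \<Phi> x $ 1 - g 2 x $ 3 * \<Phi> x $ 1) + (g 1 x $ 3 * \<Phi> x $ 2 - g 3 x $ 1 * \<Phi> x $ 2)
       + (g 2 x $ 1 * \<Phi> x $ 3 - g 1 x $ 2 * \<Phi> x $ 3))"
      by (simp add: L2_inner_def c_def inner_vec_def sum_3 algebra_simps)
    also have "\<dots> = (LINT x|lebesgue_on \<Omega>. (f x $ 1 * pd 2 \<Phi> x $ 3 - f x $ 1 * pd 3 \<Phi> x $ 2) + (f x $ 2 * pd 3 \<Phi> x $ 1 - f x $ 2 * pd 1 \<Phi> x $ 3)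
       + (f x $ 3 * pd 1 \<Phi> x $ 2 - f x $ 3 * pd 2 \<Phi> x $ 1))"
      using i1 i2 by (simp add: ibp)
    also have "\<dots> = L2_inner \<Omega> f (curl \<Phi>)"
      by (simp add: L2_inner_def curl_def inner_vec_def sum_3 algebra_simps)
    finally show "L2_inner \<Omega> c \<Phi> = L2_inner \<Omega> f (curl \<Phi>)" .
  qed
  then show "f \<in> H1_curl \<Omega>" using fL cL by (auto simp: H1_curl_def)
qed

lemma test_functions_H1_vec:
  assumes "\<Phi> \<in> test_functions S" shows "\<Phi> \<in> H1_vec \<Omega>"
  unfolding H1_vec_def H1_def
proof safe
  fix i
  have t: "(\<lambda>x. \<Phi> x $ i) \<in> test_functions S" by (rule test_functions_linear[OF bounded_linear_vec_nth assms])
  show "(\<lambda>x. \<Phi> x $ i) \<in> L2 \<Omega>" by (rule L2_square_integrable(1)[OF \<Omega>_borel test_sq[OF t]])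
  have "(\<lambda>x. (\<chi> j. pd j (\<lambda>x. \<Phi> x $ i) x) $ k) \<in> L2 \<Omega>" for k
    using L2_square_integrable(1)[OF \<Omega>_borel test_sq[OF test_functions_pd[OF t]]] by simp
  then have "(\<lambda>x. \<chi> j. pd j (\<lambda>x. \<Phi> x $ i) x) \<in> L2 \<Omega>" by (rule L2_vecI)
  then show "\<exists>g\<in>L2 \<Omega>. has_weak_grad \<Omega> (\<lambda>x. \<Phi> x $ i) g"
    using smooth_has_weak_grad[OF test_functions_smooth[OF t]] by blast
qed

lemma test_function_in_graph_curl:
  assumes "\<Phi> \<in> test_functions S"
  shows "(emb \<Omega> \<Phi>, emb \<Omega> (curl \<Phi>)) \<in> graph_curl \<Omega>"
  by (rule smooth_in_graph_curl[OF test_functions_smooth[OF assms] test_sq[OF assms] test_sq[OF test_functions_curl[OF assms]]])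

text \<open>The easy inclusion: test fields show that \<open>k\<close> is the weak curl of
  \<open>h\<close>, and trace tests with \<open>H1_vec\<close> fields are special cases of the
  duality.\<close>

lemma graph0_curl_rep:
  assumes "(h, k) \<in> graph0_curl \<Omega>"
  shows "rep_l2 h \<in> H1_0_curl \<Omega>" "emb \<Omega> (rep_l2 h) = h" "emb \<Omega> (wcurl \<Omega> (rep_l2 h)) = k"
proof -
  have c: "cut \<Omega> h = h" "cut \<Omega> k = k" and d: "\<And>u a. (u, a) \<in> graph_curl \<Omega> \<Longrightarrow> h \<bullet> a = k \<bullet> u"
    using assms by (auto simp: graph0_curl_def)
  have "(h, k) \<in> graph_curl \<Omega>"
    unfolding graph_curl_def
  proof (clarsimp simp: c)
    fix \<Phi> :: "R3 \<Rightarrow> R3" assume \<Phi>: "\<Phi> \<in> test_functions \<Omega>"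
    have "k \<bullet> emb \<Omega> \<Phi> = h \<bullet> emb \<Omega> (curl \<Phi>)" using d[OF test_function_in_graph_curl[OF \<Phi>]] by simp
    then show "k \<bullet> to_l2 \<Phi> = h \<bullet> to_l2 (curl \<Phi>)"
      using test_sq[OF \<Phi>] test_sq[OF test_functions_curl[OF \<Phi>]]
      by (simp add: L2_square_integrable[OF \<Omega>_borel] cut_sym[OF \<Omega>_borel, symmetric] c)
  qed
  note g = graph_curl_rep[OF this]
  show "emb \<Omega> (rep_l2 h) = h" "emb \<Omega> (wcurl \<Omega> (rep_l2 h)) = k" using g by auto
  have "tangential_trace \<Omega> (rep_l2 h) \<phi> = 0" if "\<phi> \<in> H1_vec \<Omega>" for \<phi>
  proof -
    have \<phi>: "\<phi> \<in> H1_curl \<Omega>" using that H1_vec_subset_H1_curl by blast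
    show ?thesis
      unfolding tangential_trace_def
      using d[OF wcurl(2)[OF \<phi>]] g H1_curl_L2[OF \<phi>] H1_curl_L2[OF g(1)] wcurl(1)[OF \<phi>] wcurl(1)[OF g(1)]
      by (simp add: L2_inner_emb(1)[OF \<Omega>_borel])
  qed
  then show "rep_l2 h \<in> H1_0_curl \<Omega>" using g(1) by (simp add: H1_0_curl_def)
qed

text \<open>The hard inclusion. Test fields on the whole space restrict to \<open>H1_vec\<close>
  fields, so a vanishing trace says that the zero extension of the curl is the weak curl of the zero
  extension. Then \<open>curl_duality\<close> extends the test to every pair in the graph.\<close>

lemma H1_0_curl_in_graph0:
  assumes "bounded \<Omega>" "two_sided_ball_condition \<Omega> r" "r > 0" and \<psi>: "\<psi> \<in> H1_0_curl \<Omega>"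
  shows "(emb \<Omega> \<psi>, emb \<Omega> (wcurl \<Omega> \<psi>)) \<in> graph0_curl \<Omega>"
proof -
  have \<psi>c: "\<psi> \<in> H1_curl \<Omega>" and tr: "\<And>\<phi>. \<phi> \<in> H1_vec \<Omega> \<Longrightarrow> tangential_trace \<Omega> \<psi> \<phi> = 0"
    using \<psi> by (auto simp: H1_0_curl_def)
  define h k where "h = emb \<Omega> \<psi>" and "k = emb \<Omega> (wcurl \<Omega> \<psi>)"
  have c: "cut \<Omega> h = h" "cut \<Omega> k = k" using wcurl(2)[OF \<psi>c] by (auto simp: graph_curl_def h_def k_def)
  have all: "k \<bullet> to_l2 \<Phi> = h \<bullet> to_l2 (curl \<Phi>)" if \<Phi>: "\<Phi> \<in> test_functions UNIV" for \<Phi>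
  proof -
    have \<Phi>v: "\<Phi> \<in> H1_vec \<Omega>" by (rule test_functions_H1_vec[OF \<Phi>])
    then have \<Phi>c: "\<Phi> \<in> H1_curl \<Omega>" using H1_vec_subset_H1_curl by blast
    have "emb \<Omega> (wcurl \<Omega> \<Phi>) = emb \<Omega> (curl \<Phi>)"
      by (rule H1_curlI(2)[OF H1_curl_L2[OF \<Phi>c] test_function_in_graph_curl[OF \<Phi>]])
    then have "h \<bullet> emb \<Omega> (curl \<Phi>) = k \<bullet> emb \<Omega> \<Phi>"
      using tr[OF \<Phi>v] H1_curl_L2[OF \<Phi>c] H1_curl_L2[OF \<psi>c] wcurl(1)[OF \<Phi>c] wcurl(1)[OF \<psi>c]
      by (simp add: tangential_trace_def L2_inner_emb(1)[OF \<Omega>_borel] h_def k_def)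
    then show ?thesis
      using test_sq[OF \<Phi>] test_sq[OF test_functions_curl[OF \<Phi>]]
      by (simp add: L2_square_integrable[OF \<Omega>_borel] cut_sym[OF \<Omega>_borel, symmetric] c)
  qed
  have "h \<bullet> a = k \<bullet> u" if ua: "(u, a) \<in> graph_curl \<Omega>" for u a
  proof -
    \<comment> \<open>Representatives set to 0 at every point outside \<open>\<Omega>\<close>, since
      \<open>curl_duality\<close> asks for exact vanishing there.\<close>
    define R where "R v x = indicator \<Omega> x *\<^sub>R rep_l2 v x" for v :: "(R3, R3) l2" and x
    have sq: "square_integrable (R v)" for v
      unfolding R_def by (simp add: square_integrable_indicator_scale[OF \<Omega>_borel])
    have toR: "to_l2 (R v) = cut \<Omega> v" for v by (simp add: R_def[abs_def] cut_def)
    have uc: "cut \<Omega> u = u" "cut \<Omega> a = a" using ua by (auto simp: graph_curl_def)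
    have I: "(LINT x|lborel. R v x \<bullet> g x) = cut \<Omega> v \<bullet> to_l2 g" if "square_integrable g" for v g
      using inner_to_l2[OF sq that] toR by simp
    have "(LINT x|lborel. R a x \<bullet> R h x) = (LINT x|lborel. R u x \<bullet> R k x)"
    proof (rule curl_duality[OF op assms(1-3)])
      show "(LINT x|lborel. R k x \<bullet> \<Phi> x) = (LINT x|lborel. R h x \<bullet> curl \<Phi> x)" if "\<Phi> \<in> test_functions UNIV" for \<Phi>
        using all[OF that] by (simp add: I test_sq[OF that] test_sq[OF test_functions_curl[OF that]] c)
      show "(LINT x|lborel. R a x \<bullet> \<Phi> x) = (LINT x|lborel. R u x \<bullet> curl \<Phi> x)" if "\<Phi> \<in> test_functions \<Omega>" for \<Phi>
        using ua that by (simp add: I test_sq[OF that] test_sq[OF test_functions_curl[OF that]] uc graph_curl_def)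
    qed (simp_all add: sq, simp_all add: R_def)
    then show ?thesis by (simp add: I sq toR c uc inner_commute)
  qed
  then show ?thesis using c by (auto simp: graph0_curl_def h_def k_def)
qed

lemma has_weak_grad_iff:
  assumes "u \<in> L2 \<Omega>" "g \<in> L2 \<Omega>"
  shows "has_weak_grad \<Omega> u g \<longleftrightarrow> (\<forall>\<phi>\<in>test_functions \<Omega>. \<forall>i.
      emb \<Omega> u \<bullet> to_l2 (pd i \<phi>) = - (emb \<Omega> g \<bullet> to_l2 (\<lambda>x. \<phi> x *\<^sub>R axis i (1::real))))"
proof -
  have "(LINT x|lebesgue_on \<Omega>. u x * pd i \<phi> x) = emb \<Omega> u \<bullet> to_l2 (pd i \<phi>)"
    "(LINT x|lebesgue_on \<Omega>. g x $ i * \<phi> x) = emb \<Omega> g \<bullet> to_l2 (\<lambda>x. \<phi> x *\<^sub>R axis i (1::real))"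
    if \<phi>: "\<phi> \<in> test_functions \<Omega>" for \<phi> i
    using L2_inner_to_l2[OF \<Omega>_borel assms(1) test_sq[OF test_functions_pd[OF \<phi>, of i]]]
      L2_inner_to_l2[OF \<Omega>_borel assms(2) test_sq[OF test_functions_scaleR_right[OF smooth_const \<phi>, of "axis i (1::real)"]]]
    by (simp_all add: L2_inner_def inner_axis mult.commute)
  then show ?thesis unfolding has_weak_grad_def by simp
qed

lemma wgrad:
  assumes "u \<in> L2 \<Omega>" "g \<in> L2 \<Omega>" "has_weak_grad \<Omega> u g"
  shows "wgrad \<Omega> u \<in> L2 \<Omega>" "has_weak_grad \<Omega> u (wgrad \<Omega> u)" "emb \<Omega> (wgrad \<Omega> u) = emb \<Omega> g"
proof -
  have "\<exists>g. g \<in> L2 \<Omega> \<and> has_weak_grad \<Omega> u g" using assms by blast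
  from someI_ex[OF this] show w: "wgrad \<Omega> u \<in> L2 \<Omega>" "has_weak_grad \<Omega> u (wgrad \<Omega> u)"
    by (auto simp: wgrad_def)
  have "emb \<Omega> (wgrad \<Omega> u) - emb \<Omega> g = 0"
  proof (rule eq_0_if_orthogonal_to_test_fields)
    show "cut \<Omega> (emb \<Omega> (wgrad \<Omega> u) - emb \<Omega> g) = emb \<Omega> (wgrad \<Omega> u) - emb \<Omega> g"
      by (simp add: cut_diff[OF \<Omega>_borel] cut_emb[OF \<Omega>_borel] w assms)
    show "(emb \<Omega> (wgrad \<Omega> u) - emb \<Omega> g) \<bullet> to_l2 (\<lambda>x. \<phi> x *\<^sub>R axis i (1::real)) = 0" if "\<phi> \<in> test_functions \<Omega>" for \<phi> i
      using w(2) assms(3) that has_weak_grad_iff[OF assms(1) w(1)] has_weak_grad_iff[OF assms(1,2)]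
      by (simp add: inner_diff)
  qed
  then show "emb \<Omega> (wgrad \<Omega> u) = emb \<Omega> g" by simp
qed

text \<open>Gradients of test functions are curl-free test fields, so every weak curl is orthogonal
  to them, and the orthogonality passes to the limit defining \<open>H1_0\<close>.\<close>

lemma H1_0_wgrad:
  assumes "u \<in> H1_0 \<Omega>"
  shows "wgrad \<Omega> u \<in> L2 \<Omega>" "(e, a) \<in> graph_curl \<Omega> \<Longrightarrow> a \<bullet> emb \<Omega> (wgrad \<Omega> u) = 0"
proof -
  obtain g \<phi> where u: "u \<in> L2 \<Omega>" and g: "g \<in> L2 \<Omega>" "has_weak_grad \<Omega> u g"
    and \<phi>: "\<And>k::nat. \<phi> k \<in> test_functions \<Omega>" "(\<lambda>k. H1_norm \<Omega> (\<lambda>x. \<phi> k x - u x)) \<longlonglongrightarrow> 0"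
    using assms by (auto simp: H1_0_def H1_def)
  note w = wgrad[OF u g]
  show "wgrad \<Omega> u \<in> L2 \<Omega>" by (rule w)
  assume ea: "(e, a) \<in> graph_curl \<Omega>"
  then have ac: "cut \<Omega> a = a" by (simp add: graph_curl_def)
  define D where "D k x = (\<chi> i. pd i (\<phi> k) x)" for k x
  have tD: "D k \<in> test_functions \<Omega>" for k
    unfolding D_def
  proof (rule test_functions_mapI[OF \<phi>(1)])
    show "smooth (\<lambda>x. \<chi> i. pd i (\<phi> k) x)" by (rule curl_grad_eq_0(2)[OF test_functions_smooth[OF \<phi>(1)]])
    fix x assume "x \<notin> closure {x. \<phi> k x \<noteq> 0}"
    then have "pd i (\<phi> k) x = 0" for i unfolding pd_def by (rule dderiv_zero_outside)
    then show "(\<chi> i. pd i (\<phi> k) x) = 0" by (simp add: vec_eq_iff)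
  qed
  note sD = test_sq[OF tD]
  note DL = L2_square_integrable(1)[OF \<Omega>_borel sD]
  have \<phi>L: "\<phi> k \<in> L2 \<Omega>" for k by (rule L2_square_integrable(1)[OF \<Omega>_borel test_sq[OF \<phi>(1)]])
  \<comment> \<open>The norm refers to the chosen weak gradient of the difference; by uniqueness
    this is the difference of the gradients almost everywhere.\<close>
  have le: "norm (emb \<Omega> (D k) - emb \<Omega> (wgrad \<Omega> u)) \<le> H1_norm \<Omega> (\<lambda>x. \<phi> k x - u x)" for k
  proof -
    have dL: "(\<lambda>x. \<phi> k x - u x) \<in> L2 \<Omega>" "(\<lambda>x. D k x - wgrad \<Omega> u x) \<in> L2 \<Omega>"
      by (intro L2_diff[OF \<Omega>_borel] \<phi>L u DL w)+
    have "has_weak_grad \<Omega> (\<phi> k) (D k)"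
      unfolding D_def by (rule smooth_has_weak_grad[OF test_functions_smooth[OF \<phi>(1)]])
    then have "has_weak_grad \<Omega> (\<lambda>x. \<phi> k x - u x) (\<lambda>x. D k x - wgrad \<Omega> u x)"
      using w(2) unfolding has_weak_grad_iff[OF dL] has_weak_grad_iff[OF \<phi>L DL] has_weak_grad_iff[OF u w(1)]
      by (simp add: emb_diff[OF \<Omega>_borel] \<phi>L u DL w inner_diff)
    note w' = wgrad[OF dL this]
    have "norm (emb \<Omega> (D k) - emb \<Omega> (wgrad \<Omega> u)) = L2_norm \<Omega> (wgrad \<Omega> (\<lambda>x. \<phi> k x - u x))"
      using w' by (simp add: L2_norm_emb[OF \<Omega>_borel] emb_diff[OF \<Omega>_borel] DL w)
    also have "\<dots> \<le> H1_norm \<Omega> (\<lambda>x. \<phi> k x - u x)"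
      unfolding H1_norm_def by (rule real_le_rsqrt) simp
    finally show ?thesis .
  qed
  have "(\<lambda>k. norm (emb \<Omega> (D k) - emb \<Omega> (wgrad \<Omega> u))) \<longlonglongrightarrow> 0"
    by (rule tendsto_sandwich[OF _ _ tendsto_const \<phi>(2)]) (auto intro!: always_eventually le)
  then have lim: "(\<lambda>k. emb \<Omega> (D k)) \<longlonglongrightarrow> emb \<Omega> (wgrad \<Omega> u)"
    by (simp add: tendsto_norm_zero_iff LIM_zero_iff)
  have "a \<bullet> emb \<Omega> (D k) = 0" for k
  proof -
    have "curl (D k) = (\<lambda>x. 0)"
      unfolding D_def by (rule ext) (rule curl_grad_eq_0(1)[OF test_functions_smooth[OF \<phi>(1)]])
    then have "a \<bullet> to_l2 (D k) = 0" using ea tD[of k] by (simp add: graph_curl_def zero_l2_def[symmetric])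
    then show ?thesis by (simp add: L2_square_integrable(2)[OF \<Omega>_borel sD] cut_sym[OF \<Omega>_borel, symmetric] ac)
  qed
  moreover have "(\<lambda>k. a \<bullet> emb \<Omega> (D k)) \<longlonglongrightarrow> a \<bullet> emb \<Omega> (wgrad \<Omega> u)" by (intro tendsto_intros lim)
  ultimately show "a \<bullet> emb \<Omega> (wgrad \<Omega> u) = 0" by (simp add: LIMSEQ_const_iff)
qed

end

section \<open>Integration in time\<close>

text \<open>The integral from 0 to \<open>t\<close>; for negative \<open>t\<close> the interval is
  empty and the value is 0.\<close>

definition prim :: "(real \<Rightarrow> 'h::{banach, second_countable_topology}) \<Rightarrow> real \<Rightarrow> 'h" where
  "prim f t = (LINT r|lborel. indicator {0..t} r *\<^sub>R f r)"

lemma square_integrable_interval: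
  "square_integrable f \<Longrightarrow> square_integrable (\<lambda>t. indicator {a..b::real} t *\<^sub>R f t)"
  by (rule square_integrable_indicator_scale) simp

lemma integrable_interval:
  "square_integrable f \<Longrightarrow> integrable lborel (\<lambda>t. indicator {a..b::real} t *\<^sub>R f t)"
  by (rule square_integrable_imp_integrable_bounded[OF square_integrable_interval, where B="{a..b}"]) auto

lemma integrable_interval_inner:
  assumes "square_integrable f" "square_integrable g"
  shows "integrable lborel (\<lambda>t. indicator {a..b::real} t *\<^sub>R (f t \<bullet> g t))"
  using square_integrable_inner[OF square_integrable_interval[OF assms(1), of a b] assms(2)] by simp

lemma prim_measurable [measurable]:
  assumes [measurable]: "f \<in> borel_measurable borel"
  shows "prim f \<in> borel_measurable borel"
proof -
  have "(\<lambda>(t, r). indicator {0..t} r *\<^sub>R f r) = (\<lambda>p. indicator {p. 0 \<le> snd p \<and> snd p \<le> fst p} p *\<^sub>R f (snd p))"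
    by (auto simp: fun_eq_iff indicator_def)
  moreover have "(\<lambda>p. indicator {p. 0 \<le> snd p \<and> snd p \<le> fst p} p *\<^sub>R f (snd p)) \<in> borel_measurable (lborel \<Otimes>\<^sub>M lborel)"
    by measurable
  ultimately have "(\<lambda>(t, r). indicator {0..t} r *\<^sub>R f r) \<in> borel_measurable (lborel \<Otimes>\<^sub>M lborel)" by simp
  then have "(\<lambda>t. LINT r|lborel. indicator {0..t} r *\<^sub>R f r) \<in> borel_measurable lborel"
    by (intro lborel.borel_measurable_lebesgue_integral)
  then show ?thesis by (simp add: prim_def[abs_def])
qed

lemma prim_cong: "(\<And>r. 0 \<le> r \<Longrightarrow> r \<le> t \<Longrightarrow> f r = g r) \<Longrightarrow> prim f t = prim g t"
  unfolding prim_def by (rule Bochner_Integration.integral_cong) (auto simp: indicator_def)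

lemma prim_cong_AE:
  assumes "f \<in> borel_measurable borel" "g \<in> borel_measurable borel"
    and "AE r\<in>{0..b} in lborel. f r = g r" "t \<le> b"
  shows "prim f t = prim g t"
  unfolding prim_def
  by (rule integral_cong_AE) (use assms in \<open>auto simp: indicator_def elim!: eventually_mono\<close>)

lemma prim_linear:
  assumes "bounded_linear L" "square_integrable f"
  shows "prim (\<lambda>t. L (f t)) t = L (prim f t)"
  unfolding prim_def
  by (subst integral_bounded_linear[OF assms(1) integrable_interval[OF assms(2)], symmetric])
    (simp add: linear_scale[OF bounded_linear.linear[OF assms(1)]])

lemma prim_inner: "square_integrable f \<Longrightarrow> prim f t \<bullet> c = prim (\<lambda>t. f t \<bullet> c) t"
  using prim_linear[OF bounded_linear_inner_left] by metis

lemma prim_diff: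
  assumes "square_integrable f" "square_integrable g"
  shows "prim (\<lambda>t. f t - g t) t = prim f t - prim g t"
  unfolding prim_def scaleR_diff_right
  by (intro Bochner_Integration.integral_diff integrable_interval assms)

lemma prim_tail:
  assumes "square_integrable f" "0 \<le> r" "r \<le> b"
  shows "(LINT t|lborel. indicator {r..b} t *\<^sub>R f t) = prim f b - prim f r"
proof -
  have "prim f b = (LINT t|lborel. indicator {0..r} t *\<^sub>R f t + indicator {r..b} t *\<^sub>R f t)"
    unfolding prim_def
  proof (rule integral_cong_AE)
    note [measurable] = square_integrable_measurable[OF assms(1)]
    have "AE t in lborel. t \<noteq> r" by (rule AE_lborel_singleton)
    then show "AE t in lborel. indicator {0..b} t *\<^sub>R f t = indicator {0..r} t *\<^sub>R f t + indicator {r..b} t *\<^sub>R f t"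
      by eventually_elim (use assms in \<open>auto simp: indicator_def\<close>)
  qed (use square_integrable_measurable[OF assms(1)] in auto)
  also have "\<dots> = prim f r + (LINT t|lborel. indicator {r..b} t *\<^sub>R f t)"
    unfolding prim_def by (intro Bochner_Integration.integral_add integrable_interval assms)
  finally show ?thesis by simp
qed

text \<open>Cauchy-Schwarz against the constant vector \<open>prim f t - prim f r\<close> on the
  interval, after which one factor of its squared norm cancels. The primitive is thus Hoelder
  continuous with exponent 1/2.\<close>

lemma power2_norm_prim_le:
  fixes f :: "real \<Rightarrow> 'h::{real_inner, banach, second_countable_topology}"
  assumes "square_integrable f" "0 \<le> r" "r \<le> t"
  shows "(norm (prim f t - prim f r))\<^sup>2 \<le> (t - r) * (LINT x|lborel. indicator {r..t} x *\<^sub>R (norm (f x))\<^sup>2)"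
proof -
  define v where "v = prim f t - prim f r"
  have i: "integrable lborel (\<lambda>x. indicator {r..t} x *\<^sub>R f x)" by (rule integrable_interval[OF assms(1)])
  have sq1: "square_integrable (\<lambda>x. indicator {r..t} x *\<^sub>R v)" by (rule square_integrable_indicator) (use assms in auto)
  have sqf: "square_integrable (\<lambda>x. indicator {r..t} x *\<^sub>R f x)" by (rule square_integrable_interval[OF assms(1)])
  have "(norm v)\<^sup>2 = (LINT x|lborel. indicator {r..t} x *\<^sub>R f x) \<bullet> v"
    unfolding power2_norm_eq_inner by (simp add: v_def prim_tail[OF assms])
  also have "\<dots> = (LINT x|lborel. (indicator {r..t} x *\<^sub>R f x) \<bullet> v)"
    by (rule integral_inner_left[symmetric]) (rule i)
  also have "\<dots> = (LINT x|lborel. (indicator {r..t} x *\<^sub>R f x) \<bullet> (indicator {r..t} x *\<^sub>R v))"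
    by (rule Bochner_Integration.integral_cong) (auto simp: indicator_def)
  also have "\<dots> = to_l2 (\<lambda>x. indicator {r..t} x *\<^sub>R f x) \<bullet> to_l2 (\<lambda>x. indicator {r..t} x *\<^sub>R v)"
    by (rule inner_to_l2[OF sqf sq1, symmetric])
  also have "\<dots> \<le> norm (to_l2 (\<lambda>x. indicator {r..t} x *\<^sub>R f x)) * norm (to_l2 (\<lambda>x. indicator {r..t} x *\<^sub>R v))"
    by (rule norm_cauchy_schwarz)
  finally have "((norm v)\<^sup>2)\<^sup>2 \<le> (norm (to_l2 (\<lambda>x. indicator {r..t} x *\<^sub>R f x)))\<^sup>2 * (norm (to_l2 (\<lambda>x. indicator {r..t} x *\<^sub>R v)))\<^sup>2"
    unfolding power_mult_distrib[symmetric] by (intro power_mono) auto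
  also have "(norm (to_l2 (\<lambda>x. indicator {r..t} x *\<^sub>R v)))\<^sup>2 = (t - r) * (norm v)\<^sup>2"
  proof -
    have "(\<lambda>x. (norm (indicator {r..t} x *\<^sub>R v))\<^sup>2) = (\<lambda>x. indicator {r..t} x * (norm v)\<^sup>2)"
      by (auto simp: indicator_def fun_eq_iff)
    then show ?thesis using assms by (simp add: power2_norm_to_l2[OF sq1])
  qed
  also have "(norm (to_l2 (\<lambda>x. indicator {r..t} x *\<^sub>R f x)))\<^sup>2 = (LINT x|lborel. indicator {r..t} x *\<^sub>R (norm (f x))\<^sup>2)"
    unfolding power2_norm_to_l2[OF sqf] by (rule Bochner_Integration.integral_cong) (auto simp: indicator_def)
  finally have le: "(norm v)\<^sup>2 * (norm v)\<^sup>2 \<le> ((t - r) * (LINT x|lborel. indicator {r..t} x *\<^sub>R (norm (f x))\<^sup>2)) * (norm v)\<^sup>2"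
    by (simp add: power2_eq_square mult_ac)
  show ?thesis
  proof (cases "v = 0")
    case True
    then show ?thesis using assms by (auto simp: v_def[symmetric] intro!: mult_nonneg_nonneg)
  next
    case False
    then show ?thesis unfolding v_def[symmetric] by (intro mult_right_le_imp_le[OF le]) simp
  qed
qed

lemma prim_tendsto:
  fixes f :: "real \<Rightarrow> 'h::{real_inner, banach, second_countable_topology}"
  assumes "square_integrable f" "t \<in> {0..b}"
  shows "(prim f \<longlongrightarrow> prim f t) (at t within {0..b})"
proof -
  define C where "C = (LINT x|lborel. (norm (f x))\<^sup>2)"
  have i: "integrable lborel (\<lambda>x. (norm (f x))\<^sup>2)" using assms(1) by (simp add: square_integrable_def)
  have C: "(LINT x|lborel. indicator {r..s} x *\<^sub>R (norm (f x))\<^sup>2) \<le> C" for r s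
    unfolding C_def using i by (intro integral_mono integrable_mult_indicator) (auto simp: indicator_def)
  have C0: "C \<ge> 0" unfolding C_def by simp
  have le: "(norm (prim f s - prim f t))\<^sup>2 \<le> \<bar>s - t\<bar> * C" if "s \<in> {0..b}" for s
  proof (cases "s \<le> t")
    case True
    have "(norm (prim f t - prim f s))\<^sup>2 \<le> (t - s) * (LINT x|lborel. indicator {s..t} x *\<^sub>R (norm (f x))\<^sup>2)"
      using that True by (intro power2_norm_prim_le assms) auto
    also have "\<dots> \<le> (t - s) * C" using True by (intro mult_left_mono C) auto
    finally show ?thesis using True by (simp add: norm_minus_commute)
  next
    case False
    have "(norm (prim f s - prim f t))\<^sup>2 \<le> (s - t) * (LINT x|lborel. indicator {t..s} x *\<^sub>R (norm (f x))\<^sup>2)"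
      using assms(2) False by (intro power2_norm_prim_le assms) auto
    also have "\<dots> \<le> (s - t) * C" using False by (intro mult_left_mono C) auto
    finally show ?thesis using False by simp
  qed
  have "((\<lambda>s. norm (prim f s - prim f t)) \<longlongrightarrow> 0) (at t within {0..b})"
  proof (rule tendsto_sandwich[of "\<lambda>_. 0" "\<lambda>s. norm (prim f s - prim f t)" _ "\<lambda>s. sqrt (\<bar>s - t\<bar> * C)"])
    show "((\<lambda>s. sqrt (\<bar>s - t\<bar> * C)) \<longlongrightarrow> 0) (at t within {0..b})"
      by (rule tendsto_eq_intros refl | simp)+
    show "\<forall>\<^sub>F s in at t within {0..b}. norm (prim f s - prim f t) \<le> sqrt (\<bar>s - t\<bar> * C)"
      unfolding eventually_at_filter using le by (intro always_eventually) (auto intro: real_le_rsqrt)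
    show "\<forall>\<^sub>F s in at t within {0..b}. 0 \<le> norm (prim f s - prim f t)" by simp
  qed (rule tendsto_const)
  then show ?thesis by (simp add: tendsto_norm_zero_iff LIM_zero_iff)
qed

lemma square_integrable_interval_bounded:
  fixes f :: "real \<Rightarrow> 'h::{real_inner, banach, second_countable_topology}"
  assumes "f \<in> borel_measurable borel" "\<And>t. t \<in> {a..b} \<Longrightarrow> norm (f t) \<le> C"
  shows "square_integrable (\<lambda>t. indicator {a..b} t *\<^sub>R f t)"
proof (rule square_integrable_bound[OF square_integrable_indicator[of "{a..b}" "1::real"], where C=C])
  show "AE x in lborel. norm (indicator {a..b} x *\<^sub>R f x) \<le> C * norm (indicator {a..b} x *\<^sub>R (1::real))"
    using assms(2) by (auto simp: indicator_def)
qed (use assms(1) in \<open>auto simp: emeasure_lborel_Icc_eq\<close>)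

lemma square_integrable_prim:
  fixes f :: "real \<Rightarrow> 'h::{real_inner, banach, second_countable_topology}"
  assumes "square_integrable f" shows "square_integrable (\<lambda>t. indicator {0..b} t *\<^sub>R prim f t)"
proof -
  have "continuous_on {0..b} (prim f)" unfolding continuous_on_def using prim_tendsto[OF assms] by blast
  then have "bounded (prim f ` {0..b})" by (intro compact_imp_bounded compact_continuous_image) auto
  then obtain C where "\<forall>x\<in>prim f ` {0..b}. norm x \<le> C" by (auto simp: bounded_iff)
  then show ?thesis
    using square_integrable_measurable[OF assms] by (intro square_integrable_interval_bounded[where C=C] prim_measurable) auto
qed

lemma square_integrable_interval_continuous:
  fixes f :: "real \<Rightarrow> 'h::{real_inner, banach, second_countable_topology}"
  assumes "continuous_on UNIV f" shows "square_integrable (\<lambda>t. indicator {a..b} t *\<^sub>R f t)"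
proof -
  have "bounded (f ` {a..b})"
    using assms continuous_on_subset by (intro compact_imp_bounded compact_continuous_image) auto
  then obtain C where "\<forall>x\<in>f ` {a..b}. norm x \<le> C" by (auto simp: bounded_iff)
  then show ?thesis
    by (intro square_integrable_interval_bounded[where C=C] borel_measurable_continuous_onI assms) auto
qed

text \<open>Fubini on a triangle, with the indicator of the half-line as kernel. This is integration
  by parts for primitives of functions that are merely square integrable.\<close>

lemma integral_prim_inner:
  fixes f g :: "real \<Rightarrow> 'h::{real_inner, banach, second_countable_topology}"
  assumes f: "square_integrable f" and g: "square_integrable g"
  shows "(LINT t|lborel. indicator {0..b} t *\<^sub>R (prim f t \<bullet> g t))
    = (LINT r|lborel. indicator {0..b} r *\<^sub>R (f r \<bullet> (prim g b - prim g r)))"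
proof -
  define f' where "f' t = indicator {0..b} t *\<^sub>R f t" for t
  define g' where "g' t = indicator {0..b} t *\<^sub>R g t" for t
  have L: "integrable lborel f'" "integrable lborel g'"
    unfolding f'_def g'_def by (rule integrable_interval[OF f], rule integrable_interval[OF g])
  let ?\<rho> = "indicator {0..} :: real \<Rightarrow> real"
  have "integrable (lborel \<Otimes>\<^sub>M lborel) (\<lambda>(x, y). ?\<rho> (x - y) * (g' x \<bullet> f' y))"
    by (rule mollifier_swap(1)[OF L(2,1), where C=1]) auto
  from lborel_pair.Fubini_integral[OF this]
  have "(LINT x|lborel. LINT y|lborel. ?\<rho> (x - y) * (g' x \<bullet> f' y)) = (LINT y|lborel. LINT x|lborel. ?\<rho> (x - y) * (g' x \<bullet> f' y))"
    by simp
  moreover have "(LINT y|lborel. ?\<rho> (x - y) * (g' x \<bullet> f' y)) = indicator {0..b} x *\<^sub>R (prim f x \<bullet> g x)" for x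
  proof (cases "x \<in> {0..b}")
    case True
    have "(LINT y|lborel. ?\<rho> (x - y) * (g' x \<bullet> f' y)) = (LINT y|lborel. (indicator {0..x} y *\<^sub>R f y) \<bullet> g x)"
      using True by (intro Bochner_Integration.integral_cong) (auto simp: indicator_def f'_def g'_def inner_commute)
    also have "\<dots> = prim f x \<bullet> g x"
      unfolding prim_def by (rule integral_inner_left) (rule integrable_interval[OF f])
    finally show ?thesis using True by simp
  qed (simp add: g'_def)
  moreover have "(LINT x|lborel. ?\<rho> (x - y) * (g' x \<bullet> f' y)) = indicator {0..b} y *\<^sub>R (f y \<bullet> (prim g b - prim g y))" for y
  proof (cases "y \<in> {0..b}")
    case True
    have "(LINT x|lborel. ?\<rho> (x - y) * (g' x \<bullet> f' y)) = (LINT x|lborel. (indicator {y..b} x *\<^sub>R g x) \<bullet> f y)"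
      using True by (intro Bochner_Integration.integral_cong) (auto simp: indicator_def f'_def g'_def inner_commute)
    also have "\<dots> = (prim g b - prim g y) \<bullet> f y"
      using True by (subst integral_inner_left) (auto simp: prim_tail[OF g] intro: integrable_interval[OF g])
    finally show ?thesis using True by (simp add: inner_commute)
  qed (simp add: f'_def)
  ultimately show ?thesis by simp
qed

section \<open>The abstract evolution problem\<close>

text \<open>The set \<open>G\<close> stands for the graph of the curl, \<open>s\<close> for
  multiplication by \<open>\<sigma>\<close> and \<open>m\<close> for multiplication by
  \<open>\<mu>\<close>. All operator bounds come from \<open>\<Lambda>\<close>, so that the final
  constant can depend on \<open>\<Lambda>\<close> and the length of the time interval only.\<close>

locale evolution =
  fixes G :: "('h::{real_inner, banach, second_countable_topology} \<times> 'h) set"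
    and s m :: "'h \<Rightarrow> 'h" and \<Lambda> :: real
  assumes subspace_G: "subspace G" and closed_G: "closed G"
    and G_unique: "\<And>a. (0, a) \<in> G \<Longrightarrow> a = 0"
    and \<Lambda>: "\<Lambda> \<ge> 1"
    and s_linear: "bounded_linear s" and s_sym: "\<And>x y. s x \<bullet> y = x \<bullet> s y"
    and s_lower: "\<And>x. inverse \<Lambda> * (norm x)\<^sup>2 \<le> s x \<bullet> x" and s_upper: "\<And>x. s x \<bullet> x \<le> \<Lambda> * (norm x)\<^sup>2"
    and m_linear: "bounded_linear m" and m_sym: "\<And>x y. m x \<bullet> y = x \<bullet> m y"
    and m_lower: "\<And>x. inverse \<Lambda> * (norm x)\<^sup>2 \<le> m x \<bullet> x" and m_upper: "\<And>x. m x \<bullet> x \<le> \<Lambda> * (norm x)\<^sup>2"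

text \<open>The form is evaluated at \<open>x - c *\<^sub>R s x\<close> with
  \<open>c = inverse \<Lambda>\<close>. This turns an upper bound on the quadratic form into a norm
  bound with the same constant; used at a preimage under \<open>m\<close>, it yields the lower bound
  for the inverse.\<close>

lemma symmetric_form_bound:
  fixes s :: "'h::real_inner \<Rightarrow> 'h"
  assumes "\<Lambda> > 0" "bounded_linear s" "\<And>x y. s x \<bullet> y = x \<bullet> s y" "\<And>x. 0 \<le> s x \<bullet> x" "\<And>x. s x \<bullet> x \<le> \<Lambda> * (norm x)\<^sup>2"
  shows "(norm (s x))\<^sup>2 \<le> \<Lambda> * (s x \<bullet> x)"
proof -
  define c where "c = inverse \<Lambda>"
  have c: "c > 0" "c * \<Lambda> = 1" using assms(1) by (auto simp: c_def)
  note lin = bounded_linear.linear[OF assms(2)]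
  have "0 \<le> s (x - c *\<^sub>R s x) \<bullet> (x - c *\<^sub>R s x)" by (rule assms(4))
  also have "\<dots> = s x \<bullet> x - 2 * c * (s x \<bullet> s x) + c\<^sup>2 * (s (s x) \<bullet> s x)"
    using assms(3)[of x "s x"] assms(3)[of "s x" x]
    by (simp add: linear_diff[OF lin] linear_scale[OF lin] inner_diff power2_eq_square algebra_simps inner_commute)
  also have "\<dots> \<le> s x \<bullet> x - 2 * c * (s x \<bullet> s x) + c\<^sup>2 * (\<Lambda> * (norm (s x))\<^sup>2)"
    using assms(5)[of "s x"] by (intro add_left_mono mult_left_mono) auto
  also have "c\<^sup>2 * (\<Lambda> * (norm (s x))\<^sup>2) = c * (s x \<bullet> s x)"
    using c(2) by (simp add: power2_eq_square power2_norm_eq_inner[unfolded power2_eq_square] mult.assoc[symmetric])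
  finally have "c * (s x \<bullet> s x) \<le> s x \<bullet> x" by (simp add: algebra_simps)
  then have "\<Lambda> * (c * (s x \<bullet> s x)) \<le> \<Lambda> * (s x \<bullet> x)" using assms(1) by (intro mult_left_mono) auto
  then show ?thesis using c(2) by (simp add: power2_norm_eq_inner mult.assoc[symmetric] mult.commute)
qed

context evolution
begin

lemma \<Lambda>_pos: "\<Lambda> > 0" and inverse_\<Lambda>_pos: "inverse \<Lambda> > 0"
  using \<Lambda> by auto

lemma s_nonneg: "0 \<le> s x \<bullet> x"
  using s_lower[of x] inverse_\<Lambda>_pos by (meson mult_nonneg_nonneg order_trans less_imp_le zero_le_power2)

lemma m_nonneg: "0 \<le> m x \<bullet> x"
  using m_lower[of x] inverse_\<Lambda>_pos by (meson mult_nonneg_nonneg order_trans less_imp_le zero_le_power2)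

lemma norm_s_le: "norm (s x) \<le> \<Lambda> * norm x"
proof -
  have "(norm (s x))\<^sup>2 \<le> \<Lambda> * (\<Lambda> * (norm x)\<^sup>2)"
    using symmetric_form_bound[OF \<Lambda>_pos s_linear s_sym s_nonneg s_upper, of x] s_upper[of x] \<Lambda>_pos
    by (meson mult_left_mono order_trans less_imp_le)
  then have "(norm (s x))\<^sup>2 \<le> (\<Lambda> * norm x)\<^sup>2" by (simp add: power2_eq_square mult_ac)
  then show ?thesis by (rule power2_le_imp_le) (use \<Lambda>_pos in simp)
qed

lemma coercive_le: "inverse \<Lambda> * (norm x)\<^sup>2 \<le> y \<bullet> x \<Longrightarrow> norm x \<le> \<Lambda> * norm y"
proof -
  assume "inverse \<Lambda> * (norm x)\<^sup>2 \<le> y \<bullet> x"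
  also have "\<dots> \<le> norm y * norm x" by (rule norm_cauchy_schwarz)
  finally have "\<Lambda> * (inverse \<Lambda> * (norm x)\<^sup>2) \<le> \<Lambda> * (norm y * norm x)"
    using \<Lambda>_pos by (intro mult_left_mono) auto
  then have "norm x * norm x \<le> (\<Lambda> * norm y) * norm x"
    using \<Lambda>_pos by (simp add: power2_eq_square mult.assoc[symmetric])
  then show ?thesis using \<Lambda>_pos by (cases "x = 0") (auto simp: mult_le_cancel_right)
qed

text \<open>Coercivity bounds the functional \<open>m x \<mapsto> y \<bullet> x\<close> on the range
  of \<open>m\<close>, and by symmetry its representing vector is a preimage of
  \<open>y\<close>.\<close>

lemma m_surj: "\<exists>x. m x = y"
proof -
  let ?R = "(\<lambda>x. (m x, y \<bullet> x)) ` UNIV"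
  have "linear (\<lambda>x. (m x, y \<bullet> x))"
    by (rule linearI) (auto simp: linear_add[OF bounded_linear.linear[OF m_linear]]
        linear_scale[OF bounded_linear.linear[OF m_linear]] inner_add)
  then have sub: "subspace ?R" by (rule linear_subspace_image) (rule subspace_UNIV)
  have bd: "\<bar>l\<bar> \<le> (norm y * \<Lambda>) * norm v" if vl: "(v, l) \<in> ?R" for v l
  proof -
    obtain x where "(v, l) = (m x, y \<bullet> x)" using vl by blast
    then have x: "v = m x" "l = y \<bullet> x" by simp_all
    have "\<bar>l\<bar> \<le> norm y * norm x" unfolding x(2) by (rule Cauchy_Schwarz_ineq2)
    also have "\<dots> \<le> norm y * (\<Lambda> * norm v)"
      unfolding x(1) by (intro mult_left_mono coercive_le m_lower) auto
    finally show ?thesis by (simp add: mult.assoc)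
  qed
  obtain u where u: "\<And>v l. (v, l) \<in> ?R \<Longrightarrow> u \<bullet> v = l"
    by (rule hilbert_representation[OF sub bd]) (use \<Lambda>_pos in auto)
  have "m u \<bullet> x = y \<bullet> x" for x using u[of "m x" "y \<bullet> x"] m_sym by simp
  then have "(m u - y) \<bullet> (m u - y) = 0" by (simp only: inner_diff_left)
  then show ?thesis by (intro exI[of _ u]) simp
qed

definition mi :: "'h \<Rightarrow> 'h" where "mi y = (SOME x. m x = y)"

lemma m_mi [simp]: "m (mi y) = y"
  unfolding mi_def by (rule someI_ex[OF m_surj])

lemma m_inj: "m x = m y \<Longrightarrow> x = y"
  using coercive_le[OF m_lower, of "x - y"] by (simp add: linear_diff[OF bounded_linear.linear[OF m_linear]])

lemma mi_m [simp]: "mi (m x) = x"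
  by (rule m_inj) simp

lemma norm_mi_le: "norm (mi y) \<le> \<Lambda> * norm y"
  using coercive_le[OF m_lower, of "mi y"] by simp

lemma mi_linear: "bounded_linear mi"
proof (rule bounded_linear_intro)
  show "mi (x + y) = mi x + mi y" for x y
    by (rule m_inj) (simp add: linear_add[OF bounded_linear.linear[OF m_linear]])
  show "mi (c *\<^sub>R x) = c *\<^sub>R mi x" for c x
    by (rule m_inj) (simp add: linear_scale[OF bounded_linear.linear[OF m_linear]])
  show "norm (mi x) \<le> norm x * \<Lambda>" for x using norm_mi_le[of x] by (simp add: mult.commute)
qed

lemma mi_sym: "mi x \<bullet> y = x \<bullet> mi y"
  using m_sym[of "mi x" "mi y"] by simp

lemma mi_lower: "inverse \<Lambda> * (norm y)\<^sup>2 \<le> mi y \<bullet> y"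
proof -
  have "(norm y)\<^sup>2 \<le> \<Lambda> * (mi y \<bullet> y)"
    using symmetric_form_bound[OF \<Lambda>_pos m_linear m_sym m_nonneg m_upper, of "mi y"] by (simp add: inner_commute)
  then show ?thesis using \<Lambda>_pos by (simp add: field_simps)
qed

definition adj :: "('h \<times> 'h) set" where
  "adj = {(h, k). \<forall>(e, a)\<in>G. h \<bullet> a = k \<bullet> e}"

lemma adjD: "(h, k) \<in> adj \<Longrightarrow> (e, a) \<in> G \<Longrightarrow> h \<bullet> a = k \<bullet> e"
  by (auto simp: adj_def)

lemma adj_diff: "(h, k) \<in> adj \<Longrightarrow> (h', k') \<in> adj \<Longrightarrow> (h - h', k - k') \<in> adj"
  by (force simp: adj_def inner_diff)

text \<open>Countably many pairs suffice to test membership in \<open>adj\<close>.\<close>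

lemma AE_adjI:
  assumes "\<And>e a. (e, a) \<in> G \<Longrightarrow> AE t in M. t \<in> S \<longrightarrow> h t \<bullet> a = k t \<bullet> e"
  shows "AE t in M. t \<in> S \<longrightarrow> (h t, k t) \<in> adj"
proof -
  obtain D :: "('h \<times> 'h) set" where D: "countable D" "\<And>X. open X \<Longrightarrow> X \<noteq> {} \<Longrightarrow> \<exists>d\<in>D. d \<in> X"
    by (rule countable_dense_setE) blast
  \<comment> \<open>Projecting a countable dense set of the whole product to \<open>G\<close> gives
    the test pairs; continuity of the projection carries the identity to all of
    \<open>G\<close>.\<close>
  have "AE t in M. \<forall>d\<in>D. t \<in> S \<longrightarrow> h t \<bullet> snd (proj G d) = k t \<bullet> fst (proj G d)"
    unfolding AE_ball_countable[OF D(1)]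
    using proj_in[OF subspace_G closed_G] assms by (metis prod.collapse)
  then show ?thesis
  proof eventually_elim
    fix t assume *: "\<forall>d\<in>D. t \<in> S \<longrightarrow> h t \<bullet> snd (proj G d) = k t \<bullet> fst (proj G d)"
    show "t \<in> S \<longrightarrow> (h t, k t) \<in> adj"
    proof
      assume "t \<in> S"
      have cp: "continuous_on UNIV (proj G)" by (intro linear_continuous_on bounded_linear_proj subspace_G closed_G)
      have "open {w. h t \<bullet> snd (proj G w) \<noteq> k t \<bullet> fst (proj G w)}"
        by (intro open_Collect_neq continuous_on_inner continuous_on_const continuous_on_fst continuous_on_snd cp)
      then have all: "h t \<bullet> snd (proj G w) = k t \<bullet> fst (proj G w)" for w
        using D(2)[of "{w. h t \<bullet> snd (proj G w) \<noteq> k t \<bullet> fst (proj G w)}"] * \<open>t \<in> S\<close> by blast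
      then show "(h t, k t) \<in> adj"
        unfolding adj_def
      proof safe
        fix e a assume "(e, a) \<in> G"
        then have "proj G (e, a) = (e, a)" by (rule proj_id[OF subspace_G closed_G])
        then show "h t \<bullet> a = k t \<bullet> e" using all[of "(e, a)"] by simp
      qed
    qed
  qed
qed

text \<open>Lions' projection argument. A smooth \<open>G\<close>-valued function \<open>\<phi>\<close> is tested with \<open>(1 + t) \<phi>\<close>,
  and with \<open>(1 + b) s \<phi>(b)\<close> for the terminal value, which yields coercivity without Gronwall's lemma.
  The unknown \<open>z\<close> represents \<open>s E(b)\<close>; carrying it along bounds \<open>E\<close> uniformly in time.\<close>

definition C1 :: "(real \<Rightarrow> 'h \<times> 'h) \<Rightarrow> (real \<Rightarrow> 'h \<times> 'h) \<Rightarrow> bool" where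
  "C1 \<phi> \<phi>' \<longleftrightarrow> (\<forall>t. (\<phi> has_vector_derivative \<phi>' t) (at t)) \<and> continuous_on UNIV \<phi>' \<and> (\<forall>t. \<phi> t \<in> G)"

lemma C1_continuous: "C1 \<phi> \<phi>' \<Longrightarrow> continuous_on UNIV \<phi>" "C1 \<phi> \<phi>' \<Longrightarrow> continuous_on UNIV \<phi>'"
  unfolding C1_def by (auto intro: continuous_at_imp_continuous_on has_vector_derivative_continuous)

text \<open>What acts on a test function \<open>(e, c)\<close> once the time derivative has been
  moved off the unknown: pairing with \<open>(E, a)\<close> gives
  \<open>- (E \<bullet> s e') + a \<bullet> mi c\<close>.\<close>

definition dual_op :: "(real \<Rightarrow> 'h \<times> 'h) \<Rightarrow> (real \<Rightarrow> 'h \<times> 'h) \<Rightarrow> real \<Rightarrow> 'h \<times> 'h" where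
  "dual_op \<phi> \<phi>' t = (- s (fst (\<phi>' t)), mi (snd (\<phi> t)))"

lemma dual_op_continuous: "C1 \<phi> \<phi>' \<Longrightarrow> continuous_on UNIV (dual_op \<phi> \<phi>')"
  unfolding dual_op_def
  by (intro continuous_intros bounded_linear.continuous_on[OF s_linear] bounded_linear.continuous_on[OF mi_linear] C1_continuous)

definition sqnorm :: "real \<Rightarrow> (real \<Rightarrow> 'h \<times> 'h) \<Rightarrow> real" where
  "sqnorm b \<phi> = (LINT t|lborel. indicator {0..b} t *\<^sub>R (norm (\<phi> t))\<^sup>2)"

text \<open>Differentiating the weighted energy \<open>Q\<close> leaves half of the unweighted form
  \<open>q\<close>, so the integral controls the first component as well as the second. It also
  leaves \<open>- Q b\<close>; the extra pairing at time \<open>b\<close> equals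
  \<open>2 * Q b\<close> and makes this term favourable.\<close>

lemma energy_identity:
  assumes \<phi>: "C1 \<phi> \<phi>'" and b: "0 \<le> b"
  shows "(norm (fst (\<phi> 0)))\<^sup>2 + (norm (fst (\<phi> b)))\<^sup>2 + sqnorm b \<phi>
    \<le> 2 * \<Lambda> * ((LINT t|lborel. indicator {0..b} t *\<^sub>R (dual_op \<phi> \<phi>' t \<bullet> ((1 + t) *\<^sub>R \<phi> t)))
        + fst (\<phi> b) \<bullet> ((1 + b) *\<^sub>R s (fst (\<phi> b))))"
proof -
  define q where "q t = s (fst (\<phi> t)) \<bullet> fst (\<phi> t)" for t
  define p where "p t = mi (snd (\<phi> t)) \<bullet> snd (\<phi> t)" for t
  define Q where "Q t = (1 + t) * q t / 2" for t
  note cont = C1_continuous[OF \<phi>]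
  have cs: "continuous_on A (\<lambda>t. s (f t))" if "continuous_on A f" for A and f :: "real \<Rightarrow> 'h"
    using that by (rule bounded_linear.continuous_on[OF s_linear])
  have cmi: "continuous_on A (\<lambda>t. mi (f t))" if "continuous_on A f" for A and f :: "real \<Rightarrow> 'h"
    using that by (rule bounded_linear.continuous_on[OF mi_linear])
  have dq: "(q has_real_derivative 2 * (s (fst (\<phi>' t)) \<bullet> fst (\<phi> t))) (at t)" for t
  proof -
    have "((\<lambda>t. fst (\<phi> t)) has_vector_derivative fst (\<phi>' t)) (at t)"
      using \<phi> bounded_linear.has_vector_derivative[OF bounded_linear_fst, of \<phi> "\<phi>' t" "at t"] by (simp add: C1_def)
    moreover from this have "((\<lambda>t. s (fst (\<phi> t))) has_vector_derivative s (fst (\<phi>' t))) (at t)"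
      by (rule bounded_linear.has_vector_derivative[OF s_linear])
    ultimately have "(q has_vector_derivative (s (fst (\<phi> t)) \<bullet> fst (\<phi>' t) + s (fst (\<phi>' t)) \<bullet> fst (\<phi> t))) (at t)"
      unfolding q_def by (intro bounded_bilinear.has_vector_derivative[OF bounded_bilinear_inner])
    moreover have "s (fst (\<phi> t)) \<bullet> fst (\<phi>' t) = s (fst (\<phi>' t)) \<bullet> fst (\<phi> t)" by (metis s_sym inner_commute)
    ultimately show ?thesis by (simp add: has_real_derivative_iff_has_vector_derivative)
  qed
  have dQ: "(Q has_real_derivative q t / 2 + (1 + t) * (s (fst (\<phi>' t)) \<bullet> fst (\<phi> t))) (at t)" for t
    unfolding Q_def by (rule derivative_eq_intros dq refl | simp add: algebra_simps)+
  define R where "R t = q t / 2 + (1 + t) * (s (fst (\<phi>' t)) \<bullet> fst (\<phi> t))" for t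
  have cR: "continuous_on A R" "continuous_on A q" "continuous_on A p" for A
    unfolding R_def q_def p_def
    by (intro continuous_intros cs cmi continuous_on_subset[OF cont(1)] continuous_on_subset[OF cont(2)]; simp)+
  have FTC: "(LINT t|lborel. indicator {0..b} t *\<^sub>R R t) = Q b - Q 0"
  proof -
    have "isCont R t" for t using cR(1)[of UNIV] by (simp add: continuous_on_eq_continuous_at)
    moreover have "(Q has_real_derivative R t) (at t)" for t using dQ[of t] by (simp add: R_def)
    ultimately have "has_bochner_integral lborel (\<lambda>t. R t * indicator {0..b} t) (Q b - Q 0)"
      using has_bochner_integral_FTC_Icc_real[OF b, of Q R] by (simp add: mult.commute)
    then show ?thesis by (simp add: has_bochner_integral_integral_eq mult.commute)
  qed
  have int: "integrable lborel (\<lambda>t. indicator {0..b} t *\<^sub>R f t)" if "continuous_on {0..b} f" for f :: "real \<Rightarrow> real"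
    using borel_integrable_compact[OF _ that] by simp
  have pointwise: "dual_op \<phi> \<phi>' t \<bullet> ((1 + t) *\<^sub>R \<phi> t) = q t / 2 + (1 + t) * p t - R t" for t
    by (simp add: dual_op_def inner_prod_def R_def p_def algebra_simps)
  have "(LINT t|lborel. indicator {0..b} t *\<^sub>R (dual_op \<phi> \<phi>' t \<bullet> ((1 + t) *\<^sub>R \<phi> t)))
      = (LINT t|lborel. indicator {0..b} t *\<^sub>R (q t / 2 + (1 + t) * p t) - indicator {0..b} t *\<^sub>R R t)"
    unfolding pointwise scaleR_diff_right ..
  also have "\<dots> = (LINT t|lborel. indicator {0..b} t *\<^sub>R (q t / 2 + (1 + t) * p t)) - (Q b - Q 0)"
    unfolding FTC[symmetric] by (intro Bochner_Integration.integral_diff int continuous_intros cR) simp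
  finally have "(LINT t|lborel. indicator {0..b} t *\<^sub>R (dual_op \<phi> \<phi>' t \<bullet> ((1 + t) *\<^sub>R \<phi> t)))
      = (LINT t|lborel. indicator {0..b} t *\<^sub>R (q t / 2 + (1 + t) * p t)) - (Q b - Q 0)" .
  moreover have "fst (\<phi> b) \<bullet> ((1 + b) *\<^sub>R s (fst (\<phi> b))) = 2 * Q b"
    by (simp add: Q_def q_def inner_commute)
  ultimately have eq: "(LINT t|lborel. indicator {0..b} t *\<^sub>R (dual_op \<phi> \<phi>' t \<bullet> ((1 + t) *\<^sub>R \<phi> t))) + fst (\<phi> b) \<bullet> ((1 + b) *\<^sub>R s (fst (\<phi> b)))
      = (LINT t|lborel. indicator {0..b} t *\<^sub>R (q t / 2 + (1 + t) * p t)) + Q b + Q 0"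
    by linarith
  have "sqnorm b \<phi> \<le> (LINT t|lborel. indicator {0..b} t *\<^sub>R (2 * \<Lambda> * (q t / 2 + (1 + t) * p t)))"
    unfolding sqnorm_def
  proof (intro integral_mono int continuous_intros cR continuous_on_subset[OF cont(1)])
    fix t :: real
    have 1: "inverse \<Lambda> * (norm (fst (\<phi> t)))\<^sup>2 \<le> q t" "inverse \<Lambda> * (norm (snd (\<phi> t)))\<^sup>2 \<le> p t"
      unfolding q_def p_def by (rule s_lower, rule mi_lower)
    have 2: "(norm (fst (\<phi> t)))\<^sup>2 \<le> \<Lambda> * q t" "(norm (snd (\<phi> t)))\<^sup>2 \<le> \<Lambda> * p t"
      using 1 \<Lambda>_pos by (auto simp: field_simps)
    have p0: "0 \<le> \<Lambda> * p t" using 2(2) by (meson order_trans zero_le_power2)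
    have "(norm (\<phi> t))\<^sup>2 \<le> 2 * \<Lambda> * (q t / 2 + (1 + t) * p t)" if "0 \<le> t"
    proof -
      have "(norm (\<phi> t))\<^sup>2 = (norm (fst (\<phi> t)))\<^sup>2 + (norm (snd (\<phi> t)))\<^sup>2"
        by (simp add: norm_prod_def)
      also have "\<dots> \<le> \<Lambda> * q t + \<Lambda> * p t" using 2 by simp
      also have "\<dots> \<le> \<Lambda> * q t + (2 + 2 * t) * (\<Lambda> * p t)"
        using p0 that mult_right_mono[of 1 "2 + 2 * t" "\<Lambda> * p t"] by simp
      finally show ?thesis by (simp add: algebra_simps)
    qed
    then show "indicator {0..b} t *\<^sub>R (norm (\<phi> t))\<^sup>2 \<le> indicator {0..b} t *\<^sub>R (2 * \<Lambda> * (q t / 2 + (1 + t) * p t))"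
      by (auto simp: indicator_def)
  qed simp_all
  also have "\<dots> = 2 * \<Lambda> * (LINT t|lborel. indicator {0..b} t *\<^sub>R (q t / 2 + (1 + t) * p t))"
    by (subst integral_mult_right_zero[symmetric], rule Bochner_Integration.integral_cong) (auto simp: indicator_def)
  finally have 3: "sqnorm b \<phi> \<le> 2 * \<Lambda> * (LINT t|lborel. indicator {0..b} t *\<^sub>R (q t / 2 + (1 + t) * p t))" .
  have 4: "(norm (fst (\<phi> t)))\<^sup>2 \<le> 2 * \<Lambda> * Q t" if "t \<ge> 0" for t
  proof -
    have "(norm (fst (\<phi> t)))\<^sup>2 \<le> \<Lambda> * q t"
      using s_lower[of "fst (\<phi> t)"] \<Lambda>_pos by (simp add: q_def field_simps)
    also have "\<dots> \<le> (1 + t) * (\<Lambda> * q t)"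
      using that mult_right_mono[of 1 "1 + t" "\<Lambda> * q t"] \<Lambda>_pos s_nonneg by (simp add: q_def)
    finally show ?thesis by (simp add: Q_def algebra_simps)
  qed
  show ?thesis
    unfolding eq using 3 4[of 0] 4[OF b] by (simp add: algebra_simps)
qed

text \<open>By the energy estimate, the data functional is bounded in terms of the operator image of
  the test function. Its representing vector is a weak solution: one component gives the fields on
  \<open>{0..b}\<close>, the other the terminal value \<open>z\<close>, while \<open>k\<close>
  prescribes the initial value.\<close>

lemma lions:
  assumes b: "0 \<le> b" and F: "square_integrable F"
  obtains U z where "square_integrable U" "\<forall>t. U t \<in> G"
    "(LINT t|lborel. (norm (U t))\<^sup>2) + (norm z)\<^sup>2 \<le> (2 * \<Lambda>\<^sup>2 * (1 + b))\<^sup>2 * ((norm k)\<^sup>2 + (LINT t|lborel. indicator {0..b} t *\<^sub>R (norm (F t))\<^sup>2))"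
    "\<forall>\<phi> \<phi>'. C1 \<phi> \<phi>' \<longrightarrow> z \<bullet> fst (\<phi> b) + (LINT t|lborel. indicator {0..b} t *\<^sub>R (U t \<bullet> dual_op \<phi> \<phi>' t))
       = k \<bullet> fst (\<phi> 0) + (LINT t|lborel. indicator {0..b} t *\<^sub>R (F t \<bullet> \<phi> t))"
proof -
  \<comment> \<open>The factor \<open>2 * \<Lambda>\<close> comes from
    \<open>energy_identity\<close>, and \<open>(1 + b) * \<Lambda>\<close> bounds the norm of the
    multiplier \<open>W\<close> by that of the test function.\<close>
  define K where "K = 2 * \<Lambda>\<^sup>2 * (1 + b)"
  have K: "K \<ge> 0" using b by (simp add: K_def)
  let ?P = "proj G"
  note P = bounded_linear_proj[OF subspace_G closed_G]
  define I where "I f = to_l2 (\<lambda>t. indicator {0..b} t *\<^sub>R f t)" for f :: "real \<Rightarrow> 'h \<times> 'h"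
  have sqI: "square_integrable (\<lambda>t. indicator {0..b} t *\<^sub>R f t)" if "continuous_on UNIV f" for f :: "real \<Rightarrow> 'h \<times> 'h"
    by (rule square_integrable_interval_continuous[OF that])
  have innerI: "I f \<bullet> I g = (LINT t|lborel. indicator {0..b} t *\<^sub>R (f t \<bullet> g t))"
    if "square_integrable (\<lambda>t. indicator {0..b} t *\<^sub>R f t)" "square_integrable (\<lambda>t. indicator {0..b} t *\<^sub>R g t)" for f g
    unfolding I_def inner_to_l2[OF that] by (rule Bochner_Integration.integral_cong) (auto simp: indicator_def)
  have I_scaleR: "I (\<lambda>t. d *\<^sub>R f t) = d *\<^sub>R I f" if "continuous_on UNIV f" for d and f :: "real \<Rightarrow> 'h \<times> 'h"
    unfolding I_def by (subst to_l2_scaleR[OF sqI[OF that], symmetric]) (simp add: mult.commute)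
  have cP: "continuous_on UNIV (\<lambda>t. ?P (dual_op \<phi> \<phi>' t))" if "C1 \<phi> \<phi>'" for \<phi> \<phi>'
    using dual_op_continuous[OF that] by (rule bounded_linear.continuous_on[OF P])
  \<comment> \<open>Projected to \<open>G\<close>, because the unknown takes values in
    \<open>G\<close> and sees only that part of the operator image; pairings with the
    \<open>G\<close>-valued multipliers are unchanged.\<close>
  define Mo where "Mo \<phi> \<phi>' = (I (\<lambda>t. ?P (dual_op \<phi> \<phi>' t)), fst (\<phi> b))" for \<phi> \<phi>'
  define dat where "dat = (I F, k)"
  define el where "el \<phi> = dat \<bullet> (I \<phi>, fst (\<phi> 0))" for \<phi>
  define R where "R = {(Mo \<phi> \<phi>', el \<phi>) | \<phi> \<phi>'. C1 \<phi> \<phi>'}"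
  have sub: "subspace R"
  proof (rule subspaceI)
    have c0: "C1 (\<lambda>_. 0) (\<lambda>_. 0)" using subspace_0[OF subspace_G] by (simp add: C1_def)
    have z: "s 0 = 0" "mi 0 = 0" "?P 0 = 0"
      using linear_0 bounded_linear.linear s_linear mi_linear P by blast+
    have "Mo (\<lambda>_. 0) (\<lambda>_. 0) = 0" "el (\<lambda>_. 0) = 0"
      by (simp_all add: Mo_def el_def I_def dual_op_def z zero_prod_def[symmetric] zero_l2_def[symmetric])
    then show "0 \<in> R" unfolding R_def using c0 by (force simp: zero_prod_def)
    show "x + y \<in> R" if xy: "x \<in> R" "y \<in> R" for x y
    proof -
      obtain \<phi> \<phi>' \<psi> \<psi>' where *: "x = (Mo \<phi> \<phi>', el \<phi>)" "C1 \<phi> \<phi>'" "y = (Mo \<psi> \<psi>', el \<psi>)" "C1 \<psi> \<psi>'"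
        using xy unfolding R_def by blast
      have c: "C1 (\<lambda>t. \<phi> t + \<psi> t) (\<lambda>t. \<phi>' t + \<psi>' t)"
        using *(2,4) unfolding C1_def
        by (auto intro!: has_vector_derivative_add continuous_intros subspace_add[OF subspace_G])
      have "dual_op (\<lambda>t. \<phi> t + \<psi> t) (\<lambda>t. \<phi>' t + \<psi>' t) t = dual_op \<phi> \<phi>' t + dual_op \<psi> \<psi>' t" for t
        by (simp add: dual_op_def linear_add[OF bounded_linear.linear[OF s_linear]] linear_add[OF bounded_linear.linear[OF mi_linear]])
      then have "Mo (\<lambda>t. \<phi> t + \<psi> t) (\<lambda>t. \<phi>' t + \<psi>' t) = Mo \<phi> \<phi>' + Mo \<psi> \<psi>'"
        by (simp add: Mo_def I_def linear_add[OF bounded_linear.linear[OF P]] scaleR_add_right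
            to_l2_add[OF sqI[OF cP[OF *(2)]] sqI[OF cP[OF *(4)]]])
      moreover have "el (\<lambda>t. \<phi> t + \<psi> t) = el \<phi> + el \<psi>"
        by (simp add: el_def I_def scaleR_add_right inner_prod_def inner_add dat_def
            to_l2_add[OF sqI[OF C1_continuous(1)[OF *(2)]] sqI[OF C1_continuous(1)[OF *(4)]]])
      ultimately have "x + y = (Mo (\<lambda>t. \<phi> t + \<psi> t) (\<lambda>t. \<phi>' t + \<psi>' t), el (\<lambda>t. \<phi> t + \<psi> t))" using * by simp
      then show ?thesis using c unfolding R_def by blast
    qed
    show "d *\<^sub>R x \<in> R" if x: "x \<in> R" for d x
    proof -
      obtain \<phi> \<phi>' where *: "x = (Mo \<phi> \<phi>', el \<phi>)" "C1 \<phi> \<phi>'" using x unfolding R_def by blast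
      have c: "C1 (\<lambda>t. d *\<^sub>R \<phi> t) (\<lambda>t. d *\<^sub>R \<phi>' t)"
        using *(2) unfolding C1_def
        by (auto intro!: bounded_linear.has_vector_derivative[OF bounded_linear_scaleR_right] continuous_intros subspace_scale[OF subspace_G])
      have "dual_op (\<lambda>t. d *\<^sub>R \<phi> t) (\<lambda>t. d *\<^sub>R \<phi>' t) t = d *\<^sub>R dual_op \<phi> \<phi>' t" for t
        by (simp add: dual_op_def linear_scale[OF bounded_linear.linear[OF s_linear]] linear_scale[OF bounded_linear.linear[OF mi_linear]])
      then have "Mo (\<lambda>t. d *\<^sub>R \<phi> t) (\<lambda>t. d *\<^sub>R \<phi>' t) = d *\<^sub>R Mo \<phi> \<phi>'"
        by (simp add: Mo_def linear_scale[OF bounded_linear.linear[OF P]] I_scaleR[OF cP[OF *(2)]])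
      moreover have "el (\<lambda>t. d *\<^sub>R \<phi> t) = d * el \<phi>"
        by (simp add: el_def dat_def distrib_left I_scaleR[OF C1_continuous(1)[OF *(2)]])
      ultimately have "d *\<^sub>R x = (Mo (\<lambda>t. d *\<^sub>R \<phi> t) (\<lambda>t. d *\<^sub>R \<phi>' t), el (\<lambda>t. d *\<^sub>R \<phi> t))" using * by simp
      then show ?thesis using c unfolding R_def by blast
    qed
  qed
  have bound: "\<bar>l\<bar> \<le> (K * norm dat) * norm x" if xl: "(x, l) \<in> R" for x l
  proof -
    obtain \<phi> \<phi>' where *: "x = Mo \<phi> \<phi>'" "l = el \<phi>" and \<phi>: "C1 \<phi> \<phi>'" using xl unfolding R_def by blast
    note c\<phi> = C1_continuous(1)[OF \<phi>]
    define N where "N = sqrt ((norm (fst (\<phi> 0)))\<^sup>2 + (norm (fst (\<phi> b)))\<^sup>2 + sqnorm b \<phi>)"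
    have sq0: "sqnorm b \<phi> \<ge> 0" unfolding sqnorm_def by (simp add: integral_nonneg_AE)
    have N2: "N\<^sup>2 = (norm (fst (\<phi> 0)))\<^sup>2 + (norm (fst (\<phi> b)))\<^sup>2 + sqnorm b \<phi>"
      unfolding N_def using sq0 by simp
    have N0: "N \<ge> 0" by (simp add: N_def sq0)
    have nI: "(norm (I \<phi>))\<^sup>2 = sqnorm b \<phi>"
      unfolding power2_norm_eq_inner innerI[OF sqI[OF c\<phi>] sqI[OF c\<phi>]] sqnorm_def ..
    define W where "W = (I (\<lambda>t. (1 + t) *\<^sub>R \<phi> t), (1 + b) *\<^sub>R s (fst (\<phi> b)))"
    have cw: "continuous_on UNIV (\<lambda>t. (1 + t) *\<^sub>R \<phi> t)" by (intro continuous_intros c\<phi>)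
    have "x \<bullet> W = (LINT t|lborel. indicator {0..b} t *\<^sub>R (dual_op \<phi> \<phi>' t \<bullet> ((1 + t) *\<^sub>R \<phi> t))) + fst (\<phi> b) \<bullet> ((1 + b) *\<^sub>R s (fst (\<phi> b)))"
    proof -
      have "?P (dual_op \<phi> \<phi>' t) \<bullet> ((1 + t) *\<^sub>R \<phi> t) = dual_op \<phi> \<phi>' t \<bullet> ((1 + t) *\<^sub>R \<phi> t)" for t
        using \<phi> by (simp add: proj_sym[OF subspace_G closed_G] proj_id[OF subspace_G closed_G] C1_def)
      then show ?thesis
        unfolding * W_def Mo_def inner_prod_def fst_conv snd_conv innerI[OF sqI[OF cP[OF \<phi>]] sqI[OF cw]] by simp
    qed
    then have "N\<^sup>2 \<le> 2 * \<Lambda> * (x \<bullet> W)" using energy_identity[OF \<phi> b] N2 by simp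
    also have "\<dots> \<le> 2 * \<Lambda> * (norm x * norm W)" using \<Lambda>_pos by (intro mult_left_mono norm_cauchy_schwarz) auto
    also have "\<dots> \<le> 2 * \<Lambda> * (norm x * ((1 + b) * \<Lambda> * N))"
    proof (intro mult_left_mono)
      have "(norm (I (\<lambda>t. (1 + t) *\<^sub>R \<phi> t)))\<^sup>2 \<le> (1 + b)\<^sup>2 * sqnorm b \<phi>"
      proof -
        have "(norm (I (\<lambda>t. (1 + t) *\<^sub>R \<phi> t)))\<^sup>2 = (LINT t|lborel. indicator {0..b} t *\<^sub>R (((1 + t) *\<^sub>R \<phi> t) \<bullet> ((1 + t) *\<^sub>R \<phi> t)))"
          unfolding power2_norm_eq_inner innerI[OF sqI[OF cw] sqI[OF cw]] ..
        also have "\<dots> \<le> (LINT t|lborel. (1 + b)\<^sup>2 * (indicator {0..b} t *\<^sub>R (norm (\<phi> t))\<^sup>2))"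
        proof (rule integral_mono)
          show "integrable lborel (\<lambda>t. indicator {0..b} t *\<^sub>R (((1 + t) *\<^sub>R \<phi> t) \<bullet> ((1 + t) *\<^sub>R \<phi> t)))"
            by (intro borel_integrable_compact continuous_intros continuous_on_subset[OF c\<phi>]) auto
          show "integrable lborel (\<lambda>t. (1 + b)\<^sup>2 * (indicator {0..b} t *\<^sub>R (norm (\<phi> t))\<^sup>2))"
            by (intro integrable_mult_right borel_integrable_compact continuous_intros continuous_on_subset[OF c\<phi>]) auto
          show "indicator {0..b} t *\<^sub>R (((1 + t) *\<^sub>R \<phi> t) \<bullet> ((1 + t) *\<^sub>R \<phi> t)) \<le> (1 + b)\<^sup>2 * (indicator {0..b} t *\<^sub>R (norm (\<phi> t))\<^sup>2)" for t
          proof (cases "t \<in> {0..b}")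
            case True
            then have "(1 + t)\<^sup>2 * (norm (\<phi> t))\<^sup>2 \<le> (1 + b)\<^sup>2 * (norm (\<phi> t))\<^sup>2"
              by (intro mult_right_mono power_mono) auto
            moreover have "((1 + t) *\<^sub>R \<phi> t) \<bullet> ((1 + t) *\<^sub>R \<phi> t) = (1 + t)\<^sup>2 * (norm (\<phi> t))\<^sup>2"
              by (simp add: power2_norm_eq_inner power2_eq_square[of "1 + t"] mult.assoc)
            ultimately show ?thesis using True by simp
          qed simp
        qed
        also have "\<dots> = (1 + b)\<^sup>2 * sqnorm b \<phi>" by (simp add: sqnorm_def)
        finally show ?thesis .
      qed
      moreover have "(norm ((1 + b) *\<^sub>R s (fst (\<phi> b))))\<^sup>2 \<le> (1 + b)\<^sup>2 * (\<Lambda>\<^sup>2 * (norm (fst (\<phi> b)))\<^sup>2)"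
        unfolding norm_scaleR power_mult_distrib[symmetric]
        using norm_s_le[of "fst (\<phi> b)"] b by (intro power_mono) (auto simp: mult.assoc intro!: mult_left_mono)
      moreover have "(1 + b)\<^sup>2 * sqnorm b \<phi> \<le> (1 + b)\<^sup>2 * (\<Lambda>\<^sup>2 * sqnorm b \<phi>)"
        using sq0 \<Lambda> mult_right_mono[of 1 "\<Lambda>\<^sup>2" "sqnorm b \<phi>"] by (intro mult_left_mono) (auto simp: one_le_power)
      ultimately have "(norm W)\<^sup>2 \<le> (1 + b)\<^sup>2 * \<Lambda>\<^sup>2 * (sqnorm b \<phi> + (norm (fst (\<phi> b)))\<^sup>2)"
        by (simp add: W_def norm_prod_def algebra_simps)
      also have "\<dots> \<le> (1 + b)\<^sup>2 * \<Lambda>\<^sup>2 * N\<^sup>2" unfolding N2 by (intro mult_left_mono) auto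
      finally have "(norm W)\<^sup>2 \<le> ((1 + b) * \<Lambda> * N)\<^sup>2" by (simp add: power_mult_distrib)
      then show "norm W \<le> (1 + b) * \<Lambda> * N" by (rule power2_le_imp_le) (use b \<Lambda>_pos N0 in simp)
    qed (use \<Lambda>_pos in auto)
    finally have "N * N \<le> (K * norm x) * N" by (simp add: K_def power2_eq_square mult_ac)
    then have NK: "N \<le> K * norm x"
      using N0 K by (cases "N = 0") (auto simp: mult_le_cancel_right)
    have "\<bar>l\<bar> \<le> norm dat * norm (I \<phi>, fst (\<phi> 0))"
      unfolding * el_def by (rule Cauchy_Schwarz_ineq2)
    also have "norm (I \<phi>, fst (\<phi> 0)) \<le> N"
      unfolding norm_prod_def N_def by (simp add: nI)
    finally have "\<bar>l\<bar> \<le> norm dat * N" by (simp add: mult_left_mono)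
    also have "\<dots> \<le> norm dat * (K * norm x)" by (intro mult_left_mono NK) simp
    finally show ?thesis by (simp add: mult_ac)
  qed
  have "0 \<le> K * norm dat" using K by simp
  then obtain u where u: "norm u \<le> K * norm dat" "\<And>x l. (x, l) \<in> R \<Longrightarrow> u \<bullet> x = l"
    using hilbert_representation[OF sub bound] by metis
  \<comment> \<open>The representing class is truncated to the interval and projected once more, so
    that \<open>U t\<close> lies in \<open>G\<close> for every \<open>t\<close>.\<close>
  define U where "U t = ?P (indicator {0..b} t *\<^sub>R rep_l2 (fst u) t)" for t
  define z where "z = snd u"
  have sqU: "square_integrable U"
    unfolding U_def[abs_def] by (rule square_integrable_linear[OF square_integrable_interval P]) simp
  show thesis
  proof (rule that[of U z])
    show "square_integrable U" by (rule sqU)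
    show "\<forall>t. U t \<in> G" unfolding U_def by (intro allI proj_in[OF subspace_G closed_G])
    have "(LINT t|lborel. (norm (U t))\<^sup>2) \<le> (LINT t|lborel. (norm (rep_l2 (fst u) t))\<^sup>2)"
    proof (rule integral_mono)
      show "integrable lborel (\<lambda>t. (norm (U t))\<^sup>2)" using sqU by (simp add: square_integrable_def)
      show "integrable lborel (\<lambda>t. (norm (rep_l2 (fst u) t))\<^sup>2)" using square_integrable_rep[of "fst u"] by (simp add: square_integrable_def)
      fix t
      have "norm (?P x) \<le> norm x" for x
      proof -
        have "(norm (?P x))\<^sup>2 = x \<bullet> ?P x"
          using proj_orth[OF subspace_G closed_G proj_in[OF subspace_G closed_G], of x x] by (simp add: inner_diff power2_norm_eq_inner)
        also have "\<dots> \<le> norm x * norm (?P x)" by (rule norm_cauchy_schwarz)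
        finally show ?thesis by (cases "?P x = 0") (auto simp: power2_eq_square mult_le_cancel_right)
      qed
      from this[of "indicator {0..b} t *\<^sub>R rep_l2 (fst u) t"]
      have "norm (U t) \<le> norm (rep_l2 (fst u) t)" unfolding U_def by (rule order_trans) (simp add: indicator_def)
      then show "(norm (U t))\<^sup>2 \<le> (norm (rep_l2 (fst u) t))\<^sup>2" by (intro power_mono) auto
    qed
    also have "\<dots> = (norm (fst u))\<^sup>2" by (rule power2_norm_l2[symmetric])
    finally have "(LINT t|lborel. (norm (U t))\<^sup>2) + (norm z)\<^sup>2 \<le> (norm u)\<^sup>2"
      by (simp add: z_def norm_prod_def)
    also have "\<dots> \<le> (K * norm dat)\<^sup>2" using u(1) by (intro power_mono) auto
    also have "(norm dat)\<^sup>2 = (norm k)\<^sup>2 + (LINT t|lborel. indicator {0..b} t *\<^sub>R (norm (F t))\<^sup>2)"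
    proof -
      have "(norm (I F))\<^sup>2 = (LINT t|lborel. indicator {0..b} t *\<^sub>R (norm (F t))\<^sup>2)"
        unfolding power2_norm_eq_inner innerI[OF square_integrable_interval[OF F] square_integrable_interval[OF F]] ..
      then show ?thesis by (simp add: dat_def norm_prod_def)
    qed
    then have "(K * norm dat)\<^sup>2 = K\<^sup>2 * ((norm k)\<^sup>2 + (LINT t|lborel. indicator {0..b} t *\<^sub>R (norm (F t))\<^sup>2))"
      by (simp add: power_mult_distrib)
    finally show "(LINT t|lborel. (norm (U t))\<^sup>2) + (norm z)\<^sup>2 \<le> (2 * \<Lambda>\<^sup>2 * (1 + b))\<^sup>2 * ((norm k)\<^sup>2 + (LINT t|lborel. indicator {0..b} t *\<^sub>R (norm (F t))\<^sup>2))"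
      by (simp only: K_def)
    show "\<forall>\<phi> \<phi>'. C1 \<phi> \<phi>' \<longrightarrow> z \<bullet> fst (\<phi> b) + (LINT t|lborel. indicator {0..b} t *\<^sub>R (U t \<bullet> dual_op \<phi> \<phi>' t))
       = k \<bullet> fst (\<phi> 0) + (LINT t|lborel. indicator {0..b} t *\<^sub>R (F t \<bullet> \<phi> t))"
    proof (intro allI impI)
      fix \<phi> \<phi>' assume \<phi>: "C1 \<phi> \<phi>'"
      have "(Mo \<phi> \<phi>', el \<phi>) \<in> R" unfolding R_def using \<phi> by blast
      then have "u \<bullet> Mo \<phi> \<phi>' = el \<phi>" by (rule u(2))
      moreover have "el \<phi> = k \<bullet> fst (\<phi> 0) + (LINT t|lborel. indicator {0..b} t *\<^sub>R (F t \<bullet> \<phi> t))"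
        unfolding el_def dat_def
        by (simp add: innerI[OF square_integrable_interval[OF F] sqI[OF C1_continuous(1)[OF \<phi>]]])
      moreover have "fst u \<bullet> I (\<lambda>t. ?P (dual_op \<phi> \<phi>' t)) = (LINT t|lborel. indicator {0..b} t *\<^sub>R (U t \<bullet> dual_op \<phi> \<phi>' t))"
        unfolding I_def inner_rep_to_l2[OF sqI[OF cP[OF \<phi>]]]
      proof (rule Bochner_Integration.integral_cong)
        fix t
        show "rep_l2 (fst u) t \<bullet> (indicator {0..b} t *\<^sub>R ?P (dual_op \<phi> \<phi>' t)) = indicator {0..b} t *\<^sub>R (U t \<bullet> dual_op \<phi> \<phi>' t)"
          by (cases "t \<in> {0..b}") (simp_all add: U_def proj_sym[OF subspace_G closed_G])
      qed simp
      ultimately show "z \<bullet> fst (\<phi> b) + (LINT t|lborel. indicator {0..b} t *\<^sub>R (U t \<bullet> dual_op \<phi> \<phi>' t))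
         = k \<bullet> fst (\<phi> 0) + (LINT t|lborel. indicator {0..b} t *\<^sub>R (F t \<bullet> \<phi> t))"
        by (simp add: Mo_def inner_prod_def z_def)
    qed
  qed
qed

end

section \<open>Existence, uniqueness and estimates for the abstract problem\<close>

lemma square_integrable_Pair:
  assumes "square_integrable f" "square_integrable g"
  shows "square_integrable (\<lambda>t. (f t, g t))"
proof -
  have "bounded_linear (\<lambda>x::'b. (x, 0::'c))" "bounded_linear (\<lambda>x::'c. (0::'b, x))"
    by (intro bounded_linear_Pair bounded_linear_ident bounded_linear_zero)+
  from square_integrable_add[OF square_integrable_linear[OF assms(1) this(1)] square_integrable_linear[OF assms(2) this(2)]]
  show ?thesis by simp
qed

lemma prim_antiderivative:
  fixes \<eta> \<eta>' :: "real \<Rightarrow> real"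
  assumes "\<And>t. (\<eta> has_real_derivative \<eta>' t) (at t)" "continuous_on UNIV \<eta>'" "0 \<le> t"
  shows "prim \<eta>' t = \<eta> t - \<eta> 0"
proof -
  have "isCont \<eta>' t" for t using assms(2) by (simp add: continuous_on_eq_continuous_at)
  then have "has_bochner_integral lborel (\<lambda>r. \<eta>' r * indicator {0..t} r) (\<eta> t - \<eta> 0)"
    using has_bochner_integral_FTC_Icc_real[OF assms(3), of \<eta> \<eta>'] assms(1) by simp
  then show ?thesis unfolding prim_def by (simp add: has_bochner_integral_integral_eq mult.commute)
qed

context evolution
begin

definition field_H :: "(real \<Rightarrow> 'h) \<Rightarrow> 'h \<Rightarrow> (real \<Rightarrow> 'h) \<Rightarrow> real \<Rightarrow> 'h" where
  "field_H JM H0 a t = H0 + prim (\<lambda>r. mi (JM r - a r)) t"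

text \<open>The system integrated in time: the initial value is built into \<open>field_H\<close>,
  and no time derivative of \<open>E\<close> occurs. The fields are square integrable on the whole
  line, while the equations are imposed on \<open>{0..b}\<close>.\<close>

definition is_sol :: "real \<Rightarrow> 'h \<Rightarrow> (real \<Rightarrow> 'h) \<Rightarrow> (real \<Rightarrow> 'h) \<Rightarrow> 'h \<Rightarrow> (real \<Rightarrow> 'h) \<Rightarrow> (real \<Rightarrow> 'h) \<Rightarrow> bool" where
  "is_sol b JE0 JEt JM H0 E a \<longleftrightarrow> square_integrable E \<and> square_integrable a \<and>
     (AE t\<in>{0..b} in lborel. (E t, a t) \<in> G) \<and>
     (AE t\<in>{0..b} in lborel. (field_H JM H0 a t, s (E t) + (JE0 + prim JEt t)) \<in> adj)"

text \<open>The squared norm of the data in \<open>lions\<close>: initial value \<open>k\<close> and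
  source \<open>(- JEt, mi JM)\<close>.\<close>

definition data_norm :: "real \<Rightarrow> 'h \<Rightarrow> (real \<Rightarrow> 'h) \<Rightarrow> (real \<Rightarrow> 'h) \<Rightarrow> real" where
  "data_norm b k JEt JM = (norm k)\<^sup>2 + (LINT t|lborel. indicator {0..b} t *\<^sub>R (norm (- JEt t, mi (JM t)))\<^sup>2)"

text \<open>The weak equation is tested with scalar functions of time multiplied by a fixed pair of
  \<open>G\<close>. The constant function identifies the terminal value, antiderivatives of test
  functions give the integrated equation almost everywhere, and \<open>AE_adjI\<close> makes the
  null set independent of the pair. The value \<open>K0 - JE0\<close> is what the first equation at
  time 0 forces on \<open>s E\<close>.\<close>

lemma sol_exists:
  assumes b: "0 \<le> b" and JEt: "square_integrable JEt" and JM: "square_integrable JM" and H0: "(H0, K0) \<in> adj"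
  obtains E a z where "is_sol b JE0 JEt JM H0 E a" "\<And>t. (E t, a t) \<in> G"
    "(field_H JM H0 a b, z + (JE0 + prim JEt b)) \<in> adj"
    "(LINT t|lborel. (norm (E t, a t))\<^sup>2) + (norm z)\<^sup>2 \<le> (2 * \<Lambda>\<^sup>2 * (1 + b))\<^sup>2 * data_norm b (K0 - JE0) JEt JM"
proof -
  define k where "k = K0 - JE0"
  define F where "F t = (- JEt t, mi (JM t))" for t
  have F: "square_integrable F"
    unfolding F_def by (intro square_integrable_Pair square_integrable_uminus JEt square_integrable_linear[OF JM mi_linear])
  obtain U z where U: "square_integrable U" "\<forall>t. U t \<in> G"
    and bound: "(LINT t|lborel. (norm (U t))\<^sup>2) + (norm z)\<^sup>2 \<le> (2 * \<Lambda>\<^sup>2 * (1 + b))\<^sup>2 * ((norm k)\<^sup>2 + (LINT t|lborel. indicator {0..b} t *\<^sub>R (norm (F t))\<^sup>2))"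
    and eq: "\<forall>\<phi> \<phi>'. C1 \<phi> \<phi>' \<longrightarrow> z \<bullet> fst (\<phi> b) + (LINT t|lborel. indicator {0..b} t *\<^sub>R (U t \<bullet> dual_op \<phi> \<phi>' t))
       = k \<bullet> fst (\<phi> 0) + (LINT t|lborel. indicator {0..b} t *\<^sub>R (F t \<bullet> \<phi> t))"
    by (rule lions[OF b F, of k], rule that; assumption)
  define E where "E t = fst (U t)" for t
  define a where "a t = snd (U t)" for t
  have UEa: "U t = (E t, a t)" for t by (simp add: E_def a_def)
  have Ea: "square_integrable E" "square_integrable a"
    unfolding E_def[abs_def] a_def[abs_def]
    by (rule square_integrable_linear[OF U(1) bounded_linear_fst], rule square_integrable_linear[OF U(1) bounded_linear_snd])
  define g where "g t = mi (JM t - a t)" for t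
  have g: "square_integrable g"
    unfolding g_def[abs_def] by (intro square_integrable_linear[OF _ mi_linear] square_integrable_diff JM Ea)
  have tested: "z \<bullet> e = k \<bullet> e + (prim g b \<bullet> c - prim JEt b \<bullet> e) \<and>
      (AE t\<in>{0..b} in lborel. s (E t) \<bullet> e = k \<bullet> e + (prim g t \<bullet> c - prim JEt t \<bullet> e))"
    if v: "(e, c) \<in> G" for e c
  proof -
    define r where "r t = g t \<bullet> c - JEt t \<bullet> e" for t
    define w where "w t = E t \<bullet> s e" for t
    have sqr: "square_integrable r" unfolding r_def
      by (intro square_integrable_diff square_integrable_linear[OF g bounded_linear_inner_left] square_integrable_linear[OF JEt bounded_linear_inner_left])
    have sqw: "square_integrable w" unfolding w_def by (rule square_integrable_linear[OF Ea(1) bounded_linear_inner_left])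
    have prim_r: "prim r t = prim g t \<bullet> c - prim JEt t \<bullet> e" for t
      unfolding r_def[abs_def]
      by (subst prim_diff) (auto intro: square_integrable_linear[OF g bounded_linear_inner_left]
          square_integrable_linear[OF JEt bounded_linear_inner_left] simp: prim_inner[OF g] prim_inner[OF JEt])
    \<comment> \<open>The source is integrated by parts in time, so that only \<open>\<eta>'\<close>
      and boundary values of \<open>\<eta>\<close> remain; afterwards \<open>\<eta>'\<close> can be
      chosen freely.\<close>
    have weak: "\<eta> b * (z \<bullet> e) = \<eta> 0 * (k \<bullet> e) + \<eta> 0 * prim r b
        + (LINT t|lborel. indicator {0..b} t *\<^sub>R (\<eta>' t * (w t + (prim r b - prim r t))))"
      if \<eta>: "\<And>t. (\<eta> has_real_derivative \<eta>' t) (at t)" "continuous_on UNIV \<eta>'" for \<eta> \<eta>' :: "real \<Rightarrow> real"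
    proof -
      have c\<eta>: "continuous_on UNIV \<eta>" using \<eta>(1) by (auto intro: DERIV_isCont continuous_at_imp_continuous_on)
      have "C1 (\<lambda>t. \<eta> t *\<^sub>R (e, c)) (\<lambda>t. \<eta>' t *\<^sub>R (e, c))"
        unfolding C1_def using \<eta> v
        by (auto intro!: derivative_eq_intros continuous_intros subspace_scale[OF subspace_G, of "(e, c)", simplified])
      from eq[rule_format, OF this]
      have "\<eta> b * (z \<bullet> e) = \<eta> 0 * (k \<bullet> e) + (LINT t|lborel. indicator {0..b} t *\<^sub>R (F t \<bullet> (\<eta> t *\<^sub>R (e, c))))
          - (LINT t|lborel. indicator {0..b} t *\<^sub>R (U t \<bullet> dual_op (\<lambda>t. \<eta> t *\<^sub>R (e, c)) (\<lambda>t. \<eta>' t *\<^sub>R (e, c)) t))"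
        by simp
      moreover have "(LINT t|lborel. indicator {0..b} t *\<^sub>R (F t \<bullet> (\<eta> t *\<^sub>R (e, c))))
          - (LINT t|lborel. indicator {0..b} t *\<^sub>R (U t \<bullet> dual_op (\<lambda>t. \<eta> t *\<^sub>R (e, c)) (\<lambda>t. \<eta>' t *\<^sub>R (e, c)) t))
        = (LINT t|lborel. indicator {0..b} t *\<^sub>R (\<eta> t * r t + \<eta>' t * w t))"
      proof -
        have i1: "integrable lborel (\<lambda>t. indicator {0..b} t *\<^sub>R (F t \<bullet> (\<eta> t *\<^sub>R (e, c))))"
        proof -
          have "square_integrable (\<lambda>t. indicator {0..b} t *\<^sub>R (\<eta> t *\<^sub>R (e, c)))"
            by (intro square_integrable_interval_continuous continuous_intros c\<eta>)
          from square_integrable_inner[OF F this] show ?thesis by (simp only: inner_scaleR_right real_scaleR_def)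
        qed
        have i2: "integrable lborel (\<lambda>t. indicator {0..b} t *\<^sub>R (U t \<bullet> dual_op (\<lambda>t. \<eta> t *\<^sub>R (e, c)) (\<lambda>t. \<eta>' t *\<^sub>R (e, c)) t))"
        proof -
          have "square_integrable (\<lambda>t. indicator {0..b} t *\<^sub>R (dual_op (\<lambda>t. \<eta> t *\<^sub>R (e, c)) (\<lambda>t. \<eta>' t *\<^sub>R (e, c)) t))"
            by (intro square_integrable_interval_continuous dual_op_continuous) fact
          from square_integrable_inner[OF U(1) this] show ?thesis by simp
        qed
        have "F t \<bullet> (\<eta> t *\<^sub>R (e, c)) - U t \<bullet> dual_op (\<lambda>t. \<eta> t *\<^sub>R (e, c)) (\<lambda>t. \<eta>' t *\<^sub>R (e, c)) t = \<eta> t * r t + \<eta>' t * w t" for t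
          by (simp add: F_def UEa dual_op_def r_def g_def w_def linear_scale[OF bounded_linear.linear[OF s_linear]]
              linear_scale[OF bounded_linear.linear[OF mi_linear]] linear_diff[OF bounded_linear.linear[OF mi_linear]]
              mi_sym[of "a t"] inner_diff algebra_simps)
        then show ?thesis
          by (subst Bochner_Integration.integral_diff[OF i1 i2, symmetric]) (simp only: scaleR_diff_right[symmetric])
      qed
      moreover have "(LINT t|lborel. indicator {0..b} t *\<^sub>R (\<eta> t * r t + \<eta>' t * w t))
        = \<eta> 0 * prim r b + (LINT t|lborel. indicator {0..b} t *\<^sub>R (\<eta>' t * (w t + (prim r b - prim r t))))"
      proof -
        \<comment> \<open>Truncation makes \<open>\<eta>'\<close> square integrable; on the interval
          \<open>\<eta>\<close> becomes \<open>\<eta> 0 + prim d\<close>, the form needed for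
          \<open>integral_prim_inner\<close>.\<close>
        define d where "d t = indicator {0..b} t *\<^sub>R \<eta>' t" for t
        have sqd: "square_integrable d" unfolding d_def by (rule square_integrable_interval_continuous[OF \<eta>(2)])
        have pd: "prim d t = \<eta> t - \<eta> 0" if "t \<in> {0..b}" for t
          using that prim_antiderivative[OF \<eta>, of t] prim_cong[of t d \<eta>'] by (auto simp: d_def)
        have iw: "integrable lborel (\<lambda>t. indicator {0..b} t *\<^sub>R (\<eta>' t * w t))"
          using square_integrable_inner[OF sqd sqw] by (simp add: d_def mult_ac)
        have ir: "integrable lborel (\<lambda>t. \<eta> 0 * (indicator {0..b} t *\<^sub>R r t))"
          by (intro integrable_mult_right integrable_interval sqr)
        have ip: "integrable lborel (\<lambda>t. indicator {0..b} t *\<^sub>R (prim d t \<bullet> r t))"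
          using square_integrable_inner[OF square_integrable_prim[OF sqd, of b] sqr] by (simp add: mult.assoc)
        have iq: "integrable lborel (\<lambda>t. indicator {0..b} t *\<^sub>R (d t \<bullet> (prim r b - prim r t)))"
        proof -
          have "square_integrable (\<lambda>t. indicator {0..b} t *\<^sub>R prim r b - indicator {0..b} t *\<^sub>R prim r t)"
            by (intro square_integrable_diff square_integrable_prim sqr square_integrable_indicator) (auto simp: b)
          from square_integrable_inner[OF sqd this] show ?thesis by (simp add: algebra_simps)
        qed
        have "(LINT t|lborel. indicator {0..b} t *\<^sub>R (\<eta> t * r t + \<eta>' t * w t))
          = (LINT t|lborel. (\<eta> 0 * (indicator {0..b} t *\<^sub>R r t) + indicator {0..b} t *\<^sub>R (prim d t \<bullet> r t)) + indicator {0..b} t *\<^sub>R (\<eta>' t * w t))"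
          by (rule Bochner_Integration.integral_cong) (auto simp: indicator_def pd algebra_simps)
        also have "\<dots> = \<eta> 0 * prim r b + (LINT t|lborel. indicator {0..b} t *\<^sub>R (prim d t \<bullet> r t)) + (LINT t|lborel. indicator {0..b} t *\<^sub>R (\<eta>' t * w t))"
          unfolding prim_def[of r b]
          by (subst Bochner_Integration.integral_add[OF Bochner_Integration.integrable_add[OF ir ip] iw],
              subst Bochner_Integration.integral_add[OF ir ip]) simp
        also have "\<dots> = \<eta> 0 * prim r b + (LINT t|lborel. indicator {0..b} t *\<^sub>R (d t \<bullet> (prim r b - prim r t)) + indicator {0..b} t *\<^sub>R (\<eta>' t * w t))"
          unfolding integral_prim_inner[OF sqd sqr] by (subst Bochner_Integration.integral_add[OF iq iw]) simp
        also have "\<dots> = \<eta> 0 * prim r b + (LINT t|lborel. indicator {0..b} t *\<^sub>R (\<eta>' t * (w t + (prim r b - prim r t))))"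
          by (intro arg_cong2[where f="(+)"] refl Bochner_Integration.integral_cong) (auto simp: d_def indicator_def algebra_simps)
        finally show ?thesis .
      qed
      ultimately show ?thesis by simp
    qed
    have zb: "z \<bullet> e = k \<bullet> e + prim r b"
      using weak[of "\<lambda>_. 1" "\<lambda>_. 0"] by simp
    have sqq: "square_integrable (\<lambda>t. indicator {0..b} t *\<^sub>R (w t - prim r t - k \<bullet> e))"
      using square_integrable_diff[OF square_integrable_diff[OF square_integrable_interval[OF sqw] square_integrable_prim[OF sqr]]
          square_integrable_indicator[of "{0..b}" "k \<bullet> e"]] b
      by (simp add: algebra_simps)
    \<comment> \<open>By \<open>zb\<close> the boundary terms combine to
      \<open>(\<eta> b - \<eta> 0) * (z \<bullet> e)\<close>, which is the integral of the test
      function times \<open>z \<bullet> e\<close>. What remains is orthogonal to all test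
      functions.\<close>
    have "AE t\<in>{0<..<b} in lborel. indicator {0..b} t *\<^sub>R (w t - prim r t - k \<bullet> e) = 0"
    proof (rule AE_eq_0_if_orthogonal_to_test_functions[OF sqq])
      fix \<theta> :: "real \<Rightarrow> real" assume \<theta>: "\<theta> \<in> test_functions {0<..<b}"
      note s\<theta> = test_functions_smooth[OF \<theta>]
      obtain \<eta> where \<eta>: "\<And>x. (\<eta> has_real_derivative \<theta> x) (at x)"
        using smooth_antiderivative_ex[OF s\<theta>] by blast
      have "(\<eta> b - \<eta> 0) * (z \<bullet> e) = (LINT t|lborel. indicator {0..b} t *\<^sub>R (\<theta> t * (w t + (prim r b - prim r t))))"
        using weak[OF \<eta> smooth_continuous[OF s\<theta>]] zb by (simp add: algebra_simps)
      moreover have "(\<eta> b - \<eta> 0) * (z \<bullet> e) = (LINT t|lborel. indicator {0..b} t *\<^sub>R (\<theta> t * (z \<bullet> e)))"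
        using prim_antiderivative[OF \<eta> smooth_continuous[OF s\<theta>] b] unfolding prim_def by (simp add: mult.assoc[symmetric])
      moreover have "integrable lborel (\<lambda>t. indicator {0..b} t *\<^sub>R (\<theta> t * (z \<bullet> e)))"
        using integrable_interval[OF test_functions_square_integrable(1)[OF \<theta>], of 0 b] by (simp add: mult.assoc[symmetric])
      moreover have "integrable lborel (\<lambda>t. (indicator {0..b} t *\<^sub>R (w t - prim r t - k \<bullet> e)) * \<theta> t)"
        using square_integrable_inner[OF sqq test_functions_square_integrable(1)[OF \<theta>]] by simp
      moreover have "(indicator {0..b} t *\<^sub>R (w t - prim r t - k \<bullet> e)) * \<theta> t + indicator {0..b} t *\<^sub>R (\<theta> t * (z \<bullet> e))
        = indicator {0..b} t *\<^sub>R (\<theta> t * (w t + (prim r b - prim r t)))" for t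
        unfolding zb by (simp add: algebra_simps)
      ultimately show "(LINT t|lborel. (indicator {0..b} t *\<^sub>R (w t - prim r t - k \<bullet> e)) * \<theta> t) = 0"
        using Bochner_Integration.integral_add[of lborel "\<lambda>t. (indicator {0..b} t *\<^sub>R (w t - prim r t - k \<bullet> e)) * \<theta> t"
            "\<lambda>t. indicator {0..b} t *\<^sub>R (\<theta> t * (z \<bullet> e))"] by simp
    qed simp
    moreover have "AE t in lborel. t \<noteq> 0" "AE t in lborel. t \<noteq> b" by (rule AE_lborel_singleton)+
    ultimately have "AE t\<in>{0..b} in lborel. s (E t) \<bullet> e = k \<bullet> e + prim r t"
      by eventually_elim (auto simp: w_def s_sym)
    then show ?thesis using zb by (simp add: prim_r)
  qed
  have Hg: "field_H JM H0 a t = H0 + prim g t" for t by (simp add: field_H_def g_def[abs_def])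
  have key: "(H0 + prim g t) \<bullet> c = (x + (JE0 + prim JEt t)) \<bullet> e"
    if "(e, c) \<in> G" "x \<bullet> e = k \<bullet> e + (prim g t \<bullet> c - prim JEt t \<bullet> e)" for e c x t
    using that(2) adjD[OF H0 that(1)] by (simp add: k_def inner_add inner_diff)
  show thesis
  proof (rule that[of E a z])
    have "AE t\<in>{0..b} in lborel. (field_H JM H0 a t, s (E t) + (JE0 + prim JEt t)) \<in> adj"
    proof (rule AE_adjI)
      fix e c assume v: "(e, c) \<in> G"
      show "AE t\<in>{0..b} in lborel. field_H JM H0 a t \<bullet> c = (s (E t) + (JE0 + prim JEt t)) \<bullet> e"
        using tested[OF v, THEN conjunct2] by eventually_elim (auto simp: Hg intro: key[OF v])
    qed
    then show "is_sol b JE0 JEt JM H0 E a" unfolding is_sol_def using Ea U(2) by (auto simp: UEa[symmetric])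
    show "(E t, a t) \<in> G" for t using U(2) by (simp add: UEa[symmetric])
    show "(field_H JM H0 a b, z + (JE0 + prim JEt b)) \<in> adj"
      unfolding adj_def Hg using tested key by blast
    show "(LINT t|lborel. (norm (E t, a t))\<^sup>2) + (norm z)\<^sup>2 \<le> (2 * \<Lambda>\<^sup>2 * (1 + b))\<^sup>2 * data_norm b (K0 - JE0) JEt JM"
      using bound by (simp only: data_norm_def F_def k_def UEa)
  qed
qed

text \<open>The differences satisfy \<open>s e \<bullet> e = - (prim y \<bullet> m y)\<close> almost
  everywhere. The right side integrates to minus half of
  \<open>m (prim y b) \<bullet> prim y b\<close>, so \<open>e\<close> vanishes by coercivity of
  \<open>s\<close>, and the difference of the curls by \<open>G_unique\<close>.\<close>

lemma sol_unique:
  assumes b: "0 \<le> b" and JM: "square_integrable JM"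
    and 1: "is_sol b JE0 JEt JM H0 E a" and 2: "is_sol b JE0 JEt JM H0 E' a'"
  shows "AE t\<in>{0..b} in lborel. E t = E' t \<and> a t = a' t"
proof -
  define e where "e t = E t - E' t" for t
  define c where "c t = a t - a' t" for t
  define y where "y t = mi (a' t - a t)" for t
  have sq: "square_integrable E" "square_integrable a" "square_integrable E'" "square_integrable a'"
    using 1 2 by (auto simp: is_sol_def)
  have sqe: "square_integrable e" unfolding e_def by (intro square_integrable_diff sq)
  have sqy: "square_integrable y"
    unfolding y_def by (intro square_integrable_linear[OF _ mi_linear] square_integrable_diff sq)
  have my: "m (y t) = - c t" for t by (simp add: y_def c_def)
  have sqmy: "square_integrable (\<lambda>t. m (y t))" by (rule square_integrable_linear[OF sqy m_linear])
  have H: "field_H JM H0 a t - field_H JM H0 a' t = prim y t" for t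
  proof -
    have "y = (\<lambda>t. mi (JM t - a t) - mi (JM t - a' t))"
      by (simp add: fun_eq_iff y_def linear_diff[OF bounded_linear.linear[OF mi_linear], symmetric])
    then show ?thesis
      by (simp add: field_H_def) (subst prim_diff; intro square_integrable_linear[OF _ mi_linear] square_integrable_diff JM sq refl)
  qed
  have eG: "AE t\<in>{0..b} in lborel. (e t, c t) \<in> G"
  proof -
    have "AE t\<in>{0..b} in lborel. (E t, a t) \<in> G" "AE t\<in>{0..b} in lborel. (E' t, a' t) \<in> G"
      using 1 2 by (auto simp: is_sol_def)
    then show ?thesis
      by eventually_elim (use subspace_diff[OF subspace_G] in \<open>force simp: e_def c_def\<close>)
  qed
  have "AE t\<in>{0..b} in lborel. (prim y t, s (e t)) \<in> adj"
  proof -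
    have "AE t\<in>{0..b} in lborel. (field_H JM H0 a t, s (E t) + (JE0 + prim JEt t)) \<in> adj"
      "AE t\<in>{0..b} in lborel. (field_H JM H0 a' t, s (E' t) + (JE0 + prim JEt t)) \<in> adj"
      using 1 2 by (auto simp: is_sol_def)
    then show ?thesis
    proof eventually_elim
      fix t assume *: "t \<in> {0..b} \<longrightarrow> (field_H JM H0 a t, s (E t) + (JE0 + prim JEt t)) \<in> adj"
        "t \<in> {0..b} \<longrightarrow> (field_H JM H0 a' t, s (E' t) + (JE0 + prim JEt t)) \<in> adj"
      show "t \<in> {0..b} \<longrightarrow> (prim y t, s (e t)) \<in> adj"
        using * adj_diff[of "field_H JM H0 a t" "s (E t) + (JE0 + prim JEt t)" "field_H JM H0 a' t" "s (E' t) + (JE0 + prim JEt t)"]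
        by (simp add: H e_def linear_diff[OF bounded_linear.linear[OF s_linear]])
    qed
  qed
  with eG have rel: "AE t\<in>{0..b} in lborel. s (e t) \<bullet> e t = - (prim y t \<bullet> m (y t))"
    by eventually_elim (force dest: adjD simp: my)
  define X where "X = (LINT t|lborel. indicator {0..b} t *\<^sub>R (prim y t \<bullet> m (y t)))"
  \<comment> \<open>Integration by parts in time reproduces \<open>X\<close> with the opposite sign,
    because \<open>m\<close> is symmetric; this evaluates \<open>2 * X\<close> as a nonnegative
    quadratic form.\<close>
  have "X = (LINT t|lborel. indicator {0..b} t *\<^sub>R (y t \<bullet> m (prim y b)) - indicator {0..b} t *\<^sub>R (prim y t \<bullet> m (y t)))"
    unfolding X_def integral_prim_inner[OF sqy sqmy] prim_linear[OF m_linear sqy]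
  proof (rule Bochner_Integration.integral_cong)
    fix t
    have "y t \<bullet> m (prim y t) = prim y t \<bullet> m (y t)" by (metis m_sym inner_commute)
    then show "indicator {0..b} t *\<^sub>R (y t \<bullet> (m (prim y b) - m (prim y t)))
        = indicator {0..b} t *\<^sub>R (y t \<bullet> m (prim y b)) - indicator {0..b} t *\<^sub>R (prim y t \<bullet> m (y t))"
      by (simp add: inner_diff right_diff_distrib)
  qed simp
  also have "\<dots> = (LINT t|lborel. indicator {0..b} t *\<^sub>R (y t \<bullet> m (prim y b))) - X"
    unfolding X_def
  proof (rule Bochner_Integration.integral_diff)
    show "integrable lborel (\<lambda>t. indicator {0..b} t *\<^sub>R (y t \<bullet> m (prim y b)))"
      by (rule integrable_interval[OF square_integrable_linear[OF sqy bounded_linear_inner_left]])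
    show "integrable lborel (\<lambda>t. indicator {0..b} t *\<^sub>R (prim y t \<bullet> m (y t)))"
      using square_integrable_inner[OF square_integrable_prim[OF sqy, of b] sqmy] by simp
  qed
  also have "(LINT t|lborel. indicator {0..b} t *\<^sub>R (y t \<bullet> m (prim y b))) = prim y b \<bullet> m (prim y b)"
    unfolding prim_inner[OF sqy] by (simp add: prim_def)
  finally have "2 * X = m (prim y b) \<bullet> prim y b" by (simp add: inner_commute)
  then have X: "X \<ge> 0" using m_nonneg[of "prim y b"] by simp
  have ie: "integrable lborel (\<lambda>t. indicator {0..b} t *\<^sub>R (s (e t) \<bullet> e t))"
    by (rule integrable_interval_inner[OF square_integrable_linear[OF sqe s_linear] sqe])
  have nn: "0 \<le> indicator {0..b} t *\<^sub>R (s (e t) \<bullet> e t)" for t by (simp add: s_nonneg)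
  have "(LINT t|lborel. indicator {0..b} t *\<^sub>R (s (e t) \<bullet> e t)) = (LINT t|lborel. - (indicator {0..b} t *\<^sub>R (prim y t \<bullet> m (y t))))"
  proof (rule integral_cong_AE)
    show "(\<lambda>t. indicator {0..b} t *\<^sub>R (s (e t) \<bullet> e t)) \<in> borel_measurable lborel" using ie by simp
    note [measurable] = square_integrable_measurable[OF sqy] square_integrable_measurable[OF sqmy]
    show "(\<lambda>t. - (indicator {0..b} t *\<^sub>R (prim y t \<bullet> m (y t)))) \<in> borel_measurable lborel" by measurable
  qed (use rel in \<open>auto simp: indicator_def elim!: eventually_mono\<close>)
  then have "(LINT t|lborel. indicator {0..b} t *\<^sub>R (s (e t) \<bullet> e t)) \<le> 0" using X by (simp add: X_def)
  then have "(LINT t|lborel. indicator {0..b} t *\<^sub>R (s (e t) \<bullet> e t)) = 0"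
    by (intro antisym Bochner_Integration.integral_nonneg nn)
  then have "AE t in lborel. indicator {0..b} t *\<^sub>R (s (e t) \<bullet> e t) = 0"
    using integral_nonneg_eq_0_iff_AE[OF ie] nn by simp
  with eG show ?thesis
  proof eventually_elim
    fix t assume *: "indicator {0..b} t *\<^sub>R (s (e t) \<bullet> e t) = 0" and G: "t \<in> {0..b} \<longrightarrow> (e t, c t) \<in> G"
    show "t \<in> {0..b} \<longrightarrow> E t = E' t \<and> a t = a' t"
    proof
      assume t: "t \<in> {0..b}"
      then have "s (e t) \<bullet> e t = 0" using * by simp
      then have "norm (e t) \<le> \<Lambda> * norm (0::'h)" using s_lower[of "e t"] by (intro coercive_le) simp
      then have e0: "e t = 0" by simp
      then have "c t = 0" using G t G_unique by simp
      with e0 show "E t = E' t \<and> a t = a' t" by (simp add: e_def c_def)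
    qed
  qed
qed

lemma data_norm_mono:
  assumes "b \<le> b'" "square_integrable JEt" "square_integrable JM"
  shows "data_norm b k JEt JM \<le> data_norm b' k JEt JM" "0 \<le> data_norm b k JEt JM"
proof -
  have F: "square_integrable (\<lambda>t. (- JEt t, mi (JM t)))"
    by (intro square_integrable_Pair square_integrable_uminus assms square_integrable_linear[OF assms(3) mi_linear])
  have "integrable lborel (\<lambda>t. indicator {0..c} t *\<^sub>R (norm (- JEt t, mi (JM t)))\<^sup>2)" for c
    using F unfolding square_integrable_def by (intro integrable_mult_indicator) auto
  then show "data_norm b k JEt JM \<le> data_norm b' k JEt JM"
    unfolding data_norm_def using assms(1) by (intro add_left_mono integral_mono) (auto simp: indicator_def)
  show "0 \<le> data_norm b k JEt JM"
    unfolding data_norm_def by (intro add_nonneg_nonneg integral_nonneg_AE) auto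
qed

text \<open>For each \<open>b\<close> the solution constructed on \<open>{0..b}\<close> agrees with
  the given one and supplies a bounded vector \<open>z\<close> that fits the equation at time
  \<open>b\<close>. For almost every \<open>b\<close> it is compared with \<open>s (E b)\<close> by
  testing with \<open>(E b, a b)\<close> itself. That gives
  \<open>s (E b) \<bullet> E b = z \<bullet> E b\<close>, which coercivity turns into the bound,
  without identifying \<open>z\<close> and \<open>s (E b)\<close>.\<close>

lemma sol_estimate:
  assumes T: "0 \<le> T" and JEt: "square_integrable JEt" and JM: "square_integrable JM" and H0: "(H0, K0) \<in> adj"
    and sol: "is_sol T JE0 JEt JM H0 E a"
  defines "B \<equiv> (2 * \<Lambda>\<^sup>2 * (1 + T))\<^sup>2 * data_norm T (K0 - JE0) JEt JM"
  shows "(LINT t|lborel. indicator {0..T} t *\<^sub>R (norm (a t))\<^sup>2) \<le> B"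
    and "AE t\<in>{0..T} in lborel. (norm (E t))\<^sup>2 \<le> \<Lambda>\<^sup>2 * B"
proof -
  have sq: "square_integrable E" "square_integrable a" using sol by (auto simp: is_sol_def)
  have le: "(2 * \<Lambda>\<^sup>2 * (1 + b))\<^sup>2 * data_norm b (K0 - JE0) JEt JM \<le> B" if "0 \<le> b" "b \<le> T" for b
    unfolding B_def using that \<Lambda>_pos data_norm_mono[OF _ JEt JM]
    by (intro mult_mono power_mono mult_left_mono) auto
  have terminal: "\<exists>z. (field_H JM H0 a b, z + (JE0 + prim JEt b)) \<in> adj \<and> (norm z)\<^sup>2 \<le> B \<and>
     (LINT t|lborel. indicator {0..b} t *\<^sub>R (norm (a t))\<^sup>2) \<le> B"
    if b: "b \<in> {0..T}" for b
  proof -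
    obtain E' a' z where s': "is_sol b JE0 JEt JM H0 E' a'"
      "(field_H JM H0 a' b, z + (JE0 + prim JEt b)) \<in> adj"
      "(LINT t|lborel. (norm (E' t, a' t))\<^sup>2) + (norm z)\<^sup>2 \<le> (2 * \<Lambda>\<^sup>2 * (1 + b))\<^sup>2 * data_norm b (K0 - JE0) JEt JM"
      by (rule sol_exists[OF _ JEt JM H0, of b JE0], use b in simp, rule that; assumption)
    have sq': "square_integrable E'" "square_integrable a'" using s'(1) by (auto simp: is_sol_def)
    have "AE t\<in>{0..T} in lborel. (E t, a t) \<in> G"
      "AE t\<in>{0..T} in lborel. (field_H JM H0 a t, s (E t) + (JE0 + prim JEt t)) \<in> adj"
      using sol by (auto simp: is_sol_def)
    then have "AE t\<in>{0..b} in lborel. (E t, a t) \<in> G"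
      "AE t\<in>{0..b} in lborel. (field_H JM H0 a t, s (E t) + (JE0 + prim JEt t)) \<in> adj"
      using b by (force elim: eventually_mono)+
    then have "is_sol b JE0 JEt JM H0 E a" unfolding is_sol_def using sq by blast
    then have eq: "AE t\<in>{0..b} in lborel. E t = E' t \<and> a t = a' t"
      using b by (intro sol_unique[OF _ JM _ s'(1)]) auto
    \<comment> \<open>Agreement almost everywhere on \<open>{0..b}\<close> makes the two magnetic
      fields equal at the single time \<open>b\<close>, where \<open>z\<close> fits the
      equation.\<close>
    have "prim (\<lambda>r. mi (JM r - a r)) b = prim (\<lambda>r. mi (JM r - a' r)) b"
      by (rule prim_cong_AE[where b=b])
        (use eq in \<open>auto intro!: square_integrable_measurable square_integrable_linear[OF _ mi_linear] square_integrable_diff JM sq sq' elim!: eventually_mono\<close>)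
    then have "(field_H JM H0 a b, z + (JE0 + prim JEt b)) \<in> adj" using s'(2) by (simp add: field_H_def)
    moreover have tot: "(LINT t|lborel. (norm (E' t, a' t))\<^sup>2) + (norm z)\<^sup>2 \<le> B" using s'(3) le[of b] b by simp
    moreover have "0 \<le> (LINT t|lborel. (norm (E' t, a' t))\<^sup>2)" by simp
    moreover have "(LINT t|lborel. indicator {0..b} t *\<^sub>R (norm (a t))\<^sup>2) \<le> (LINT t|lborel. (norm (E' t, a' t))\<^sup>2)"
    proof (rule integral_mono_AE)
      show "integrable lborel (\<lambda>t. indicator {0..b} t *\<^sub>R (norm (a t))\<^sup>2)"
        using sq(2) unfolding square_integrable_def by (intro integrable_mult_indicator) auto
      show "integrable lborel (\<lambda>t. (norm (E' t, a' t))\<^sup>2)"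
        using square_integrable_Pair[OF sq'] by (simp add: square_integrable_def)
      show "AE t in lborel. indicator {0..b} t *\<^sub>R (norm (a t))\<^sup>2 \<le> (norm (E' t, a' t))\<^sup>2"
        using eq by eventually_elim (auto simp: indicator_def norm_prod_def)
    qed
    moreover have "0 \<le> (norm z)\<^sup>2" by simp
    ultimately show ?thesis by (intro exI[of _ z]) linarith
  qed
  show "(LINT t|lborel. indicator {0..T} t *\<^sub>R (norm (a t))\<^sup>2) \<le> B" using terminal[of T] T by auto
  have "AE t\<in>{0..T} in lborel. (E t, a t) \<in> G"
    "AE t\<in>{0..T} in lborel. (field_H JM H0 a t, s (E t) + (JE0 + prim JEt t)) \<in> adj"
    using sol by (auto simp: is_sol_def)
  then show "AE t\<in>{0..T} in lborel. (norm (E t))\<^sup>2 \<le> \<Lambda>\<^sup>2 * B"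
  proof eventually_elim
    fix t assume G: "t \<in> {0..T} \<longrightarrow> (E t, a t) \<in> G"
      and A: "t \<in> {0..T} \<longrightarrow> (field_H JM H0 a t, s (E t) + (JE0 + prim JEt t)) \<in> adj"
    show "t \<in> {0..T} \<longrightarrow> (norm (E t))\<^sup>2 \<le> \<Lambda>\<^sup>2 * B"
    proof
      assume t: "t \<in> {0..T}"
      obtain z where z: "(field_H JM H0 a t, z + (JE0 + prim JEt t)) \<in> adj" "(norm z)\<^sup>2 \<le> B" using terminal[OF t] by blast
      have "(z + (JE0 + prim JEt t)) \<bullet> E t = (s (E t) + (JE0 + prim JEt t)) \<bullet> E t"
        using adjD[OF z(1)] adjD[of _ _ "E t" "a t"] G A t by metis
      then have "inverse \<Lambda> * (norm (E t))\<^sup>2 \<le> z \<bullet> E t" using s_lower[of "E t"] by (simp add: inner_add)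
      then have "norm (E t) \<le> \<Lambda> * norm z" by (rule coercive_le)
      then have "(norm (E t))\<^sup>2 \<le> (\<Lambda> * norm z)\<^sup>2" by (intro power_mono) auto
      also have "\<dots> \<le> \<Lambda>\<^sup>2 * B" unfolding power_mult_distrib using z(2) by (intro mult_left_mono) auto
      finally show "(norm (E t))\<^sup>2 \<le> \<Lambda>\<^sup>2 * B" .
    qed
  qed
qed

end

section \<open>Multiplication operators\<close>

definition mulop :: "('a \<Rightarrow> 'b \<Rightarrow> 'b) \<Rightarrow> ('a::euclidean_space, 'b::{real_inner, second_countable_topology, banach}) l2 \<Rightarrow> ('a, 'b) l2" where
  "mulop A u = to_l2 (\<lambda>x. A x (rep_l2 u x))"

text \<open>The bounds are pointwise. Measurability is asked of compositions, which suits an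
  operator that is a matrix field on a domain and the identity elsewhere.\<close>

locale multiplier =
  fixes A :: "'a::euclidean_space \<Rightarrow> 'b::{real_inner, second_countable_topology, banach} \<Rightarrow> 'b" and \<Lambda> :: real
  assumes \<Lambda>_pos: "\<Lambda> > 0"
    and measurable_A: "\<And>f. f \<in> borel_measurable borel \<Longrightarrow> (\<lambda>x. A x (f x)) \<in> borel_measurable borel"
    and bounds: "AE x in lborel. bounded_linear (A x) \<and> (\<forall>y z. A x y \<bullet> z = y \<bullet> A x z) \<and>
      (\<forall>y. inverse \<Lambda> * (norm y)\<^sup>2 \<le> A x y \<bullet> y \<and> A x y \<bullet> y \<le> \<Lambda> * (norm y)\<^sup>2)"
begin

lemma sq_A:
  assumes f: "square_integrable f"
  shows "square_integrable (\<lambda>x. A x (f x))"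
proof (rule square_integrable_bound[OF f measurable_A, where C=\<Lambda>])
  show "AE x in lborel. norm (A x (f x)) \<le> \<Lambda> * norm (f x)"
    using bounds
  proof eventually_elim
    fix x assume *: "bounded_linear (A x) \<and> (\<forall>y z. A x y \<bullet> z = y \<bullet> A x z) \<and>
      (\<forall>y. inverse \<Lambda> * (norm y)\<^sup>2 \<le> A x y \<bullet> y \<and> A x y \<bullet> y \<le> \<Lambda> * (norm y)\<^sup>2)"
    have "0 \<le> A x y \<bullet> y" for y
      using * \<Lambda>_pos by (meson mult_nonneg_nonneg order_trans less_imp_le zero_le_power2 positive_imp_inverse_positive)
    then have "(norm (A x (f x)))\<^sup>2 \<le> \<Lambda> * (A x (f x) \<bullet> f x)"
      using * by (intro symmetric_form_bound \<Lambda>_pos) auto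
    also have "\<dots> \<le> \<Lambda> * (\<Lambda> * (norm (f x))\<^sup>2)" using * \<Lambda>_pos by (intro mult_left_mono) auto
    finally have "(norm (A x (f x)))\<^sup>2 \<le> (\<Lambda> * norm (f x))\<^sup>2" by (simp add: power2_eq_square mult_ac)
    then show "norm (A x (f x)) \<le> \<Lambda> * norm (f x)" by (rule power2_le_imp_le) (use \<Lambda>_pos in simp)
  qed
qed (use square_integrable_measurable[OF f] in simp)

lemma rep_mulop: "AE x in lborel. rep_l2 (mulop A u) x = A x (rep_l2 u x)"
  unfolding mulop_def by (rule rep_to_l2[OF sq_A]) simp

lemma inner_mulop: "mulop A u \<bullet> v = (LINT x|lborel. A x (rep_l2 u x) \<bullet> rep_l2 v x)"
  unfolding mulop_def using inner_to_l2[OF sq_A[OF square_integrable_rep] square_integrable_rep, of u v] by simp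

lemma mulop_sym: "mulop A u \<bullet> v = u \<bullet> mulop A v"
proof -
  have "mulop A u \<bullet> v = (LINT x|lborel. rep_l2 u x \<bullet> A x (rep_l2 v x))"
    unfolding inner_mulop
  proof (rule integral_cong_AE)
    show "AE x in lborel. A x (rep_l2 u x) \<bullet> rep_l2 v x = rep_l2 u x \<bullet> A x (rep_l2 v x)"
      using bounds by eventually_elim blast
  qed (auto intro!: borel_measurable_inner measurable_A)
  also have "\<dots> = mulop A v \<bullet> u" unfolding inner_mulop by (simp add: inner_commute)
  also have "\<dots> = u \<bullet> mulop A v" by (rule inner_commute)
  finally show ?thesis .
qed

lemma mulop_integrable: "integrable lborel (\<lambda>x. A x (rep_l2 u x) \<bullet> rep_l2 u x)"
  by (intro square_integrable_inner sq_A) simp_all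

lemma mulop_lower: "inverse \<Lambda> * (norm u)\<^sup>2 \<le> mulop A u \<bullet> u"
proof -
  have i: "integrable lborel (\<lambda>x. (norm (rep_l2 u x))\<^sup>2)" using square_integrable_rep[of u] by (simp add: square_integrable_def)
  have "inverse \<Lambda> * (norm u)\<^sup>2 = (LINT x|lborel. inverse \<Lambda> * (norm (rep_l2 u x))\<^sup>2)" by (simp add: power2_norm_l2)
  also have "\<dots> \<le> mulop A u \<bullet> u"
    unfolding inner_mulop using i
  proof (intro integral_mono_AE mulop_integrable)
    show "AE x in lborel. inverse \<Lambda> * (norm (rep_l2 u x))\<^sup>2 \<le> A x (rep_l2 u x) \<bullet> rep_l2 u x"
      using bounds by eventually_elim blast
  qed simp
  finally show ?thesis .
qed

lemma mulop_upper: "mulop A u \<bullet> u \<le> \<Lambda> * (norm u)\<^sup>2"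
proof -
  have i: "integrable lborel (\<lambda>x. (norm (rep_l2 u x))\<^sup>2)" using square_integrable_rep[of u] by (simp add: square_integrable_def)
  have "mulop A u \<bullet> u \<le> (LINT x|lborel. \<Lambda> * (norm (rep_l2 u x))\<^sup>2)"
    unfolding inner_mulop using i
  proof (intro integral_mono_AE mulop_integrable)
    show "AE x in lborel. A x (rep_l2 u x) \<bullet> rep_l2 u x \<le> \<Lambda> * (norm (rep_l2 u x))\<^sup>2"
      using bounds by eventually_elim blast
  qed simp
  also have "\<dots> = \<Lambda> * (norm u)\<^sup>2" by (simp add: power2_norm_l2)
  finally show ?thesis .
qed

lemma bounded_linear_mulop: "bounded_linear (mulop A)"
proof (rule bounded_linear_intro)
  show "mulop A (u + v) = mulop A u + mulop A v" for u v
    using rep_mulop[of "u + v"] rep_mulop[of u] rep_mulop[of v] rep_add[of u v] rep_add[of "mulop A u" "mulop A v"] bounds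
    by (intro l2_eqI, eventually_elim) (simp add: linear_add[OF bounded_linear.linear])
  show lin: "mulop A (c *\<^sub>R u) = c *\<^sub>R mulop A u" for c u
    using rep_mulop[of "c *\<^sub>R u"] rep_mulop[of u] rep_scaleR[of c u] rep_scaleR[of c "mulop A u"] bounds
    by (intro l2_eqI, eventually_elim) (simp add: linear_scale[OF bounded_linear.linear])
  show "norm (mulop A u) \<le> norm u * \<Lambda>" for u
  proof -
    have "norm (mulop A u) * norm (mulop A u) = (LINT x|lborel. (norm (A x (rep_l2 u x)))\<^sup>2)"
      unfolding power2_eq_square[symmetric] mulop_def by (rule power2_norm_to_l2[OF sq_A]) simp
    also have "\<dots> \<le> (LINT x|lborel. \<Lambda> * (A x (rep_l2 u x) \<bullet> rep_l2 u x))"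
    proof (rule integral_mono_AE)
      show "integrable lborel (\<lambda>x. (norm (A x (rep_l2 u x)))\<^sup>2)" using sq_A[OF square_integrable_rep, of u] by (simp add: square_integrable_def)
      show "integrable lborel (\<lambda>x. \<Lambda> * (A x (rep_l2 u x) \<bullet> rep_l2 u x))" by (intro integrable_mult_right mulop_integrable)
      show "AE x in lborel. (norm (A x (rep_l2 u x)))\<^sup>2 \<le> \<Lambda> * (A x (rep_l2 u x) \<bullet> rep_l2 u x)"
        using bounds
      proof eventually_elim
        fix x assume *: "bounded_linear (A x) \<and> (\<forall>y z. A x y \<bullet> z = y \<bullet> A x z) \<and>
          (\<forall>y. inverse \<Lambda> * (norm y)\<^sup>2 \<le> A x y \<bullet> y \<and> A x y \<bullet> y \<le> \<Lambda> * (norm y)\<^sup>2)"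
        have "0 \<le> A x y \<bullet> y" for y
          using * \<Lambda>_pos by (meson mult_nonneg_nonneg order_trans less_imp_le zero_le_power2 positive_imp_inverse_positive)
        then show "(norm (A x (rep_l2 u x)))\<^sup>2 \<le> \<Lambda> * (A x (rep_l2 u x) \<bullet> rep_l2 u x)"
          using * by (intro symmetric_form_bound \<Lambda>_pos) auto
      qed
    qed
    also have "\<dots> = \<Lambda> * (mulop A u \<bullet> u)" by (simp add: inner_mulop)
    also have "\<dots> \<le> \<Lambda> * (norm (mulop A u) * norm u)" using \<Lambda>_pos by (intro mult_left_mono norm_cauchy_schwarz) auto
    finally have "norm (mulop A u) * norm (mulop A u) \<le> (norm u * \<Lambda>) * norm (mulop A u)" by (simp add: mult_ac)
    then show ?thesis using \<Lambda>_pos by (cases "mulop A u = 0") (auto simp: mult_le_cancel_right)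
  qed
qed

end

section \<open>Bochner spaces\<close>

lemma square_integrable_imp_lebesgue_on_measurable:
  assumes "square_integrable (U :: real \<Rightarrow> 'w::{real_inner, second_countable_topology, banach})"
  shows "U \<in> borel_measurable (lebesgue_on {0..T})"
  using square_integrable_measurable[OF assms] by (intro measurable_restrict_space1 measurable_completion) simp

text \<open>In the next two lemmas \<open>j\<close> identifies \<open>(V, N)\<close>, up to null sets, with the closed subspace
  \<open>W\<close> of a Hilbert space, and \<open>r\<close> chooses representatives. Projecting onto \<open>W\<close> makes approximating
  simple functions \<open>V\<close>-valued.\<close>

lemma Bochner_L2I:
  fixes U :: "real \<Rightarrow> 'w::{real_inner, second_countable_topology, banach}" and r :: "'w \<Rightarrow> R3 \<Rightarrow> R3"
  assumes W: "subspace W" "closed W" and r: "\<And>w. w \<in> W \<Longrightarrow> r w \<in> V"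
    and j: "\<And>f. f \<in> V \<Longrightarrow> j f \<in> W" "\<And>f. f \<in> V \<Longrightarrow> N f = norm (j f)"
      "\<And>w f. w \<in> W \<Longrightarrow> f \<in> V \<Longrightarrow> N (\<lambda>x. r w x - f x) = norm (w - j f)"
    and U: "square_integrable U" "AE t\<in>{0..T} in lborel. f t \<in> V \<and> j (f t) = U t"
  shows "f \<in> Bochner_L2 T V N"
proof -
  have ae: "AE t in lebesgue_on {0..T}. f t \<in> V \<and> j (f t) = U t"
    using U(2) by (subst AE_lebesgue_on_iff) auto
  have sp: "space (lebesgue_on {0..T}) = {0..T}" by (simp add: space_restrict_space)
  obtain s where s: "\<And>i. simple_function (lebesgue_on {0..T}) (s i)"
    "\<And>x. x \<in> {0..T} \<Longrightarrow> (\<lambda>i. s i x) \<longlonglongrightarrow> U x"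
    using borel_measurable_implies_sequence_metric[OF square_integrable_imp_lebesgue_on_measurable[OF U(1), of T], of 0]
    unfolding sp by blast
  define S where "S k t = r (proj W (s k t))" for k t
  have "simple_function (lebesgue_on {0..T}) (S k)" for k
    unfolding S_def using simple_function_compose[OF s(1), of "\<lambda>x. r (proj W x)" k] by (simp add: comp_def)
  moreover have "S k ` {0..T} \<subseteq> V" for k
    unfolding S_def using r proj_in[OF W] by blast
  moreover have "AE t in lebesgue_on {0..T}. (\<lambda>k. N (\<lambda>x. S k t x - f t x)) \<longlonglongrightarrow> 0"
    using ae AE_space
  proof eventually_elim
    fix t assume *: "f t \<in> V \<and> j (f t) = U t" and "t \<in> space (lebesgue_on {0..T})"
    then have t: "t \<in> {0..T}" by (simp add: space_restrict_space)
    have "(\<lambda>k. proj W (s k t)) \<longlonglongrightarrow> proj W (U t)"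
      using s(2)[OF t] by (rule bounded_linear.tendsto[OF bounded_linear_proj[OF W]])
    moreover have "U t \<in> W" using * j(1) by metis
    then have "proj W (U t) = U t" by (rule proj_id[OF W])
    ultimately have "(\<lambda>k. norm (proj W (s k t) - U t)) \<longlonglongrightarrow> 0"
      by (simp add: tendsto_norm_zero_iff LIM_zero_iff)
    moreover have "N (\<lambda>x. S k t x - f t x) = norm (proj W (s k t) - U t)" for k
      unfolding S_def using * j(3)[OF proj_in[OF W]] by simp
    ultimately show "(\<lambda>k. N (\<lambda>x. S k t x - f t x)) \<longlonglongrightarrow> 0" by simp
  qed
  moreover have "integrable (lebesgue_on {0..T}) (\<lambda>t. (N (f t))\<^sup>2)"
  proof (subst integral_lebesgue_on(2))
    show "(\<lambda>t. indicator {0..T} t *\<^sub>R (norm (U t))\<^sup>2) \<in> borel_measurable borel"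
      using square_integrable_measurable[OF U(1)] by measurable
    show "AE t in lborel. indicator {0..T} t *\<^sub>R (norm (U t))\<^sup>2 = indicator {0..T} t *\<^sub>R (N (f t))\<^sup>2"
      using U(2) by eventually_elim (auto simp: indicator_def j(2))
    show "integrable lborel (\<lambda>t. indicator {0..T} t *\<^sub>R (norm (U t))\<^sup>2)"
      using U(1) unfolding square_integrable_def by (intro integrable_mult_indicator) auto
  qed simp
  ultimately show ?thesis
    unfolding Bochner_L2_def using ae by (auto intro!: exI[of _ S] elim: eventually_mono)
qed

lemma Bochner_L2D:
  fixes j :: "(R3 \<Rightarrow> R3) \<Rightarrow> 'w::{real_inner, second_countable_topology, banach}"
  assumes j: "\<And>f. f \<in> V \<Longrightarrow> N f = norm (j f)"
      "\<And>g f. g \<in> V \<Longrightarrow> f \<in> V \<Longrightarrow> N (\<lambda>x. g x - f x) = norm (j g - j f)"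
    and f: "f \<in> Bochner_L2 T V N"
  obtains U where "square_integrable U" "AE t\<in>{0..T} in lborel. f t \<in> V \<and> j (f t) = U t"
proof -
  let ?M = "lebesgue_on {0..T}"
  obtain s where fV: "AE t in ?M. f t \<in> V"
    and s: "\<And>k::nat. simple_function ?M (s k)" "\<And>k. s k ` {0..T} \<subseteq> V"
      "AE t in ?M. (\<lambda>k. N (\<lambda>x. s k t x - f t x)) \<longlonglongrightarrow> 0"
    and int: "integrable ?M (\<lambda>t. (N (f t))\<^sup>2)"
    using f unfolding Bochner_L2_def by auto
  have sm: "(\<lambda>t. j (s k t)) \<in> borel_measurable ?M" for k
    using borel_measurable_simple_function[OF simple_function_compose[OF s(1), of j k]] by (simp add: comp_def)
  have L: "(\<lambda>t. lim (\<lambda>k. j (s k t))) \<in> borel_measurable ?M"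
    by (rule borel_measurable_lim_metric[OF sm])
  have conv: "AE t in ?M. f t \<in> V \<and> lim (\<lambda>k. j (s k t)) = j (f t)"
    using fV s(3) AE_space
  proof eventually_elim
    fix t assume V: "f t \<in> V" and lim: "(\<lambda>k. N (\<lambda>x. s k t x - f t x)) \<longlonglongrightarrow> 0" and "t \<in> space ?M"
    then have "t \<in> {0..T}" by (simp add: space_restrict_space)
    then have sV: "s k t \<in> V" for k using s(2) by blast
    have "(\<lambda>k. norm (j (s k t) - j (f t))) \<longlonglongrightarrow> 0" using lim j(2)[OF sV V] by simp
    then have "(\<lambda>k. j (s k t)) \<longlonglongrightarrow> j (f t)" by (simp add: tendsto_norm_zero_iff LIM_zero_iff)
    then show "f t \<in> V \<and> lim (\<lambda>k. j (s k t)) = j (f t)" using V limI by blast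
  qed
  define F where "F t = lim (\<lambda>k. j (s k t))" for t
  have "integrable ?M (\<lambda>t. (norm (F t))\<^sup>2)"
  proof (rule integrable_cong_AE_imp[OF int])
    have [measurable]: "F \<in> borel_measurable ?M" using L by (simp add: F_def[abs_def])
    show "(\<lambda>t. (norm (F t))\<^sup>2) \<in> borel_measurable ?M" by measurable
    show "AE t in ?M. (N (f t))\<^sup>2 = (norm (F t))\<^sup>2"
      using conv by eventually_elim (simp add: F_def j(1))
  qed
  then have "AE t in lborel. rep_l2 (emb {0..T} F) t = indicator {0..T} t *\<^sub>R F t"
    using L by (intro ex_square_integrable_version) (simp_all add: F_def[abs_def])
  moreover have "AE t\<in>{0..T} in lborel. f t \<in> V \<and> F t = j (f t)"
    using conv by (subst (asm) AE_lebesgue_on_iff) (simp_all add: F_def)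
  ultimately have "AE t\<in>{0..T} in lborel. f t \<in> V \<and> j (f t) = rep_l2 (emb {0..T} F) t"
    by eventually_elim auto
  then show thesis by (rule that[OF square_integrable_rep])
qed

text \<open>Isometric for the norm of \<open>H1_curl\<close>, with image
  \<open>graph_curl \<Omega>\<close>; it is the map \<open>j\<close> when the Bochner lemmas are
  applied to the curl spaces.\<close>

definition curl_pair :: "R3 set \<Rightarrow> (R3 \<Rightarrow> R3) \<Rightarrow> (R3, R3) l2 \<times> (R3, R3) l2" where
  "curl_pair \<Omega> f = (emb \<Omega> f, emb \<Omega> (wcurl \<Omega> f))"

context
  fixes \<Omega> :: "R3 set"
  assumes op: "open \<Omega>"
begin

lemma Bochner_L2_L2I:
  assumes "square_integrable U" "AE t\<in>{0..T} in lborel. f t \<in> L2 \<Omega> \<and> emb \<Omega> (f t) = U t"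
  shows "f \<in> Bochner_L2 T (L2 \<Omega>) (L2_norm \<Omega>)"
proof (rule Bochner_L2I[OF _ _ _ _ _ _ assms])
  note b = \<Omega>_borel[OF op]
  let ?W = "{u :: (R3, R3) l2. cut \<Omega> u = u}"
  show "subspace ?W" by (rule subspaceI) (auto simp: cut_zero[OF b] cut_add[OF b] cut_scaleR[OF b])
  show "closed ?W" by (intro closed_Collect_eq linear_continuous_on[OF bounded_linear_cut[OF b]] continuous_on_id)
  show "rep_l2 w \<in> L2 \<Omega>" for w :: "(R3, R3) l2" by (rule rep_L2[OF b])
  show "emb \<Omega> f \<in> ?W" "L2_norm \<Omega> f = norm (emb \<Omega> f)" if "f \<in> L2 \<Omega>" for f
    using that by (simp_all add: cut_emb[OF b] L2_norm_emb[OF b])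
  show "L2_norm \<Omega> (\<lambda>x. rep_l2 w x - f x) = norm (w - emb \<Omega> f)" if "w \<in> ?W" "f \<in> L2 \<Omega>" for w f
    using that by (simp add: L2_norm_emb[OF b] L2_diff[OF b] emb_diff[OF b] rep_L2[OF b])
qed

lemma Bochner_L2_L2D:
  assumes "f \<in> Bochner_L2 T (L2 \<Omega>) (L2_norm \<Omega>)"
  obtains U where "square_integrable U" "AE t\<in>{0..T} in lborel. f t \<in> L2 \<Omega> \<and> emb \<Omega> (f t) = U t"
  by (rule Bochner_L2D[OF _ _ assms, of "emb \<Omega>"])
    (use \<Omega>_borel[OF op] in \<open>auto simp: L2_norm_emb L2_diff emb_diff\<close>)

lemma curl_pair_diff:
  assumes "f \<in> H1_curl \<Omega>" "g \<in> H1_curl \<Omega>"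
  shows "(\<lambda>x. f x - g x) \<in> H1_curl \<Omega>" "curl_pair \<Omega> (\<lambda>x. f x - g x) = curl_pair \<Omega> f - curl_pair \<Omega> g"
proof -
  note b = \<Omega>_borel[OF op]
  note L = H1_curl_L2[OF op assms(1)] H1_curl_L2[OF op assms(2)]
  have "(emb \<Omega> f, emb \<Omega> (wcurl \<Omega> f)) - (emb \<Omega> g, emb \<Omega> (wcurl \<Omega> g)) \<in> graph_curl \<Omega>"
    by (intro subspace_diff subspace_graph_curl wcurl op assms)
  then have "(emb \<Omega> (\<lambda>x. f x - g x), emb \<Omega> (wcurl \<Omega> f) - emb \<Omega> (wcurl \<Omega> g)) \<in> graph_curl \<Omega>"
    by (simp add: emb_diff[OF b] L)
  from H1_curlI[OF op L2_diff[OF b L] this]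
  show "(\<lambda>x. f x - g x) \<in> H1_curl \<Omega>" "curl_pair \<Omega> (\<lambda>x. f x - g x) = curl_pair \<Omega> f - curl_pair \<Omega> g"
    by (auto simp: curl_pair_def emb_diff[OF b] L)
qed

lemma H1_curl_norm_eq: "f \<in> H1_curl \<Omega> \<Longrightarrow> H1_curl_norm \<Omega> f = norm (curl_pair \<Omega> f)"
  by (simp add: H1_curl_norm_def curl_pair_def norm_prod_def L2_norm_emb[OF \<Omega>_borel[OF op]] wcurl[OF op] H1_curl_L2[OF op])

lemma Bochner_L2_curl:
  assumes U: "square_integrable U" and W: "subspace W" "closed W" "\<And>w. w \<in> W \<Longrightarrow> rep_l2 (fst w) \<in> V \<and> curl_pair \<Omega> (rep_l2 (fst w)) = w"
    and V: "V \<subseteq> H1_curl \<Omega>" "\<And>f. f \<in> V \<Longrightarrow> curl_pair \<Omega> f \<in> W"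
    and f: "AE t\<in>{0..T} in lborel. f t \<in> V \<and> curl_pair \<Omega> (f t) = U t"
  shows "f \<in> Bochner_L2 T V (H1_curl_norm \<Omega>)"
proof (rule Bochner_L2I[OF W(1,2) _ V(2) _ _ U f])
  show "rep_l2 (fst w) \<in> V" if "w \<in> W" for w using W(3)[OF that] by simp
  show "H1_curl_norm \<Omega> f = norm (curl_pair \<Omega> f)" if "f \<in> V" for f using that V H1_curl_norm_eq by blast
  fix w f assume w: "w \<in> W" and f: "f \<in> V"
  have H: "rep_l2 (fst w) \<in> H1_curl \<Omega>" "f \<in> H1_curl \<Omega>" using W(3)[OF w] V(1) f by auto
  show "H1_curl_norm \<Omega> (\<lambda>x. rep_l2 (fst w) x - f x) = norm (w - curl_pair \<Omega> f)"
    using H1_curl_norm_eq[OF curl_pair_diff(1)[OF H]] curl_pair_diff(2)[OF H] W(3)[OF w] by simp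
qed

lemma Bochner_L2_curlD:
  assumes "f \<in> Bochner_L2 T V (H1_curl_norm \<Omega>)" "V \<subseteq> H1_curl \<Omega>"
  obtains U where "square_integrable U" "AE t\<in>{0..T} in lborel. f t \<in> V \<and> curl_pair \<Omega> (f t) = U t"
proof (rule Bochner_L2D[OF _ _ assms(1), of "curl_pair \<Omega>"])
  show "H1_curl_norm \<Omega> f = norm (curl_pair \<Omega> f)" if "f \<in> V" for f using that assms(2) H1_curl_norm_eq by blast
  fix g f assume "g \<in> V" "f \<in> V"
  then have H: "g \<in> H1_curl \<Omega>" "f \<in> H1_curl \<Omega>" using assms(2) by auto
  show "H1_curl_norm \<Omega> (\<lambda>x. g x - f x) = norm (curl_pair \<Omega> g - curl_pair \<Omega> f)"
    using H1_curl_norm_eq[OF curl_pair_diff(1)[OF H]] curl_pair_diff(2)[OF H] by simp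
qed

end

section \<open>Weak time derivatives\<close>

lemma test_function_deriv:
  assumes "\<eta> \<in> test_functions {0<..<T::real}"
  shows "(\<eta> has_real_derivative deriv \<eta> t) (at t)" "continuous_on UNIV (deriv \<eta>)" "\<eta> 0 = 0" "\<eta> T = 0"
proof -
  note s = test_functions_smooth[OF assms]
  have D: "(\<eta> has_real_derivative dderiv \<eta> 1 t) (at t)" for t
    using s smooth_derivative(1)[OF s, of t] by (intro real_has_derivative_iff) (auto simp: differentiable_def)
  then have eq: "deriv \<eta> = dderiv \<eta> 1" by (auto simp: fun_eq_iff intro: DERIV_imp_deriv)
  show "(\<eta> has_real_derivative deriv \<eta> t) (at t)" unfolding eq by (rule D)
  show "continuous_on UNIV (deriv \<eta>)" unfolding eq by (rule smooth_continuous[OF smooth_derivative(2)[OF s]])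
  show "\<eta> 0 = 0" "\<eta> T = 0" by (rule test_functions_zero_outside[OF assms], simp)+
qed

text \<open>On the interval \<open>deriv \<eta>\<close> has integral 0 and primitive
  \<open>\<eta>\<close>, so constants drop out and \<open>integral_prim_inner\<close> moves the
  derivative.\<close>

lemma integral_deriv_prim:
  fixes g :: "real \<Rightarrow> real"
  assumes T: "0 \<le> T" and \<eta>: "\<eta> \<in> test_functions {0<..<T}" and g: "square_integrable g"
  shows "(LINT t|lborel. indicator {0..T} t *\<^sub>R (deriv \<eta> t * (c + prim g t))) = - (LINT t|lborel. indicator {0..T} t *\<^sub>R (\<eta> t * g t))"
    and "integrable lborel (\<lambda>t. indicator {0..T} t *\<^sub>R (deriv \<eta> t * (c + prim g t)))"
proof -
  note d = test_function_deriv[OF \<eta>]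
  define D where "D t = indicator {0..T} t *\<^sub>R deriv \<eta> t" for t
  have sqD: "square_integrable D" unfolding D_def by (rule square_integrable_interval_continuous[OF d(2)])
  have pD: "prim D t = \<eta> t" if "t \<in> {0..T}" for t
    using that prim_antiderivative[OF d(1,2), of t] prim_cong[of t D "deriv \<eta>"] d(3) by (auto simp: D_def)
  have i1: "integrable lborel (\<lambda>t. indicator {0..T} t *\<^sub>R (deriv \<eta> t * (prim g T + c)))"
  proof -
    have eq: "indicator {0..T} t *\<^sub>R (deriv \<eta> t * (prim g T + c)) = (indicator {0..T} t *\<^sub>R D t) * (prim g T + c)" for t
      by (simp add: D_def indicator_def)
    show ?thesis unfolding eq by (intro integrable_mult_left integrable_interval[OF sqD])
  qed
  have i2: "integrable lborel (\<lambda>t. indicator {0..T} t *\<^sub>R (D t \<bullet> (prim g T - prim g t)))"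
  proof -
    have "square_integrable (\<lambda>t. indicator {0..T} t *\<^sub>R prim g T - indicator {0..T} t *\<^sub>R prim g t)"
      by (intro square_integrable_diff square_integrable_prim g square_integrable_indicator) (auto simp: T)
    from square_integrable_inner[OF sqD this] show ?thesis by (simp add: algebra_simps)
  qed
  have eq: "indicator {0..T} t *\<^sub>R (deriv \<eta> t * (c + prim g t))
      = indicator {0..T} t *\<^sub>R (deriv \<eta> t * (prim g T + c)) - indicator {0..T} t *\<^sub>R (D t \<bullet> (prim g T - prim g t))" for t
    by (simp add: D_def indicator_def algebra_simps)
  show "integrable lborel (\<lambda>t. indicator {0..T} t *\<^sub>R (deriv \<eta> t * (c + prim g t)))"
    unfolding eq by (rule Bochner_Integration.integrable_diff[OF i1 i2])
  have z: "(LINT t|lborel. indicator {0..T} t *\<^sub>R deriv \<eta> t) = 0"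
    using prim_antiderivative[OF d(1,2) T] d(3,4) by (simp add: prim_def)
  have "(LINT t|lborel. indicator {0..T} t *\<^sub>R (deriv \<eta> t * (c + prim g t)))
      = (LINT t|lborel. indicator {0..T} t *\<^sub>R (deriv \<eta> t * (prim g T + c))) - (LINT t|lborel. indicator {0..T} t *\<^sub>R (D t \<bullet> (prim g T - prim g t)))"
    unfolding eq by (rule Bochner_Integration.integral_diff[OF i1 i2])
  also have "(LINT t|lborel. indicator {0..T} t *\<^sub>R (deriv \<eta> t * (prim g T + c))) = 0"
  proof -
    have "(LINT t|lborel. indicator {0..T} t *\<^sub>R (deriv \<eta> t * (prim g T + c))) = (LINT t|lborel. (indicator {0..T} t *\<^sub>R deriv \<eta> t) * (prim g T + c))"
      by (simp add: mult.assoc)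
    also have "\<dots> = 0" by (subst integral_mult_left_zero) (simp only: z mult_zero_left)
    finally show ?thesis .
  qed
  also have "(LINT t|lborel. indicator {0..T} t *\<^sub>R (D t \<bullet> (prim g T - prim g t))) = (LINT t|lborel. indicator {0..T} t *\<^sub>R (prim D t \<bullet> g t))"
    by (rule integral_prim_inner[OF sqD g, symmetric])
  also have "\<dots> = (LINT t|lborel. indicator {0..T} t *\<^sub>R (\<eta> t * g t))"
    by (rule Bochner_Integration.integral_cong) (auto simp: indicator_def pD)
  finally show "(LINT t|lborel. indicator {0..T} t *\<^sub>R (deriv \<eta> t * (c + prim g t))) = - (LINT t|lborel. indicator {0..T} t *\<^sub>R (\<eta> t * g t))"
    by simp
qed

text \<open>The decomposition behind the du Bois-Reymond lemma; \<open>\<theta>\<^sub>0\<close> has integral one.\<close>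

lemma test_function_decomposition:
  fixes T :: real
  assumes "T > 0"
  obtains \<theta>\<^sub>0 where "\<theta>\<^sub>0 \<in> test_functions {0<..<T}"
    "\<And>\<theta>. \<theta> \<in> test_functions {0<..<T} \<Longrightarrow> \<exists>\<eta>\<in>test_functions {0<..<T}. \<forall>t. \<theta> t = (LINT t|lborel. \<theta> t) * \<theta>\<^sub>0 t + deriv \<eta> t"
proof -
  define \<beta> where "\<beta> = box_bump (T/3) (2*T/3)"
  have \<beta>: "\<beta> \<in> test_functions {0<..<T}"
    unfolding \<beta>_def using assms by (intro box_bump_test_function) auto
  have "(LINT t|lborel. \<beta> t) \<noteq> 0"
  proof
    assume "(LINT t|lborel. \<beta> t) = 0"
    then have "AE t in lborel. \<beta> t = 0"
      using integral_nonneg_eq_0_iff_AE[OF test_functions_square_integrable(2)[OF \<beta>]] box_bump_nonneg by (auto simp: \<beta>_def)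
    then have "AE t in lborel. t \<notin> box (T/3) (2*T/3)"
      by eventually_elim (simp add: \<beta>_def box_bump_eq_0_iff)
    then have "box (T/3) (2*T/3) \<in> null_sets lborel" by (subst AE_iff_null_sets) auto
    then have "emeasure lborel {T/3<..<2*T/3} = 0" by auto
    then show False using assms by simp
  qed
  then obtain k where k: "k * (LINT t|lborel. \<beta> t) = 1" by (metis left_inverse)
  define \<theta>\<^sub>0 where "\<theta>\<^sub>0 t = k * \<beta> t" for t
  have \<theta>\<^sub>0: "\<theta>\<^sub>0 \<in> test_functions {0<..<T}"
    unfolding \<theta>\<^sub>0_def using test_functions_scaleR_left[OF smooth_const \<beta>, of k] by simp
  have I0: "(LINT t|lborel. \<theta>\<^sub>0 t) = 1" unfolding \<theta>\<^sub>0_def using k by simp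
  show thesis
  proof (rule that[OF \<theta>\<^sub>0])
    fix \<theta> :: "real \<Rightarrow> real" assume \<theta>: "\<theta> \<in> test_functions {0<..<T}"
    define I where "I = (LINT t|lborel. \<theta> t)"
    \<comment> \<open>Since \<open>g\<close> has integral 0, its antiderivative vanishes on both
      sides of the common support and is again a test function.\<close>
    define g where "g t = \<theta> t - I * \<theta>\<^sub>0 t" for t
    have sg: "smooth g"
      unfolding g_def by (intro smooth_diff smooth_cmult test_functions_smooth[OF \<theta>] test_functions_smooth[OF \<theta>\<^sub>0])
    define K where "K = closure {t. \<theta> t \<noteq> 0} \<union> closure {t. \<theta>\<^sub>0 t \<noteq> 0}"
    have K: "compact K" "K \<subseteq> {0<..<T}" using \<theta> \<theta>\<^sub>0 by (auto simp: K_def test_functions_def)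
    have gK: "g t = 0" if "t \<notin> K" for t
      using that closure_subset[of "{t. \<theta> t \<noteq> 0}"] closure_subset[of "{t. \<theta>\<^sub>0 t \<noteq> 0}"] unfolding K_def g_def by force
    obtain a b where ab: "0 < a" "a < b" "b < T" "K \<subseteq> {a..b}"
    proof (cases "K = {}")
      case True
      then show thesis using that[of "T/3" "2*T/3"] assms by auto
    next
      case False
      obtain x y where xy: "x \<in> K" "\<forall>t\<in>K. x \<le> t" "y \<in> K" "\<forall>t\<in>K. t \<le> y"
        using compact_attains_inf[OF K(1) False] compact_attains_sup[OF K(1) False] by metis
      then have "0 < x" "x \<le> y" "y < T" using K(2) by auto
      then show thesis using that[of "x/2" y] xy by force
    qed
    obtain \<eta>0 where \<eta>0: "\<And>x. (\<eta>0 has_real_derivative g x) (at x)" "smooth \<eta>0"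
      using smooth_antiderivative_ex[OF sg] by blast
    define \<eta> where "\<eta> t = \<eta>0 t - \<eta>0 0" for t
    have D: "(\<eta> has_real_derivative g x) (at x)" for x
      unfolding \<eta>_def using DERIV_diff[OF \<eta>0(1) DERIV_const] by simp
    have cont: "continuous_on A \<eta>" for A using D by (auto intro: DERIV_isCont continuous_at_imp_continuous_on)
    have const: "\<eta> q = \<eta> p" if "p < q" "\<And>x. p < x \<Longrightarrow> x < q \<Longrightarrow> x \<notin> {a..b}" for p q
      using that D gK ab(4) by (intro DERIV_isconst_end[OF _ cont]) (metis subsetD)+
    have left: "\<eta> t = 0" if "t \<le> a" for t
    proof (cases t "0::real" rule: linorder_cases)
      case less then show ?thesis using const[of t 0] ab by (simp add: \<eta>_def)
    next
      case greater then show ?thesis using const[of 0 t] ab that by (simp add: \<eta>_def)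
    qed (simp add: \<eta>_def)
    have "\<eta> T = 0"
    proof -
      have "\<eta> T = prim g T"
        using prim_antiderivative[OF D smooth_continuous[OF sg], of T] assms left[of 0] ab by simp
      also have "\<dots> = (LINT t|lborel. g t)"
        unfolding prim_def by (rule Bochner_Integration.integral_cong) (use gK ab in \<open>force simp: indicator_def\<close>)+
      also have "\<dots> = 0"
        unfolding g_def using I0 test_functions_square_integrable(2)[OF \<theta>] test_functions_square_integrable(2)[OF \<theta>\<^sub>0]
        by (simp add: I_def)
      finally show ?thesis .
    qed
    then have right: "\<eta> t = 0" if "t \<ge> b" for t
    proof (cases t T rule: linorder_cases)
      case less then show ?thesis using const[of t T] ab that \<open>\<eta> T = 0\<close> by simp
    next
      case greater then show ?thesis using const[of T t] ab that \<open>\<eta> T = 0\<close> by simp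
    qed (use \<open>\<eta> T = 0\<close> in simp)
    have "\<eta> \<in> test_functions {0<..<T}"
    proof (rule test_functionsI[where K="{a..b}"])
      show "smooth \<eta>" unfolding \<eta>_def by (intro smooth_diff \<eta>0 smooth_const)
      show "t \<in> {a..b}" if "\<eta> t \<noteq> 0" for t using left[of t] right[of t] that by (cases "t \<le> a"; cases "b \<le> t"; simp)
    qed (use ab in auto)
    moreover have "\<theta> t = (LINT t|lborel. \<theta> t) * \<theta>\<^sub>0 t + deriv \<eta> t" for t
      unfolding DERIV_imp_deriv[OF D] by (simp add: g_def I_def)
    ultimately show "\<exists>\<eta>\<in>test_functions {0<..<T}. \<forall>t. \<theta> t = (LINT t|lborel. \<theta> t) * \<theta>\<^sub>0 t + deriv \<eta> t" by blast
  qed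
qed

context
  fixes \<Omega> :: "R3 set"
  assumes op: "open \<Omega>"
begin

lemma integral_time:
  fixes T :: real
  assumes U: "square_integrable U" and f: "AE t\<in>{0..T} in lborel. f t \<in> L2 \<Omega> \<and> emb \<Omega> (f t) = U t"
    and \<eta>: "\<eta> \<in> borel_measurable borel" and w: "(w :: R3 \<Rightarrow> R3) \<in> L2 \<Omega>"
  shows "(LINT t|lebesgue_on {0..T}. \<eta> t * L2_inner \<Omega> (f t) w) = (LINT t|lborel. indicator {0..T} t *\<^sub>R (\<eta> t * (U t \<bullet> emb \<Omega> w)))"
proof (rule integral_lebesgue_on(1))
  show "(\<lambda>t. indicator {0..T} t *\<^sub>R (\<eta> t * (U t \<bullet> emb \<Omega> w))) \<in> borel_measurable borel"
    using square_integrable_measurable[OF U] \<eta>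
    by (intro borel_measurable_scaleR borel_measurable_times borel_measurable_inner borel_measurable_indicator) auto
  show "AE t in lborel. indicator {0..T} t *\<^sub>R (\<eta> t * (U t \<bullet> emb \<Omega> w)) = indicator {0..T} t *\<^sub>R (\<eta> t * L2_inner \<Omega> (f t) w)"
    using f by eventually_elim (auto simp: indicator_def L2_inner_emb(1)[OF \<Omega>_borel[OF op] _ w])
qed auto

lemma has_time_derivI:
  assumes T: "0 \<le> T" and V: "square_integrable V" "AE t\<in>{0..T} in lborel. ft t \<in> L2 \<Omega> \<and> emb \<Omega> (ft t) = V t"
    and f: "AE t\<in>{0..T} in lborel. f t \<in> L2 \<Omega> \<and> emb \<Omega> (f t) = c + prim V t"
  shows "has_time_deriv \<Omega> T f ft"
  unfolding has_time_deriv_def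
proof (intro conjI ballI)
  show "ft \<in> Bochner_L2 T (L2 \<Omega>) (L2_norm \<Omega>)" by (rule Bochner_L2_L2I[OF op V])
  fix \<eta> :: "real \<Rightarrow> real" and w :: "R3 \<Rightarrow> R3" assume \<eta>: "\<eta> \<in> test_functions {0<..<T}" and w: "w \<in> L2 \<Omega>"
  define U where "U t = indicator {0..T} t *\<^sub>R c + indicator {0..T} t *\<^sub>R prim V t" for t
  have sqU: "square_integrable U"
    unfolding U_def by (intro square_integrable_add square_integrable_prim V square_integrable_indicator) (auto simp: T)
  have fU: "AE t\<in>{0..T} in lborel. f t \<in> L2 \<Omega> \<and> emb \<Omega> (f t) = U t"
    using f by eventually_elim (simp add: U_def)
  have sqw: "square_integrable (\<lambda>t. V t \<bullet> emb \<Omega> w)" by (rule square_integrable_linear[OF V(1) bounded_linear_inner_left])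
  have "(LINT t|lebesgue_on {0..T}. deriv \<eta> t * L2_inner \<Omega> (f t) w)
      = (LINT t|lborel. indicator {0..T} t *\<^sub>R (deriv \<eta> t * (U t \<bullet> emb \<Omega> w)))"
    by (rule integral_time[OF sqU fU borel_measurable_continuous_onI[OF test_function_deriv(2)[OF \<eta>]] w])
  also have "\<dots> = (LINT t|lborel. indicator {0..T} t *\<^sub>R (deriv \<eta> t * (c \<bullet> emb \<Omega> w + prim (\<lambda>t. V t \<bullet> emb \<Omega> w) t)))"
    by (rule Bochner_Integration.integral_cong) (auto simp: U_def indicator_def inner_add prim_inner[OF V(1)])
  also have "\<dots> = - (LINT t|lborel. indicator {0..T} t *\<^sub>R (\<eta> t * (V t \<bullet> emb \<Omega> w)))"
    by (rule integral_deriv_prim(1)[OF T \<eta> sqw])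
  also have "\<dots> = - (LINT t|lebesgue_on {0..T}. \<eta> t * L2_inner \<Omega> (ft t) w)"
    by (subst integral_time[OF V test_functions_measurable[OF \<eta>] w]) simp
  finally show "(LINT t|lebesgue_on {0..T}. deriv \<eta> t * L2_inner \<Omega> (f t) w) = - (LINT t|lebesgue_on {0..T}. \<eta> t * L2_inner \<Omega> (ft t) w)" .
qed

text \<open>The du Bois-Reymond lemma: \<open>U - prim V\<close> is orthogonal to all derivatives of
  test functions, so by the decomposition it equals its average \<open>c\<close> against
  \<open>\<theta>\<^sub>0\<close>.\<close>

lemma has_time_derivD:
  assumes T: "T > 0" and U: "square_integrable U" "AE t\<in>{0..T} in lborel. f t \<in> L2 \<Omega> \<and> emb \<Omega> (f t) = U t"
    and V: "square_integrable V" "AE t\<in>{0..T} in lborel. ft t \<in> L2 \<Omega> \<and> emb \<Omega> (ft t) = V t"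
    and deriv: "has_time_deriv \<Omega> T f ft"
  obtains c where "AE t\<in>{0..T} in lborel. U t = c + prim V t"
proof -
  note b = \<Omega>_borel[OF op]
  obtain \<theta>\<^sub>0 where \<theta>\<^sub>0: "\<theta>\<^sub>0 \<in> test_functions {0<..<T}"
    "\<And>\<theta>. \<theta> \<in> test_functions {0<..<T} \<Longrightarrow> \<exists>\<eta>\<in>test_functions {0<..<T}. \<forall>t. \<theta> t = (LINT t|lborel. \<theta> t) * \<theta>\<^sub>0 t + deriv \<eta> t"
    using test_function_decomposition[OF T] by metis
  define D where "D t = indicator {0..T} t *\<^sub>R U t - indicator {0..T} t *\<^sub>R prim V t" for t
  have sqD: "square_integrable D"
    unfolding D_def by (intro square_integrable_diff square_integrable_interval square_integrable_prim U V)
  have iD: "integrable lborel (\<lambda>t. \<theta> t *\<^sub>R D t)" if "\<theta> \<in> test_functions {0<..<T}" for \<theta> :: "real \<Rightarrow> real"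
  proof -
    note \<theta> = that
    obtain C where C: "0 \<le> C" "\<And>x. norm (\<theta> x) \<le> C" by (rule test_functions_bounded[OF \<theta>]) blast
    have "integrable lborel D"
      by (rule square_integrable_imp_integrable_bounded[OF sqD, where B="{0..T}"]) (auto simp: D_def)
    then have i: "integrable lborel (\<lambda>t. C *\<^sub>R D t)" by (intro integrable_scaleR_right)
    show ?thesis
    proof (rule Bochner_Integration.integrable_bound[OF i])
      show "(\<lambda>t. \<theta> t *\<^sub>R D t) \<in> borel_measurable lborel"
        using test_functions_measurable[OF \<theta>] square_integrable_measurable[OF sqD] by simp
      have "norm (\<theta> t *\<^sub>R D t) \<le> norm (C *\<^sub>R D t)" for t
        using mult_right_mono[OF C(2) norm_ge_zero, of t "D t"] C(1) by simp
      then show "AE t in lborel. norm (\<theta> t *\<^sub>R D t) \<le> norm (C *\<^sub>R D t)" by simp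
    qed
  qed
  define c where "c = (LINT t|lborel. \<theta>\<^sub>0 t *\<^sub>R D t)"
  have cutU: "AE t\<in>{0..T} in lborel. cut \<Omega> (U t) = U t"
    using U(2) by eventually_elim (metis cut_emb[OF b])
  have cutV: "AE t\<in>{0..T} in lborel. cut \<Omega> (V t) = V t"
    using V(2) by eventually_elim (metis cut_emb[OF b])
  \<comment> \<open>The weak derivative is tested with fields on \<open>\<Omega>\<close> only.
    Arbitrary vectors \<open>w\<close> can be used once \<open>D\<close> is known to vanish outside
    \<open>\<Omega>\<close>, which for the primitive is shown here.\<close>
  have primV: "cut \<Omega> (prim V t) = prim V t" if "t \<le> T" for t
  proof -
    have "cut \<Omega> (prim V t) = prim (\<lambda>t. cut \<Omega> (V t)) t" by (rule prim_linear[OF bounded_linear_cut[OF b] V(1), symmetric])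
    also have "\<dots> = prim V t"
      by (rule prim_cong_AE[OF _ _ cutV that])
        (intro square_integrable_measurable square_integrable_linear[OF _ bounded_linear_cut[OF b]] V)+
    finally show ?thesis .
  qed
  have cutD: "AE t in lborel. cut \<Omega> (D t) = D t"
    using cutU by eventually_elim (auto simp: D_def indicator_def cut_diff[OF b] cut_zero[OF b] primV)
  have orth: "(LINT t|lborel. deriv \<eta> t *\<^sub>R D t) \<bullet> w = 0" if \<eta>: "\<eta> \<in> test_functions {0<..<T}" for \<eta> w
  proof -
    note d = test_function_deriv[OF \<eta>]
    have deriv_test: "deriv \<eta> \<in> test_functions {0<..<T}"
    proof -
      have "deriv \<eta> = dderiv \<eta> 1"
        using d(1) by (auto simp: fun_eq_iff has_field_derivative_def dest!: frechet_derivative_at)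
          (metis frechet_derivative_at mult.right_neutral)
      then show ?thesis using test_functions_dderiv[OF \<eta>] by simp
    qed
    define w' where "w' = rep_l2 w"
    have w': "w' \<in> L2 \<Omega>" "emb \<Omega> w' = cut \<Omega> w" by (simp_all add: w'_def rep_L2[OF b])
    have sqw: "square_integrable (\<lambda>t. V t \<bullet> emb \<Omega> w')" by (rule square_integrable_linear[OF V(1) bounded_linear_inner_left])
    have "(LINT t|lborel. deriv \<eta> t *\<^sub>R D t) \<bullet> w = (LINT t|lborel. (deriv \<eta> t *\<^sub>R D t) \<bullet> w)"
      by (rule integral_inner_left[symmetric]) (rule iD[OF deriv_test])
    also have "\<dots> = (LINT t|lborel. indicator {0..T} t *\<^sub>R (deriv \<eta> t * (U t \<bullet> emb \<Omega> w'))
        - indicator {0..T} t *\<^sub>R (deriv \<eta> t * (0 + prim (\<lambda>t. V t \<bullet> emb \<Omega> w') t)))"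
    proof (rule integral_cong_AE)
      note [measurable] = square_integrable_measurable[OF sqD] test_functions_measurable[OF deriv_test]
        square_integrable_measurable[OF U(1)] square_integrable_measurable[OF sqw]
      show "(\<lambda>t. (deriv \<eta> t *\<^sub>R D t) \<bullet> w) \<in> borel_measurable lborel" by measurable
      show "(\<lambda>t. indicator {0..T} t *\<^sub>R (deriv \<eta> t * (U t \<bullet> emb \<Omega> w'))
        - indicator {0..T} t *\<^sub>R (deriv \<eta> t * (0 + prim (\<lambda>t. V t \<bullet> emb \<Omega> w') t))) \<in> borel_measurable lborel" by measurable
      show "AE t in lborel. (deriv \<eta> t *\<^sub>R D t) \<bullet> w = indicator {0..T} t *\<^sub>R (deriv \<eta> t * (U t \<bullet> emb \<Omega> w'))
        - indicator {0..T} t *\<^sub>R (deriv \<eta> t * (0 + prim (\<lambda>t. V t \<bullet> emb \<Omega> w') t))"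
        using cutD
      proof eventually_elim
        fix t assume "cut \<Omega> (D t) = D t"
        then have "D t \<bullet> w = D t \<bullet> emb \<Omega> w'" unfolding w'(2) by (metis cut_sym[OF b])
        then have "(deriv \<eta> t *\<^sub>R D t) \<bullet> w = deriv \<eta> t * (D t \<bullet> emb \<Omega> w')" by simp
        then show "(deriv \<eta> t *\<^sub>R D t) \<bullet> w = indicator {0..T} t *\<^sub>R (deriv \<eta> t * (U t \<bullet> emb \<Omega> w'))
          - indicator {0..T} t *\<^sub>R (deriv \<eta> t * (0 + prim (\<lambda>t. V t \<bullet> emb \<Omega> w') t))"
          by (simp add: D_def inner_diff prim_inner[OF V(1), symmetric] algebra_simps)
      qed
    qed
    also have "\<dots> = (LINT t|lborel. indicator {0..T} t *\<^sub>R (deriv \<eta> t * (U t \<bullet> emb \<Omega> w')))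
        - (LINT t|lborel. indicator {0..T} t *\<^sub>R (deriv \<eta> t * (0 + prim (\<lambda>t. V t \<bullet> emb \<Omega> w') t)))"
    proof (rule Bochner_Integration.integral_diff)
      show "integrable lborel (\<lambda>t. indicator {0..T} t *\<^sub>R (deriv \<eta> t * (0 + prim (\<lambda>t. V t \<bullet> emb \<Omega> w') t)))"
        by (rule integral_deriv_prim(2)[OF less_imp_le[OF T] \<eta> sqw])
      show "integrable lborel (\<lambda>t. indicator {0..T} t *\<^sub>R (deriv \<eta> t * (U t \<bullet> emb \<Omega> w')))"
        using integrable_interval_inner[OF test_functions_square_integrable(1)[OF deriv_test]
            square_integrable_linear[OF U(1) bounded_linear_inner_left[of "emb \<Omega> w'"]], of 0 T] by simp
    qed
    also have "(LINT t|lborel. indicator {0..T} t *\<^sub>R (deriv \<eta> t * (0 + prim (\<lambda>t. V t \<bullet> emb \<Omega> w') t)))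
        = - (LINT t|lborel. indicator {0..T} t *\<^sub>R (\<eta> t * (V t \<bullet> emb \<Omega> w')))"
      by (rule integral_deriv_prim(1)[OF less_imp_le[OF T] \<eta> sqw])
    also have "(LINT t|lborel. indicator {0..T} t *\<^sub>R (deriv \<eta> t * (U t \<bullet> emb \<Omega> w')))
        = (LINT t|lebesgue_on {0..T}. deriv \<eta> t * L2_inner \<Omega> (f t) w')"
      by (rule integral_time[OF U test_functions_measurable[OF deriv_test] w'(1), symmetric])
    also have "(LINT t|lborel. indicator {0..T} t *\<^sub>R (\<eta> t * (V t \<bullet> emb \<Omega> w')))
        = (LINT t|lebesgue_on {0..T}. \<eta> t * L2_inner \<Omega> (ft t) w')"
      by (rule integral_time[OF V test_functions_measurable[OF \<eta>] w'(1), symmetric])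
    finally show ?thesis using deriv \<eta> w'(1) by (simp add: has_time_deriv_def)
  qed
  have all: "AE t\<in>{0<..<T} in lborel. (D t - c) \<bullet> w = 0" for w
  proof -
    define h where "h t = D t \<bullet> w - indicator {0..T} t *\<^sub>R (c \<bullet> w)" for t
    have sqh: "square_integrable h"
      unfolding h_def by (intro square_integrable_diff square_integrable_linear[OF sqD bounded_linear_inner_left] square_integrable_indicator)
        (use T in auto)
    have "AE t\<in>{0<..<T} in lborel. h t = 0"
    proof (rule AE_eq_0_if_orthogonal_to_test_functions[OF sqh])
      fix \<theta> :: "real \<Rightarrow> real" assume \<theta>: "\<theta> \<in> test_functions {0<..<T}"
      define I where "I = (LINT t|lborel. \<theta> t)"
      obtain \<eta> where \<eta>: "\<eta> \<in> test_functions {0<..<T}" "\<And>t. \<theta> t = I * \<theta>\<^sub>0 t + deriv \<eta> t"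
        using \<theta>\<^sub>0(2)[OF \<theta>] by (auto simp: I_def)
      have d\<eta>: "deriv \<eta> t *\<^sub>R D t = \<theta> t *\<^sub>R D t - I *\<^sub>R (\<theta>\<^sub>0 t *\<^sub>R D t)" for t
        unfolding \<eta>(2)[of t] by (simp add: algebra_simps)
      have "(LINT t|lborel. deriv \<eta> t *\<^sub>R D t) = (LINT t|lborel. \<theta> t *\<^sub>R D t) - I *\<^sub>R c"
        unfolding d\<eta> c_def
        by (subst Bochner_Integration.integral_diff) (intro integrable_scaleR_right iD \<theta> \<theta>\<^sub>0(1) | simp only: integral_scaleR_right)+
      then have eq: "(LINT t|lborel. \<theta> t *\<^sub>R D t) \<bullet> w = I * (c \<bullet> w)"
        using orth[OF \<eta>(1), of w] by (simp add: inner_diff)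
      have i1: "integrable lborel (\<lambda>t. (\<theta> t *\<^sub>R D t) \<bullet> w)" by (rule integrable_inner_left) (rule iD[OF \<theta>])
      have i2: "integrable lborel (\<lambda>t. \<theta> t * (c \<bullet> w))"
        using test_functions_square_integrable(2)[OF \<theta>] by simp
      have "(LINT t|lborel. h t * \<theta> t) = (LINT t|lborel. (\<theta> t *\<^sub>R D t) \<bullet> w - \<theta> t * (c \<bullet> w))"
      proof (rule Bochner_Integration.integral_cong)
        show "h t * \<theta> t = (\<theta> t *\<^sub>R D t) \<bullet> w - \<theta> t * (c \<bullet> w)" for t
        proof (cases "t \<in> {0<..<T}")
          case True
          then show ?thesis by (simp add: h_def algebra_simps)
        next
          case False
          then have "\<theta> t = 0" by (rule test_functions_zero_outside[OF \<theta>])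
          then show ?thesis by simp
        qed
      qed simp
      also have "\<dots> = (LINT t|lborel. (\<theta> t *\<^sub>R D t) \<bullet> w) - (LINT t|lborel. \<theta> t * (c \<bullet> w))"
        by (rule Bochner_Integration.integral_diff[OF i1 i2])
      also have "(LINT t|lborel. (\<theta> t *\<^sub>R D t) \<bullet> w) = (LINT t|lborel. \<theta> t *\<^sub>R D t) \<bullet> w"
        by (rule integral_inner_left) (rule iD[OF \<theta>])
      finally show "(LINT t|lborel. h t * \<theta> t) = 0" using eq by (simp add: I_def)
    qed simp
    then show ?thesis by eventually_elim (auto simp: h_def inner_diff indicator_def)
  qed
  \<comment> \<open>The exceptional null set depends on \<open>w\<close>; a countable dense set of
    vectors makes it uniform.\<close>
  obtain Q :: "(R3, R3) l2 set" where Q: "countable Q" "\<And>X. open X \<Longrightarrow> X \<noteq> {} \<Longrightarrow> \<exists>d\<in>Q. d \<in> X"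
    by (rule countable_dense_setE) blast
  have "AE t in lborel. \<forall>w\<in>Q. t \<in> {0<..<T} \<longrightarrow> (D t - c) \<bullet> w = 0"
    unfolding AE_ball_countable[OF Q(1)] using all by blast
  moreover have "AE t in lborel. t \<noteq> 0" "AE t in lborel. t \<noteq> T" by (rule AE_lborel_singleton)+
  ultimately have "AE t\<in>{0..T} in lborel. U t = c + prim V t"
  proof eventually_elim
    fix t assume *: "\<forall>w\<in>Q. t \<in> {0<..<T} \<longrightarrow> (D t - c) \<bullet> w = 0" and "t \<noteq> 0" "t \<noteq> T"
    show "t \<in> {0..T} \<longrightarrow> U t = c + prim V t"
    proof
      assume t: "t \<in> {0..T}"
      have "open {w. (D t - c) \<bullet> w \<noteq> 0}" by (intro open_Collect_neq continuous_intros)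
      then have "(D t - c) \<bullet> w = 0" for w using Q(2)[of "{w. (D t - c) \<bullet> w \<noteq> 0}"] * t \<open>t \<noteq> 0\<close> \<open>t \<noteq> T\<close> by force
      then have "D t - c = 0" using inner_eq_zero_iff by blast
      then show "U t = c + prim V t" using t by (simp add: D_def algebra_simps)
    qed
  qed
  then show thesis by (rule that)
qed

text \<open>The norm over \<open>\<Omega>\<close> sees only the part of a class inside
  \<open>\<Omega>\<close>, hence the passage through \<open>cut\<close>; continuity itself is that
  of the primitive.\<close>

lemma cont_representativeI:
  assumes V: "square_integrable V" and f: "AE t\<in>{0..T} in lborel. f t \<in> L2 \<Omega> \<and> emb \<Omega> (f t) = c + prim V t"
    and S: "\<And>t. t \<in> {0..T} \<Longrightarrow> rep_l2 (c + prim V t) \<in> S"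
  shows "cont_representative \<Omega> T S f (\<lambda>t. rep_l2 (c + prim V t))"
  unfolding cont_representative_def
proof (intro conjI ballI)
  note b = \<Omega>_borel[OF op]
  show "AE t in lebesgue_on {0..T}. AE x in lebesgue_on \<Omega>. rep_l2 (c + prim V t) x = f t x"
  proof (subst AE_lebesgue_on_iff[of "{0..T}"])
    show "AE t\<in>{0..T} in lborel. (AE x in lebesgue_on \<Omega>. rep_l2 (c + prim V t) x = f t x)"
      using f
    proof eventually_elim
      fix t assume "t \<in> {0..T} \<longrightarrow> f t \<in> L2 \<Omega> \<and> emb \<Omega> (f t) = c + prim V t"
      then show "t \<in> {0..T} \<longrightarrow> (AE x in lebesgue_on \<Omega>. rep_l2 (c + prim V t) x = f t x)"
        using emb_eq_iff[OF b, of "rep_l2 (c + prim V t)" "f t"] cut_emb[OF b, of "f t"] by (auto simp: rep_L2[OF b])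
    qed
  qed simp
  fix t assume t: "t \<in> {0..T}"
  show "rep_l2 (c + prim V t) \<in> S" by (rule S[OF t])
  have "((\<lambda>s. norm (cut \<Omega> (prim V s - prim V t))) \<longlongrightarrow> norm (cut \<Omega> (prim V t - prim V t))) (at t within {0..T})"
    by (intro tendsto_intros bounded_linear.tendsto[OF bounded_linear_cut[OF b]] prim_tendsto[OF V t])
  then show "((\<lambda>s. L2_norm \<Omega> (\<lambda>x. rep_l2 (c + prim V s) x - rep_l2 (c + prim V t) x)) \<longlongrightarrow> 0) (at t within {0..T})"
    by (simp add: L2_norm_emb[OF b] L2_diff[OF b] emb_diff[OF b] rep_L2[OF b] cut_diff[OF b, symmetric] cut_zero[OF b])
qed

end

section \<open>The eddy current system as an abstract evolution\<close>

text \<open>The coefficient is extended by the identity outside \<open>\<Omega>\<close>, which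
  respects both bounds because \<open>\<Lambda> \<ge> 1\<close>. The resulting operator is coercive
  on all of \<open>l2\<close> and still commutes with \<open>cut\<close>.\<close>

lemma coefficient_operator:
  fixes \<kappa> :: "R3 \<Rightarrow> real^3^3"
  assumes op: "open \<Omega>" and \<Lambda>: "\<Lambda> \<ge> 1" and \<kappa>: "\<kappa> \<in> borel_measurable (lebesgue_on \<Omega>)"
    and ell: "AE x in lebesgue_on \<Omega>. transpose (\<kappa> x) = \<kappa> x \<and>
      (\<forall>\<eta>. inverse \<Lambda> * (norm \<eta>)\<^sup>2 \<le> (\<kappa> x *v \<eta>) \<bullet> \<eta> \<and> (\<kappa> x *v \<eta>) \<bullet> \<eta> \<le> \<Lambda> * (norm \<eta>)\<^sup>2)"
  obtains s :: "(R3, R3) l2 \<Rightarrow> (R3, R3) l2" where "bounded_linear s" "\<And>u v. s u \<bullet> v = u \<bullet> s v"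
    "\<And>u. inverse \<Lambda> * (norm u)\<^sup>2 \<le> s u \<bullet> u" "\<And>u. s u \<bullet> u \<le> \<Lambda> * (norm u)\<^sup>2"
    "\<And>u. cut \<Omega> (s u) = s (cut \<Omega> u)"
    "\<And>f. f \<in> L2 \<Omega> \<Longrightarrow> (\<lambda>x. \<kappa> x *v f x) \<in> L2 \<Omega>" "\<And>f. f \<in> L2 \<Omega> \<Longrightarrow> emb \<Omega> (\<lambda>x. \<kappa> x *v f x) = s (emb \<Omega> f)"
proof -
  note b = \<Omega>_borel[OF op]
  have "(\<lambda>x. indicator \<Omega> x *\<^sub>R \<kappa> x) \<in> borel_measurable lebesgue"
    using \<kappa> by (subst (asm) borel_measurable_restrict_space_iff) (simp_all add: b)
  then obtain g where g: "g \<in> borel_measurable borel" "AE x in lborel. g x = indicator \<Omega> x *\<^sub>R \<kappa> x"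
    using ex_borel_version by blast
  define A where "A x y = (if x \<in> \<Omega> then g x *v y else y)" for x y
  have "AE x\<in>\<Omega> in lborel. transpose (\<kappa> x) = \<kappa> x \<and>
      (\<forall>\<eta>. inverse \<Lambda> * (norm \<eta>)\<^sup>2 \<le> (\<kappa> x *v \<eta>) \<bullet> \<eta> \<and> (\<kappa> x *v \<eta>) \<bullet> \<eta> \<le> \<Lambda> * (norm \<eta>)\<^sup>2)"
    using ell unfolding AE_lebesgue_on_iff[OF b] .
  then have g': "AE x\<in>\<Omega> in lborel. g x = \<kappa> x \<and> transpose (g x) = g x \<and>
      (\<forall>\<eta>. inverse \<Lambda> * (norm \<eta>)\<^sup>2 \<le> (g x *v \<eta>) \<bullet> \<eta> \<and> (g x *v \<eta>) \<bullet> \<eta> \<le> \<Lambda> * (norm \<eta>)\<^sup>2)"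
    using g(2) by eventually_elim auto
  interpret multiplier A \<Lambda>
  proof
    show "\<Lambda> > 0" using \<Lambda> by simp
    show "(\<lambda>x. A x (f x)) \<in> borel_measurable borel" if [measurable]: "f \<in> borel_measurable borel" for f
    proof -
      have "continuous_on UNIV (\<lambda>p :: (real^3^3) \<times> R3. fst p *v snd p)"
        unfolding matrix_vector_mult_def by (intro continuous_intros)
      then have "(\<lambda>x. g x *v f x) \<in> borel_measurable borel"
        using borel_measurable_continuous_Pair[OF g(1) that, of "(*v)"] by simp
      then show ?thesis unfolding A_def by (intro measurable_If_set) (simp_all add: b that)
    qed
    show "AE x in lborel. bounded_linear (A x) \<and> (\<forall>y z. A x y \<bullet> z = y \<bullet> A x z) \<and>
      (\<forall>y. inverse \<Lambda> * (norm y)\<^sup>2 \<le> A x y \<bullet> y \<and> A x y \<bullet> y \<le> \<Lambda> * (norm y)\<^sup>2)"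
      using g'
    proof eventually_elim
      fix x assume *: "x \<in> \<Omega> \<longrightarrow> g x = \<kappa> x \<and> transpose (g x) = g x \<and>
      (\<forall>\<eta>. inverse \<Lambda> * (norm \<eta>)\<^sup>2 \<le> (g x *v \<eta>) \<bullet> \<eta> \<and> (g x *v \<eta>) \<bullet> \<eta> \<le> \<Lambda> * (norm \<eta>)\<^sup>2)"
      show "bounded_linear (A x) \<and> (\<forall>y z. A x y \<bullet> z = y \<bullet> A x z) \<and>
        (\<forall>y. inverse \<Lambda> * (norm y)\<^sup>2 \<le> A x y \<bullet> y \<and> A x y \<bullet> y \<le> \<Lambda> * (norm y)\<^sup>2)"
      proof (cases "x \<in> \<Omega>")
        case True
        have "(g x *v y) \<bullet> z = y \<bullet> (g x *v z)" for y z
          using * True by (metis dot_lmul_matrix transpose_matrix_vector)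
        moreover have "\<forall>\<eta>. inverse \<Lambda> * (norm \<eta>)\<^sup>2 \<le> (g x *v \<eta>) \<bullet> \<eta> \<and> (g x *v \<eta>) \<bullet> \<eta> \<le> \<Lambda> * (norm \<eta>)\<^sup>2"
          using * True by blast
        ultimately show ?thesis using True by (simp add: A_def[abs_def] matrix_vector_mul_bounded_linear)
      next
        case False
        have "inverse \<Lambda> \<le> 1" using \<Lambda> by (simp add: inverse_le_1_iff)
        then have "inverse \<Lambda> * (norm y)\<^sup>2 \<le> (norm y)\<^sup>2" "(norm y)\<^sup>2 \<le> \<Lambda> * (norm y)\<^sup>2" for y :: R3
          using \<Lambda> by (auto intro: mult_left_le_one_le mult_right_mono[of 1 \<Lambda> "(norm y)\<^sup>2", simplified] simp: mult_right_le_one_le)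
        then show ?thesis using False by (simp add: A_def[abs_def] bounded_linear_ident power2_norm_eq_inner)
      qed
    qed
  qed
  have lin0: "AE x in lborel. A x 0 = 0" using bounds by eventually_elim (auto simp: linear_0[OF bounded_linear.linear])
  have cut: "cut \<Omega> (mulop A u) = mulop A (cut \<Omega> u)" for u
    using rep_cut[OF b, of "mulop A u"] rep_cut[OF b, of u] rep_mulop[of u] rep_mulop[of "cut \<Omega> u"] lin0
    by (intro l2_eqI, eventually_elim) (auto simp: indicator_def)
  have L: "AE x in lborel. rep_l2 (mulop A (emb \<Omega> f)) x = indicator \<Omega> x *\<^sub>R (\<kappa> x *v f x)" if "f \<in> L2 \<Omega>" for f
    using rep_emb[OF b that] rep_mulop[of "emb \<Omega> f"] g' lin0
    by eventually_elim (auto simp: indicator_def A_def)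
  show thesis
    by (rule that[of "mulop A", OF bounded_linear_mulop mulop_sym mulop_lower mulop_upper cut L2I[OF b L]])
qed

lemma prim_0 [simp]: "prim f 0 = 0"
proof -
  have "AE r in lborel. indicator {0..0::real} r *\<^sub>R f r = 0"
    using AE_lborel_singleton[of "0::real"] by eventually_elim simp
  then show ?thesis unfolding prim_def by (rule integral_eq_zero_AE)
qed

lemma AE_lborel_ex_Ioo:
  fixes a b :: real
  assumes "AE t in lborel. P t" "a < b"
  shows "\<exists>t\<in>{a<..<b}. P t"
proof (rule ccontr)
  assume "\<not> ?thesis"
  with assms(1) have "AE t in lborel. t \<notin> {a<..<b}" by (auto elim: eventually_mono)
  then have "{a<..<b} \<in> null_sets lborel" by (subst AE_iff_null_sets) auto
  then show False using assms(2) by auto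
qed

text \<open>Members of \<open>graph_curl\<close> are by definition tested with exactly these fields.
  Consequently test fields are admissible in the second weak equation.\<close>

lemma test_function_in_graph0_curl:
  assumes op: "open \<Omega>" and \<Phi>: "\<Phi> \<in> test_functions \<Omega>"
  shows "(to_l2 \<Phi>, to_l2 (curl \<Phi>)) \<in> graph0_curl \<Omega>"
proof -
  note b = \<Omega>_borel[OF op]
  have cut: "cut \<Omega> (to_l2 \<Psi>) = to_l2 \<Psi>" if "\<Psi> \<in> test_functions \<Omega>" for \<Psi> :: "R3 \<Rightarrow> R3"
    using rep_cut[OF b, of "to_l2 \<Psi>"] rep_to_l2[OF test_functions_square_integrable(1)[OF that]]
    by (intro l2_eqI, eventually_elim) (use test_functions_zero_outside[OF that] in \<open>auto simp: indicator_def\<close>)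
  show ?thesis
    using \<Phi> cut[OF \<Phi>] cut[OF test_functions_curl[OF \<Phi>]]
    by (auto simp: graph0_curl_def graph_curl_def inner_commute)
qed

text \<open>The first factor is the squared constant of \<open>lions\<close> on the full interval;
  the factor \<open>2 * \<Lambda>\<^sup>2\<close> bounds \<open>data_norm\<close> by the norms of
  the given data.\<close>

definition data_bound :: "real \<Rightarrow> real \<Rightarrow> real" where
  "data_bound \<Lambda> T = (2 * \<Lambda>\<^sup>2 * (1 + T))\<^sup>2 * (2 * \<Lambda>\<^sup>2)"

context evolution
begin

text \<open>A translation of \<open>sol_estimate\<close> into the norms of the data. The time
  derivative of the magnetic field is bounded through \<open>a\<close>, and the field itself by
  integrating that derivative, at the price of a factor \<open>T\<close>.\<close>

lemma sol_bounds:
  assumes T: "0 \<le> T" and JEt: "square_integrable JEt" and JM: "square_integrable JM" and H0: "(H0, K0) \<in> adj"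
    and sol: "is_sol T JE0 JEt JM H0 E a"
  defines "D \<equiv> (norm H0)\<^sup>2 + (norm K0)\<^sup>2 + (norm JE0)\<^sup>2 + (LINT t|lborel. indicator {0..T} t *\<^sub>R ((norm (JM t))\<^sup>2 + (norm (JEt t))\<^sup>2))"
  shows "AE t\<in>{0..T} in lborel. (norm (E t))\<^sup>2 \<le> \<Lambda>\<^sup>2 * data_bound \<Lambda> T * D"
    and "(LINT t|lborel. indicator {0..T} t *\<^sub>R (norm (mi (JM t - a t)))\<^sup>2) \<le> 2 * \<Lambda>\<^sup>2 * (1 + data_bound \<Lambda> T) * D"
    and "t \<in> {0..T} \<Longrightarrow> (norm (field_H JM H0 a t))\<^sup>2 \<le> (2 + 4 * T * \<Lambda>\<^sup>2 * (1 + data_bound \<Lambda> T)) * D"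
proof -
  define I where "I = (LINT t|lborel. indicator {0..T} t *\<^sub>R ((norm (JM t))\<^sup>2 + (norm (JEt t))\<^sup>2))"
  define B where "B = (2 * \<Lambda>\<^sup>2 * (1 + T))\<^sup>2 * data_norm T (K0 - JE0) JEt JM"
  have sqa: "square_integrable a" using sol by (simp add: is_sol_def)
  have \<Lambda>2: "1 \<le> \<Lambda>\<^sup>2" using \<Lambda> by simp
  have int: "integrable lborel (\<lambda>t. indicator {0..T} t *\<^sub>R (norm (f t))\<^sup>2)" if "square_integrable f" for f :: "real \<Rightarrow> 'h"
    using integrable_interval_inner[OF that that, of 0 T] by (simp add: power2_norm_eq_inner)
  have mono: "(LINT t|lborel. indicator {0..T} t *\<^sub>R f t) \<le> (LINT t|lborel. indicator {0..T} t *\<^sub>R g t)"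
    if "integrable lborel (\<lambda>t. indicator {0..T} t *\<^sub>R f t)" "integrable lborel (\<lambda>t. indicator {0..T} t *\<^sub>R g t)" "\<And>t. f t \<le> g t"
    for f g :: "real \<Rightarrow> real"
    using that by (intro integral_mono) (auto simp: indicator_def)
  have iI: "integrable lborel (\<lambda>t. indicator {0..T} t *\<^sub>R ((norm (JM t))\<^sup>2 + (norm (JEt t))\<^sup>2))"
    using Bochner_Integration.integrable_add[OF int[OF JM] int[OF JEt]] by (simp add: algebra_simps)
  have I0: "0 \<le> I" unfolding I_def by (intro integral_nonneg_AE) (auto simp: indicator_def)
  have D: "D = (norm H0)\<^sup>2 + (norm K0)\<^sup>2 + (norm JE0)\<^sup>2 + I" by (simp add: D_def I_def)
  have D0: "0 \<le> D" unfolding D using I0 by simp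
  have "data_norm T (K0 - JE0) JEt JM \<le> 2 * \<Lambda>\<^sup>2 * D"
  proof -
    have "(LINT t|lborel. indicator {0..T} t *\<^sub>R (norm (- JEt t, mi (JM t)))\<^sup>2)
        \<le> (LINT t|lborel. indicator {0..T} t *\<^sub>R (\<Lambda>\<^sup>2 * ((norm (JM t))\<^sup>2 + (norm (JEt t))\<^sup>2)))"
    proof (rule mono)
      have "square_integrable (\<lambda>t. (- JEt t, mi (JM t)))"
        by (intro square_integrable_Pair square_integrable_uminus square_integrable_linear[OF JM mi_linear] JEt)
      from integrable_interval_inner[OF this this, of 0 T]
      show "integrable lborel (\<lambda>t. indicator {0..T} t *\<^sub>R (norm (- JEt t, mi (JM t)))\<^sup>2)"
        by (simp add: power2_norm_eq_inner)
      show "integrable lborel (\<lambda>t. indicator {0..T} t *\<^sub>R (\<Lambda>\<^sup>2 * ((norm (JM t))\<^sup>2 + (norm (JEt t))\<^sup>2)))"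
        using integrable_mult_right[OF iI, of "\<Lambda>\<^sup>2"] by (simp add: algebra_simps)
      fix t
      have "(norm (mi (JM t)))\<^sup>2 \<le> (\<Lambda> * norm (JM t))\<^sup>2" by (intro power_mono norm_mi_le) simp
      moreover have "(norm (JEt t))\<^sup>2 \<le> \<Lambda>\<^sup>2 * (norm (JEt t))\<^sup>2" using mult_right_mono[OF \<Lambda>2, of "(norm (JEt t))\<^sup>2"] by simp
      ultimately show "(norm (- JEt t, mi (JM t)))\<^sup>2 \<le> \<Lambda>\<^sup>2 * ((norm (JM t))\<^sup>2 + (norm (JEt t))\<^sup>2)"
        by (simp add: norm_Pair power_mult_distrib algebra_simps)
    qed
    also have "\<dots> = (LINT t|lborel. \<Lambda>\<^sup>2 * (indicator {0..T} t *\<^sub>R ((norm (JM t))\<^sup>2 + (norm (JEt t))\<^sup>2)))"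
      by (rule Bochner_Integration.integral_cong) (simp_all add: mult.left_commute)
    also have "\<dots> = \<Lambda>\<^sup>2 * I" by (simp only: integral_mult_right_zero I_def)
    finally have 1: "(LINT t|lborel. indicator {0..T} t *\<^sub>R (norm (- JEt t, mi (JM t)))\<^sup>2) \<le> \<Lambda>\<^sup>2 * I" .
    have "(norm (K0 - JE0))\<^sup>2 \<le> 2 * (norm K0)\<^sup>2 + 2 * (norm JE0)\<^sup>2" using norm_add_power2_le[of K0 "- JE0"] by simp
    also have "\<dots> \<le> 2 * (D - I)" unfolding D by simp
    also have "\<dots> \<le> \<Lambda>\<^sup>2 * (2 * (D - I))" using mult_right_mono[OF \<Lambda>2, of "2 * (D - I)"] by (simp add: D)
    finally have "data_norm T (K0 - JE0) JEt JM \<le> \<Lambda>\<^sup>2 * (2 * (D - I)) + \<Lambda>\<^sup>2 * I" using 1 by (simp add: data_norm_def)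
    also have "\<dots> \<le> 2 * \<Lambda>\<^sup>2 * D" using I0 by (simp add: algebra_simps)
    finally show ?thesis .
  qed
  then have "B \<le> (2 * \<Lambda>\<^sup>2 * (1 + T))\<^sup>2 * (2 * \<Lambda>\<^sup>2 * D)" unfolding B_def by (rule mult_left_mono) simp
  then have B: "B \<le> data_bound \<Lambda> T * D" by (simp add: data_bound_def mult.assoc)
  have est: "(LINT t|lborel. indicator {0..T} t *\<^sub>R (norm (a t))\<^sup>2) \<le> B"
    "AE t\<in>{0..T} in lborel. (norm (E t))\<^sup>2 \<le> \<Lambda>\<^sup>2 * B"
    unfolding B_def by (rule sol_estimate[OF T JEt JM H0 sol])+
  have "\<Lambda>\<^sup>2 * B \<le> \<Lambda>\<^sup>2 * data_bound \<Lambda> T * D" using mult_left_mono[OF B, of "\<Lambda>\<^sup>2"] by (simp add: mult.assoc)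
  with est(2) show "AE t\<in>{0..T} in lborel. (norm (E t))\<^sup>2 \<le> \<Lambda>\<^sup>2 * data_bound \<Lambda> T * D"
    by (auto elim!: eventually_mono intro: order_trans)
  define V where "V t = mi (JM t - a t)" for t
  have sqV: "square_integrable V"
    unfolding V_def by (intro square_integrable_linear[OF _ mi_linear] square_integrable_diff JM sqa)
  define X where "X = (LINT t|lborel. indicator {0..T} t *\<^sub>R (norm (V t))\<^sup>2)"
  have X: "X \<le> 2 * \<Lambda>\<^sup>2 * (1 + data_bound \<Lambda> T) * D"
  proof -
    have i: "integrable lborel (\<lambda>t. 2 * \<Lambda>\<^sup>2 * (indicator {0..T} t *\<^sub>R ((norm (JM t))\<^sup>2 + (norm (JEt t))\<^sup>2) + indicator {0..T} t *\<^sub>R (norm (a t))\<^sup>2))"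
      by (intro integrable_mult_right Bochner_Integration.integrable_add iI int sqa)
    have eq: "2 * \<Lambda>\<^sup>2 * (indicator {0..T} t *\<^sub>R ((norm (JM t))\<^sup>2 + (norm (JEt t))\<^sup>2) + indicator {0..T} t *\<^sub>R (norm (a t))\<^sup>2)
        = indicator {0..T} t *\<^sub>R (2 * \<Lambda>\<^sup>2 * ((norm (JM t))\<^sup>2 + (norm (JEt t))\<^sup>2 + (norm (a t))\<^sup>2))" for t
      by (simp add: algebra_simps)
    have "X \<le> (LINT t|lborel. indicator {0..T} t *\<^sub>R (2 * \<Lambda>\<^sup>2 * ((norm (JM t))\<^sup>2 + (norm (JEt t))\<^sup>2 + (norm (a t))\<^sup>2)))"
      unfolding X_def
    proof (rule mono[OF int[OF sqV] i[unfolded eq]])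
      fix t
      have "(norm (V t))\<^sup>2 \<le> (\<Lambda> * norm (JM t - a t))\<^sup>2" unfolding V_def by (intro power_mono norm_mi_le) simp
      also have "\<dots> \<le> \<Lambda>\<^sup>2 * (2 * (norm (JM t))\<^sup>2 + 2 * (norm (a t))\<^sup>2)"
        unfolding power_mult_distrib using norm_add_power2_le[of "JM t" "- a t"] by (intro mult_left_mono) simp_all
      also have "\<dots> \<le> 2 * \<Lambda>\<^sup>2 * ((norm (JM t))\<^sup>2 + (norm (JEt t))\<^sup>2 + (norm (a t))\<^sup>2)" by (simp add: algebra_simps)
      finally show "(norm (V t))\<^sup>2 \<le> 2 * \<Lambda>\<^sup>2 * ((norm (JM t))\<^sup>2 + (norm (JEt t))\<^sup>2 + (norm (a t))\<^sup>2)" .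
    qed
    also have "\<dots> = 2 * \<Lambda>\<^sup>2 * (I + (LINT t|lborel. indicator {0..T} t *\<^sub>R (norm (a t))\<^sup>2))"
      unfolding eq[symmetric] I_def using Bochner_Integration.integral_add[OF iI int[OF sqa]] by (simp only: integral_mult_right_zero)
    also have "\<dots> \<le> 2 * \<Lambda>\<^sup>2 * (D + data_bound \<Lambda> T * D)" using est(1) B by (intro mult_left_mono add_mono) (simp_all add: D)
    finally show ?thesis by (simp add: algebra_simps)
  qed
  then show "(LINT t|lborel. indicator {0..T} t *\<^sub>R (norm (mi (JM t - a t)))\<^sup>2) \<le> 2 * \<Lambda>\<^sup>2 * (1 + data_bound \<Lambda> T) * D"
    by (simp add: X_def V_def)
  assume t: "t \<in> {0..T}"
  have "(norm (prim V t - prim V 0))\<^sup>2 \<le> (t - 0) * (LINT x|lborel. indicator {0..t} x *\<^sub>R (norm (V x))\<^sup>2)"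
    by (rule power2_norm_prim_le[OF sqV]) (use t in auto)
  also have "\<dots> \<le> T * X"
    unfolding X_def
  proof (rule mult_mono)
    show "(LINT x|lborel. indicator {0..t} x *\<^sub>R (norm (V x))\<^sup>2) \<le> (LINT x|lborel. indicator {0..T} x *\<^sub>R (norm (V x))\<^sup>2)"
      using t integrable_interval_inner[OF sqV sqV, of 0 t] int[OF sqV]
      by (intro integral_mono) (auto simp: power2_norm_eq_inner indicator_def)
    show "0 \<le> (LINT x|lborel. indicator {0..t} x *\<^sub>R (norm (V x))\<^sup>2)"
      by (intro integral_nonneg_AE) (auto simp: indicator_def)
  qed (use t in auto)
  also have "\<dots> \<le> T * (2 * \<Lambda>\<^sup>2 * (1 + data_bound \<Lambda> T) * D)" using X T by (intro mult_left_mono)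
  finally have "(norm (prim V t))\<^sup>2 \<le> T * (2 * \<Lambda>\<^sup>2 * (1 + data_bound \<Lambda> T) * D)" by simp
  moreover have "(norm H0)\<^sup>2 \<le> D" unfolding D using I0 by simp
  moreover have "(norm (H0 + prim V t))\<^sup>2 \<le> 2 * (norm H0)\<^sup>2 + 2 * (norm (prim V t))\<^sup>2" by (rule norm_add_power2_le)
  ultimately have "(norm (H0 + prim V t))\<^sup>2 \<le> 2 * D + 2 * (T * (2 * \<Lambda>\<^sup>2 * (1 + data_bound \<Lambda> T) * D))" by linarith
  then show "(norm (field_H JM H0 a t))\<^sup>2 \<le> (2 + 4 * T * \<Lambda>\<^sup>2 * (1 + data_bound \<Lambda> T)) * D"
    by (simp add: field_H_def V_def[abs_def] algebra_simps)
qed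

end

section \<open>Weak solutions\<close>

lemma AE_time: "(AE t in lebesgue_on {0..T::real}. P t) \<longleftrightarrow> (AE t\<in>{0..T} in lborel. P t)"
  by (rule AE_lebesgue_on_iff) simp

lemma H1_0_curl_H1_curl: "\<psi> \<in> H1_0_curl \<Omega> \<Longrightarrow> \<psi> \<in> H1_curl \<Omega>"
  by (simp add: H1_0_curl_def)

text \<open>The sum of the three constants in \<open>sol_bounds\<close>, for the electric field, the
  magnetic field and its time derivative.\<close>

definition stability_constant :: "real \<Rightarrow> real \<Rightarrow> real" where
  "stability_constant \<Lambda> T = \<Lambda>\<^sup>2 * data_bound \<Lambda> T + (2 + 4 * T * \<Lambda>\<^sup>2 * (1 + data_bound \<Lambda> T)) + 2 * \<Lambda>\<^sup>2 * (1 + data_bound \<Lambda> T)"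

text \<open>Interface between the Sobolev and the abstract side. \<open>J0\<close>,
  \<open>JD\<close> and \<open>J\<close> represent in the Hilbert space the initial value of
  \<open>JE\<close>, its time derivative and \<open>JM\<close>. The geometry of the domain is
  condensed into the hypothesis \<open>graph0\<close>.\<close>

locale eddy_current = evolution "graph_curl \<Omega>" s m \<Lambda> for \<Omega> s m \<Lambda> +
  fixes \<mu> :: "R3 \<Rightarrow> real" and \<sigma> :: "R3 \<Rightarrow> real^3^3" and T :: real
    and H0 :: "R3 \<Rightarrow> R3" and JE JM :: "real \<Rightarrow> R3 \<Rightarrow> R3" and J0 :: "(R3, R3) l2" and JD J :: "real \<Rightarrow> (R3, R3) l2"
  assumes op: "open \<Omega>"
    and graph0: "\<And>\<psi>. \<psi> \<in> H1_0_curl \<Omega> \<Longrightarrow> (emb \<Omega> \<psi>, emb \<Omega> (wcurl \<Omega> \<psi>)) \<in> graph0_curl \<Omega>"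
    and cut_s: "\<And>u. cut \<Omega> (s u) = s (cut \<Omega> u)" and cut_m: "\<And>u. cut \<Omega> (m u) = m (cut \<Omega> u)"
    and \<sigma>: "\<And>f. f \<in> L2 \<Omega> \<Longrightarrow> (\<lambda>x. \<sigma> x *v f x) \<in> L2 \<Omega>" "\<And>f. f \<in> L2 \<Omega> \<Longrightarrow> emb \<Omega> (\<lambda>x. \<sigma> x *v f x) = s (emb \<Omega> f)"
    and \<mu>: "\<And>f :: R3 \<Rightarrow> R3. f \<in> L2 \<Omega> \<Longrightarrow> (\<lambda>x. \<mu> x *\<^sub>R f x) \<in> L2 \<Omega>" "\<And>f. f \<in> L2 \<Omega> \<Longrightarrow> emb \<Omega> (\<lambda>x. \<mu> x *\<^sub>R f x) = m (emb \<Omega> f)"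
    and T: "T > 0"
    and JD: "square_integrable JD" and J: "square_integrable J"
    and JE: "AE t\<in>{0..T} in lborel. JE t \<in> L2 \<Omega> \<and> emb \<Omega> (JE t) = J0 + prim JD t"
    and cut_J0: "cut \<Omega> J0 = J0"
    and JM: "AE t\<in>{0..T} in lborel. JM t \<in> X_space \<Omega> (\<lambda>x. 1) \<and> emb \<Omega> (JM t) = J t"
    and H0: "H0 \<in> Y_space \<Omega> \<mu>"
begin

abbreviation "sol E a \<equiv> is_sol T J0 JD J (emb \<Omega> H0) E a"
abbreviation "dtH a t \<equiv> mi (J t - a t)"
abbreviation "weak_equations E H Ht t \<equiv>
  (\<forall>\<phi>\<in>H1_curl \<Omega>. (LINT x|lebesgue_on \<Omega>. H t x \<bullet> wcurl \<Omega> \<phi> x) - (LINT x|lebesgue_on \<Omega>. (\<sigma> x *v E t x) \<bullet> \<phi> x)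
      = (LINT x|lebesgue_on \<Omega>. JE t x \<bullet> \<phi> x)) \<and>
  (\<forall>\<psi>\<in>H1_0_curl \<Omega>. (LINT x|lebesgue_on \<Omega>. E t x \<bullet> wcurl \<Omega> \<psi> x) + (LINT x|lebesgue_on \<Omega>. \<mu> x * (Ht t x \<bullet> \<psi> x))
      = (LINT x|lebesgue_on \<Omega>. JM t x \<bullet> \<psi> x))"
abbreviation "fieldH a t \<equiv> emb \<Omega> H0 + prim (dtH a) t"

lemmas borel_\<Omega> = \<Omega>_borel[OF op]

lemma H0_L2: "H0 \<in> L2 \<Omega>" and H0_graph0: "(emb \<Omega> H0, emb \<Omega> (wcurl \<Omega> H0)) \<in> graph0_curl \<Omega>"
  using H0 graph0 by (auto simp: Y_space_def X_space_def)

lemma graph0_adj: "(h, k) \<in> graph0_curl \<Omega> \<longleftrightarrow> (h, k) \<in> adj \<and> cut \<Omega> h = h \<and> cut \<Omega> k = k"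
  by (auto simp: graph0_curl_def adj_def)

lemma graph_cut: "(e, a) \<in> graph_curl \<Omega> \<Longrightarrow> cut \<Omega> e = e \<and> cut \<Omega> a = a"
  by (simp add: graph_curl_def)

lemma cut_mi: "cut \<Omega> (mi u) = mi (cut \<Omega> u)"
  using cut_m[of "mi u"] mi_m[of "cut \<Omega> (mi u)"] by simp

lemma solD:
  assumes "sol E a"
  shows "square_integrable E" "square_integrable a" "square_integrable (dtH a)"
    "AE t\<in>{0..T} in lborel. (E t, a t) \<in> graph_curl \<Omega>"
    "AE t\<in>{0..T} in lborel. (fieldH a t, s (E t) + (J0 + prim JD t)) \<in> adj"
  using assms J by (auto simp: is_sol_def field_H_def intro!: square_integrable_linear[OF _ mi_linear] square_integrable_diff)

lemma cut_prim:
  assumes "square_integrable f" "AE t\<in>{0..T} in lborel. cut \<Omega> (f t) = f t" "t \<le> T"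
  shows "cut \<Omega> (prim f t) = prim f t"
proof -
  have "cut \<Omega> (prim f t) = prim (\<lambda>t. cut \<Omega> (f t)) t" by (rule prim_linear[OF bounded_linear_cut[OF borel_\<Omega>] assms(1), symmetric])
  also have "\<dots> = prim f t"
    by (rule prim_cong_AE[OF _ _ assms(2,3)])
      (intro square_integrable_measurable square_integrable_linear[OF _ bounded_linear_cut[OF borel_\<Omega>]] assms(1))+
  finally show ?thesis .
qed

lemma cut_J: "AE t\<in>{0..T} in lborel. cut \<Omega> (J t) = J t"
  using JM by eventually_elim (auto simp: X_space_def cut_emb[OF borel_\<Omega>] dest!: sym[of "emb \<Omega> _"])

lemma cut_dtH:
  assumes "sol E a" shows "AE t\<in>{0..T} in lborel. cut \<Omega> (dtH a t) = dtH a t"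
  using cut_J solD(4)[OF assms] by eventually_elim (auto simp: cut_mi cut_diff[OF borel_\<Omega>] dest: graph_cut)

lemma cut_fieldH:
  assumes "sol E a" "t \<le> T" shows "cut \<Omega> (fieldH a t) = fieldH a t"
  using cut_prim[OF solD(3)[OF assms(1)] cut_dtH[OF assms(1)] assms(2)] by (simp add: cut_add[OF borel_\<Omega>] cut_emb[OF borel_\<Omega> H0_L2])

lemma X_space_iff:
  assumes "f \<in> L2 \<Omega>"
  shows "f \<in> X_space \<Omega> \<mu> \<longleftrightarrow> (\<forall>u\<in>H1_0 \<Omega>. m (emb \<Omega> f) \<bullet> emb \<Omega> (wgrad \<Omega> u) = 0)"
proof -
  have "(LINT x|lebesgue_on \<Omega>. \<mu> x * (f x \<bullet> wgrad \<Omega> u x)) = m (emb \<Omega> f) \<bullet> emb \<Omega> (wgrad \<Omega> u)" if "u \<in> H1_0 \<Omega>" for u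
    using L2_inner_emb(1)[OF borel_\<Omega> \<mu>(1)[OF assms] H1_0_wgrad(1)[OF op that]] by (simp add: L2_inner_def \<mu>(2)[OF assms])
  then show ?thesis using assms by (simp add: X_space_def)
qed

text \<open>Applying \<open>m\<close> to the field at time \<open>t\<close> gives \<open>m\<close>
  of the initial field plus the integral of \<open>J - a\<close>. The initial field and
  \<open>J\<close> satisfy the constraint by assumption, and \<open>a\<close>, being a weak curl, is
  orthogonal to gradients.\<close>

lemma fieldH_X_space:
  assumes sol: "sol E a" and t: "t \<in> {0..T}"
  shows "rep_l2 (fieldH a t) \<in> X_space \<Omega> \<mu>"
proof (subst X_space_iff, goal_cases)
  case 2
  show ?case
  proof
    fix u assume u: "u \<in> H1_0 \<Omega>"
    define w where "w = emb \<Omega> (wgrad \<Omega> u)"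
    have "AE t\<in>{0..T} in lborel. (J t - a t) \<bullet> w = 0"
      using JM solD(4)[OF sol]
    proof eventually_elim
      fix t assume 1: "t \<in> {0..T} \<longrightarrow> JM t \<in> X_space \<Omega> (\<lambda>x. 1) \<and> emb \<Omega> (JM t) = J t"
        and 2: "t \<in> {0..T} \<longrightarrow> (E t, a t) \<in> graph_curl \<Omega>"
      show "t \<in> {0..T} \<longrightarrow> (J t - a t) \<bullet> w = 0"
      proof
        assume t: "t \<in> {0..T}"
        then have "JM t \<in> L2 \<Omega>" "L2_inner \<Omega> (JM t) (wgrad \<Omega> u) = 0" using 1 u by (auto simp: X_space_def L2_inner_def)
        then have "J t \<bullet> w = 0" using 1 t by (simp add: w_def L2_inner_emb(1)[OF borel_\<Omega> _ H1_0_wgrad(1)[OF op u]])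
        moreover have "a t \<bullet> w = 0" unfolding w_def using 2 t H1_0_wgrad(2)[OF op u] by blast
        ultimately show "(J t - a t) \<bullet> w = 0" by (simp add: inner_diff)
      qed
    qed
    then have "prim (\<lambda>t. (J t - a t) \<bullet> w) t = prim (\<lambda>t. 0) t"
      by (intro prim_cong_AE[where b=T])
        (use t solD(2)[OF sol] J in \<open>auto intro!: borel_measurable_inner borel_measurable_diff square_integrable_measurable\<close>)
    then have "prim (\<lambda>t. J t - a t) t \<bullet> w = 0"
      by (subst prim_inner) (auto simp: prim_def intro: square_integrable_diff J solD(2)[OF sol])
    moreover have "m (prim (dtH a) t) = prim (\<lambda>t. J t - a t) t"
      using prim_linear[OF m_linear solD(3)[OF sol], of t] by simp
    moreover have "m (emb \<Omega> H0) \<bullet> w = 0" using H0 u X_space_iff[OF H0_L2] by (simp add: Y_space_def w_def)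
    moreover have "m (fieldH a t) = m (emb \<Omega> H0) + m (prim (dtH a) t)" by (rule linear_add[OF bounded_linear.linear[OF m_linear]])
    moreover have "cut \<Omega> (fieldH a t) = fieldH a t" using cut_fieldH[OF sol] t by simp
    ultimately show "m (emb \<Omega> (rep_l2 (fieldH a t))) \<bullet> emb \<Omega> (wgrad \<Omega> u) = 0"
      by (simp add: rep_L2[OF borel_\<Omega>] w_def inner_add)
  qed
qed (simp add: rep_L2[OF borel_\<Omega>])

lemma fieldH_emb: "sol E a \<Longrightarrow> t \<in> {0..T} \<Longrightarrow> emb \<Omega> (rep_l2 (fieldH a t)) = fieldH a t"
  using cut_fieldH by (simp add: rep_L2[OF borel_\<Omega>])

lemma has_time_deriv_H:
  assumes sol: "sol E a" and H: "AE t\<in>{0..T} in lborel. H t \<in> L2 \<Omega> \<and> emb \<Omega> (H t) = fieldH a t"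
  shows "has_time_deriv \<Omega> T H (\<lambda>t. rep_l2 (dtH a t))"
  by (rule has_time_derivI[OF op less_imp_le[OF T] solD(3)[OF sol] _ H])
    (use cut_dtH[OF sol] in \<open>simp add: rep_L2[OF borel_\<Omega>]\<close>)

lemma cont_representative_H:
  assumes sol: "sol E a" and H: "AE t\<in>{0..T} in lborel. H t \<in> L2 \<Omega> \<and> emb \<Omega> (H t) = fieldH a t"
  shows "cont_representative \<Omega> T (X_space \<Omega> \<mu>) H (\<lambda>t. rep_l2 (fieldH a t))"
  by (rule cont_representativeI[OF op solD(3)[OF sol] H fieldH_X_space[OF sol]])

text \<open>With \<open>V\<close> the time derivative of \<open>H\<close>, the choice
  \<open>a = J - m V\<close> makes \<open>fieldH a\<close> equal to \<open>H\<close> once the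
  constant of integration is identified. The second weak equation, tested with test fields, puts
  \<open>(e, a)\<close> into the graph, and the first puts the magnetic side into the
  adjoint.\<close>

lemma weak_solution_sol:
  assumes "weak_solution \<Omega> \<mu> \<sigma> T JE JM H0 E H"
  obtains e a where "sol e a" "AE t\<in>{0..T} in lborel. E t \<in> L2 \<Omega> \<and> emb \<Omega> (E t) = e t"
    "AE t\<in>{0..T} in lborel. H t \<in> L2 \<Omega> \<and> emb \<Omega> (H t) = fieldH a t"
proof -
  obtain Ht Hc where E: "E \<in> Bochner_L2 T (H1_curl \<Omega>) (H1_curl_norm \<Omega>)" and H: "H \<in> Bochner_L2 T (H1_0_curl \<Omega>) (H1_curl_norm \<Omega>)"
    and Ht: "has_time_deriv \<Omega> T H Ht"
    and eqs: "AE t in lebesgue_on {0..T}. weak_equations E H Ht t"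
    and Hc: "cont_representative \<Omega> T (X_space \<Omega> \<mu>) H Hc" "AE x in lebesgue_on \<Omega>. Hc 0 x = H0 x"
    using assms unfolding weak_solution_def by blast
  obtain UE where UE: "square_integrable UE" "AE t\<in>{0..T} in lborel. E t \<in> H1_curl \<Omega> \<and> curl_pair \<Omega> (E t) = UE t"
    by (rule Bochner_L2_curlD[OF op E subset_refl])
  obtain UH where UH: "square_integrable UH" "AE t\<in>{0..T} in lborel. H t \<in> H1_0_curl \<Omega> \<and> curl_pair \<Omega> (H t) = UH t"
    by (rule Bochner_L2_curlD[OF op H]) (auto intro: H1_0_curl_H1_curl)
  obtain V where V: "square_integrable V" "AE t\<in>{0..T} in lborel. Ht t \<in> L2 \<Omega> \<and> emb \<Omega> (Ht t) = V t"
    using Ht by (auto simp: has_time_deriv_def intro: Bochner_L2_L2D[OF op])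
  define e where "e t = fst (UE t)" for t
  have sqe: "square_integrable e" unfolding e_def by (rule square_integrable_linear[OF UE(1) bounded_linear_fst])
  have e: "AE t\<in>{0..T} in lborel. E t \<in> L2 \<Omega> \<and> emb \<Omega> (E t) = e t"
    using UE(2) by eventually_elim (auto simp: e_def curl_pair_def H1_curl_L2[OF op] dest: sym)
  have h: "AE t\<in>{0..T} in lborel. H t \<in> L2 \<Omega> \<and> emb \<Omega> (H t) = fst (UH t)"
    using UH(2) by eventually_elim (auto simp: curl_pair_def H1_curl_L2[OF op] H1_0_curl_H1_curl dest: sym)
  obtain c where c: "AE t\<in>{0..T} in lborel. fst (UH t) = c + prim V t"
    by (rule has_time_derivD[OF op T square_integrable_linear[OF UH(1) bounded_linear_fst] h V Ht])
  \<comment> \<open>Both \<open>Hc\<close> and \<open>c + prim V\<close> are versions of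
    \<open>H\<close> continuous in time. If they differed at 0 they would differ on an interval to
    the right of 0, although they agree almost everywhere.\<close>
  have c_H0: "c = emb \<Omega> H0"
  proof (rule ccontr)
    assume "c \<noteq> emb \<Omega> H0"
    have L: "Hc t \<in> L2 \<Omega>" if "t \<in> {0..T}" for t using Hc(1) that by (auto simp: cont_representative_def X_space_def)
    have "0 \<in> {0..T}" using T by simp
    have "emb \<Omega> (Hc 0) = emb \<Omega> H0" using Hc(2) emb_eq_iff[OF borel_\<Omega> L H0_L2] T by simp
    moreover have "((\<lambda>t. L2_norm \<Omega> (\<lambda>x. Hc t x - Hc 0 x)) \<longlongrightarrow> 0) (at 0 within {0..T})"
      using Hc(1) T by (simp add: cont_representative_def)
    moreover have "L2_norm \<Omega> (\<lambda>x. Hc t x - Hc 0 x) = norm (emb \<Omega> (Hc t) - emb \<Omega> (Hc 0))" if "t \<in> {0..T}" for t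
      using L[OF that] L[OF \<open>0 \<in> {0..T}\<close>] by (simp add: L2_norm_emb[OF borel_\<Omega>] L2_diff[OF borel_\<Omega>] emb_diff[OF borel_\<Omega>])
    ultimately have "((\<lambda>t. norm (emb \<Omega> (Hc t) - emb \<Omega> H0)) \<longlongrightarrow> 0) (at 0 within {0..T})"
      by (auto simp: eventually_at_filter elim!: Lim_transform_eventually)
    then have "((\<lambda>t. emb \<Omega> (Hc t)) \<longlongrightarrow> emb \<Omega> H0) (at 0 within {0..T})"
      by (simp add: tendsto_norm_zero_iff LIM_zero_iff)
    then have "((\<lambda>t. emb \<Omega> (Hc t) - (c + prim V t)) \<longlongrightarrow> emb \<Omega> H0 - (c + prim V 0)) (at 0 within {0..T})"
      using T by (intro tendsto_diff tendsto_add tendsto_const prim_tendsto[OF V(1)]) simp_all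
    then have "\<forall>\<^sub>F t in at 0 within {0..T}. emb \<Omega> (Hc t) - (c + prim V t) \<noteq> 0"
      by (rule tendsto_imp_eventually_ne) (use \<open>c \<noteq> emb \<Omega> H0\<close> in auto)
    then obtain d where d: "d > 0" "\<And>t. t \<in> {0..T} \<Longrightarrow> t \<noteq> 0 \<Longrightarrow> dist t 0 < d \<Longrightarrow> emb \<Omega> (Hc t) - (c + prim V t) \<noteq> 0"
      by (auto simp: eventually_at)
    have "AE t\<in>{0..T} in lborel. (AE x in lebesgue_on \<Omega>. Hc t x = H t x)"
      using Hc(1) by (subst (asm) cont_representative_def) (simp add: AE_time)
    with h c have "AE t\<in>{0..T} in lborel. emb \<Omega> (Hc t) = c + prim V t"
    proof eventually_elim
      fix t assume "t \<in> {0..T} \<longrightarrow> (AE x in lebesgue_on \<Omega>. Hc t x = H t x)"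
        "t \<in> {0..T} \<longrightarrow> H t \<in> L2 \<Omega> \<and> emb \<Omega> (H t) = fst (UH t)" "t \<in> {0..T} \<longrightarrow> fst (UH t) = c + prim V t"
      then show "t \<in> {0..T} \<longrightarrow> emb \<Omega> (Hc t) = c + prim V t" using emb_eq_iff[OF borel_\<Omega> L[of t], of "H t"] by auto
    qed
    from AE_lborel_ex_Ioo[OF this, of 0 "min d T"] obtain t where "t \<in> {0<..<min d T}" "emb \<Omega> (Hc t) = c + prim V t"
      using d(1) T by auto
    then show False using d(2)[of t] by auto
  qed
  define a where "a t = J t - m (V t)" for t
  have sqa: "square_integrable a" unfolding a_def by (intro square_integrable_diff square_integrable_linear[OF _ m_linear] J V)
  have dtH: "dtH a = V" by (simp add: a_def fun_eq_iff)
  have H': "AE t\<in>{0..T} in lborel. H t \<in> L2 \<Omega> \<and> emb \<Omega> (H t) = fieldH a t"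
    using h c by eventually_elim (simp add: dtH c_H0)
  have eqs': "AE t\<in>{0..T} in lborel. weak_equations E H Ht t"
    using eqs unfolding AE_time .
  have "AE t\<in>{0..T} in lborel. (e t, a t) \<in> graph_curl \<Omega> \<and> (fieldH a t, s (e t) + (J0 + prim JD t)) \<in> adj"
    using eqs' e H' V(2) JE JM
  proof eventually_elim
    fix t
    assume eqs: "t \<in> {0..T} \<longrightarrow> weak_equations E H Ht t"
      and "t \<in> {0..T} \<longrightarrow> E t \<in> L2 \<Omega> \<and> emb \<Omega> (E t) = e t"
      and "t \<in> {0..T} \<longrightarrow> H t \<in> L2 \<Omega> \<and> emb \<Omega> (H t) = fieldH a t"
      and "t \<in> {0..T} \<longrightarrow> Ht t \<in> L2 \<Omega> \<and> emb \<Omega> (Ht t) = V t"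
      and "t \<in> {0..T} \<longrightarrow> JE t \<in> L2 \<Omega> \<and> emb \<Omega> (JE t) = J0 + prim JD t"
      and "t \<in> {0..T} \<longrightarrow> JM t \<in> X_space \<Omega> (\<lambda>x. 1) \<and> emb \<Omega> (JM t) = J t"
    show "t \<in> {0..T} \<longrightarrow> (e t, a t) \<in> graph_curl \<Omega> \<and> (fieldH a t, s (e t) + (J0 + prim JD t)) \<in> adj"
    proof (intro impI conjI)
      assume t: "t \<in> {0..T}"
      have L: "E t \<in> L2 \<Omega>" "H t \<in> L2 \<Omega>" "Ht t \<in> L2 \<Omega>" "JE t \<in> L2 \<Omega>" "JM t \<in> L2 \<Omega>"
        and emb: "emb \<Omega> (E t) = e t" "emb \<Omega> (H t) = fieldH a t" "emb \<Omega> (Ht t) = V t" "emb \<Omega> (JE t) = J0 + prim JD t" "emb \<Omega> (JM t) = J t"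
        using t \<open>t \<in> {0..T} \<longrightarrow> E t \<in> L2 \<Omega> \<and> emb \<Omega> (E t) = e t\<close> \<open>t \<in> {0..T} \<longrightarrow> H t \<in> L2 \<Omega> \<and> emb \<Omega> (H t) = fieldH a t\<close>
          \<open>t \<in> {0..T} \<longrightarrow> Ht t \<in> L2 \<Omega> \<and> emb \<Omega> (Ht t) = V t\<close> \<open>t \<in> {0..T} \<longrightarrow> JE t \<in> L2 \<Omega> \<and> emb \<Omega> (JE t) = J0 + prim JD t\<close>
          \<open>t \<in> {0..T} \<longrightarrow> JM t \<in> X_space \<Omega> (\<lambda>x. 1) \<and> emb \<Omega> (JM t) = J t\<close>
        by (auto simp: X_space_def)
      show "(fieldH a t, s (e t) + (J0 + prim JD t)) \<in> adj"
        unfolding adj_def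
      proof (clarify)
        fix u c assume uc: "(u, c) \<in> graph_curl \<Omega>"
        note r = graph_curl_rep[OF op uc]
        have "L2_inner \<Omega> (H t) (wcurl \<Omega> (rep_l2 u)) - L2_inner \<Omega> (\<lambda>x. \<sigma> x *v E t x) (rep_l2 u) = L2_inner \<Omega> (JE t) (rep_l2 u)"
          using eqs t r(1) by (simp add: L2_inner_def)
        then show "fieldH a t \<bullet> c = (s (e t) + (J0 + prim JD t)) \<bullet> u"
          by (simp add: L2_inner_emb(1)[OF borel_\<Omega>] L \<sigma> H1_curl_L2[OF op] wcurl[OF op] r emb rep_L2(1)[OF borel_\<Omega>] inner_add del: rep_L2)
      qed
      have "cut \<Omega> (e t) = e t" "cut \<Omega> (a t) = a t"
        using cut_emb[OF borel_\<Omega> L(1)] cut_emb[OF borel_\<Omega> L(3)] cut_emb[OF borel_\<Omega> L(5)] by (simp_all add: emb a_def cut_diff[OF borel_\<Omega>] cut_m)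
      moreover have "a t \<bullet> to_l2 \<Phi> = e t \<bullet> to_l2 (curl \<Phi>)" if \<Phi>: "\<Phi> \<in> test_functions \<Omega>" for \<Phi>
      proof -
        note r = graph0_curl_rep[OF op test_function_in_graph0_curl[OF op \<Phi>]]
        have "L2_inner \<Omega> (E t) (wcurl \<Omega> (rep_l2 (to_l2 \<Phi>))) + L2_inner \<Omega> (\<lambda>x. \<mu> x *\<^sub>R Ht t x) (rep_l2 (to_l2 \<Phi>)) = L2_inner \<Omega> (JM t) (rep_l2 (to_l2 \<Phi>))"
          using eqs t r(1) by (simp add: L2_inner_def)
        then show ?thesis
          by (simp add: L2_inner_emb(1)[OF borel_\<Omega>] L \<mu> wcurl(1)[OF op H1_0_curl_H1_curl[OF r(1)]] r emb rep_L2(1)[OF borel_\<Omega>] a_def inner_diff del: rep_L2)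
      qed
      ultimately show "(e t, a t) \<in> graph_curl \<Omega>" by (simp add: graph_curl_def)
    qed
  qed
  then have "sol e a" using sqe sqa by (auto simp: is_sol_def field_H_def elim: eventually_mono)
  then show thesis using e H' by (rule that)
qed

text \<open>Representatives of the abstract solution serve as the fields at every time; in
  particular \<open>H\<close> is its own continuous representative.\<close>

lemma ex_weak_solution: "\<exists>E H. weak_solution \<Omega> \<mu> \<sigma> T JE JM H0 E H"
proof -
  have adj: "(emb \<Omega> H0, emb \<Omega> (wcurl \<Omega> H0)) \<in> adj" using H0_graph0 by (simp add: graph0_adj)
  obtain e a where sol: "sol e a" and G: "\<And>t. (e t, a t) \<in> graph_curl \<Omega>"
    by (rule sol_exists[OF less_imp_le[OF T] JD J adj, of J0], rule that; assumption)
  define E where "E t = rep_l2 (e t)" for t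
  define H where "H t = rep_l2 (fieldH a t)" for t
  define Ht where "Ht t = rep_l2 (dtH a t)" for t
  define k where "k t = s (e t) + (J0 + prim JD t)" for t
  \<comment> \<open>The adjoint relation together with support in \<open>\<Omega>\<close> makes
    \<open>k t\<close> the curl of the magnetic field and gives the latter a vanishing
    trace.\<close>
  have hk: "AE t\<in>{0..T} in lborel. (fieldH a t, k t) \<in> graph0_curl \<Omega>"
    using solD(5)[OF sol] JE
  proof eventually_elim
    fix t assume 1: "t \<in> {0..T} \<longrightarrow> (fieldH a t, s (e t) + (J0 + prim JD t)) \<in> adj"
      and 2: "t \<in> {0..T} \<longrightarrow> JE t \<in> L2 \<Omega> \<and> emb \<Omega> (JE t) = J0 + prim JD t"
    show "t \<in> {0..T} \<longrightarrow> (fieldH a t, k t) \<in> graph0_curl \<Omega>"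
    proof
      assume t: "t \<in> {0..T}"
      then have "cut \<Omega> (J0 + prim JD t) = J0 + prim JD t" using 2 by (metis cut_emb[OF borel_\<Omega>])
      then have "cut \<Omega> (k t) = k t" using graph_cut[OF G[of t]] by (simp add: k_def cut_add[OF borel_\<Omega>] cut_s)
      then show "(fieldH a t, k t) \<in> graph0_curl \<Omega>"
        unfolding graph0_adj using 1 t cut_fieldH[OF sol] by (simp add: k_def)
    qed
  qed
  have H_L2: "AE t\<in>{0..T} in lborel. H t \<in> L2 \<Omega> \<and> emb \<Omega> (H t) = fieldH a t"
    using fieldH_emb[OF sol] by (simp add: H_def rep_L2(1)[OF borel_\<Omega>] del: rep_L2)
  have "E \<in> Bochner_L2 T (H1_curl \<Omega>) (H1_curl_norm \<Omega>)"
  proof (rule Bochner_L2_curl[OF op square_integrable_Pair[OF solD(1,2)[OF sol]] subspace_G closed_G])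
    show "rep_l2 (fst w) \<in> H1_curl \<Omega> \<and> curl_pair \<Omega> (rep_l2 (fst w)) = w" if "w \<in> graph_curl \<Omega>" for w
      using graph_curl_rep[OF op, of "fst w" "snd w"] that by (simp add: curl_pair_def)
    show "curl_pair \<Omega> f \<in> graph_curl \<Omega>" if "f \<in> H1_curl \<Omega>" for f using wcurl(2)[OF op that] by (simp add: curl_pair_def)
    show "AE t\<in>{0..T} in lborel. E t \<in> H1_curl \<Omega> \<and> curl_pair \<Omega> (E t) = (e t, a t)"
      using graph_curl_rep[OF op G] by (simp add: curl_pair_def E_def)
  qed simp
  moreover have "H \<in> Bochner_L2 T (H1_0_curl \<Omega>) (H1_curl_norm \<Omega>)"
  proof (rule Bochner_L2_curl[OF op _ subspace_graph0_curl[OF op] closed_graph0_curl[OF op]])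
    \<comment> \<open>The primitives and constants are truncated to \<open>{0..T}\<close> in order
      to be square integrable on the line.\<close>
    show "square_integrable (\<lambda>t. (indicator {0..T} t *\<^sub>R emb \<Omega> H0 + indicator {0..T} t *\<^sub>R prim (dtH a) t,
        s (e t) + (indicator {0..T} t *\<^sub>R J0 + indicator {0..T} t *\<^sub>R prim JD t)))"
      by (intro square_integrable_Pair square_integrable_add square_integrable_prim square_integrable_indicator
          square_integrable_linear[OF _ s_linear] solD[OF sol] JD) (use T in auto)
    show "rep_l2 (fst w) \<in> H1_0_curl \<Omega> \<and> curl_pair \<Omega> (rep_l2 (fst w)) = w" if "w \<in> graph0_curl \<Omega>" for w
      using graph0_curl_rep[OF op, of "fst w" "snd w"] that by (simp add: curl_pair_def)
    show "curl_pair \<Omega> f \<in> graph0_curl \<Omega>" if "f \<in> H1_0_curl \<Omega>" for f using graph0[OF that] by (simp add: curl_pair_def)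
    show "AE t\<in>{0..T} in lborel. H t \<in> H1_0_curl \<Omega> \<and> curl_pair \<Omega> (H t)
        = (indicator {0..T} t *\<^sub>R emb \<Omega> H0 + indicator {0..T} t *\<^sub>R prim (dtH a) t,
           s (e t) + (indicator {0..T} t *\<^sub>R J0 + indicator {0..T} t *\<^sub>R prim JD t))"
      using hk by eventually_elim (use graph0_curl_rep[OF op] in \<open>auto simp: curl_pair_def H_def k_def\<close>)
  qed (auto intro: H1_0_curl_H1_curl)
  moreover have "has_time_deriv \<Omega> T H Ht" using has_time_deriv_H[OF sol H_L2] by (simp add: Ht_def[abs_def])
  moreover have "AE t in lborel. t \<in> {0..T} \<longrightarrow>
      (\<forall>\<phi>\<in>H1_curl \<Omega>. L2_inner \<Omega> (H t) (wcurl \<Omega> \<phi>) - L2_inner \<Omega> (\<lambda>x. \<sigma> x *v E t x) \<phi> = L2_inner \<Omega> (JE t) \<phi>) \<and>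
      (\<forall>\<psi>\<in>H1_0_curl \<Omega>. L2_inner \<Omega> (E t) (wcurl \<Omega> \<psi>) + L2_inner \<Omega> (\<lambda>x. \<mu> x *\<^sub>R Ht t x) \<psi> = L2_inner \<Omega> (JM t) \<psi>)"
    using hk H_L2 JE JM cut_dtH[OF sol]
  proof eventually_elim
    fix t assume *: "t \<in> {0..T} \<longrightarrow> (fieldH a t, k t) \<in> graph0_curl \<Omega>"
      "t \<in> {0..T} \<longrightarrow> H t \<in> L2 \<Omega> \<and> emb \<Omega> (H t) = fieldH a t"
      "t \<in> {0..T} \<longrightarrow> JE t \<in> L2 \<Omega> \<and> emb \<Omega> (JE t) = J0 + prim JD t"
      "t \<in> {0..T} \<longrightarrow> JM t \<in> X_space \<Omega> (\<lambda>x. 1) \<and> emb \<Omega> (JM t) = J t"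
      "t \<in> {0..T} \<longrightarrow> cut \<Omega> (dtH a t) = dtH a t"
    have E: "E t \<in> L2 \<Omega>" "emb \<Omega> (E t) = e t" using graph_curl_rep[OF op G[of t]] by (simp_all add: E_def rep_L2(1)[OF borel_\<Omega>] del: rep_L2)
    have Ht: "Ht t \<in> L2 \<Omega>" by (simp add: Ht_def rep_L2(1)[OF borel_\<Omega>] del: rep_L2)
    show "t \<in> {0..T} \<longrightarrow>
      (\<forall>\<phi>\<in>H1_curl \<Omega>. L2_inner \<Omega> (H t) (wcurl \<Omega> \<phi>) - L2_inner \<Omega> (\<lambda>x. \<sigma> x *v E t x) \<phi> = L2_inner \<Omega> (JE t) \<phi>) \<and>
      (\<forall>\<psi>\<in>H1_0_curl \<Omega>. L2_inner \<Omega> (E t) (wcurl \<Omega> \<psi>) + L2_inner \<Omega> (\<lambda>x. \<mu> x *\<^sub>R Ht t x) \<psi> = L2_inner \<Omega> (JM t) \<psi>)"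
    proof (intro impI conjI ballI)
      assume t: "t \<in> {0..T}"
      have L: "H t \<in> L2 \<Omega>" "JE t \<in> L2 \<Omega>" "JM t \<in> L2 \<Omega>" and hk: "(fieldH a t, k t) \<in> adj"
        and emb: "emb \<Omega> (H t) = fieldH a t" "emb \<Omega> (JE t) = J0 + prim JD t" "emb \<Omega> (JM t) = J t" "emb \<Omega> (Ht t) = dtH a t"
        using * t by (auto simp: X_space_def graph0_adj Ht_def rep_L2(2)[OF borel_\<Omega>])
      show "L2_inner \<Omega> (H t) (wcurl \<Omega> \<phi>) - L2_inner \<Omega> (\<lambda>x. \<sigma> x *v E t x) \<phi> = L2_inner \<Omega> (JE t) \<phi>" if \<phi>: "\<phi> \<in> H1_curl \<Omega>" for \<phi>
        using adjD[OF hk wcurl(2)[OF op \<phi>]]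
        by (simp add: L2_inner_emb(1)[OF borel_\<Omega>] L E \<sigma> emb H1_curl_L2[OF op \<phi>] wcurl(1)[OF op \<phi>] k_def inner_add)
      show "L2_inner \<Omega> (E t) (wcurl \<Omega> \<psi>) + L2_inner \<Omega> (\<lambda>x. \<mu> x *\<^sub>R Ht t x) \<psi> = L2_inner \<Omega> (JM t) \<psi>" if \<psi>: "\<psi> \<in> H1_0_curl \<Omega>" for \<psi>
      proof -
        note \<psi>' = H1_0_curl_H1_curl[OF \<psi>]
        have "emb \<Omega> \<psi> \<bullet> a t = emb \<Omega> (wcurl \<Omega> \<psi>) \<bullet> e t" using graph0[OF \<psi>] G[of t] by (auto simp: graph0_curl_def)
        then show ?thesis
          by (simp add: L2_inner_emb(1)[OF borel_\<Omega>] L E Ht \<mu> emb H1_curl_L2[OF op \<psi>'] wcurl(1)[OF op \<psi>'] inner_diff)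
            (simp add: inner_commute)
      qed
    qed
  qed
  then have "AE t in lebesgue_on {0..T}.
      (\<forall>\<phi>\<in>H1_curl \<Omega>. L2_inner \<Omega> (H t) (wcurl \<Omega> \<phi>) - L2_inner \<Omega> (\<lambda>x. \<sigma> x *v E t x) \<phi> = L2_inner \<Omega> (JE t) \<phi>) \<and>
      (\<forall>\<psi>\<in>H1_0_curl \<Omega>. L2_inner \<Omega> (E t) (wcurl \<Omega> \<psi>) + L2_inner \<Omega> (\<lambda>x. \<mu> x *\<^sub>R Ht t x) \<psi> = L2_inner \<Omega> (JM t) \<psi>)"
    unfolding AE_time .
  moreover have "cont_representative \<Omega> T (X_space \<Omega> \<mu>) H H"
    using cont_representative_H[OF sol H_L2] by (simp add: H_def[abs_def])
  moreover have "AE x in lebesgue_on \<Omega>. H 0 x = H0 x"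
    using emb_eq_iff[OF borel_\<Omega> rep_L2(1)[OF borel_\<Omega>] H0_L2, of "fieldH a 0"] fieldH_emb[OF sol, of 0] T by (simp add: H_def del: rep_L2)
  ultimately show ?thesis
    unfolding weak_solution_def L2_inner_def inner_scaleR_left by blast
qed

text \<open>At every time the magnetic field is determined by the primitive of a function of
  \<open>a\<close>, so \<open>sol_unique\<close> settles both fields.\<close>

lemma weak_solution_unique:
  assumes "weak_solution \<Omega> \<mu> \<sigma> T JE JM H0 E H" "weak_solution \<Omega> \<mu> \<sigma> T JE JM H0 E' H'"
  shows "AE t in lebesgue_on {0..T}. AE x in lebesgue_on \<Omega>. E t x = E' t x \<and> H t x = H' t x"
proof -
  obtain e a where 1: "sol e a" "AE t\<in>{0..T} in lborel. E t \<in> L2 \<Omega> \<and> emb \<Omega> (E t) = e t"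
    "AE t\<in>{0..T} in lborel. H t \<in> L2 \<Omega> \<and> emb \<Omega> (H t) = fieldH a t"
    by (rule weak_solution_sol[OF assms(1)])
  obtain e' a' where 2: "sol e' a'" "AE t\<in>{0..T} in lborel. E' t \<in> L2 \<Omega> \<and> emb \<Omega> (E' t) = e' t"
    "AE t\<in>{0..T} in lborel. H' t \<in> L2 \<Omega> \<and> emb \<Omega> (H' t) = fieldH a' t"
    by (rule weak_solution_sol[OF assms(2)])
  have eq: "AE t\<in>{0..T} in lborel. e t = e' t \<and> a t = a' t"
    by (rule sol_unique[OF less_imp_le[OF T] J 1(1) 2(1)])
  have p: "prim (dtH a) t = prim (dtH a') t" if "t \<le> T" for t
    by (rule prim_cong_AE[OF _ _ _ that])
      (use eq in \<open>auto intro!: square_integrable_measurable solD(3)[OF 1(1)] solD(3)[OF 2(1)] elim!: eventually_mono\<close>)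
  have "AE t\<in>{0..T} in lborel. (AE x in lebesgue_on \<Omega>. E t x = E' t x \<and> H t x = H' t x)"
    using 1(2,3) 2(2,3) eq
  proof eventually_elim
    fix t assume "t \<in> {0..T} \<longrightarrow> E t \<in> L2 \<Omega> \<and> emb \<Omega> (E t) = e t" "t \<in> {0..T} \<longrightarrow> H t \<in> L2 \<Omega> \<and> emb \<Omega> (H t) = fieldH a t"
      "t \<in> {0..T} \<longrightarrow> E' t \<in> L2 \<Omega> \<and> emb \<Omega> (E' t) = e' t" "t \<in> {0..T} \<longrightarrow> H' t \<in> L2 \<Omega> \<and> emb \<Omega> (H' t) = fieldH a' t"
      "t \<in> {0..T} \<longrightarrow> e t = e' t \<and> a t = a' t"
    then show "t \<in> {0..T} \<longrightarrow> (AE x in lebesgue_on \<Omega>. E t x = E' t x \<and> H t x = H' t x)"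
      using p[of t] emb_eq_iff[OF borel_\<Omega>, of "E t" "E' t"] emb_eq_iff[OF borel_\<Omega>, of "H t" "H' t"] by force
  qed
  then show ?thesis unfolding AE_time .
qed

text \<open>The electric field is bounded for almost every time, hence the essential supremum; the
  magnetic field is bounded at each time through its continuous representative.\<close>

lemma weak_solution_estimate:
  assumes weak: "weak_solution \<Omega> \<mu> \<sigma> T JE JM H0 E H"
    and JEt: "AE t\<in>{0..T} in lborel. JEt t \<in> L2 \<Omega> \<and> emb \<Omega> (JEt t) = JD t"
  shows "\<exists>Ht Hc JEc. has_time_deriv \<Omega> T H Ht \<and> cont_representative \<Omega> T (X_space \<Omega> \<mu>) H Hc \<and>
    cont_representative \<Omega> T (L2 \<Omega>) JE JEc \<and>
    esssup (lebesgue_on {0..T}) (\<lambda>t. ereal ((L2_norm \<Omega> (E t))\<^sup>2)) + (SUP t\<in>{0..T}. ereal ((L2_norm \<Omega> (Hc t))\<^sup>2))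
      + ereal (LINT t|lebesgue_on {0..T}. (L2_norm \<Omega> (Ht t))\<^sup>2)
    \<le> ereal (stability_constant \<Lambda> T * ((H1_curl_norm \<Omega> H0)\<^sup>2 + (L2_norm \<Omega> (JEc 0))\<^sup>2
        + (LINT t|lebesgue_on {0..T}. (L2_norm \<Omega> (JE t))\<^sup>2 + (L2_norm \<Omega> (JM t))\<^sup>2 + (L2_norm \<Omega> (JEt t))\<^sup>2)))"
proof -
  obtain e a where sol: "sol e a" and e: "AE t\<in>{0..T} in lborel. E t \<in> L2 \<Omega> \<and> emb \<Omega> (E t) = e t"
    and h: "AE t\<in>{0..T} in lborel. H t \<in> L2 \<Omega> \<and> emb \<Omega> (H t) = fieldH a t"
    by (rule weak_solution_sol[OF weak])
  define K0 where "K0 = emb \<Omega> (wcurl \<Omega> H0)"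
  define q where "q = data_bound \<Lambda> T"
  have adj: "(emb \<Omega> H0, K0) \<in> adj" using H0_graph0 by (simp add: graph0_adj K0_def)
  define D where "D = (norm (emb \<Omega> H0))\<^sup>2 + (norm K0)\<^sup>2 + (norm J0)\<^sup>2 + (LINT t|lborel. indicator {0..T} t *\<^sub>R ((norm (J t))\<^sup>2 + (norm (JD t))\<^sup>2))"
  note bounds = sol_bounds[OF less_imp_le[OF T] JD J adj sol, folded D_def q_def]
  define Ht where "Ht t = rep_l2 (dtH a t)" for t
  define Hc where "Hc t = rep_l2 (fieldH a t)" for t
  define JEc where "JEc t = rep_l2 (J0 + prim JD t)" for t
  have int: "integrable lborel (\<lambda>t. indicator {0..T} t *\<^sub>R (norm (f t))\<^sup>2)" if "square_integrable f" for f :: "real \<Rightarrow> (R3, R3) l2"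
    using integrable_interval_inner[OF that that, of 0 T] by (simp add: power2_norm_eq_inner)
  have q0: "0 \<le> q" by (simp add: q_def data_bound_def)
  have "esssup (lebesgue_on {0..T}) (\<lambda>t. ereal ((L2_norm \<Omega> (E t))\<^sup>2)) \<le> ereal (\<Lambda>\<^sup>2 * q * D)"
  proof (rule esssup_I)
    have "(\<lambda>t. (L2_norm \<Omega> (E t))\<^sup>2) \<in> borel_measurable (lebesgue_on {0..T})"
    proof (rule integral_lebesgue_on(3))
      show "(\<lambda>t. indicator {0..T} t *\<^sub>R (norm (e t))\<^sup>2) \<in> borel_measurable borel"
        using square_integrable_measurable[OF solD(1)[OF sol]] by measurable
      show "AE t in lborel. indicator {0..T} t *\<^sub>R (norm (e t))\<^sup>2 = indicator {0..T} t *\<^sub>R (L2_norm \<Omega> (E t))\<^sup>2"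
        using e by eventually_elim (auto simp: indicator_def L2_norm_emb[OF borel_\<Omega>])
    qed simp
    then show "(\<lambda>t. ereal ((L2_norm \<Omega> (E t))\<^sup>2)) \<in> borel_measurable (lebesgue_on {0..T})" by measurable
    show "AE t in lebesgue_on {0..T}. ereal ((L2_norm \<Omega> (E t))\<^sup>2) \<le> ereal (\<Lambda>\<^sup>2 * q * D)"
      unfolding AE_time using e bounds(1) by eventually_elim (auto simp: L2_norm_emb[OF borel_\<Omega>])
  qed
  moreover have "(SUP t\<in>{0..T}. ereal ((L2_norm \<Omega> (Hc t))\<^sup>2)) \<le> ereal ((2 + 4 * T * \<Lambda>\<^sup>2 * (1 + q)) * D)"
  proof (rule SUP_least)
    fix t assume t: "t \<in> {0..T}"
    have "L2_norm \<Omega> (Hc t) = norm (fieldH a t)"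
      by (simp add: L2_norm_emb[OF borel_\<Omega>] Hc_def rep_L2(1)[OF borel_\<Omega>] fieldH_emb[OF sol t] del: rep_L2)
    then show "ereal ((L2_norm \<Omega> (Hc t))\<^sup>2) \<le> ereal ((2 + 4 * T * \<Lambda>\<^sup>2 * (1 + q)) * D)"
      using bounds(3)[OF t] by (simp add: field_H_def)
  qed
  moreover have "(LINT t|lebesgue_on {0..T}. (L2_norm \<Omega> (Ht t))\<^sup>2) \<le> 2 * \<Lambda>\<^sup>2 * (1 + q) * D"
  proof -
    have "(LINT t|lebesgue_on {0..T}. (L2_norm \<Omega> (Ht t))\<^sup>2) = (LINT t|lborel. indicator {0..T} t *\<^sub>R (norm (dtH a t))\<^sup>2)"
    proof (rule integral_lebesgue_on(1))
      show "(\<lambda>t. indicator {0..T} t *\<^sub>R (norm (dtH a t))\<^sup>2) \<in> borel_measurable borel"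
        using square_integrable_measurable[OF solD(3)[OF sol]] by measurable
      show "AE t in lborel. indicator {0..T} t *\<^sub>R (norm (dtH a t))\<^sup>2 = indicator {0..T} t *\<^sub>R (L2_norm \<Omega> (Ht t))\<^sup>2"
        using cut_dtH[OF sol] by eventually_elim (auto simp: indicator_def L2_norm_emb[OF borel_\<Omega>] Ht_def rep_L2[OF borel_\<Omega>])
    qed simp
    then show ?thesis using bounds(2) by simp
  qed
  ultimately have "esssup (lebesgue_on {0..T}) (\<lambda>t. ereal ((L2_norm \<Omega> (E t))\<^sup>2)) + (SUP t\<in>{0..T}. ereal ((L2_norm \<Omega> (Hc t))\<^sup>2))
      + ereal (LINT t|lebesgue_on {0..T}. (L2_norm \<Omega> (Ht t))\<^sup>2)
    \<le> ereal (\<Lambda>\<^sup>2 * q * D) + ereal ((2 + 4 * T * \<Lambda>\<^sup>2 * (1 + q)) * D) + ereal (2 * \<Lambda>\<^sup>2 * (1 + q) * D)"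
    by (intro add_mono) simp_all
  also have "\<dots> = ereal (stability_constant \<Lambda> T * D)" by (simp add: stability_constant_def q_def algebra_simps)
  also have "\<dots> \<le> ereal (stability_constant \<Lambda> T * ((H1_curl_norm \<Omega> H0)\<^sup>2 + (L2_norm \<Omega> (JEc 0))\<^sup>2
        + (LINT t|lebesgue_on {0..T}. (L2_norm \<Omega> (JE t))\<^sup>2 + (L2_norm \<Omega> (JM t))\<^sup>2 + (L2_norm \<Omega> (JEt t))\<^sup>2)))"
  proof -
    define F where "F t = indicator {0..T} t *\<^sub>R J0 + indicator {0..T} t *\<^sub>R prim JD t" for t
    have sqF: "square_integrable F" unfolding F_def
      by (intro square_integrable_add square_integrable_prim JD square_integrable_indicator) (use T in auto)
    \<comment> \<open>The abstract bound involves \<open>JE\<close> only through its initial value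
      and its derivative; adding the nonnegative integral of its square matches the stated
      right-hand side.\<close>
    have "(LINT t|lborel. indicator {0..T} t *\<^sub>R ((norm (J t))\<^sup>2 + (norm (JD t))\<^sup>2))
        \<le> (LINT t|lborel. indicator {0..T} t *\<^sub>R (norm (F t))\<^sup>2 + indicator {0..T} t *\<^sub>R (norm (J t))\<^sup>2 + indicator {0..T} t *\<^sub>R (norm (JD t))\<^sup>2)"
      unfolding scaleR_add_right
      by (intro integral_mono Bochner_Integration.integrable_add int sqF J JD) simp
    also have "\<dots> = (LINT t|lebesgue_on {0..T}. (L2_norm \<Omega> (JE t))\<^sup>2 + (L2_norm \<Omega> (JM t))\<^sup>2 + (L2_norm \<Omega> (JEt t))\<^sup>2)"
    proof (rule integral_lebesgue_on(1)[symmetric])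
      show "(\<lambda>t. indicator {0..T} t *\<^sub>R (norm (F t))\<^sup>2 + indicator {0..T} t *\<^sub>R (norm (J t))\<^sup>2 + indicator {0..T} t *\<^sub>R (norm (JD t))\<^sup>2) \<in> borel_measurable borel"
        using sqF J JD by measurable
      show "AE t in lborel. indicator {0..T} t *\<^sub>R (norm (F t))\<^sup>2 + indicator {0..T} t *\<^sub>R (norm (J t))\<^sup>2 + indicator {0..T} t *\<^sub>R (norm (JD t))\<^sup>2
          = indicator {0..T} t *\<^sub>R ((L2_norm \<Omega> (JE t))\<^sup>2 + (L2_norm \<Omega> (JM t))\<^sup>2 + (L2_norm \<Omega> (JEt t))\<^sup>2)"
        using JE JM JEt by eventually_elim (auto simp: indicator_def L2_norm_emb[OF borel_\<Omega>] F_def X_space_def)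
    qed simp
    moreover have "(H1_curl_norm \<Omega> H0)\<^sup>2 = (norm (emb \<Omega> H0))\<^sup>2 + (norm K0)\<^sup>2"
      using H0 H1_curl_norm_eq[OF op, of H0] by (simp add: Y_space_def H1_0_curl_H1_curl curl_pair_def norm_prod_def K0_def)
    moreover have "L2_norm \<Omega> (JEc 0) = norm J0" by (simp add: JEc_def L2_norm_emb[OF borel_\<Omega>] rep_L2[OF borel_\<Omega>] cut_J0)
    moreover have "0 \<le> stability_constant \<Lambda> T" using q0 T by (simp add: stability_constant_def q_def)
    ultimately show ?thesis by (auto simp: D_def intro!: mult_left_mono)
  qed
  finally have est: "esssup (lebesgue_on {0..T}) (\<lambda>t. ereal ((L2_norm \<Omega> (E t))\<^sup>2)) + (SUP t\<in>{0..T}. ereal ((L2_norm \<Omega> (Hc t))\<^sup>2))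
      + ereal (LINT t|lebesgue_on {0..T}. (L2_norm \<Omega> (Ht t))\<^sup>2)
    \<le> ereal (stability_constant \<Lambda> T * ((H1_curl_norm \<Omega> H0)\<^sup>2 + (L2_norm \<Omega> (JEc 0))\<^sup>2
        + (LINT t|lebesgue_on {0..T}. (L2_norm \<Omega> (JE t))\<^sup>2 + (L2_norm \<Omega> (JM t))\<^sup>2 + (L2_norm \<Omega> (JEt t))\<^sup>2)))" .
  have "has_time_deriv \<Omega> T H Ht" "cont_representative \<Omega> T (X_space \<Omega> \<mu>) H Hc"
    unfolding Ht_def[abs_def] Hc_def[abs_def] by (rule has_time_deriv_H[OF sol h] cont_representative_H[OF sol h])+
  moreover have "cont_representative \<Omega> T (L2 \<Omega>) JE JEc"
    unfolding JEc_def[abs_def] by (rule cont_representativeI[OF op JD JE rep_L2(1)[OF borel_\<Omega>]])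
  ultimately show ?thesis using est by blast
qed

end

theorem theorem3p1:
  fixes \<Lambda> T :: real
  assumes "\<Lambda> \<ge> 1" and "T > 0"
  shows "\<exists>C::real. \<forall>(\<Omega> :: R3 set) r \<mu> \<sigma> H0 JE JEt JM.
    standing_assumptions \<Lambda> \<Omega> r \<mu> \<sigma> \<and>
    H0 \<in> Y_space \<Omega> \<mu> \<and>
    JE \<in> Bochner_L2 T (L2 \<Omega>) (L2_norm \<Omega>) \<and>
    has_time_deriv \<Omega> T JE JEt \<and>
    JM \<in> Bochner_L2 T (X_space \<Omega> (\<lambda>x. 1)) (L2_norm \<Omega>)
    \<longrightarrow>
    (\<exists>E H. weak_solution \<Omega> \<mu> \<sigma> T JE JM H0 E H) \<and>
    (\<forall>E H E' H'. weak_solution \<Omega> \<mu> \<sigma> T JE JM H0 E H \<and> weak_solution \<Omega> \<mu> \<sigma> T JE JM H0 E' H' \<longrightarrow>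
       (AE t in lebesgue_on {0..T}. AE x in lebesgue_on \<Omega>. E t x = E' t x \<and> H t x = H' t x)) \<and>
    (\<forall>E H. weak_solution \<Omega> \<mu> \<sigma> T JE JM H0 E H \<longrightarrow>
       (\<exists>Ht Hc JEc.
          has_time_deriv \<Omega> T H Ht \<and>
          cont_representative \<Omega> T (X_space \<Omega> \<mu>) H Hc \<and>
          cont_representative \<Omega> T (L2 \<Omega>) JE JEc \<and>
          esssup (lebesgue_on {0..T}) (\<lambda>t. ereal ((L2_norm \<Omega> (E t))\<^sup>2))
          + (SUP t\<in>{0..T}. ereal ((L2_norm \<Omega> (Hc t))\<^sup>2))
          + ereal (LINT t|lebesgue_on {0..T}. (L2_norm \<Omega> (Ht t))\<^sup>2)
          \<le> ereal (C * ((H1_curl_norm \<Omega> H0)\<^sup>2 + (L2_norm \<Omega> (JEc 0))\<^sup>2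
              + (LINT t|lebesgue_on {0..T}.
                   (L2_norm \<Omega> (JE t))\<^sup>2 + (L2_norm \<Omega> (JM t))\<^sup>2 + (L2_norm \<Omega> (JEt t))\<^sup>2)))))"
proof (rule exI[of _ "stability_constant \<Lambda> T"], intro allI impI, goal_cases)
  case *: (1 \<Omega> r \<mu> \<sigma> H0 JE JEt JM)
  then have op: "open \<Omega>" and bounded: "bounded \<Omega>" and r: "r > 0" "two_sided_ball_condition \<Omega> r"
    and adm: "admissible_mu \<Lambda> \<Omega> \<mu>" "admissible_sigma \<Lambda> \<Omega> \<sigma>"
    by (auto simp: standing_assumptions_def bounded_domain_def)
  note b = \<Omega>_borel[OF op]
  have \<sigma>: "\<sigma> \<in> borel_measurable (lebesgue_on \<Omega>)" "\<forall>x\<in>\<Omega>. transpose (\<sigma> x) = \<sigma> x"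
    "AE x in lebesgue_on \<Omega>. \<forall>\<eta>. inverse \<Lambda> * (norm \<eta>)\<^sup>2 \<le> (\<sigma> x *v \<eta>) \<bullet> \<eta> \<and> (\<sigma> x *v \<eta>) \<bullet> \<eta> \<le> \<Lambda> * (norm \<eta>)\<^sup>2"
    using adm(2) by (simp_all add: admissible_sigma_def)
  have "AE x in lebesgue_on \<Omega>. x \<in> \<Omega>" using AE_space by eventually_elim (simp add: space_restrict_space)
  with \<sigma>(3) have \<sigma>': "AE x in lebesgue_on \<Omega>. transpose (\<sigma> x) = \<sigma> x \<and>
      (\<forall>\<eta>. inverse \<Lambda> * (norm \<eta>)\<^sup>2 \<le> (\<sigma> x *v \<eta>) \<bullet> \<eta> \<and> (\<sigma> x *v \<eta>) \<bullet> \<eta> \<le> \<Lambda> * (norm \<eta>)\<^sup>2)"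
    by eventually_elim (use \<sigma>(2) in blast)
  obtain s where s: "bounded_linear s" "\<And>u v. s u \<bullet> v = u \<bullet> s v"
    "\<And>u. inverse \<Lambda> * (norm u)\<^sup>2 \<le> s u \<bullet> u" "\<And>u. s u \<bullet> u \<le> \<Lambda> * (norm u)\<^sup>2" "\<And>u. cut \<Omega> (s u) = s (cut \<Omega> u)"
    "\<And>f. f \<in> L2 \<Omega> \<Longrightarrow> (\<lambda>x. \<sigma> x *v f x) \<in> L2 \<Omega>" "\<And>f. f \<in> L2 \<Omega> \<Longrightarrow> emb \<Omega> (\<lambda>x. \<sigma> x *v f x) = s (emb \<Omega> f)"
    by (rule coefficient_operator[OF op assms(1) \<sigma>(1) \<sigma>'], rule that; assumption)
  \<comment> \<open>The scalar coefficient as a multiple of the identity matrix, so that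
    \<open>coefficient_operator\<close> provides both \<open>s\<close> and \<open>m\<close>.\<close>
  define M :: "R3 \<Rightarrow> real^3^3" where "M x = \<mu> x *\<^sub>R mat 1" for x
  have M_mult: "M x *v y = \<mu> x *\<^sub>R y" for x y by (simp add: M_def scaleR_matrix_vector_assoc[symmetric])
  have M_transpose: "transpose (M x) = M x" for x by (simp add: M_def transpose_scalar)
  obtain L where "L-lipschitz_on \<Omega> \<mu>" using adm(1) by (auto simp: admissible_mu_def)
  then have "\<mu> \<in> borel_measurable (lebesgue_on \<Omega>)"
    by (intro continuous_imp_measurable_on_sets_lebesgue lipschitz_on_continuous_on) (simp_all add: b)
  then have M: "M \<in> borel_measurable (lebesgue_on \<Omega>)" unfolding M_def[abs_def] by measurable
  have "AE x in lebesgue_on \<Omega>. \<exists>g. GDERIV \<mu> x :> g \<and> inverse \<Lambda> \<le> \<mu> x \<and> \<mu> x \<le> max (\<mu> x) (norm g) \<and> max (\<mu> x) (norm g) \<le> \<Lambda>"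
    using adm(1) by (simp add: admissible_mu_def)
  \<comment> \<open>The upper bound for \<open>\<mu>\<close> is contained in the bound for its
    maximum with the norm of the gradient.\<close>
  then have M': "AE x in lebesgue_on \<Omega>. transpose (M x) = M x \<and>
      (\<forall>\<eta>. inverse \<Lambda> * (norm \<eta>)\<^sup>2 \<le> (M x *v \<eta>) \<bullet> \<eta> \<and> (M x *v \<eta>) \<bullet> \<eta> \<le> \<Lambda> * (norm \<eta>)\<^sup>2)"
    by eventually_elim (auto simp: M_mult M_transpose power2_norm_eq_inner intro!: mult_right_mono)
  obtain m where m: "bounded_linear m" "\<And>u v. m u \<bullet> v = u \<bullet> m v"
    "\<And>u. inverse \<Lambda> * (norm u)\<^sup>2 \<le> m u \<bullet> u" "\<And>u. m u \<bullet> u \<le> \<Lambda> * (norm u)\<^sup>2" "\<And>u. cut \<Omega> (m u) = m (cut \<Omega> u)"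
    "\<And>f. f \<in> L2 \<Omega> \<Longrightarrow> (\<lambda>x. M x *v f x) \<in> L2 \<Omega>" "\<And>f. f \<in> L2 \<Omega> \<Longrightarrow> emb \<Omega> (\<lambda>x. M x *v f x) = m (emb \<Omega> f)"
    by (rule coefficient_operator[OF op assms(1) M M'], rule that; assumption)
  have JEt': "JEt \<in> Bochner_L2 T (L2 \<Omega>) (L2_norm \<Omega>)" using * by (simp add: has_time_deriv_def)
  obtain U where U: "square_integrable U" "AE t\<in>{0..T} in lborel. JE t \<in> L2 \<Omega> \<and> emb \<Omega> (JE t) = U t"
    using Bochner_L2_L2D[OF op] * by blast
  obtain V where V: "square_integrable V" "AE t\<in>{0..T} in lborel. JEt t \<in> L2 \<Omega> \<and> emb \<Omega> (JEt t) = V t"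
    using Bochner_L2_L2D[OF op JEt'] by blast
  obtain c where c: "AE t\<in>{0..T} in lborel. U t = c + prim V t"
    using has_time_derivD[OF op assms(2) U V] * by blast
  obtain J where J: "square_integrable J" "AE t\<in>{0..T} in lborel. JM t \<in> X_space \<Omega> (\<lambda>x. 1) \<and> emb \<Omega> (JM t) = J t"
  proof (rule Bochner_L2D[of "X_space \<Omega> (\<lambda>x. 1)" "L2_norm \<Omega>" "emb \<Omega>" JM T])
    show "L2_norm \<Omega> f = norm (emb \<Omega> f)" if "f \<in> X_space \<Omega> (\<lambda>x. 1)" for f
      using that by (simp add: X_space_def L2_norm_emb[OF b])
    show "L2_norm \<Omega> (\<lambda>x. g x - f x) = norm (emb \<Omega> g - emb \<Omega> f)" if "g \<in> X_space \<Omega> (\<lambda>x. 1)" "f \<in> X_space \<Omega> (\<lambda>x. 1)" for g f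
      using that by (simp add: X_space_def L2_norm_emb[OF b] L2_diff[OF b] emb_diff[OF b])
  qed (use * in auto)
  \<comment> \<open>Outside \<open>{0..T}\<close> and on null sets \<open>V\<close> is arbitrary.
    Applying \<open>cut\<close> at all times, and to \<open>c\<close>, gives data supported in
    \<open>\<Omega>\<close> without exceptions.\<close>
  define JD where "JD t = cut \<Omega> (V t)" for t
  have JE: "AE t\<in>{0..T} in lborel. JE t \<in> L2 \<Omega> \<and> emb \<Omega> (JE t) = cut \<Omega> c + prim JD t"
    using U(2) c
  proof eventually_elim
    fix t assume 1: "t \<in> {0..T} \<longrightarrow> JE t \<in> L2 \<Omega> \<and> emb \<Omega> (JE t) = U t" and 2: "t \<in> {0..T} \<longrightarrow> U t = c + prim V t"
    show "t \<in> {0..T} \<longrightarrow> JE t \<in> L2 \<Omega> \<and> emb \<Omega> (JE t) = cut \<Omega> c + prim JD t"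
      using 1 2 cut_emb[OF b, of "JE t"] prim_linear[OF bounded_linear_cut[OF b] V(1), of t]
      by (auto simp: JD_def[abs_def] cut_add[OF b])
  qed
  have JEt: "AE t\<in>{0..T} in lborel. JEt t \<in> L2 \<Omega> \<and> emb \<Omega> (JEt t) = JD t"
    using V(2) by eventually_elim (metis JD_def cut_emb[OF b])
  interpret evolution "graph_curl \<Omega>" s m \<Lambda>
    by (rule evolution.intro) (rule subspace_graph_curl[OF op] closed_graph_curl[OF op] graph_curl_unique[OF op] assms s m | assumption)+
  interpret eddy_current \<Omega> s m \<Lambda> \<mu> \<sigma> T H0 JE JM "cut \<Omega> c" JD J
  proof
    show "(emb \<Omega> \<psi>, emb \<Omega> (wcurl \<Omega> \<psi>)) \<in> graph0_curl \<Omega>" if "\<psi> \<in> H1_0_curl \<Omega>" for \<psi>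
      by (rule H1_0_curl_in_graph0[OF op bounded r(2,1) that])
    show "square_integrable JD" unfolding JD_def by (rule square_integrable_linear[OF V(1) bounded_linear_cut[OF b]])
    show "(\<lambda>x. \<mu> x *\<^sub>R f x) \<in> L2 \<Omega>" "emb \<Omega> (\<lambda>x. \<mu> x *\<^sub>R f x) = m (emb \<Omega> f)" if "f \<in> L2 \<Omega>" for f :: "R3 \<Rightarrow> R3"
      using m(6,7)[OF that] by (simp_all add: M_mult)
    show "cut \<Omega> (cut \<Omega> c) = cut \<Omega> c" by (rule cut_cut[OF b])
  qed (use assms s m op J JE * in blast)+
  show ?case
    using ex_weak_solution weak_solution_unique weak_solution_estimate[OF _ JEt] by blast
qed

end
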